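(* Let $(M,g_M)$ be a compact homogeneous Riemannian manifold without boundary and let $\lambda_1(M)$ be the first nonzero eigenvalue of its Laplacian. Let $\Omega$ be a bounded domain of $M$ and let $0<\lambda_1\le\lambda_2\le\cdots\to+\infty$ be the eigenvalues of the clamped plate problem $$\Delta^2u=\mu u\ \text{ in }\Omega,\qquad u=\frac{\partial u}{\partial\nu}=0\ \text{ on }\partial\Omega .$$ Then for any $k\ge1$ such that $\lambda_{k+1}>\lambda_k$ and for any couple $(f,g)\in\Im_{\lambda_{k+1}}$, $$\sum_{i=1}^k f(\lambda_i)\le\left[\sum_{i=1}^k g(\lambda_i)\Big(\lambda_1(M)+6\lambda_i^{1/2}\Big)\right]^{1/2}\left[\sum_{i=1}^k\frac{f(\lambda_i)^2}{g(\lambda_i)(\lambda_{k+1}-\lambda_i)}\Big(\lambda_1(M)+4\lambda_i^{1/2}\Big)\right]^{1/2}.$$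
   Context: $\Delta$ denotes the Laplacian ($\Delta=\operatorname{div}\nabla$) of the Riemannian manifold $M$; eigenvalues of the Laplacian of $M$ are the numbers $\lambda$ for which $\Delta\varphi=-\lambda\varphi$ has a nonzero solution on $M$. $\Delta^2$ is the biharmonic operator and $\nu$ the outward unit normal to $\partial\Omega$. It is taken as well known that the eigenvalues of the clamped plate problem on the bounded domain $\Omega$, repeated according to multiplicity, form a countable family $0<\lambda_1\le\lambda_2\le\cdots\to+\infty$ (these are distinct from the Laplace eigenvalue $\lambda_1(M)$). For $\Lambda>0$, $\Im_\Lambda$ is the set of couples $(f,g)$ of functions defined on the open interval $(0,\Lambda)$ such that: (1) $f$ and $g$ are positive; (2) for all $x,y\in(0,\Lambda)$ with $x\ne y$, $$\left(\frac{f(x)-f(y)}{x-y}\right)^2+\left(\frac{f(x)^2}{g(x)(\Lambda-x)}+\frac{f(y)^2}{g(y)(\Lambda-y)}\right)\left(\frac{g(x)-g(y)}{x-y}\right)\le0 .$$ *)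

theory Defs
  imports "HOL-Analysis.Analysis"
begin

section \<open>Smooth functions on open subsets of Euclidean space\<close>

definition partial :: "'n::finite \<Rightarrow> (real^'n \<Rightarrow> real) \<Rightarrow> real^'n \<Rightarrow> real" where
  "partial i f x = frechet_derivative f (at x) (axis i 1)"

text \<open>The set \<open>S\<close> is meant to be open.\<close>

primrec Ck_on :: "nat \<Rightarrow> (real^'n::finite) set \<Rightarrow> (real^'n \<Rightarrow> real) \<Rightarrow> bool" where
  "Ck_on 0 S f \<longleftrightarrow> continuous_on S f"
| "Ck_on (Suc k) S f \<longleftrightarrow>
     (\<forall>x\<in>S. f differentiable (at x)) \<and> (\<forall>i. Ck_on k S (partial i f))"

definition smooth_on :: "(real^'n::finite) set \<Rightarrow> (real^'n \<Rightarrow> real) \<Rightarrow> bool" where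
  "smooth_on S f \<longleftrightarrow> (\<forall>k. Ck_on k S f)"


section \<open>Smooth and Riemannian manifolds\<close>

text \<open>The points of the manifold \<open>M\<close> are the elements of a topological type \<open>'a\<close>; its dimension
  is \<open>CARD('n)\<close>. A chart is a pair consisting of its domain and its coordinate map. Charts map onto
  open subsets of \<open>real^'n\<close>, so manifolds have no boundary. Atlases need not be maximal.\<close>

type_synonym ('a, 'n) chart = "'a set \<times> ('a \<Rightarrow> real^'n)"

abbreviation chart_dom :: "('a, 'n) chart \<Rightarrow> 'a set" where
  "chart_dom c \<equiv> fst c"

abbreviation coord :: "('a, 'n) chart \<Rightarrow> 'a \<Rightarrow> real^'n" where
  "coord c \<equiv> snd c"

abbreviation param :: "('a, 'n) chart \<Rightarrow> real^'n \<Rightarrow> 'a" where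
  "param c \<equiv> inv_into (chart_dom c) (coord c)"

definition is_chart :: "('a::topological_space, 'n::finite) chart \<Rightarrow> bool" where
  "is_chart c \<longleftrightarrow> open (chart_dom c) \<and> open (coord c ` chart_dom c) \<and>
     homeomorphism (chart_dom c) (coord c ` chart_dom c) (coord c) (param c)"

definition smooth_map ::
  "('a::topological_space, 'n::finite) chart set \<Rightarrow> ('a \<Rightarrow> 'a) \<Rightarrow> bool" where
  "smooth_map A F \<longleftrightarrow> continuous_on UNIV F \<and>
     (\<forall>c\<in>A. \<forall>d\<in>A. \<forall>i. smooth_on (coord c ` (chart_dom c \<inter> F -` chart_dom d))
                            (\<lambda>x. coord d (F (param c x)) $ i))"

text \<open>Smoothness of the identity map is smoothness of all transition maps.\<close>

definition smooth_atlas ::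
  "('a::{t2_space,second_countable_topology}, 'n::finite) chart set \<Rightarrow> bool" where
  "smooth_atlas A \<longleftrightarrow> (\<forall>c\<in>A. is_chart c) \<and> (\<Union>c\<in>A. chart_dom c) = UNIV \<and> smooth_map A (\<lambda>p. p)"

definition smooth_fun ::
  "('a::topological_space, 'n::finite) chart set \<Rightarrow> ('a \<Rightarrow> real) \<Rightarrow> bool" where
  "smooth_fun A u \<longleftrightarrow> (\<forall>c\<in>A. smooth_on (coord c ` chart_dom c) (\<lambda>x. u (param c x)))"

text \<open>The matrix of the differential of \<open>F\<close> at \<open>p\<close>, in the chart \<open>c\<close> around \<open>p\<close> and the chart \<open>d\<close>
  around \<open>F p\<close>.\<close>

definition jacobian ::
  "('a, 'n::finite) chart \<Rightarrow> ('a, 'n) chart \<Rightarrow> ('a \<Rightarrow> 'a) \<Rightarrow> 'a \<Rightarrow> real^'n^'n" where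
  "jacobian c d F p = (\<chi> i j. partial j (\<lambda>x. coord d (F (param c x)) $ i) (coord c p))"

text \<open>A metric is given by its matrices: \<open>g c p $ i $ j\<close> is the inner product at \<open>p\<close> of the \<open>i\<close>-th
  and the \<open>j\<close>-th coordinate vector field of the chart \<open>c\<close>. The third condition is the
  transformation law under changes of chart.\<close>

type_synonym ('a, 'n) metric_coeffs = "('a, 'n) chart \<Rightarrow> 'a \<Rightarrow> real^'n^'n"

definition riemannian_metric ::
  "('a::topological_space, 'n::finite) chart set \<Rightarrow> ('a, 'n) metric_coeffs \<Rightarrow> bool" where
  "riemannian_metric A g \<longleftrightarrow>
     (\<forall>c\<in>A. \<forall>p\<in>chart_dom c.
        transpose (g c p) = g c p \<and> (\<forall>v. v \<noteq> 0 \<longrightarrow> v \<bullet> (g c p *v v) > 0)) \<and>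
     (\<forall>c\<in>A. \<forall>i j. smooth_on (coord c ` chart_dom c) (\<lambda>x. g c (param c x) $ i $ j)) \<and>
     (\<forall>c\<in>A. \<forall>d\<in>A. \<forall>p\<in>chart_dom c \<inter> chart_dom d.
        g c p = transpose (jacobian c d (\<lambda>q. q) p) ** g d p ** jacobian c d (\<lambda>q. q) p)"

definition riemannian_manifold ::
  "('a::{t2_space,second_countable_topology}, 'n::finite) chart set \<Rightarrow>
   ('a, 'n) metric_coeffs \<Rightarrow> bool" where
  "riemannian_manifold A g \<longleftrightarrow> smooth_atlas A \<and> riemannian_metric A g"

definition riemannian_isometry ::
  "('a::topological_space, 'n::finite) chart set \<Rightarrow> ('a, 'n) metric_coeffs \<Rightarrow>
   ('a \<Rightarrow> 'a) \<Rightarrow> bool" where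
  "riemannian_isometry A g F \<longleftrightarrow>
     bij F \<and> smooth_map A F \<and> smooth_map A (inv F) \<and>
     (\<forall>c\<in>A. \<forall>d\<in>A. \<forall>p\<in>chart_dom c. F p \<in> chart_dom d \<longrightarrow>
        g c p = transpose (jacobian c d F p) ** g d (F p) ** jacobian c d F p)"

definition homogeneous ::
  "('a::topological_space, 'n::finite) chart set \<Rightarrow> ('a, 'n) metric_coeffs \<Rightarrow> bool" where
  "homogeneous A g \<longleftrightarrow> (\<forall>p q. \<exists>F. riemannian_isometry A g F \<and> F p = q)"

text \<open>The measure with density \<open>sqrt (det g)\<close> in every chart; these conditions determine it, and
  no orientation is needed.\<close>

definition riemannian_volume ::
  "('a::topological_space, 'n::finite) chart set \<Rightarrow> ('a, 'n) metric_coeffs \<Rightarrow> 'a measure" where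
  "riemannian_volume A g = (THE V. sets V = sets borel \<and>
     (\<forall>c\<in>A. \<forall>B\<in>sets borel. B \<subseteq> chart_dom c \<longrightarrow>
        emeasure V B = (\<integral>\<^sup>+x\<in>coord c ` B. ennreal (sqrt (det (g c (param c x)))) \<partial>lborel)))"


section \<open>Differential operators\<close>

text \<open>The definitions below are in the coordinates of a chart \<open>c\<close>; a vector field is given by its
  components in \<open>c\<close>.\<close>

definition grad ::
  "('a, 'n::finite) metric_coeffs \<Rightarrow> ('a, 'n) chart \<Rightarrow> ('a \<Rightarrow> real) \<Rightarrow> 'a \<Rightarrow> real^'n" where
  "grad g c u p = matrix_inv (g c p) *v (\<chi> j. partial j (\<lambda>x. u (param c x)) (coord c p))"

definition divergence ::
  "('a, 'n::finite) metric_coeffs \<Rightarrow> ('a, 'n) chart \<Rightarrow> ('a \<Rightarrow> real^'n) \<Rightarrow> 'a \<Rightarrow> real" where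
  "divergence g c X p =
     (\<Sum>i\<in>UNIV. partial i (\<lambda>x. sqrt (det (g c (param c x))) * X (param c x) $ i) (coord c p))
       / sqrt (det (g c p))"

text \<open>\<open>christoffel g c k i j p\<close> has upper index \<open>k\<close> and lower indices \<open>i, j\<close>.\<close>

definition christoffel ::
  "('a, 'n::finite) metric_coeffs \<Rightarrow> ('a, 'n) chart \<Rightarrow> 'n \<Rightarrow> 'n \<Rightarrow> 'n \<Rightarrow> 'a \<Rightarrow> real" where
  "christoffel g c k i j p = (1/2) * (\<Sum>l\<in>UNIV. matrix_inv (g c p) $ k $ l *
     (partial i (\<lambda>x. g c (param c x) $ j $ l) (coord c p)
      + partial j (\<lambda>x. g c (param c x) $ i $ l) (coord c p)
      - partial l (\<lambda>x. g c (param c x) $ i $ j) (coord c p)))"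

definition hessian ::
  "('a, 'n::finite) metric_coeffs \<Rightarrow> ('a, 'n) chart \<Rightarrow> ('a \<Rightarrow> real) \<Rightarrow> 'a \<Rightarrow> real^'n^'n" where
  "hessian g c u p = (\<chi> i j.
     partial i (partial j (\<lambda>x. u (param c x))) (coord c p)
     - (\<Sum>k\<in>UNIV. christoffel g c k i j p * partial k (\<lambda>x. u (param c x)) (coord c p)))"

text \<open>For smooth \<open>u\<close> the values of the following functions at \<open>p\<close> do not depend on the chart around
  \<open>p\<close>, so that any one may be chosen.\<close>

definition chart_at :: "('a, 'n) chart set \<Rightarrow> 'a \<Rightarrow> ('a, 'n) chart" where
  "chart_at A p = (SOME c. c \<in> A \<and> p \<in> chart_dom c)"

definition laplacian ::
  "('a, 'n::finite) chart set \<Rightarrow> ('a, 'n) metric_coeffs \<Rightarrow> ('a \<Rightarrow> real) \<Rightarrow> 'a \<Rightarrow> real" where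
  "laplacian A g u p = (let c = chart_at A p in divergence g c (grad g c u) p)"

definition grad_norm_sq ::
  "('a, 'n::finite) chart set \<Rightarrow> ('a, 'n) metric_coeffs \<Rightarrow> ('a \<Rightarrow> real) \<Rightarrow> 'a \<Rightarrow> real" where
  "grad_norm_sq A g u p = (let c = chart_at A p in grad g c u p \<bullet> (g c p *v grad g c u p))"

definition hess_norm_sq ::
  "('a, 'n::finite) chart set \<Rightarrow> ('a, 'n) metric_coeffs \<Rightarrow> ('a \<Rightarrow> real) \<Rightarrow> 'a \<Rightarrow> real" where
  "hess_norm_sq A g u p = (let c = chart_at A p; G = matrix_inv (g c p); H = hessian g c u p in
     \<Sum>i\<in>UNIV. \<Sum>j\<in>UNIV. \<Sum>k\<in>UNIV. \<Sum>l\<in>UNIV. G $ i $ k * G $ j $ l * H $ i $ j * H $ k $ l)"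


section \<open>Laplace eigenvalues of the manifold\<close>

definition laplace_eigenvalue ::
  "('a::topological_space, 'n::finite) chart set \<Rightarrow> ('a, 'n) metric_coeffs \<Rightarrow> real \<Rightarrow> bool" where
  "laplace_eigenvalue A g l \<longleftrightarrow>
     (\<exists>\<phi>. smooth_fun A \<phi> \<and> (\<exists>p. \<phi> p \<noteq> 0) \<and> (\<forall>p. laplacian A g \<phi> p = - l * \<phi> p))"

definition first_nonzero_laplace_eigenvalue ::
  "('a::topological_space, 'n::finite) chart set \<Rightarrow> ('a, 'n) metric_coeffs \<Rightarrow> real \<Rightarrow> bool" where
  "first_nonzero_laplace_eigenvalue A g l \<longleftrightarrow>
     laplace_eigenvalue A g l \<and> l \<noteq> 0 \<and>
     (\<forall>\<mu>. laplace_eigenvalue A g \<mu> \<and> \<mu> \<noteq> 0 \<longrightarrow> l \<le> \<mu>)"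


section \<open>The clamped plate problem\<close>

text \<open>On a complete manifold, the bounded sets are the relatively compact ones. On a compact
  manifold the last condition is automatic.\<close>

definition bounded_domain :: "'a::topological_space set \<Rightarrow> bool" where
  "bounded_domain \<Omega> \<longleftrightarrow> open \<Omega> \<and> connected \<Omega> \<and> \<Omega> \<noteq> {} \<and> compact (closure \<Omega>)"

definition test_function ::
  "('a::topological_space, 'n::finite) chart set \<Rightarrow> 'a set \<Rightarrow> ('a \<Rightarrow> real) \<Rightarrow> bool" where
  "test_function A \<Omega> \<phi> \<longleftrightarrow> smooth_fun A \<phi> \<and>
     compact (closure {p. \<phi> p \<noteq> 0}) \<and> closure {p. \<phi> p \<noteq> 0} \<subseteq> \<Omega>"

definition H2_norm ::
  "('a::topological_space, 'n::finite) chart set \<Rightarrow> ('a, 'n) metric_coeffs \<Rightarrow>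
   ('a \<Rightarrow> real) \<Rightarrow> real" where
  "H2_norm A g u = sqrt (LINT p|riemannian_volume A g.
     (u p)\<^sup>2 + grad_norm_sq A g u p + hess_norm_sq A g u p)"

text \<open>The space \<open>H\<^sup>2\<^sub>0(\<Omega>)\<close>, the completion of the test functions on \<open>\<Omega>\<close> for the \<open>H\<^sup>2\<close> norm, as a space
  of \<open>L\<^sup>2\<close> functions. They are extended by zero: the members vanish almost everywhere off \<open>\<Omega>\<close>.\<close>

definition H20 ::
  "('a::topological_space, 'n::finite) chart set \<Rightarrow> ('a, 'n) metric_coeffs \<Rightarrow> 'a set \<Rightarrow>
   ('a \<Rightarrow> real) set" where
  "H20 A g \<Omega> = {u. u \<in> borel_measurable (riemannian_volume A g) \<and>
     integrable (riemannian_volume A g) (\<lambda>p. (u p)\<^sup>2) \<and>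
     (\<exists>\<phi> :: nat \<Rightarrow> 'a \<Rightarrow> real.
        (\<forall>j. test_function A \<Omega> (\<phi> j)) \<and>
        (\<lambda>j. LINT p|riemannian_volume A g. (\<phi> j p - u p)\<^sup>2) \<longlonglongrightarrow> 0 \<and>
        (\<forall>e>0. \<exists>N. \<forall>i\<ge>N. \<forall>j\<ge>N. H2_norm A g (\<lambda>p. \<phi> i p - \<phi> j p) < e))}"

text \<open>The solutions of \<open>\<Delta>\<^sup>2 u = \<mu> u\<close> in \<open>\<Omega>\<close> with \<open>u = \<partial>u/\<partial>\<nu> = 0\<close> on \<open>\<partial>\<Omega>\<close>. Nothing is assumed
  about the boundary of \<open>\<Omega>\<close>, so the boundary conditions are expressed by membership in
  \<open>H\<^sup>2\<^sub>0(\<Omega>)\<close> and the equation holds in the sense of distributions on \<open>\<Omega>\<close>. For smooth boundary,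
  \<open>H\<^sup>2\<^sub>0(\<Omega>)\<close> is the set of \<open>u \<in> H\<^sup>2(\<Omega>)\<close> for which the traces of \<open>u\<close> and of its normal derivative vanish,
  and by elliptic regularity these are the classical solutions.\<close>

definition clamped_plate_solutions ::
  "('a::topological_space, 'n::finite) chart set \<Rightarrow> ('a, 'n) metric_coeffs \<Rightarrow> 'a set \<Rightarrow> real \<Rightarrow>
   ('a \<Rightarrow> real) set" where
  "clamped_plate_solutions A g \<Omega> \<mu> = {u \<in> H20 A g \<Omega>.
     \<forall>\<phi>. test_function A \<Omega> \<phi> \<longrightarrow>
       (LINT p|riemannian_volume A g. u p * laplacian A g (laplacian A g \<phi>) p)
       = \<mu> * (LINT p|riemannian_volume A g. u p * \<phi> p)}"

text \<open>The family \<open>(lam i)\<close>, \<open>i \<ge> 1\<close>, lists the eigenvalues of the clamped plate problem repeated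
  according to multiplicity: for each \<open>\<mu>\<close>, the \<open>u i\<close> with \<open>lam i = \<mu>\<close> form a basis, modulo almost
  everywhere equality, of the space of solutions for \<open>\<mu>\<close>. (Both are empty, respectively trivial,
  when \<open>\<mu>\<close> is not an eigenvalue. The value \<open>lam 0\<close> is irrelevant. Independence forces
  \<open>{i. 1 \<le> i \<and> lam i = \<mu>}\<close> to be finite, because sums over infinite sets are \<open>0\<close>.)\<close>

definition clamped_plate_eigenvalues ::
  "('a::topological_space, 'n::finite) chart set \<Rightarrow> ('a, 'n) metric_coeffs \<Rightarrow> 'a set \<Rightarrow>
   (nat \<Rightarrow> real) \<Rightarrow> bool" where
  "clamped_plate_eigenvalues A g \<Omega> lam \<longleftrightarrow>
     (\<exists>u :: nat \<Rightarrow> 'a \<Rightarrow> real. \<forall>\<mu>. let I = {i. 1 \<le> i \<and> lam i = \<mu>} in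
        (\<forall>i\<in>I. u i \<in> clamped_plate_solutions A g \<Omega> \<mu>) \<and>
        (\<forall>a. (AE p in riemannian_volume A g. (\<Sum>i\<in>I. a i * u i p) = 0) \<longrightarrow> (\<forall>i\<in>I. a i = 0)) \<and>
        (\<forall>v\<in>clamped_plate_solutions A g \<Omega> \<mu>.
           \<exists>a. AE p in riemannian_volume A g. v p = (\<Sum>i\<in>I. a i * u i p)))"


section \<open>The couples of functions\<close>

text \<open>Only the values on \<open>(0, \<Lambda>)\<close> matter.\<close>

definition Im_couples :: "real \<Rightarrow> ((real \<Rightarrow> real) \<times> (real \<Rightarrow> real)) set" where
  "Im_couples \<Lambda> = {(f, g).
     (\<forall>x\<in>{0<..<\<Lambda>}. f x > 0 \<and> g x > 0) \<and>
     (\<forall>x\<in>{0<..<\<Lambda>}. \<forall>y\<in>{0<..<\<Lambda>}. x \<noteq> y \<longrightarrow>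
        ((f x - f y) / (x - y))\<^sup>2
        + ((f x)\<^sup>2 / (g x * (\<Lambda> - x)) + (f y)\<^sup>2 / (g y * (\<Lambda> - y))) * ((g x - g y) / (x - y)) \<le> 0)}"

end

theory Submission
  imports Defs "HOL-Library.Diagonal_Subsequence"
begin

text \<open>The \<open>L\<^sup>2\<close>-normalised eigenfunctions of the Laplacian for \<open>lamM\<close> form a finite-dimensional space whose
  reproducing kernel is invariant under isometries, so by homogeneity an orthonormal basis can be rescaled
  to functions \<open>h a\<close> with \<open>\<Sum>a. (h a)\<^sup>2 = 1\<close>, hence \<open>\<Sum>a. \<bar>grad (h a)\<bar>\<^sup>2 = lamM\<close>. Multiplying the eigenfunctions of the
  plate by \<open>h a\<close> and projecting off the first \<open>k\<close> of them gives trial functions. Their Rayleigh quotients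
  involve the commutators \<open>[\<Delta>, h a]\<close>, whose sums over \<open>a\<close> are explicit in terms of \<open>lamM\<close>. The condition
  defining the couples \<open>(f, g)\<close> is exactly what makes the error terms in the weighted sum over the first \<open>k\<close>
  eigenvalues a nonnegative quadratic form in the matrix coefficients of \<open>h a\<close> and of the commutators.

  The trial functions are admissible because \<open>H\<^sup>2\<^sub>0(\<Omega>)\<close> is the domain of the closure of the Laplacian on test
  functions (the Hessian is controlled by the Laplacian in \<open>L\<^sup>2\<close>), and the variational characterisation of
  \<open>lam (k + 1)\<close> follows from Rellich compactness, proved with the Poincare inequality on small boxes.\<close>

section \<open>Smooth functions\<close>

text \<open>Write l for \<open>lamM\<close>, u for the i-th normalised plate eigenfunction and t_a
  for the commutator of the Laplacian with h a, applied to u. Then \<Sum> h a * t_a integrates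
  against u to - l, the squared norms of the t_a add up to at most l^2 + 4 l sqrt (lam i), and those
  of the Laplacians of h a * u to at most lam i + 2 l sqrt (lam i) + (l^2 + 4 l sqrt (lam i)). The
  first fact puts a factor l in front of the sum of the f (lam i); dividing by it leaves the weights
  l + 4 sqrt (lam i) and l + 6 sqrt (lam i), so 6 = 2 + 4. A parameter \<delta> weights the use of
  Young's inequality, and its best value turns a sum of two terms into the product of square roots.

  The obstacle is the arbitrary boundary of \<Omega>: eigenfunctions lie in H^2_0 only, and their
  Laplacians and commutators are L^2 limits along test functions. Hence facts are proved for test
  functions in a form that survives such limits. As \<open>H20\<close> is defined with the Hessian,
  while the limits control the Laplacian, an elliptic estimate has to compare the two norms.\<close>

abbreviation (input) sum_univ (binder "\<Sum>\<^sub>U" 10) where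
  "sum_univ f \<equiv> sum f UNIV"

lemma partial_unique: "(f has_derivative D) (at x) \<Longrightarrow> partial i f x = D (axis i 1)"
 unfolding partial_def using frechet_derivative_at by metis

lemma has_derivative_partial:
 assumes "f differentiable (at x)"
 shows "(f has_derivative (\<lambda>h. \<Sum>\<^sub>U i. h $ i * partial i f x)) (at x)"
proof -
 let ?D = "frechet_derivative f (at x)"
 have D: "(f has_derivative ?D) (at x)" using assms frechet_derivative_works by blast
 then have lin: "linear ?D" by (simp add: has_derivative_linear)
 have "?D h = (\<Sum>\<^sub>U i. h $ i * partial i f x)" for h
 proof -
  have "?D h = ?D (\<Sum>\<^sub>U i. h $ i *\<^sub>R axis i 1)"
   using basis_expansion[of h] by (simp add: scalar_mult_eq_scaleR)
  also have "\<dots> = (\<Sum>\<^sub>U i. h $ i * ?D (axis i 1))"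
   by (simp add: linear_sum[OF lin] linear_cmul[OF lin])
  finally show ?thesis by (simp add: partial_def)
 qed
 then have "?D = (\<lambda>h. \<Sum>\<^sub>U i. h $ i * partial i f x)" by auto
 with D show ?thesis by simp
qed

lemma partial_cong_open:
 assumes "open S" "x \<in> S" "\<And>y. y \<in> S \<Longrightarrow> f y = g y"
 shows "partial i f x = partial i g x"
proof -
 \<comment> \<open>\<open>frechet_derivative\<close> picks some derivative, so equality of the two
   predicates also covers points where neither function is differentiable.\<close>
 have "(f has_derivative D) (at x) = (g has_derivative D) (at x)" for D
  using has_derivative_transform_within_open[of f D x UNIV S g]
   has_derivative_transform_within_open[of g D x UNIV S f] assms by auto
 then show ?thesis by (simp add: partial_def frechet_derivative_def)
qed

lemma differentiable_cong_open:
 fixes f g :: "'a::real_normed_vector \<Rightarrow> 'b::real_normed_vector"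
 assumes "open S" "x \<in> S" "\<And>y. y \<in> S \<Longrightarrow> f y = g y" "f differentiable (at x)"
 shows "g differentiable (at x)"
 using assms has_derivative_transform_within_open[of f _ x UNIV S g] unfolding differentiable_def by auto

lemma Ck_on_cong:
 assumes "open S" "\<And>y. y \<in> S \<Longrightarrow> f y = g y"
 shows "Ck_on k S f \<Longrightarrow> Ck_on k S g"
 using assms(2)
proof (induction k arbitrary: f g)
 case 0
 then show ?case using continuous_on_cong[of S S f g] by simp
next
 case (Suc k)
 have "g differentiable (at x)" if "x \<in> S" for x
  using differentiable_cong_open[OF assms(1) that, of f g] Suc.prems that by auto
 moreover have "Ck_on k S (partial i g)" for i
  using Suc.IH[of "partial i f" "partial i g"] partial_cong_open[OF assms(1), of _ f g i] Suc.prems by auto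
 ultimately show ?case by simp
qed

lemma Ck_on_subset: "Ck_on k S f \<Longrightarrow> T \<subseteq> S \<Longrightarrow> Ck_on k T f"
 by (induction k arbitrary: f) (auto intro: continuous_on_subset)

lemma Ck_on_SucD: "Ck_on (Suc k) S f \<Longrightarrow> Ck_on k S f"
proof (induction k arbitrary: f)
 case 0
 then show ?case
  by (auto intro!: continuous_at_imp_continuous_on differentiable_imp_continuous_within)
qed auto

text \<open>Beyond order 0, \<open>Ck_on\<close> asks for differentiability in the full space and
  not merely within \<open>S\<close>. Smoothness can therefore be checked on small open sets, which
  is how functions given by different formulas in different charts are treated.\<close>

lemma Ck_on_local:
 assumes "\<And>x. x \<in> S \<Longrightarrow> \<exists>T. open T \<and> x \<in> T \<and> Ck_on k T f"
 shows "Ck_on k S f"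
 using assms
proof (induction k arbitrary: f)
 case 0
 show ?case unfolding Ck_on.simps
 proof (rule continuous_at_imp_continuous_on, rule ballI)
  fix x assume "x \<in> S"
  then obtain T where "open T" "x \<in> T" "continuous_on T f" using 0 by auto
  then show "isCont f x" by (simp add: continuous_on_eq_continuous_at)
 qed
next
 case (Suc k)
 have "Ck_on k S (partial i f)" for i
  using Suc.prems by (intro Suc.IH) (meson Ck_on.simps(2))
 moreover have "f differentiable (at x)" if "x \<in> S" for x
  using Suc.prems[OF that] by auto
 ultimately show ?case by simp
qed

section \<open>Differentiation rules and closure of smoothness under algebra\<close>

lemma partial_const [simp]: "partial i (\<lambda>x. c) x = 0"
 by (rule partial_unique[where D="\<lambda>h. 0"]) (rule has_derivative_const)

lemma partial_add:
 assumes "f differentiable (at x)" "g differentiable (at x)"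
 shows "partial i (\<lambda>x. f x + g x) x = partial i f x + partial i g x"
 using assms by (subst partial_unique[OF has_derivative_add[OF assms[THEN frechet_derivative_works[THEN iffD1]]]])
  (simp_all add: partial_def)

lemma partial_mult:
 assumes "f differentiable (at x)" "g differentiable (at x)"
 shows "partial i (\<lambda>x. f x * g x) x = f x * partial i g x + partial i f x * g x"
 by (subst partial_unique[OF has_derivative_mult[OF assms[THEN frechet_derivative_works[THEN iffD1]]]])
  (simp_all add: partial_def)

lemma partial_cmult:
 assumes "f differentiable (at x)"
 shows "partial i (\<lambda>x. c * f x) x = c * partial i f x"
 using partial_mult[of "\<lambda>x. c" x f i] assms by simp

lemma partial_sum:
 assumes "\<And>j. j \<in> J \<Longrightarrow> f j differentiable (at x)"
 shows "partial i (\<lambda>x. \<Sum>j\<in>J. f j x) x = (\<Sum>j\<in>J. partial i (f j) x)"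
proof -
 have "((\<lambda>x. \<Sum>j\<in>J. f j x) has_derivative (\<lambda>h. \<Sum>j\<in>J. frechet_derivative (f j) (at x) h)) (at x)"
  using assms by (intro has_derivative_sum) (simp add: frechet_derivative_works[symmetric])
 from partial_unique[OF this] show ?thesis by (simp add: partial_def)
qed

lemma partial_coord: "partial i (\<lambda>x::real^'n::finite. x $ j) x = (if i = j then 1 else 0)"
proof -
 have "((\<lambda>x::real^'n. x $ j) has_derivative (\<lambda>h. h $ j)) (at x)"
  by (rule bounded_linear.has_derivative[OF bounded_linear_vec_nth]) (rule has_derivative_ident)
 from partial_unique[OF this] show ?thesis by (simp add: axis_def)
qed

lemma Ck_on_const: "Ck_on k S (\<lambda>x::real^'a::finite. c)"
proof (induction k arbitrary: c)
 case (Suc k)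
 have "partial i (\<lambda>x::real^'a. c) = (\<lambda>x. 0)" for i by (rule ext) simp
 with Suc show ?case by simp
qed simp

lemma Ck_on_add: "open S \<Longrightarrow> Ck_on k S f \<Longrightarrow> Ck_on k S g \<Longrightarrow> Ck_on k S (\<lambda>x. f x + g x)"
proof (induction k arbitrary: f g)
 case 0 then show ?case by (simp add: continuous_on_add)
next
 case (Suc k)
 then have "Ck_on k S (partial i (\<lambda>x. f x + g x))" for i
  by (rule_tac Ck_on_cong[where f="\<lambda>x. partial i f x + partial i g x"]) (auto simp: partial_add)
 with Suc.prems show ?case by auto
qed

lemma Ck_on_mult: "open S \<Longrightarrow> Ck_on k S f \<Longrightarrow> Ck_on k S g \<Longrightarrow> Ck_on k S (\<lambda>x. f x * g x)"
proof (induction k arbitrary: f g)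
 case 0 then show ?case by (simp add: continuous_on_mult)
next
 case (Suc k)
 have "Ck_on k S (\<lambda>x. f x * partial i g x + partial i f x * g x)" for i
  using Suc.prems Ck_on_SucD[OF Suc.prems(2)] Ck_on_SucD[OF Suc.prems(3)]
  by (intro Ck_on_add Suc.IH) auto
 then have "Ck_on k S (partial i (\<lambda>x. f x * g x))" for i
  using Suc.prems by (rule_tac Ck_on_cong[where f="\<lambda>x. f x * partial i g x + partial i f x * g x"])
    (auto simp: partial_mult)
 with Suc.prems show ?case by auto
qed

lemma Ck_on_sum:
 assumes "open S" "finite J" "\<And>j. j \<in> J \<Longrightarrow> Ck_on k S (f j)"
 shows "Ck_on k S (\<lambda>x. \<Sum>j\<in>J. f j x)"
 using assms(2,3) by (induction J rule: finite_induct) (auto intro!: Ck_on_const Ck_on_add assms(1))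

lemma Ck_on_coord: "Ck_on k S (\<lambda>x::real^'n::finite. x $ j)"
proof (cases k)
 case 0 then show ?thesis by (simp add: continuous_on_component)
next
 case (Suc m)
 have "(\<lambda>x::real^'n. x $ j) differentiable (at x)" for x
  by (intro linear_imp_differentiable bounded_linear.linear bounded_linear_vec_nth)
 moreover have "partial i (\<lambda>x::real^'n. x $ j) = (\<lambda>x. if i = j then 1 else 0)" for i by (simp add: fun_eq_iff partial_coord)
 ultimately show ?thesis using Suc by (simp add: Ck_on_const)
qed

lemma smooth_onI: "(\<And>k. Ck_on k S f) \<Longrightarrow> smooth_on S f" by (simp add: smooth_on_def)

lemma smooth_on_Ck: "smooth_on S f \<Longrightarrow> Ck_on k S f" by (simp add: smooth_on_def)

lemma smooth_on_differentiable: "smooth_on S f \<Longrightarrow> x \<in> S \<Longrightarrow> f differentiable (at x)"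
 using smooth_on_Ck[of S f 1] by simp

lemma smooth_on_partial: "smooth_on S f \<Longrightarrow> smooth_on S (partial i f)"
 unfolding smooth_on_def using Ck_on.simps(2) by blast

lemma smooth_on_continuous: "smooth_on S f \<Longrightarrow> continuous_on S f"
 using smooth_on_Ck[of S f 0] by simp

lemma smooth_on_cong: "open S \<Longrightarrow> smooth_on S f \<Longrightarrow> (\<And>y. y \<in> S \<Longrightarrow> f y = g y) \<Longrightarrow> smooth_on S g"
 unfolding smooth_on_def using Ck_on_cong by blast

lemma smooth_on_subset: "smooth_on S f \<Longrightarrow> T \<subseteq> S \<Longrightarrow> smooth_on T f"
 unfolding smooth_on_def using Ck_on_subset by blast

lemma smooth_on_local:
 "(\<And>x. x \<in> S \<Longrightarrow> \<exists>T. open T \<and> x \<in> T \<and> smooth_on T f) \<Longrightarrow> smooth_on S f"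
 unfolding smooth_on_def by (meson Ck_on_local)

lemma smooth_on_const: "smooth_on S (\<lambda>x. c)" by (simp add: smooth_on_def Ck_on_const)
lemma smooth_on_coord: "smooth_on S (\<lambda>x. x $ j)" by (simp add: smooth_on_def Ck_on_coord)
lemma smooth_on_add: "open S \<Longrightarrow> smooth_on S f \<Longrightarrow> smooth_on S g \<Longrightarrow> smooth_on S (\<lambda>x. f x + g x)"
 by (simp add: smooth_on_def Ck_on_add)
lemma smooth_on_mult: "open S \<Longrightarrow> smooth_on S f \<Longrightarrow> smooth_on S g \<Longrightarrow> smooth_on S (\<lambda>x. f x * g x)"
 by (simp add: smooth_on_def Ck_on_mult)
lemma smooth_on_minus: "open S \<Longrightarrow> smooth_on S f \<Longrightarrow> smooth_on S (\<lambda>x. - f x)"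
 using smooth_on_mult[OF _ smooth_on_const[of S "-1"]] by fastforce
lemma smooth_on_diff: "open S \<Longrightarrow> smooth_on S f \<Longrightarrow> smooth_on S g \<Longrightarrow> smooth_on S (\<lambda>x. f x - g x)"
 using smooth_on_add[OF _ _ smooth_on_minus, of S f g] by simp
lemma smooth_on_sum:
 "open S \<Longrightarrow> finite J \<Longrightarrow> (\<And>j. j \<in> J \<Longrightarrow> smooth_on S (f j)) \<Longrightarrow> smooth_on S (\<lambda>x. \<Sum>j\<in>J. f j x)"
 by (simp add: smooth_on_def Ck_on_sum)
lemma smooth_on_prod:
 assumes "open S" "finite J" "\<And>j. j \<in> J \<Longrightarrow> smooth_on S (f j)"
 shows "smooth_on S (\<lambda>x. \<Prod>j\<in>J. f j x)"
 using assms(2,3) by (induction J rule: finite_induct) (auto intro!: smooth_on_const smooth_on_mult assms(1))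
lemma smooth_on_power: "open S \<Longrightarrow> smooth_on S f \<Longrightarrow> smooth_on S (\<lambda>x. f x ^ m)"
 by (induction m) (auto intro: smooth_on_const smooth_on_mult)

text \<open>A chain rule scheme: the functions \<open>\<psi> j\<close> of one real variable need only be closed under
 differentiation up to linear combinations with functions of the family.\<close>

lemma partial_real_comp:
 assumes "(\<psi> has_real_derivative d) (at (u x))" "u differentiable (at x)"
 shows "partial i (\<lambda>x. \<psi> (u x)) x = d * partial i u x"
  "(\<lambda>x. \<psi> (u x)) differentiable (at x)"
proof -
 have 1: "((\<psi> \<circ> u) has_derivative ((*) d \<circ> frechet_derivative u (at x))) (at x)"
  using assms frechet_derivative_works by (intro diff_chain_at) (auto simp: has_field_derivative_def)
 show "partial i (\<lambda>x. \<psi> (u x)) x = d * partial i u x"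
  using partial_unique[OF 1] by (simp add: o_def partial_def)
 show "(\<lambda>x. \<psi> (u x)) differentiable (at x)"
  using 1 by (auto simp: o_def differentiable_def)
qed

lemma smooth_on_real_comp:
 fixes \<psi> :: "nat \<Rightarrow> real \<Rightarrow> real"
 assumes S: "open S" and u: "smooth_on S u"
  and der: "\<And>m t. t \<in> u ` S \<Longrightarrow> (\<psi> m has_real_derivative (\<Sum>j\<le>N m. a m j * \<psi> j t)) (at t)"
 shows "smooth_on S (\<lambda>x. \<psi> m (u x))"
proof (rule smooth_onI)
 fix k show "Ck_on k S (\<lambda>x. \<psi> m (u x))"
 proof (induction k arbitrary: m)
  case 0
  show ?case
   by (auto intro!: continuous_at_imp_continuous_on differentiable_imp_continuous_within
     partial_real_comp(2)[OF der] smooth_on_differentiable[OF u])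
 next
  case (Suc k)
  have "Ck_on k S (partial i (\<lambda>x. \<psi> m (u x)))" for i
  proof (rule Ck_on_cong[OF S])
   show "Ck_on k S (\<lambda>x. (\<Sum>j\<le>N m. a m j * \<psi> j (u x)) * partial i u x)"
    using smooth_on_Ck[OF smooth_on_partial[OF u]]
    by (intro Ck_on_mult Ck_on_sum S Ck_on_const Suc) auto
  qed (auto simp: partial_real_comp(1)[OF der smooth_on_differentiable[OF u]])
  moreover have "(\<lambda>x. \<psi> m (u x)) differentiable (at x)" if "x \<in> S" for x
   using that by (auto intro!: partial_real_comp(2)[OF der smooth_on_differentiable[OF u]])
  ultimately show ?case by simp
 qed
qed

lemma smooth_on_inverse:
 assumes "open S" "smooth_on S u" "\<And>x. x \<in> S \<Longrightarrow> u x \<noteq> 0"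
 shows "smooth_on S (\<lambda>x. inverse (u x))"
proof -
 \<comment> \<open>The derivative of \<open>\<psi> m\<close> is a multiple of
   \<open>\<psi> (Suc m)\<close>, so the powers of the reciprocal form a family to which
   \<open>smooth_on_real_comp\<close> applies.\<close>
 define \<psi> where "\<psi> m t = inverse t ^ Suc m" for m :: nat and t :: real
 have "(\<psi> m has_real_derivative (\<Sum>j\<le>Suc m. (if j = Suc m then - (1 + real m) else 0) * \<psi> j t)) (at t)"
  if "t \<in> u ` S" for m t
 proof -
  have "t \<noteq> 0" using that assms(3) by auto
  then have "((\<lambda>t. inverse t ^ Suc m) has_real_derivative
    (1 + real m) * (- (inverse t * inverse t) * inverse t ^ m)) (at t)"
   using DERIV_power_Suc[OF DERIV_inverse, of t m] by (simp add: power2_eq_square numeral_2_eq_2)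
  then show ?thesis unfolding \<psi>_def
   by (rule DERIV_cong) (simp add: if_distrib sum.delta algebra_simps cong: if_cong)
 qed
 from smooth_on_real_comp[OF assms(1,2) this, of 0] show ?thesis by (simp add: \<psi>_def)
qed

lemma smooth_on_divide:
 assumes "open S" "smooth_on S u" "smooth_on S v" "\<And>x. x \<in> S \<Longrightarrow> v x \<noteq> 0"
 shows "smooth_on S (\<lambda>x. u x / v x)"
 unfolding divide_inverse using assms by (intro smooth_on_mult smooth_on_inverse)

lemma smooth_on_sqrt:
 assumes "open S" "smooth_on S u" "\<And>x. x \<in> S \<Longrightarrow> u x > 0"
 shows "smooth_on S (\<lambda>x. sqrt (u x))"
proof -
 \<comment> \<open>These are the powers t^(1/2 - m); differentiation multiplies by 1/2 - m and
   raises \<open>m\<close> by one.\<close>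
 define \<psi> where "\<psi> m t = sqrt t * inverse t ^ m" for m :: nat and t :: real
 have "(\<psi> m has_real_derivative (\<Sum>j\<le>Suc m. (if j = Suc m then 1/2 - real m else 0) * \<psi> j t)) (at t)"
  if "t \<in> u ` S" for m t
 proof -
  have t: "t > 0" using that assms(3) by auto
  have *: "((\<lambda>t. sqrt t * inverse t ^ m) has_real_derivative
   sqrt t * (- (real m * inverse t ^ (m - Suc 0) * (inverse t * inverse t))) + inverse (sqrt t) / 2 * inverse t ^ m) (at t)"
   using t by (auto intro!: derivative_eq_intros)
  have "inverse (sqrt t) = sqrt t * inverse t" using t
   by (simp add: field_simps flip: power2_eq_square)
  moreover have "real m * inverse t ^ (m - Suc 0) * (inverse t * inverse t) = real m * inverse t ^ Suc m"
   by (cases m) auto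
  ultimately show ?thesis unfolding \<psi>_def
   by (intro DERIV_cong[OF *], cases m) (simp_all add: if_distrib sum.delta algebra_simps cong: if_cong)
 qed
 from smooth_on_real_comp[OF assms(1,2) this, of 0] show ?thesis by (simp add: \<psi>_def)
qed

section \<open>Chain rule, bump functions and integration by parts\<close>

lemma has_derivative_vec_components:
 fixes \<Phi> :: "'a::real_normed_vector \<Rightarrow> real^'m"
 assumes "\<And>j. ((\<lambda>x. \<Phi> x $ j) has_derivative D j) (at x within S)"
 shows "(\<Phi> has_derivative (\<lambda>h. \<chi> j. D j h)) (at x within S)"
 using assms by (subst has_derivative_componentwise_within)
  (auto simp: Basis_vec_def inner_axis)

lemma has_derivative_jacobian:
 fixes \<Phi> :: "real^'n \<Rightarrow> real^'m"
 assumes "\<And>j. (\<lambda>x. \<Phi> x $ j) differentiable (at x)"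
 shows "(\<Phi> has_derivative (\<lambda>h. (\<chi> i j. partial j (\<lambda>x. \<Phi> x $ i) x) *v h)) (at x)"
proof -
 have "(\<Phi> has_derivative (\<lambda>h. \<chi> j. \<Sum>\<^sub>U i. h $ i * partial i (\<lambda>x. \<Phi> x $ j) x)) (at x)"
  using assms by (intro has_derivative_vec_components has_derivative_partial) auto
 moreover have "(\<lambda>h. \<chi> j. \<Sum>\<^sub>U i. h $ i * partial i (\<lambda>x. \<Phi> x $ j) x)
   = (\<lambda>h. (\<chi> i j. partial j (\<lambda>x. \<Phi> x $ i) x) *v h)"
  by (simp add: fun_eq_iff vec_eq_iff matrix_vector_mult_def mult.commute)
 ultimately show ?thesis by simp
qed

lemma partial_comp:
 fixes \<Phi> :: "real^'n \<Rightarrow> real^'m"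
 assumes "\<And>j. (\<lambda>x. \<Phi> x $ j) differentiable (at x)" "f differentiable (at (\<Phi> x))"
 shows "(\<lambda>x. f (\<Phi> x)) differentiable (at x)"
  "partial i (\<lambda>x. f (\<Phi> x)) x = (\<Sum>\<^sub>U j. partial j f (\<Phi> x) * partial i (\<lambda>x. \<Phi> x $ j) x)"
proof -
 have 1: "((\<lambda>x. f (\<Phi> x)) has_derivative (\<lambda>h. \<Sum>\<^sub>U j. ((\<chi> i j. partial j (\<lambda>x. \<Phi> x $ i) x) *v h) $ j * partial j f (\<Phi> x))) (at x)"
  using diff_chain_at[OF has_derivative_jacobian has_derivative_partial, OF assms] by (simp add: o_def)
 then show "(\<lambda>x. f (\<Phi> x)) differentiable (at x)" by (auto simp: differentiable_def)
 show "partial i (\<lambda>x. f (\<Phi> x)) x = (\<Sum>\<^sub>U j. partial j f (\<Phi> x) * partial i (\<lambda>x. \<Phi> x $ j) x)"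
  unfolding partial_unique[OF 1] by (simp add: matrix_vector_mult_basis column_def mult.commute)
qed

lemma smooth_on_comp:
 fixes \<Phi> :: "real^'n \<Rightarrow> real^'m"
 assumes S: "open S" and \<Phi>: "\<And>j. smooth_on S (\<lambda>x. \<Phi> x $ j)" and im: "\<Phi> ` S \<subseteq> T"
  and f: "smooth_on T f"
 shows "smooth_on S (\<lambda>x. f (\<Phi> x))"
proof (rule smooth_onI)
 fix k show "Ck_on k S (\<lambda>x. f (\<Phi> x))" using f
 proof (induction k arbitrary: f)
  case 0
  have "continuous_on S \<Phi>" using smooth_on_continuous[OF \<Phi>] continuous_on_vec_lambda[of S "\<lambda>j x. \<Phi> x $ j"]
   by simp
  then show ?case using continuous_on_compose2[OF smooth_on_continuous[OF 0]] im by simp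
 next
  case (Suc k)
  have d: "(\<lambda>x. \<Phi> x $ j) differentiable (at x)" "f differentiable (at (\<Phi> x))" if "x \<in> S" for x j
   using that im smooth_on_differentiable[OF \<Phi>] smooth_on_differentiable[OF Suc.prems] by auto
  have "Ck_on k S (partial i (\<lambda>x. f (\<Phi> x)))" for i
  proof (rule Ck_on_cong[OF S])
   show "Ck_on k S (\<lambda>x. \<Sum>\<^sub>U j. partial j f (\<Phi> x) * partial i (\<lambda>x. \<Phi> x $ j) x)"
    by (intro Ck_on_sum Ck_on_mult S Suc.IH smooth_on_partial[OF Suc.prems]
      smooth_on_Ck[OF smooth_on_partial[OF \<Phi>]]) auto
  qed (auto simp: partial_comp(2)[OF d])
  then show ?case using partial_comp(1)[OF d] by simp
 qed
qed

section \<open>Bump functions\<close>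

definition exp_bump :: "nat \<Rightarrow> real \<Rightarrow> real" where
 "exp_bump m t = (if t > 0 then inverse t ^ m * exp (- inverse t) else 0)"

text \<open>For t > 0, \<open>exp_bump m t\<close> is t^(-m) * exp (-1/t). The powers of 1/t belong
  to the family because differentiation raises them; \<open>smooth_on_real_comp\<close> then treats
  all members at once.\<close>

lemma exp_bump_deriv:
 "(exp_bump m has_real_derivative - real m * exp_bump (Suc m) t + exp_bump (Suc (Suc m)) t) (at t)"
proof -
 consider "t > 0" | "t < 0" | "t = 0" by linarith
 then show ?thesis
 proof cases
  case 1
  have "((\<lambda>t. inverse t ^ m * exp (- inverse t)) has_real_derivative
    - real m * (inverse t ^ Suc m * exp (- inverse t)) + inverse t ^ Suc (Suc m) * exp (- inverse t)) (at t)"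
  proof -
   have "((\<lambda>t. inverse t ^ m) has_real_derivative - real m * inverse t ^ Suc m) (at t)"
   proof (cases m)
    case (Suc k)
    show ?thesis unfolding Suc
     using DERIV_power_Suc[OF DERIV_inverse, of t k] 1 by (simp add: power2_eq_square numeral_2_eq_2 algebra_simps)
   qed simp
   moreover have "((\<lambda>t. exp (- inverse t)) has_real_derivative inverse t * inverse t * exp (- inverse t)) (at t)"
    using 1 by (auto intro!: derivative_eq_intros)
   ultimately show ?thesis by (rule DERIV_cong[OF DERIV_mult]) (simp add: algebra_simps)
  qed
  moreover have "\<forall>\<^sub>F s in nhds t. inverse s ^ m * exp (- inverse s) = exp_bump m s"
   using eventually_nhds_in_open[of "{0<..}" t] 1 by (auto simp: exp_bump_def elim!: eventually_mono)
  ultimately show ?thesis using 1 DERIV_cong_ev[OF refl _ refl] by (fastforce simp: exp_bump_def)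
 next
  case 2
  have "((\<lambda>t. 0) has_real_derivative 0) (at t)" by simp
  moreover have "\<forall>\<^sub>F s in nhds t. 0 = exp_bump m s"
   using eventually_nhds_in_open[of "{..<0}" t] 2 by (auto simp: exp_bump_def elim!: eventually_mono)
  ultimately show ?thesis using 2 DERIV_cong_ev[OF refl _ refl] by (fastforce simp: exp_bump_def)
 next
  case 3
  \<comment> \<open>With s = 1/h the difference quotient at 0 from the right is s^(m+1) / exp
    s.\<close>
  have "((\<lambda>s::real. s ^ Suc m / exp s) \<longlongrightarrow> 0) at_top" by (rule tendsto_power_div_exp_0)
  then have "((\<lambda>h::real. inverse h ^ Suc m / exp (inverse h)) \<longlongrightarrow> 0) (at_right 0)"
   by (rule filterlim_compose) (rule filterlim_inverse_at_top_right)
  then have r: "((\<lambda>h. exp_bump m h / h) \<longlongrightarrow> 0) (at_right 0)"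
   by (rule Lim_transform_eventually)
    (auto simp: exp_bump_def exp_minus field_simps eventually_at_right_less intro!: eventually_at_rightI[of 0 1])
  have l: "((\<lambda>h. exp_bump m h / h) \<longlongrightarrow> 0) (at_left 0)"
   by (rule Lim_transform_eventually[where f="\<lambda>_. 0"])
    (auto simp: exp_bump_def intro!: eventually_at_leftI[of "-1" 0])
  from r l have "((\<lambda>h. exp_bump m h / h) \<longlongrightarrow> 0) (at 0)" by (simp add: filterlim_split_at_real)
  then show ?thesis using 3 by (simp add: DERIV_def exp_bump_def)
 qed
qed

lemma smooth_on_exp_bump:
 assumes "open S" "smooth_on S u"
 shows "smooth_on S (\<lambda>x. exp_bump m (u x))"
proof (rule smooth_on_real_comp[OF assms])
 fix m t
 show "(exp_bump m has_real_derivative (\<Sum>j\<le>Suc (Suc m).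
   (if j = Suc m then - real m else if j = Suc (Suc m) then 1 else 0) * exp_bump j t)) (at t)"
 proof -
  have "(\<Sum>j\<le>m. (if j = Suc m then - real m else if j = Suc (Suc m) then 1 else 0) * exp_bump j t) = 0"
   by (rule sum.neutral) auto
  then show ?thesis using exp_bump_deriv[of m t] by simp
 qed
qed

text \<open>The squared distance is a polynomial and hence smooth at the centre as well.\<close>

definition ball_bump :: "real^'n::finite \<Rightarrow> real \<Rightarrow> real^'n \<Rightarrow> real" where
 "ball_bump a r x = exp_bump 0 (r^2 - (dist x a)^2)"

lemma ball_bump_nonneg: "ball_bump a r x \<ge> 0"
 by (simp add: ball_bump_def exp_bump_def)

lemma ball_bump_pos_iff: "r > 0 \<Longrightarrow> ball_bump a r x > 0 \<longleftrightarrow> x \<in> ball a r"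
 using power2_less_imp_less[of "dist x a" r] power_strict_mono[of "dist x a" r 2]
 by (auto simp: ball_bump_def exp_bump_def dist_commute)

lemma smooth_on_ball_bump: "open S \<Longrightarrow> smooth_on S (ball_bump a r)"
proof -
 assume S: "open S"
 have "(dist x a)^2 = (\<Sum>\<^sub>U i. (x $ i - a $ i) * (x $ i - a $ i))" for x
  by (simp add: dist_norm norm_vec_def L2_set_def sum_nonneg power2_eq_square)
 then have "smooth_on S (\<lambda>x. exp_bump 0 (r^2 - (dist x a)^2))"
  by (simp, intro smooth_on_exp_bump S smooth_on_diff smooth_on_const smooth_on_sum smooth_on_mult smooth_on_coord) auto
 then show ?thesis by (simp add: ball_bump_def[abs_def])
qed

text \<open>\<open>S\<close> and the complement of \<open>K\<close> are open sets that cover the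
  space.\<close>

lemma smooth_on_extend:
 assumes "open S" "smooth_on S w" "closed K" "K \<subseteq> S" "\<And>x. x \<notin> K \<Longrightarrow> w x = 0"
 shows "smooth_on UNIV w"
proof (rule smooth_on_local)
 fix x
 show "\<exists>T. open T \<and> x \<in> T \<and> smooth_on T w"
 proof (cases "x \<in> K")
  case True then show ?thesis using assms by blast
 next
  case False
  have "smooth_on (-K) w"
   by (rule smooth_on_cong[OF _ smooth_on_const[of _ 0]]) (use assms in auto)
  then show ?thesis using False assms(3) by (intro exI[of _ "-K"]) auto
 qed
qed

section \<open>Determinants and inverse matrices\<close>

lemma smooth_on_det:
 fixes G :: "real^'m \<Rightarrow> real^'n^'n"
 assumes S: "open S" and G: "\<And>i j. smooth_on S (\<lambda>x. G x $ i $ j)"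
 shows "smooth_on S (\<lambda>x. det (G x))"
 unfolding det_def
 by (intro smooth_on_sum smooth_on_mult smooth_on_const smooth_on_prod S G) (auto simp: finite_permutations)

lemma matrix_inv_works:
 fixes G :: "real^'n^'n"
 assumes "det G \<noteq> 0"
 shows "G ** matrix_inv G = mat 1" "matrix_inv G ** G = mat 1"
proof -
 have "\<exists>B. G ** B = mat 1 \<and> B ** G = mat 1"
  using assms by (metis invertible_det_nz invertible_def)
 from someI_ex[OF this] show "G ** matrix_inv G = mat 1" "matrix_inv G ** G = mat 1"
  by (auto simp: matrix_inv_def)
qed

lemma smooth_on_matrix_inv:
 fixes G :: "real^'m \<Rightarrow> real^'n^'n"
 assumes S: "open S" and G: "\<And>i j. smooth_on S (\<lambda>x. G x $ i $ j)" and d: "\<And>x. x \<in> S \<Longrightarrow> det (G x) \<noteq> 0"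
 shows "smooth_on S (\<lambda>x. matrix_inv (G x) $ i $ j)"
proof (rule smooth_on_cong[OF S])
 \<comment> \<open>By Cramer's rule the entry of the inverse is this quotient of
   determinants.\<close>
 show "smooth_on S (\<lambda>x. det (\<chi> k l. if l = i then axis j 1 $ k else G x $ k $ l) / det (G x))"
 proof (intro smooth_on_divide S smooth_on_det G d)
  show "smooth_on S (\<lambda>x. (\<chi> k l. if l = i then axis j 1 $ k else G x $ k $ l) $ k $ l)" for k l
   using G by (cases "l = i") (auto intro: smooth_on_const)
 qed auto
 fix x assume x: "x \<in> S"
 have "G x *v (matrix_inv (G x) *v axis j 1) = axis j 1"
  by (simp add: matrix_vector_mul_assoc matrix_inv_works d[OF x])
 then have "matrix_inv (G x) *v axis j 1 = (\<chi> k. det(\<chi> i l. if l=k then axis j 1 $ i else G x $i$l) / det (G x))"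
  using cramer[OF d[OF x]] by blast
 then have "(matrix_inv (G x) *v axis j 1) $ i = det(\<chi> k l. if l=i then axis j 1 $ k else G x $k$l) / det (G x)"
  by simp
 then show "det (\<chi> k l. if l = i then axis j 1 $ k else G x $ k $ l) / det (G x) = matrix_inv (G x) $ i $ j"
  by (simp add: matrix_vector_mult_basis column_def)
qed

section \<open>Symmetry of second derivatives\<close>

lemma partial_line_deriv:
 assumes "f differentiable (at (p + s *\<^sub>R axis i 1))"
 shows "((\<lambda>s. f (p + s *\<^sub>R axis i 1)) has_real_derivative partial i f (p + s *\<^sub>R axis i 1)) (at s)"
proof -
 have D: "(f has_derivative (\<lambda>h. \<Sum>\<^sub>U j. h $ j * partial j f (p + s *\<^sub>R axis i 1))) (at (p + s *\<^sub>R axis i 1))"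
  by (rule has_derivative_partial[OF assms])
 have "((\<lambda>s. p + s *\<^sub>R axis i (1::real)) has_derivative (\<lambda>h. h *\<^sub>R axis i 1)) (at s)"
  by (auto intro!: derivative_eq_intros)
 from diff_chain_at[OF this D]
 have "((\<lambda>s. f (p + s *\<^sub>R axis i 1)) has_derivative
  (\<lambda>h. \<Sum>\<^sub>U j. (h *\<^sub>R axis i 1) $ j * partial j f (p + s *\<^sub>R axis i 1))) (at s)"
  by (simp add: o_def)
 moreover have "(\<lambda>h. \<Sum>\<^sub>U j. (h *\<^sub>R axis i 1) $ j * partial j f (p + s *\<^sub>R axis i 1))
   = (*) (partial i f (p + s *\<^sub>R axis i 1))"
  by (simp add: fun_eq_iff axis_def if_distrib if_distribR sum.delta cong: if_cong)
 ultimately show ?thesis by (simp add: has_field_derivative_def)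
qed

text \<open>The mean value theorem in direction \<open>i\<close>, then in direction
  \<open>j\<close>. The second difference is symmetric in \<open>i\<close> and \<open>j\<close>, so
  exchanging them evaluates the same number by the mixed derivative taken in the other
  order.\<close>

lemma second_difference:
 assumes S: "open S" and f: "Ck_on 2 S f" and h: "h > 0"
  and sub: "\<And>s t. \<bar>s\<bar> \<le> h \<Longrightarrow> \<bar>t\<bar> \<le> h \<Longrightarrow> x + s *\<^sub>R axis i 1 + t *\<^sub>R axis j 1 \<in> S"
 obtains s t where "0 < s" "s < h" "0 < t" "t < h"
  "f (x + h *\<^sub>R axis i 1 + h *\<^sub>R axis j 1) - f (x + h *\<^sub>R axis i 1) - f (x + h *\<^sub>R axis j 1) + f x
  = h * (h * partial j (partial i f) (x + s *\<^sub>R axis i 1 + t *\<^sub>R axis j 1))"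
proof -
 have d: "f differentiable (at y)" "partial i f differentiable (at y)" if "y \<in> S" for y i
  using f that by (auto simp: numeral_2_eq_2)
 define g where "g s = f (x + h *\<^sub>R axis j 1 + s *\<^sub>R axis i 1) - f (x + s *\<^sub>R axis i 1)" for s
 have "(g has_real_derivative partial i f (x + h *\<^sub>R axis j 1 + s *\<^sub>R axis i 1) - partial i f (x + s *\<^sub>R axis i 1)) (at s)"
  if "0 \<le> s" "s \<le> h" for s
  unfolding g_def using sub[of s h] sub[of s 0] that h
  by (intro DERIV_diff partial_line_deriv d) (auto simp: algebra_simps)
 from MVT2[of 0 h g, OF h this] obtain s where s: "0 < s" "s < h"
  "g h - g 0 = h * (partial i f (x + h *\<^sub>R axis j 1 + s *\<^sub>R axis i 1) - partial i f (x + s *\<^sub>R axis i 1))"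
  by auto
 have "((\<lambda>t. partial i f (x + s *\<^sub>R axis i 1 + t *\<^sub>R axis j 1)) has_real_derivative
   partial j (partial i f) (x + s *\<^sub>R axis i 1 + t *\<^sub>R axis j 1)) (at t)" if "0 \<le> t" "t \<le> h" for t
  using sub[of s t] s that by (intro partial_line_deriv d) auto
 from MVT2[of 0 h, OF h this] obtain t where t: "0 < t" "t < h"
  "partial i f (x + s *\<^sub>R axis i 1 + h *\<^sub>R axis j 1) - partial i f (x + s *\<^sub>R axis i 1)
   = h * partial j (partial i f) (x + s *\<^sub>R axis i 1 + t *\<^sub>R axis j 1)" by auto
 show ?thesis
 proof (rule that[OF s(1,2) t(1,2)])
  have "f (x + h *\<^sub>R axis i 1 + h *\<^sub>R axis j 1) - f (x + h *\<^sub>R axis i 1) - f (x + h *\<^sub>R axis j 1) + f x = g h - g 0"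
   by (simp add: g_def algebra_simps)
  also have "\<dots> = h * (partial i f (x + s *\<^sub>R axis i 1 + h *\<^sub>R axis j 1) - partial i f (x + s *\<^sub>R axis i 1))"
   unfolding s(3) by (simp add: add_ac)
  finally show "f (x + h *\<^sub>R axis i 1 + h *\<^sub>R axis j 1) - f (x + h *\<^sub>R axis i 1) - f (x + h *\<^sub>R axis j 1) + f x
  = h * (h * partial j (partial i f) (x + s *\<^sub>R axis i 1 + t *\<^sub>R axis j 1))" unfolding t(3) .
 qed
qed

lemma partial_partial_commute:
 assumes S: "open S" and f: "Ck_on 2 S f" and x: "x \<in> S"
 shows "partial i (partial j f) x = partial j (partial i f) x"
proof (rule ccontr)
 assume ne: "\<not> ?thesis"
 define e where "e = \<bar>partial i (partial j f) x - partial j (partial i f) x\<bar> / 2"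
 have e: "e > 0" using ne by (simp add: e_def)
 have c: "continuous_on S (partial i (partial j f))" for i j using f by (simp add: numeral_2_eq_2)
 obtain r1 where r1: "r1 > 0" "\<And>y. dist y x < r1 \<Longrightarrow> dist (partial i (partial j f) y) (partial i (partial j f) x) < e"
  using c[of i j] S x e by (metis continuous_on_eq_continuous_at continuous_at_eps_delta dist_norm real_norm_def)
 obtain r2 where r2: "r2 > 0" "\<And>y. dist y x < r2 \<Longrightarrow> dist (partial j (partial i f) y) (partial j (partial i f) x) < e"
  using c[of j i] S x e by (metis continuous_on_eq_continuous_at continuous_at_eps_delta dist_norm real_norm_def)
 obtain r3 where r3: "r3 > 0" "ball x r3 \<subseteq> S" using S x by (meson openE)
 \<comment> \<open>The displaced points are at distance at most \<open>2 * h\<close> from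
   \<open>x\<close>, so the factor 3 keeps them inside all three balls.\<close>
 define h where "h = Min {r1, r2, r3} / 3"
 have h: "h > 0" "3 * h \<le> r1" "3 * h \<le> r2" "3 * h \<le> r3" using r1 r2 r3 by (auto simp: h_def)
 have dist: "dist (x + s *\<^sub>R axis i 1 + t *\<^sub>R axis j 1) x < 3 * h"
  if "\<bar>s\<bar> \<le> h" "\<bar>t\<bar> \<le> h" for s t and i j :: 'a
 proof -
  have "norm (s *\<^sub>R axis i (1::real) + t *\<^sub>R axis j 1) \<le> \<bar>s\<bar> + \<bar>t\<bar>"
   using norm_triangle_ineq[of "s *\<^sub>R axis i (1::real)" "t *\<^sub>R axis j 1"] by (simp add: norm_axis_1)
  then show ?thesis using that h by (simp add: dist_norm add.assoc)
 qed
 then have sub: "x + s *\<^sub>R axis i 1 + t *\<^sub>R axis j 1 \<in> S" if "\<bar>s\<bar> \<le> h" "\<bar>t\<bar> \<le> h" for s t and i j :: 'a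
  using dist[OF that, of i j] r3(2) h(4) by (intro subsetD[OF r3(2)]) (simp add: dist_commute)
 obtain s t where st: "0 < s" "s < h" "0 < t" "t < h"
  "f (x + h *\<^sub>R axis i 1 + h *\<^sub>R axis j 1) - f (x + h *\<^sub>R axis i 1) - f (x + h *\<^sub>R axis j 1) + f x
  = h * (h * partial j (partial i f) (x + s *\<^sub>R axis i 1 + t *\<^sub>R axis j 1))"
  using second_difference[OF S f h(1) sub, of i j] by blast
 obtain s' t' where st': "0 < s'" "s' < h" "0 < t'" "t' < h"
  "f (x + h *\<^sub>R axis j 1 + h *\<^sub>R axis i 1) - f (x + h *\<^sub>R axis j 1) - f (x + h *\<^sub>R axis i 1) + f x
  = h * (h * partial i (partial j f) (x + s' *\<^sub>R axis j 1 + t' *\<^sub>R axis i 1))"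
  using second_difference[OF S f h(1) sub, of j i] by blast
 have "h * (h * partial j (partial i f) (x + s *\<^sub>R axis i 1 + t *\<^sub>R axis j 1))
   = h * (h * partial i (partial j f) (x + s' *\<^sub>R axis j 1 + t' *\<^sub>R axis i 1))"
  using st(5) st'(5) by (simp only: add.assoc add.commute[of "h *\<^sub>R axis j 1" "h *\<^sub>R axis i 1"])
 then have eq: "partial j (partial i f) (x + s *\<^sub>R axis i 1 + t *\<^sub>R axis j 1)
   = partial i (partial j f) (x + s' *\<^sub>R axis j 1 + t' *\<^sub>R axis i 1)" using h by simp
 have "dist (partial j (partial i f) (x + s *\<^sub>R axis i 1 + t *\<^sub>R axis j 1)) (partial j (partial i f) x) < e"
  using st h dist[of s t i j] by (intro r2) auto
 moreover have "dist (partial i (partial j f) (x + s' *\<^sub>R axis j 1 + t' *\<^sub>R axis i 1)) (partial i (partial j f) x) < e"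
  using st' h dist[of s' t' j i] by (intro r1) auto
 ultimately show False unfolding eq e_def dist_real_def by (smt (verit) field_sum_of_halves)
qed

lemma smooth_on_partial_commute:
 "open S \<Longrightarrow> smooth_on S f \<Longrightarrow> x \<in> S \<Longrightarrow> partial i (partial j f) x = partial j (partial i f) x"
 using partial_partial_commute smooth_on_Ck by blast

section \<open>Compactly supported derivatives integrate to zero\<close>

lemma continuous_compact_support_integrable:
 fixes w :: "'a::euclidean_space \<Rightarrow> real"
 assumes "continuous_on UNIV w" "bounded {x. w x \<noteq> 0}"
 shows "integrable lborel w"
proof -
 obtain r where r: "{x. w x \<noteq> 0} \<subseteq> cball 0 r" using assms(2) by (auto simp: bounded_iff subset_iff)
 have "integrable lborel (\<lambda>x. indicator (cball 0 r) x *\<^sub>R w x)"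
  by (rule borel_integrable_compact) (auto intro: continuous_on_subset[OF assms(1)])
 moreover have "(\<lambda>x. indicator (cball 0 r) x *\<^sub>R w x) = w"
  using r by (auto simp: fun_eq_iff indicator_def)
 ultimately show ?thesis by simp
qed

text \<open>Difference quotients of \<open>w\<close> have integral 0 by translation invariance. They
  are bounded by the supremum of the derivative and vanish outside the ball of radius
  \<open>r + 1\<close>, because the increments are at most 1; dominated convergence passes to the
  derivative.\<close>

lemma integral_partial_zero:
 fixes w :: "real^'n \<Rightarrow> real"
 assumes w: "Ck_on 1 UNIV w" and supp: "bounded {x. w x \<noteq> 0}"
 shows "integral\<^sup>L lborel (partial i w) = 0" "integrable lborel (partial i w)"
proof -
 let ?e = "axis i 1 :: real^'n"
 have d: "w differentiable (at x)" for x using w by simp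
 have cw: "continuous_on UNIV w" using Ck_on_SucD[of 0 UNIV w] w by simp
 have cp: "continuous_on UNIV (partial i w)" using w by simp
 obtain r where r: "\<And>x. w x \<noteq> 0 \<Longrightarrow> norm x \<le> r" using supp unfolding bounded_iff by blast
 have pz: "partial i w x = 0" if "norm x > r" for x
 proof -
  have "partial i w x = partial i (\<lambda>x. 0) x"
   using that r by (intro partial_cong_open[of "- cball 0 r"]) (simp_all add: open_Compl, force)
  then show ?thesis by simp
 qed
 have bp: "bounded {x. partial i w x \<noteq> 0}"
  using pz by (auto simp: bounded_iff intro!: exI[of _ r]) (meson not_le)
 show ip: "integrable lborel (partial i w)" by (rule continuous_compact_support_integrable[OF cp bp])
 have iw: "integrable lborel w" by (rule continuous_compact_support_integrable[OF cw supp])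
 obtain B where B: "\<And>x. \<bar>partial i w x\<bar> \<le> B"
 proof -
  have "bounded (partial i w ` cball 0 r)"
   by (intro compact_imp_bounded compact_continuous_image continuous_on_subset[OF cp]) auto
  then obtain B where "\<forall>y\<in>partial i w ` cball 0 r. norm y \<le> B" unfolding bounded_iff by blast
  then have "\<bar>partial i w x\<bar> \<le> B" if "norm x \<le> r" for x using that by auto
  then have "\<bar>partial i w x\<bar> \<le> max B 0" for x
   by (cases "norm x \<le> r") (simp_all add: pz le_max_iff_disj)
  then show ?thesis using that by blast
 qed
 define s where "s n x = (w (x + (1 / Suc n) *\<^sub>R ?e) - w x) * Suc n" for n :: nat and x
 have shift: "integral\<^sup>L lborel (\<lambda>x. w (x + a)) = integral\<^sup>L lborel w \<and> integrable lborel (\<lambda>x. w (x + a))" for a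
 proof -
  have [measurable]: "w \<in> borel_measurable borel" using cw by (rule borel_measurable_continuous_onI)
  have "integral\<^sup>L (distr lborel borel ((+) a)) w = integral\<^sup>L lborel (\<lambda>x. w (a + x))"
   by (rule integral_distr) auto
  moreover have "integrable (distr lborel borel ((+) a)) w = integrable lborel (\<lambda>x. w (a + x))"
   by (rule integrable_distr_eq) auto
  ultimately show ?thesis using iw by (simp add: lborel_distr_plus add.commute)
 qed
 have s0: "integral\<^sup>L lborel (s n) = 0" for n
  unfolding s_def using shift iw by (simp add: Bochner_Integration.integral_diff)
 have "(\<lambda>n. integral\<^sup>L lborel (s n)) \<longlonglongrightarrow> integral\<^sup>L lborel (partial i w)"
 proof (rule integral_dominated_convergence[where w="\<lambda>x. indicator (cball 0 (r + 1)) x *\<^sub>R B"])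
  show "partial i w \<in> borel_measurable lborel" using ip by simp
  show "s n \<in> borel_measurable lborel" for n
   unfolding s_def using shift iw by (intro borel_measurable_times borel_measurable_diff) auto
  show "integrable lborel (\<lambda>x. indicator (cball 0 (r + 1)) x *\<^sub>R B)"
   by (rule borel_integrable_compact) auto
  show "AE x in lborel. (\<lambda>n. s n x) \<longlonglongrightarrow> partial i w x"
  proof (rule AE_I2)
   fix x
   have "((\<lambda>s. w (x + s *\<^sub>R ?e)) has_real_derivative partial i w (x + 0 *\<^sub>R ?e)) (at 0)"
    by (rule partial_line_deriv[OF d])
   then have "((\<lambda>h. (w (x + h *\<^sub>R ?e) - w x) / h) \<longlongrightarrow> partial i w x) (at 0)" by (simp add: DERIV_def)
   moreover have "filterlim (\<lambda>n. 1 / real (Suc n)) (at 0) sequentially"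
    unfolding filterlim_at using LIMSEQ_inverse_real_of_nat by (auto simp: inverse_eq_divide)
   ultimately have "(\<lambda>n. (w (x + (1 / real (Suc n)) *\<^sub>R ?e) - w x) / (1 / real (Suc n))) \<longlonglongrightarrow> partial i w x"
    by (rule filterlim_compose)
   then show "(\<lambda>n. s n x) \<longlonglongrightarrow> partial i w x" by (simp add: s_def)
  qed
  show "AE x in lborel. norm (s n x) \<le> indicator (cball 0 (r + 1)) x *\<^sub>R B" for n
  proof (rule AE_I2)
   fix x
   show "norm (s n x) \<le> indicator (cball 0 (r + 1)) x *\<^sub>R B"
   proof (cases "norm x \<le> r + 1")
    case True
    have "\<exists>z. 0 < z \<and> z < 1 / real (Suc n) \<and> w (x + (1 / real (Suc n)) *\<^sub>R ?e) - w (x + 0 *\<^sub>R ?e)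
      = (1 / real (Suc n) - 0) * partial i w (x + z *\<^sub>R ?e)"
     by (rule MVT2) (auto intro!: partial_line_deriv d)
    then obtain z where "w (x + (1 / real (Suc n)) *\<^sub>R ?e) - w x = 1 / real (Suc n) * partial i w (x + z *\<^sub>R ?e)"
     by auto
    then have "s n x = partial i w (x + z *\<^sub>R ?e)" by (simp add: s_def)
    then show ?thesis using True B by (simp add: indicator_def)
   next
    case False
    have "norm (x + (1 / real (Suc n)) *\<^sub>R ?e) \<ge> norm x - norm ((1 / real (Suc n)) *\<^sub>R ?e)"
     by (metis add.commute norm_diff_ineq)
    moreover have "norm ((1 / real (Suc n)) *\<^sub>R ?e) \<le> 1" by (simp add: norm_axis_1)
    ultimately have "norm (x + (1 / real (Suc n)) *\<^sub>R ?e) > r" using False by linarith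
    then have "w (x + (1 / real (Suc n)) *\<^sub>R ?e) = 0" "w x = 0" using r[of "x + (1 / real (Suc n)) *\<^sub>R ?e"] r[of x] False by fastforce+
    then show ?thesis using False by (simp add: s_def)
   qed
  qed
 qed
 then show "integral\<^sup>L lborel (partial i w) = 0" unfolding s0 using LIMSEQ_unique tendsto_const by blast
qed

section \<open>Positive definite matrices\<close>

text \<open>Cholesky factorisation by elimination of one index: \<open>S'\<close> is the Schur
  complement of the pivot \<open>S a a\<close>, and the new row of the factor is
  \<open>S a i / sqrt (S a a)\<close>.\<close>

lemma posdef_factor:
 fixes S :: "'i \<Rightarrow> 'i \<Rightarrow> real"
 assumes "finite I" "\<And>i j. S i j = S j i"
  "\<And>v. \<exists>i\<in>I. v i \<noteq> 0 \<Longrightarrow> (\<Sum>i\<in>I. \<Sum>j\<in>I. v i * v j * S i j) > 0"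
 shows "\<exists>r. \<forall>i\<in>I. \<forall>j\<in>I. S i j = (\<Sum>m\<in>I. r m i * r m j)"
 using assms
proof (induction I arbitrary: S rule: finite_induct)
 case (insert a I)
 define e where "e i = (if i = a then 1 else (0::real))" for i
 have e: "e a = 1" "\<And>i. i \<in> I \<Longrightarrow> e i = 0" using insert.hyps by (auto simp: e_def)
 have "(\<Sum>i\<in>insert a I. \<Sum>j\<in>insert a I. e i * e j * S i j) = S a a"
  using insert.hyps e by simp
 then have pos: "S a a > 0" using insert.prems(2)[of e] e by simp
 define S' where "S' i j = S i j - S a i * S a j / S a a" for i j
 have sym: "S i j = S j i" for i j using insert.prems(1) by simp
 have "\<exists>r. \<forall>i\<in>I. \<forall>j\<in>I. S' i j = (\<Sum>m\<in>I. r m i * r m j)"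
 proof (rule insert.IH)
  show "S' i j = S' j i" for i j using sym[of i j] by (simp add: S'_def)
  fix v :: "'i \<Rightarrow> real" assume v: "\<exists>i\<in>I. v i \<noteq> 0"
  define s where "s = (\<Sum>j\<in>I. S a j * v j)"
  \<comment> \<open>The value at \<open>a\<close> minimises the quadratic form for fixed
    \<open>v\<close> on \<open>I\<close>; the minimum is the form of the Schur complement at
    \<open>v\<close>.\<close>
  define w where "w = v(a := - s / S a a)"
  have wI: "w i = v i" if "i \<in> I" for i using that insert.hyps by (auto simp: w_def)
  have "0 < (\<Sum>i\<in>insert a I. \<Sum>j\<in>insert a I. w i * w j * S i j)"
   using v wI by (intro insert.prems(2)) force
  also have "\<dots> = w a * w a * S a a + (\<Sum>j\<in>I. w a * v j * S a j) + (\<Sum>i\<in>I. v i * w a * S i a + (\<Sum>j\<in>I. v i * v j * S i j))"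
   using insert.hyps wI by simp
  also have "\<dots> = w a * w a * S a a + 2 * (w a * s) + (\<Sum>i\<in>I. \<Sum>j\<in>I. v i * v j * S i j)"
  proof -
   have "(\<Sum>j\<in>I. w a * v j * S a j) = w a * s" by (simp add: s_def sum_distrib_left mult_ac)
   moreover have "(\<Sum>i\<in>I. v i * w a * S i a) = w a * s"
    unfolding s_def sum_distrib_left by (rule sum.cong) (simp_all add: sym[of _ a])
   ultimately show ?thesis by (simp add: sum.distrib)
  qed
  also have "\<dots> = (\<Sum>i\<in>I. \<Sum>j\<in>I. v i * v j * S i j) - s * s / S a a"
   using pos by (simp add: w_def field_simps)
  also have "s * s = (\<Sum>i\<in>I. \<Sum>j\<in>I. v i * v j * (S a i * S a j))"
   unfolding s_def sum_product by (simp add: mult_ac)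
  finally show "(\<Sum>i\<in>I. \<Sum>j\<in>I. v i * v j * S' i j) > 0"
   by (simp add: S'_def right_diff_distrib sum_subtractf sum_divide_distrib)
 qed
 then obtain r where r: "\<And>i j. i \<in> I \<Longrightarrow> j \<in> I \<Longrightarrow> S' i j = (\<Sum>m\<in>I. r m i * r m j)" by blast
 define r' where "r' m i = (if m = a then S a i / sqrt (S a a) else if i = a then 0 else r m i)" for m i
 have *: "(\<Sum>m\<in>I. r' m i * r' m j) = (if i = a \<or> j = a then 0 else \<Sum>m\<in>I. r m i * r m j)" for i j
 proof -
  have "(\<Sum>m\<in>I. r' m i * r' m j) = (\<Sum>m\<in>I. if i = a \<or> j = a then 0 else r m i * r m j)"
   using insert.hyps by (intro sum.cong) (auto simp: r'_def)
  then show ?thesis by simp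
 qed
 have "S i j = (\<Sum>m\<in>insert a I. r' m i * r' m j)" if "i \<in> insert a I" "j \<in> insert a I" for i j
 proof -
  have 1: "r' a i * r' a j = S a i * S a j / S a a" using pos by (simp add: r'_def)
  show ?thesis
   using insert.hyps that pos r[of i j] sym[of i a] unfolding sum.insert[OF insert.hyps] 1 *
   by (auto simp: S'_def)
 qed
 then show ?case by blast
qed simp

lemma posdef_matrix_factor:
 fixes S :: "real^'n^'n"
 assumes sym: "transpose S = S" and pos: "\<And>v. v \<noteq> 0 \<Longrightarrow> v \<bullet> (S *v v) > 0"
 obtains R :: "real^'n^'n" where "S = transpose R ** R"
proof -
 have quad: "v \<bullet> (S *v v) = (\<Sum>\<^sub>U i j. v $ i * v $ j * S $ i $ j)" for v
  by (simp add: inner_vec_def matrix_vector_mult_def sum_distrib_left mult_ac)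
 have "\<exists>r. \<forall>i\<in>UNIV. \<forall>j\<in>UNIV. S $ i $ j = (\<Sum>m::'n\<in>UNIV. r m i * r m j)"
 proof (rule posdef_factor[of UNIV "\<lambda>i j. S $ i $ j"])
  show "S $ i $ j = S $ j $ i" for i j using sym by (metis transpose_def vec_lambda_beta)
  fix v :: "'n \<Rightarrow> real" assume "\<exists>i\<in>UNIV. v i \<noteq> 0"
  then have "(\<chi> i. v i) \<noteq> 0" by (auto simp: vec_eq_iff)
  from pos[OF this] show "0 < (\<Sum>\<^sub>U i j. v i * v j * S $ i $ j)" by (simp add: quad)
 qed simp
 then obtain r where "\<And>i j. S $ i $ j = (\<Sum>m::'n\<in>UNIV. r m i * r m j)" by auto
 then have "S = transpose (\<chi> m i. r m i) ** (\<chi> m i. r m i)"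
  by (simp add: vec_eq_iff matrix_matrix_mult_def transpose_def)
 then show ?thesis using that by blast
qed

text \<open>The determinant is a square by the factorisation, and nonzero because positivity makes
  the kernel trivial.\<close>

lemma posdef_det_pos:
 fixes S :: "real^'n^'n"
 assumes sym: "transpose S = S" and pos: "\<And>v. v \<noteq> 0 \<Longrightarrow> v \<bullet> (S *v v) > 0"
 shows "det S > 0"
proof -
 obtain R :: "real^'n^'n" where R: "S = transpose R ** R" by (rule posdef_matrix_factor[OF assms])
 have "S *v v = 0 \<Longrightarrow> v = 0" for v using pos[of v] by fastforce
 then have "det S \<noteq> 0" unfolding invertible_det_nz[symmetric] invertible_left_inverse matrix_left_invertible_ker by blast
 moreover have "det S = det R * det R" by (simp add: R det_mul)
 ultimately show ?thesis by (metis not_real_square_gt_zero mult_zero_left)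
qed

lemma matrix_inv_unique_left:
 fixes S :: "real^'n^'n"
 assumes "B ** S = mat 1"
 shows "matrix_inv S = B"
proof -
 have "S ** B = mat 1" using assms by (simp add: matrix_left_right_inverse)
 then have "\<exists>A'. S ** A' = mat 1 \<and> A' ** S = mat 1" using assms by blast
 then have "S ** matrix_inv S = mat 1" unfolding matrix_inv_def by (rule someI2_ex) auto
 then have "B ** (S ** matrix_inv S) = B" by simp
 then show ?thesis using assms by (simp add: matrix_mul_assoc)
qed

lemma posdef_matrix_inv:
 fixes S :: "real^'n^'n"
 assumes sym: "transpose S = S" and pos: "\<And>v. v \<noteq> 0 \<Longrightarrow> v \<bullet> (S *v v) > 0"
 shows "transpose (matrix_inv S) = matrix_inv S" "v \<noteq> 0 \<Longrightarrow> v \<bullet> (matrix_inv S *v v) > 0"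
proof -
 have d: "det S \<noteq> 0" using posdef_det_pos[OF assms] by simp
 note inv = matrix_inv_works[OF d]
 have "transpose (matrix_inv S) ** S = mat 1"
  using arg_cong[OF inv(1), of transpose] by (simp add: matrix_transpose_mul sym transpose_mat)
 then show "transpose (matrix_inv S) = matrix_inv S" by (metis matrix_inv_unique_left)
 assume v: "v \<noteq> 0"
 let ?w = "matrix_inv S *v v"
 have w: "S *v ?w = v" by (simp add: matrix_vector_mul_assoc inv)
 then have "?w \<noteq> 0" using v by auto
 from pos[OF this] show "v \<bullet> (matrix_inv S *v v) > 0" by (simp add: w inner_commute)
qed

lemma jacobi_formula:
 fixes G :: "real^'m \<Rightarrow> real^'n^'n"
 assumes dG: "\<And>a b. (\<lambda>y. G y $ a $ b) differentiable (at x)" and d: "det (G x) \<noteq> 0"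
 shows "(\<lambda>y. det (G y)) differentiable (at x)"
  "partial i (\<lambda>y. det (G y)) x
   = det (G x) * (\<Sum>\<^sub>U a b. matrix_inv (G x) $ a $ b * partial i (\<lambda>y. G y $ b $ a) x)"
proof -
 have diff: "(\<lambda>y. det (M y)) differentiable (at x)"
  if "\<And>a b. (\<lambda>y. M y $ a $ b) differentiable (at x)" for M :: "real^'m \<Rightarrow> real^'n^'n"
 proof -
  have "((\<lambda>y. det (M y)) has_derivative (\<lambda>h. \<Sum>p | p permutes (UNIV::'n set). of_int (sign p) *
    (\<Sum>\<^sub>U a. frechet_derivative (\<lambda>y. M y $ a $ p a) (at x) h * (\<Prod>b\<in>UNIV - {a}. M x $ b $ p b)))) (at x)"
   unfolding det_def using that frechet_derivative_works
   by (intro has_derivative_sum has_derivative_mult_right has_derivative_prod) blast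
  then show ?thesis by (auto simp: differentiable_def)
 qed
 show "(\<lambda>y. det (G y)) differentiable (at x)" by (rule diff[OF dG])
 \<comment> \<open>After this normalisation \<open>M x\<close> is the identity. A permutation other
   than \<open>id\<close> moves at least two indices, so each of its products keeps a zero factor
   even when one factor is replaced by a derivative; only the trace of the derivative
   remains.\<close>
 define M where "M y = matrix_inv (G x) ** G y" for y
 have M: "M y $ a $ b = (\<Sum>\<^sub>U k. matrix_inv (G x) $ a $ k * G y $ k $ b)" for y a b
  by (simp add: M_def matrix_matrix_mult_def)
 have dM: "(\<lambda>y. M y $ a $ b) differentiable (at x)" for a b
  unfolding M using dG by (intro differentiable_sum differentiable_mult) auto
 have pM: "partial i (\<lambda>y. M y $ a $ b) x = (\<Sum>\<^sub>U k. matrix_inv (G x) $ a $ k * partial i (\<lambda>y. G y $ k $ b) x)" for a b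
  unfolding M using dG by (subst partial_sum) (auto intro!: differentiable_mult simp: partial_cmult)
 have Mx: "M x = mat 1" by (simp add: M_def matrix_inv_works[OF d])
 let ?P = "{p. p permutes (UNIV::'n set)}"
 let ?D = "\<lambda>a b. frechet_derivative (\<lambda>y. M y $ a $ b) (at x)"
 have "((\<lambda>y. det (M y)) has_derivative (\<lambda>h. \<Sum>p\<in>?P. of_int (sign p) *
   (\<Sum>\<^sub>U a. ?D a (p a) h * (\<Prod>b\<in>UNIV - {a}. M x $ b $ p b)))) (at x)"
  unfolding det_def using dM frechet_derivative_works
  by (intro has_derivative_sum has_derivative_mult_right has_derivative_prod) blast
 from partial_unique[OF this]
 have "partial i (\<lambda>y. det (M y)) x = (\<Sum>p\<in>?P. of_int (sign p) *
   (\<Sum>\<^sub>U a. partial i (\<lambda>y. M y $ a $ p a) x * (\<Prod>b\<in>UNIV - {a}. M x $ b $ p b)))"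
  by (simp add: partial_def)
 also have "\<dots> = (\<Sum>p\<in>{id}. of_int (sign p) *
   (\<Sum>\<^sub>U a. partial i (\<lambda>y. M y $ a $ p a) x * (\<Prod>b\<in>UNIV - {a}. M x $ b $ p b)))"
 proof (rule sum.mono_neutral_right)
  show "\<forall>p\<in>?P - {id}. of_int (sign p) *
   (\<Sum>\<^sub>U a. partial i (\<lambda>y. M y $ a $ p a) x * (\<Prod>b\<in>UNIV - {a}. M x $ b $ p b)) = 0"
  proof
   fix p assume p: "p \<in> ?P - {id}"
   have "(\<Prod>b\<in>UNIV - {a}. M x $ b $ p b) = 0" for a
   proof -
    have inj: "inj p" using p by (auto dest: permutes_inj)
    obtain c where c: "p c \<noteq> c" using p by fastforce
    have "\<exists>b. b \<noteq> a \<and> p b \<noteq> b"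
    proof (cases "c = a")
     case True
     have "p (p c) \<noteq> p c" using inj c by (simp add: inj_eq)
     then show ?thesis using c True by (intro exI[of _ "p c"]) auto
    qed (use c in blast)
    then obtain b where b: "b \<noteq> a" "p b \<noteq> b" by blast
    then have "M x $ b $ p b = 0" by (auto simp: Mx mat_def)
    then show ?thesis using b(1) by (intro prod_zero bexI[of _ b]) auto
   qed
   then show "of_int (sign p) *
    (\<Sum>\<^sub>U a. partial i (\<lambda>y. M y $ a $ p a) x * (\<Prod>b\<in>UNIV - {a}. M x $ b $ p b)) = 0"
    by (simp only: mult_zero_right sum.neutral_const)
  qed
 qed (auto simp: permutes_id finite_permutations)
 also have "\<dots> = (\<Sum>\<^sub>U a. partial i (\<lambda>y. M y $ a $ a) x)" by (simp add: Mx mat_def)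
 finally have pdet: "partial i (\<lambda>y. det (M y)) x = (\<Sum>\<^sub>U a. partial i (\<lambda>y. M y $ a $ a) x)" .
 have "det (G x) * det (matrix_inv (G x)) = 1"
  using arg_cong[OF matrix_inv_works(1)[OF d], of det] by (simp add: det_mul)
 then have "(\<lambda>y. det (G y)) = (\<lambda>y. det (G x) * det (M y))" by (simp add: M_def det_mul fun_eq_iff)
 then have "partial i (\<lambda>y. det (G y)) x = det (G x) * partial i (\<lambda>y. det (M y)) x"
  using partial_cmult[OF diff[OF dM], of i "det (G x)"] by (simp only:)
 then show "partial i (\<lambda>y. det (G y)) x
   = det (G x) * (\<Sum>\<^sub>U a b. matrix_inv (G x) $ a $ b * partial i (\<lambda>y. G y $ b $ a) x)"
  by (simp add: pdet pM)
qed

text \<open>Differentiate the identity that \<open>matrix_inv (G y) ** G y\<close> is constant, and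
  multiply by the inverse from the right.\<close>

lemma partial_matrix_inv:
 fixes G :: "real^'m \<Rightarrow> real^'n^'n"
 assumes U: "open U" and x: "x \<in> U" and G: "\<And>a b. smooth_on U (\<lambda>y. G y $ a $ b)"
  and d: "\<And>x. x \<in> U \<Longrightarrow> det (G x) \<noteq> 0"
 shows "partial i (\<lambda>y. matrix_inv (G y) $ a $ b) x
  = - (\<Sum>\<^sub>U k l. matrix_inv (G x) $ a $ k * partial i (\<lambda>y. G y $ k $ l) x * matrix_inv (G x) $ l $ b)"
proof -
 let ?K = "\<lambda>y. matrix_inv (G y)"
 have dG: "(\<lambda>y. G y $ a $ b) differentiable (at x)" for a b using smooth_on_differentiable[OF G x] .
 have dK: "(\<lambda>y. ?K y $ a $ b) differentiable (at x)" for a b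
  using smooth_on_differentiable[OF smooth_on_matrix_inv[OF U G d] x] by blast
 have P: "(\<Sum>\<^sub>U k. ?K x $ a $ k * partial i (\<lambda>y. G y $ k $ l) x) = - (\<Sum>\<^sub>U k. partial i (\<lambda>y. ?K y $ a $ k) x * G x $ k $ l)" for l
 proof -
  have "partial i (\<lambda>y. \<Sum>\<^sub>U k. ?K y $ a $ k * G y $ k $ l) x = partial i (\<lambda>y. (mat 1 :: real^'n^'n) $ a $ l) x"
  proof (rule partial_cong_open[OF U x])
   fix y assume "y \<in> U"
   then show "(\<Sum>\<^sub>U k. ?K y $ a $ k * G y $ k $ l) = (mat 1 :: real^'n^'n) $ a $ l"
    using matrix_inv_works(2)[OF d] by (simp add: matrix_matrix_mult_def vec_eq_iff)
  qed
  also have "\<dots> = 0" by simp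
  finally show ?thesis using dG dK
   by (subst (asm) partial_sum) (auto intro!: differentiable_mult simp: partial_mult sum.distrib eq_neg_iff_add_eq_0)
 qed
 have "(\<Sum>\<^sub>U k l. ?K x $ a $ k * partial i (\<lambda>y. G y $ k $ l) x * ?K x $ l $ b)
  = (\<Sum>\<^sub>U l. (\<Sum>\<^sub>U k. ?K x $ a $ k * partial i (\<lambda>y. G y $ k $ l) x) * ?K x $ l $ b)"
  by (subst sum.swap) (simp add: sum_distrib_right)
 also have "\<dots> = - (\<Sum>\<^sub>U l k. partial i (\<lambda>y. ?K y $ a $ k) x * G x $ k $ l * ?K x $ l $ b)"
  unfolding P by (simp add: sum_negf sum_distrib_right)
 also have "(\<Sum>\<^sub>U l k. partial i (\<lambda>y. ?K y $ a $ k) x * G x $ k $ l * ?K x $ l $ b)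
   = (\<Sum>\<^sub>U k. partial i (\<lambda>y. ?K y $ a $ k) x * (G x ** ?K x) $ k $ b)"
  by (subst sum.swap) (simp add: matrix_matrix_mult_def sum_distrib_left mult_ac)
 also have "\<dots> = partial i (\<lambda>y. ?K y $ a $ b) x"
  by (simp add: matrix_inv_works(1)[OF d[OF x]] mat_def if_distrib sum.delta cong: if_cong)
 finally show ?thesis by simp
qed

section \<open>The Laplacian and the Hessian in a chart\<close>

text \<open>The coordinate operators are defined for an arbitrary matrix field on
  \<open>real^'n\<close>, so that they can be compared for two fields related by a pullback before
  any manifold appears.\<close>

definition christ :: "(real^'n \<Rightarrow> real^'n^'n) \<Rightarrow> 'n::finite \<Rightarrow> 'n \<Rightarrow> 'n \<Rightarrow> real^'n \<Rightarrow> real" where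
 "christ G k i j x = (1/2) * (\<Sum>\<^sub>U l. matrix_inv (G x) $ k $ l *
  (partial i (\<lambda>x. G x $ j $ l) x + partial j (\<lambda>x. G x $ i $ l) x - partial l (\<lambda>x. G x $ i $ j) x))"

definition hess :: "(real^'n \<Rightarrow> real^'n^'n) \<Rightarrow> (real^'n::finite \<Rightarrow> real) \<Rightarrow> real^'n \<Rightarrow> real^'n^'n" where
 "hess G u x = (\<chi> i j. partial i (partial j u) x - (\<Sum>\<^sub>U k. christ G k i j x * partial k u x))"

definition lgrad :: "(real^'n \<Rightarrow> real^'n^'n) \<Rightarrow> (real^'n::finite \<Rightarrow> real) \<Rightarrow> real^'n \<Rightarrow> real^'n" where
 "lgrad G u x = matrix_inv (G x) *v (\<chi> i. partial i u x)"

text \<open>The inner product of the gradients of \<open>u\<close> and \<open>v\<close>, the carre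
  du champ of the Laplacian: it is the extra term in the product rule for
  \<open>llap\<close>.\<close>

definition lgam :: "(real^'n \<Rightarrow> real^'n^'n) \<Rightarrow> (real^'n::finite \<Rightarrow> real) \<Rightarrow> (real^'n \<Rightarrow> real) \<Rightarrow> real^'n \<Rightarrow> real" where
 "lgam G u v x = (\<Sum>\<^sub>U i. partial i u x * lgrad G v x $ i)"

definition llap :: "(real^'n \<Rightarrow> real^'n^'n) \<Rightarrow> (real^'n::finite \<Rightarrow> real) \<Rightarrow> real^'n \<Rightarrow> real" where
 "llap G u x = (\<Sum>\<^sub>U i. partial i (\<lambda>x. sqrt (det (G x)) * lgrad G u x $ i) x) / sqrt (det (G x))"

lemma sum_rotate3: "(\<Sum>a\<in>A. \<Sum>b\<in>B. \<Sum>c\<in>C. f a b c) = (\<Sum>b\<in>B. \<Sum>c\<in>C. \<Sum>a\<in>A. f a b c)"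
 by (subst sum.swap) (intro sum.cong refl sum.swap)

lemma sum_swap4: "(\<Sum>p\<in>A. \<Sum>q\<in>B. \<Sum>r\<in>C. \<Sum>s\<in>D. f p q r s) = (\<Sum>r\<in>C. \<Sum>s\<in>D. \<Sum>p\<in>A. \<Sum>q\<in>B. f p q r s)"
proof -
 have "(\<Sum>p\<in>A. \<Sum>q\<in>B. \<Sum>r\<in>C. \<Sum>s\<in>D. f p q r s) = (\<Sum>p\<in>A. \<Sum>r\<in>C. \<Sum>s\<in>D. \<Sum>q\<in>B. f p q r s)"
  by (intro sum.cong refl sum_rotate3)
 also have "\<dots> = (\<Sum>r\<in>C. \<Sum>s\<in>D. \<Sum>p\<in>A. \<Sum>q\<in>B. f p q r s)" by (rule sum_rotate3)
 finally show ?thesis .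
qed

lemma transpose_nth: "transpose S = S \<Longrightarrow> S $ i $ j = S $ j $ i" for S :: "'a^'n^'n"
 by (drule arg_cong[where f="\<lambda>M. M $ i $ j"]) (simp add: transpose_def)

locale local_metric =
 fixes U :: "(real^'n::finite) set" and G :: "real^'n \<Rightarrow> real^'n^'n"
 assumes open_U: "open U" and smooth_G: "\<And>i j. smooth_on U (\<lambda>x. G x $ i $ j)"
  and sym_G: "\<And>x. x \<in> U \<Longrightarrow> transpose (G x) = G x"
  and pos_G: "\<And>x v. x \<in> U \<Longrightarrow> v \<noteq> 0 \<Longrightarrow> v \<bullet> (G x *v v) > 0"
begin

abbreviation "K x \<equiv> matrix_inv (G x)"

lemma det_pos: "x \<in> U \<Longrightarrow> det (G x) > 0"
 using posdef_det_pos sym_G pos_G by blast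

lemma det_ne: "x \<in> U \<Longrightarrow> det (G x) \<noteq> 0" using det_pos by force

lemma transpose_K: "x \<in> U \<Longrightarrow> transpose (K x) = K x"
 by (rule posdef_matrix_inv(1)[OF sym_G pos_G])

lemma symG: "x \<in> U \<Longrightarrow> G x $ i $ j = G x $ j $ i"
 by (rule transpose_nth[OF sym_G])

lemma symK: "x \<in> U \<Longrightarrow> K x $ i $ j = K x $ j $ i"
 by (rule transpose_nth[OF transpose_K])

lemma smooth_K: "smooth_on U (\<lambda>x. K x $ i $ j)"
 using smooth_on_matrix_inv[OF open_U smooth_G det_ne] .

lemma partial_K: "x \<in> U \<Longrightarrow> partial i (\<lambda>y. K y $ a $ b) x
  = - (\<Sum>\<^sub>U k l. K x $ a $ k * partial i (\<lambda>y. G y $ k $ l) x * K x $ l $ b)"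
 by (rule partial_matrix_inv[OF open_U _ smooth_G det_ne])

lemma lgrad_component: "lgrad G u x $ i = (\<Sum>\<^sub>U j. K x $ i $ j * partial j u x)"
 by (simp add: lgrad_def matrix_vector_mult_def)

lemma smooth_lgrad: "smooth_on U u \<Longrightarrow> smooth_on U (\<lambda>x. lgrad G u x $ i)"
 unfolding lgrad_component
 by (intro smooth_on_sum smooth_on_mult smooth_K smooth_on_partial open_U) auto

lemma smooth_lgam: "smooth_on U u \<Longrightarrow> smooth_on U v \<Longrightarrow> smooth_on U (lgam G u v)"
 unfolding lgam_def[abs_def]
 by (intro smooth_on_sum smooth_on_mult smooth_lgrad smooth_on_partial open_U) auto

lemma smooth_density: "smooth_on U (\<lambda>x. sqrt (det (G x)))"
 by (intro smooth_on_sqrt smooth_on_det open_U smooth_G det_pos)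

lemma smooth_llap: "smooth_on U u \<Longrightarrow> smooth_on U (llap G u)"
 unfolding llap_def[abs_def] using det_pos
 by (intro smooth_on_divide smooth_on_sum smooth_on_partial smooth_on_mult smooth_lgrad smooth_density open_U) force+

lemma lgam_commute: "x \<in> U \<Longrightarrow> lgam G u v x = lgam G v u x"
 unfolding lgam_def lgrad_component sum_distrib_left
 by (subst sum.swap) (simp add: symK[of x] mult_ac)

lemma partial_G_sym: "x \<in> U \<Longrightarrow> partial k (\<lambda>x. G x $ i $ j) x = partial k (\<lambda>x. G x $ j $ i) x"
 by (intro partial_cong_open[OF open_U]) (auto simp: symG)

lemma christ_sym: "x \<in> U \<Longrightarrow> christ G k i j x = christ G k j i x"
 unfolding christ_def by (simp add: partial_G_sym[of x _ i j] add_ac)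

lemma hess_sym: "smooth_on U u \<Longrightarrow> x \<in> U \<Longrightarrow> hess G u x $ i $ j = hess G u x $ j $ i"
 unfolding hess_def by (simp add: christ_sym[of x _ i j] smooth_on_partial_commute[OF open_U, of u x i j])

text \<open>The derivative of the metric in the direction of the gradient of \<open>a\<close>,
  evaluated on the gradients of \<open>u\<close> and \<open>b\<close>. The Christoffel symbols enter
  \<open>hess_formula\<close> through such terms only.\<close>

definition third :: "(real^'n \<Rightarrow> real) \<Rightarrow> (real^'n \<Rightarrow> real) \<Rightarrow> (real^'n \<Rightarrow> real) \<Rightarrow> real^'n \<Rightarrow> real" where
 "third a u b x = (\<Sum>\<^sub>U k r s. 
  lgrad G a x $ k * lgrad G u x $ r * lgrad G b x $ s * partial k (\<lambda>x. G x $ r $ s) x)"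

lemma lgam_lower: "x \<in> U \<Longrightarrow> (\<Sum>\<^sub>U k. lgrad G u x $ k * partial k v x) = lgam G u v x"
 by (subst lgam_commute) (auto simp: lgam_def mult.commute)

text \<open>\<open>partial_K\<close> turns the derivative of the inverse metric into minus the
  derivative of the metric with both indices raised; this is the origin of
  \<open>- third a u b x\<close>.\<close>

lemma lgam_lgam:
 assumes x: "x \<in> U" and s: "smooth_on U a" "smooth_on U u" "smooth_on U b"
 shows "lgam G a (lgam G u b) x = - third a u b x
  + (\<Sum>\<^sub>U k p. lgrad G a x $ k * lgrad G b x $ p * partial k (partial p u) x)
  + (\<Sum>\<^sub>U k p. lgrad G a x $ k * lgrad G u x $ p * partial k (partial p b) x)"
proof -
 have d: "partial i w differentiable (at x)" if "smooth_on U w" for i w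
  using smooth_on_differentiable[OF smooth_on_partial[OF that] x] .
 have dK: "(\<lambda>x. K x $ i $ j) differentiable (at x)" for i j
  using smooth_on_differentiable[OF smooth_K x] .
 have raise: "(\<Sum>\<^sub>U q. K x $ p $ q * partial q w x) = lgrad G w x $ p" for p w
  by (simp add: lgrad_component)
 have raise': "(\<Sum>\<^sub>U q. K x $ q $ p * partial q w x) = lgrad G w x $ p" for p w
  by (simp add: lgrad_component symK[OF x, of _ p])
 have P: "partial k (lgam G u b) x
   = - (\<Sum>\<^sub>U r s. lgrad G u x $ r * lgrad G b x $ s * partial k (\<lambda>x. G x $ r $ s) x)
   + (\<Sum>\<^sub>U p. lgrad G b x $ p * partial k (partial p u) x)
   + (\<Sum>\<^sub>U p. lgrad G u x $ p * partial k (partial p b) x)" for k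
 proof -
  have "partial k (lgam G u b) x = partial k (\<lambda>x. \<Sum>\<^sub>U p q. partial p u x * (K x $ p $ q * partial q b x)) x"
   by (simp add: lgam_def[abs_def] lgrad_component sum_distrib_left)
  also have "\<dots> = (\<Sum>\<^sub>U p q. partial k (\<lambda>x. partial p u x * (K x $ p $ q * partial q b x)) x)"
  proof -
   have t: "(\<lambda>x. partial p u x * (K x $ p $ q * partial q b x)) differentiable (at x)" for p q
    by (intro differentiable_mult d dK s)
   then have "(\<lambda>x. \<Sum>\<^sub>U q. partial p u x * (K x $ p $ q * partial q b x)) differentiable (at x)" for p
    by (intro differentiable_sum) auto
   then show ?thesis by (simp add: partial_sum t)
  qed
  also have "\<dots> = (\<Sum>\<^sub>U p q. partial p u x * (K x $ p $ q * partial k (partial q b) x)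
    + partial p u x * (partial k (\<lambda>x. K x $ p $ q) x * partial q b x)
    + partial k (partial p u) x * (K x $ p $ q * partial q b x))"
   by (intro sum.cong refl) (subst partial_mult; (intro differentiable_mult d dK s)?;
     subst partial_mult; (intro differentiable_mult d dK s)?; simp add: distrib_left)
  also have "\<dots> = (\<Sum>\<^sub>U p q. partial p u x * (K x $ p $ q * partial k (partial q b) x))
    + (\<Sum>\<^sub>U p q. partial p u x * (partial k (\<lambda>x. K x $ p $ q) x * partial q b x))
    + (\<Sum>\<^sub>U p q. partial k (partial p u) x * (K x $ p $ q * partial q b x))"
   by (simp add: sum.distrib)
  also have "(\<Sum>\<^sub>U p q. partial p u x * (K x $ p $ q * partial k (partial q b) x))
    = (\<Sum>\<^sub>U q. (\<Sum>\<^sub>U p. K x $ p $ q * partial p u x) * partial k (partial q b) x)"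
   unfolding sum_distrib_right by (subst sum.swap) (intro sum.cong refl, simp)
  also have "(\<Sum>\<^sub>U p q. partial k (partial p u) x * (K x $ p $ q * partial q b x))
   = (\<Sum>\<^sub>U p. partial k (partial p u) x * (\<Sum>\<^sub>U q. K x $ p $ q * partial q b x))"
   by (simp add: sum_distrib_left)
  also have "(\<Sum>\<^sub>U p q. partial p u x * (partial k (\<lambda>x. K x $ p $ q) x * partial q b x))
   = - (\<Sum>\<^sub>U p q r s. (K x $ p $ r * partial p u x) * (K x $ s $ q * partial q b x) * partial k (\<lambda>y. G y $ r $ s) x)"
   unfolding partial_K[OF x]
   by (simp add: sum_negf sum_distrib_left sum_distrib_right mult_ac)
  also have "(\<Sum>\<^sub>U p q r s. (K x $ p $ r * partial p u x) * (K x $ s $ q * partial q b x) * partial k (\<lambda>y. G y $ r $ s) x)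
   = (\<Sum>\<^sub>U r s p q. (K x $ p $ r * partial p u x) * (K x $ s $ q * partial q b x) * partial k (\<lambda>y. G y $ r $ s) x)"
   by (rule sum_swap4)
  also have "\<dots> = (\<Sum>\<^sub>U r s. lgrad G u x $ r * lgrad G b x $ s * partial k (\<lambda>x. G x $ r $ s) x)"
   unfolding sum_product[symmetric] sum_distrib_right[symmetric] raise raise' ..
  finally show ?thesis unfolding raise raise' by (simp add: mult.commute)
 qed
 have "lgam G a (lgam G u b) x = (\<Sum>\<^sub>U k. lgrad G a x $ k * partial k (lgam G u b) x)"
  by (rule lgam_lower[OF x, symmetric])
 then show ?thesis unfolding P
  by (simp add: distrib_left right_diff_distrib sum.distrib sum_subtractf sum_negf sum_distrib_left third_def mult_ac)
qed

lemma third_swap: "x \<in> U \<Longrightarrow> third a u b x = third a b u x"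
 unfolding third_def
 by (rule sum.cong[OF refl], subst sum.swap) (intro sum.cong refl, simp add: partial_G_sym mult_ac)

lemma christ_lower:
 assumes x: "x \<in> U"
 shows "(\<Sum>\<^sub>U k. christ G k i j x * partial k u x) = (\<Sum>\<^sub>U l. lgrad G u x $ l * (partial i (\<lambda>x. G x $ j $ l) x
  + partial j (\<lambda>x. G x $ i $ l) x - partial l (\<lambda>x. G x $ i $ j) x)) / 2"
proof -
 let ?D = "\<lambda>k i j. partial k (\<lambda>x. G x $ i $ j) x"
 have "(\<Sum>\<^sub>U k. christ G k i j x * partial k u x)
  = (\<Sum>\<^sub>U k l. (K x $ k $ l * partial k u x) * (?D i j l + ?D j i l - ?D l i j)) / 2"
  unfolding christ_def sum_divide_distrib sum_distrib_right sum_distrib_left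
  by (intro sum.cong refl) simp
 also have "\<dots> = (\<Sum>\<^sub>U l. (\<Sum>\<^sub>U k. K x $ l $ k * partial k u x) * (?D i j l + ?D j i l - ?D l i j)) / 2"
  by (subst sum.swap) (simp add: sum_distrib_right symK[OF x])
 finally show ?thesis by (simp add: lgrad_component)
qed

lemma sum_christ:
 assumes x: "x \<in> U"
 shows "(\<Sum>\<^sub>U i j. lgrad G a x $ i * lgrad G b x $ j * (\<Sum>\<^sub>U k. christ G k i j x * partial k u x))
  = (third a b u x + third b a u x - third u a b x) / 2"
proof -
 let ?D = "\<lambda>k i j. partial k (\<lambda>x. G x $ i $ j) x"
 note christ_lower[OF x, of _ _ u]
 then have "(\<Sum>\<^sub>U i j. lgrad G a x $ i * lgrad G b x $ j * (\<Sum>\<^sub>U k. christ G k i j x * partial k u x))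
  = ((\<Sum>\<^sub>U i j l. lgrad G a x $ i * lgrad G b x $ j * lgrad G u x $ l * ?D i j l)
  + (\<Sum>\<^sub>U i j l. lgrad G a x $ i * lgrad G b x $ j * lgrad G u x $ l * ?D j i l)
  - (\<Sum>\<^sub>U i j l. lgrad G a x $ i * lgrad G b x $ j * lgrad G u x $ l * ?D l i j)) / 2"
  by (simp add: sum_distrib_left sum_divide_distrib sum.distrib sum_subtractf
    distrib_left right_diff_distrib add_divide_distrib diff_divide_distrib mult.assoc)
 also have "(\<Sum>\<^sub>U i j l. lgrad G a x $ i * lgrad G b x $ j * lgrad G u x $ l * ?D i j l) = third a b u x"
  by (simp add: third_def)
 also have "(\<Sum>\<^sub>U i j l. lgrad G a x $ i * lgrad G b x $ j * lgrad G u x $ l * ?D j i l) = third b a u x"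
  unfolding third_def by (subst sum.swap) (simp add: mult_ac)
 also have "(\<Sum>\<^sub>U i j l. lgrad G a x $ i * lgrad G b x $ j * lgrad G u x $ l * ?D l i j) = third u a b x"
  unfolding third_def by (subst (2) sum_rotate3) (simp add: mult_ac)
 finally show ?thesis .
qed

text \<open>A Koszul formula. It expresses the Hessian by iterated gradient pairings alone, so that
  its behaviour under maps follows from that of \<open>lgam\<close>. The terms \<open>third\<close>
  cancel by symmetry in the last two arguments.\<close>

lemma hess_formula:
 assumes x: "x \<in> U" and s: "smooth_on U a" "smooth_on U u" "smooth_on U b"
 shows "2 * (lgrad G a x \<bullet> (hess G u x *v lgrad G b x))
  = lgam G a (lgam G u b) x + lgam G b (lgam G u a) x - lgam G u (lgam G a b) x"
proof -
 have "lgrad G a x \<bullet> (hess G u x *v lgrad G b x)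
  = (\<Sum>\<^sub>U i j. lgrad G a x $ i * lgrad G b x $ j * partial i (partial j u) x)
  - (\<Sum>\<^sub>U i j. lgrad G a x $ i * lgrad G b x $ j * (\<Sum>\<^sub>U k. christ G k i j x * partial k u x))"
  by (simp add: inner_vec_def matrix_vector_mult_def hess_def sum_distrib_left right_diff_distrib
    left_diff_distrib sum_subtractf sum_distrib_right mult_ac)
 moreover have "(\<Sum>\<^sub>U k p. lgrad G v x $ k * lgrad G w x $ p * partial k (partial p f) x)
   = (\<Sum>\<^sub>U k p. lgrad G w x $ k * lgrad G v x $ p * partial k (partial p f) x)"
  if "smooth_on U f" for v w f
  by (subst sum.swap) (simp add: smooth_on_partial_commute[OF open_U that x] mult.commute)
 note this[OF s(1), of b u] this[OF s(2), of a b] this[OF s(3), of a u]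
 ultimately show ?thesis
  unfolding sum_christ[OF x] lgam_lgam[OF x s] lgam_lgam[OF x s(3,2,1)] lgam_lgam[OF x s(2,1,3)]
  using third_swap[OF x, of a u b] third_swap[OF x, of b u a] by (simp add: field_simps)
qed

lemma lgam_nonneg: "x \<in> U \<Longrightarrow> lgam G u u x \<ge> 0"
proof -
 assume x: "x \<in> U"
 let ?v = "\<chi> i. partial i u x"
 have "lgam G u u x = ?v \<bullet> (K x *v ?v)" by (simp add: lgam_def lgrad_def inner_vec_def)
 moreover have "?v \<bullet> (K x *v ?v) \<ge> 0"
 proof (cases "?v = 0")
  case False
  then show ?thesis using posdef_matrix_inv(2)[OF sym_G[OF x] pos_G[OF x], of ?v] by (simp add: x)
 qed simp
 ultimately show ?thesis by simp
qed

text \<open>Jacobi's formula gives the logarithmic derivative of the density as half the trace of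
  the derivative of the metric; together with the derivative of the inverse metric this is the
  contracted Christoffel term of the Hessian. As a trace, the Laplacian inherits its invariance from
  the Hessian.\<close>

lemma llap_trace:
 assumes x: "x \<in> U" and u: "smooth_on U u"
 shows "llap G u x = (\<Sum>\<^sub>U i j. K x $ i $ j * hess G u x $ i $ j)"
proof -
 let ?D = "\<lambda>k i j. partial k (\<lambda>x. G x $ i $ j) x"
 have d: "partial i u differentiable (at x)" for i
  using smooth_on_differentiable[OF smooth_on_partial[OF u] x] .
 have dK: "(\<lambda>x. K x $ i $ j) differentiable (at x)" for i j
  using smooth_on_differentiable[OF smooth_K x] .
 have dG: "(\<lambda>x. G x $ i $ j) differentiable (at x)" for i j
  using smooth_on_differentiable[OF smooth_G x] .
 have dX: "(\<lambda>x. lgrad G u x $ i) differentiable (at x)" for i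
  using smooth_on_differentiable[OF smooth_lgrad[OF u] x] .
 have dr: "(\<lambda>x. sqrt (det (G x))) differentiable (at x)"
  using smooth_on_differentiable[OF smooth_density x] .
 have r: "partial i (\<lambda>x. sqrt (det (G x))) x = sqrt (det (G x)) * ((\<Sum>\<^sub>U a b. K x $ a $ b * ?D i a b) / 2)" for i
 proof -
  have "partial i (\<lambda>x. sqrt (det (G x))) x = inverse (sqrt (det (G x))) / 2 * partial i (\<lambda>x. det (G x)) x"
   by (rule partial_real_comp) (use det_pos[OF x] jacobi_formula(1)[OF dG det_ne[OF x]] in \<open>auto intro: DERIV_real_sqrt\<close>)
  also have "\<dots> = inverse (sqrt (det (G x))) / 2 * (det (G x) * (\<Sum>\<^sub>U a b. K x $ a $ b * ?D i a b))"
   by (subst jacobi_formula(2)[OF dG det_ne[OF x]]) (simp add: partial_G_sym[OF x])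
  also have "inverse (sqrt (det (G x))) * det (G x) = sqrt (det (G x))"
   using det_pos[OF x] by (simp add: field_simps flip: power2_eq_square)
  then have "inverse (sqrt (det (G x))) / 2 * (det (G x) * c) = sqrt (det (G x)) * (c / 2)" for c
   by (metis (no_types, opaque_lifting) mult.assoc mult.commute times_divide_eq_left)
  finally show ?thesis .
 qed
 have X: "partial i (\<lambda>x. lgrad G u x $ i) x = (\<Sum>\<^sub>U j. K x $ i $ j * partial i (partial j u) x)
   - (\<Sum>\<^sub>U k l. K x $ i $ k * ?D i k l * lgrad G u x $ l)" for i
 proof -
  have "partial i (\<lambda>x. lgrad G u x $ i) x = (\<Sum>\<^sub>U j. K x $ i $ j * partial i (partial j u) x)
   + (\<Sum>\<^sub>U j. partial i (\<lambda>x. K x $ i $ j) x * partial j u x)"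
   unfolding lgrad_component by (subst partial_sum) (auto simp: partial_mult d dK sum.distrib intro!: differentiable_mult)
  also have "(\<Sum>\<^sub>U j. partial i (\<lambda>x. K x $ i $ j) x * partial j u x)
   = - (\<Sum>\<^sub>U j k l. K x $ i $ k * ?D i k l * (K x $ l $ j * partial j u x))"
   unfolding partial_K[OF x]
   by (simp add: sum_negf sum_distrib_right sum_distrib_left mult_ac)
  also have "(\<Sum>\<^sub>U j k l. K x $ i $ k * ?D i k l * (K x $ l $ j * partial j u x))
   = (\<Sum>\<^sub>U k l. K x $ i $ k * ?D i k l * lgrad G u x $ l)"
   by (subst sum_rotate3) (simp add: lgrad_component sum_distrib_left)
  finally show ?thesis by simp
 qed
 have "llap G u x = (\<Sum>\<^sub>U i. partial i (\<lambda>x. lgrad G u x $ i) x + (\<Sum>\<^sub>U a b. K x $ a $ b * ?D i a b) / 2 * lgrad G u x $ i)"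
  unfolding llap_def using det_pos[OF x]
  by (simp add: partial_mult[OF dr dX] r sum_divide_distrib add_divide_distrib)
 also have "\<dots> = (\<Sum>\<^sub>U i j. K x $ i $ j * partial i (partial j u) x)
   - (\<Sum>\<^sub>U i k l. K x $ i $ k * ?D i k l * lgrad G u x $ l)
   + (\<Sum>\<^sub>U l i j. K x $ i $ j * ?D l i j * lgrad G u x $ l) / 2"
  by (simp add: X sum.distrib sum_subtractf sum_distrib_right sum_divide_distrib)
 also have "(\<Sum>\<^sub>U l i j. K x $ i $ j * ?D l i j * lgrad G u x $ l)
  = (\<Sum>\<^sub>U i j l. K x $ i $ j * ?D l i j * lgrad G u x $ l)"
  by (rule sum_rotate3)
 finally have L: "llap G u x = (\<Sum>\<^sub>U i j. K x $ i $ j * partial i (partial j u) x)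
   - (\<Sum>\<^sub>U i k l. K x $ i $ k * ?D i k l * lgrad G u x $ l)
   + (\<Sum>\<^sub>U i j l. K x $ i $ j * ?D l i j * lgrad G u x $ l) / 2" .
 note C = christ_lower[OF x, of _ _ u]
 have S: "(\<Sum>\<^sub>U i j l. K x $ i $ j * ?D j i l * lgrad G u x $ l)
  = (\<Sum>\<^sub>U i k l. K x $ i $ k * ?D i k l * lgrad G u x $ l)"
  by (subst sum.swap) (simp add: symK[OF x])
 have "(\<Sum>\<^sub>U i j. K x $ i $ j * hess G u x $ i $ j)
  = (\<Sum>\<^sub>U i j. K x $ i $ j * partial i (partial j u) x)
  - ((\<Sum>\<^sub>U i j l. K x $ i $ j * ?D i j l * lgrad G u x $ l)
   + (\<Sum>\<^sub>U i j l. K x $ i $ j * ?D j i l * lgrad G u x $ l)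
   - (\<Sum>\<^sub>U i j l. K x $ i $ j * ?D l i j * lgrad G u x $ l)) / 2"
 proof -
  have "K x $ i $ j * hess G u x $ i $ j = K x $ i $ j * partial i (partial j u) x
   - ((\<Sum>\<^sub>U l. K x $ i $ j * ?D i j l * lgrad G u x $ l) + (\<Sum>\<^sub>U l. K x $ i $ j * ?D j i l * lgrad G u x $ l)
    - (\<Sum>\<^sub>U l. K x $ i $ j * ?D l i j * lgrad G u x $ l)) / 2" for i j
  proof -
   have h: "hess G u x $ i $ j = partial i (partial j u) x
     - (\<Sum>\<^sub>U l. lgrad G u x $ l * (?D i j l + ?D j i l - ?D l i j)) / 2"
    by (simp add: hess_def C)
   show ?thesis unfolding sum.distrib[symmetric] sum_subtractf[symmetric] h
    by (simp add: sum_distrib_left algebra_simps)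
  qed
  then show ?thesis by (simp add: sum.distrib sum_subtractf sum_divide_distrib[symmetric])
 qed
 then show ?thesis unfolding L S by (simp add: field_simps)
qed

end

section \<open>Invariance under changes of chart\<close>

definition lhess_norm :: "(real^'n \<Rightarrow> real^'n^'n) \<Rightarrow> (real^'n::finite \<Rightarrow> real) \<Rightarrow> real^'n \<Rightarrow> real" where
 "lhess_norm G u x = (let K = matrix_inv (G x); H = hess G u x in
  \<Sum>\<^sub>U i j k l. K $ i $ k * K $ j $ l * H $ i $ j * H $ k $ l)"

text \<open>Once the index sums are traces, the Jacobians brought in by a map can be moved around
  cyclically until \<open>K_push\<close> absorbs them.\<close>

lemma trace_matrix_pairing:
 "(\<Sum>\<^sub>U i j. K $ i $ j * H $ i $ j) = trace (K ** transpose H)" for K H :: "real^'n^'n"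
 by (simp add: trace_def matrix_matrix_mult_def transpose_def)

lemma trace_matrix_norm:
 "(\<Sum>\<^sub>U i j k l. K $ i $ k * K $ j $ l * H $ i $ j * H $ k $ l)
  = trace (transpose H ** (K ** (H ** transpose K)))" for K H :: "real^'n^'n"
proof -
 have "trace (transpose H ** (K ** (H ** transpose K)))
  = (\<Sum>\<^sub>U j i k l. K $ i $ k * K $ j $ l * H $ i $ j * H $ k $ l)"
  by (simp add: trace_def matrix_matrix_mult_def transpose_def sum_distrib_left mult_ac)
 also have "\<dots> = (\<Sum>\<^sub>U i j k l. K $ i $ k * K $ j $ l * H $ i $ j * H $ k $ l)"
  by (rule sum.swap)
 finally show ?thesis by simp
qed

text \<open>The map \<open>F\<close> pulls the metric \<open>H\<close> back to \<open>G\<close>.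
  Transition maps and coordinate expressions of isometries are both instances, so invariance under
  changes of chart and under isometries has a common proof.\<close>

locale metric_map = src: local_metric U G + tgt: local_metric V H
 for U :: "(real^'n::finite) set" and G and V :: "(real^'n) set" and H +
 fixes F :: "real^'n \<Rightarrow> real^'n"
 assumes smooth_Phi: "\<And>i. smooth_on U (\<lambda>x. F x $ i)"
  and Phi_into: "\<And>x. x \<in> U \<Longrightarrow> F x \<in> V"
  and pull: "\<And>x. x \<in> U \<Longrightarrow> G x = transpose (\<chi> i j. partial j (\<lambda>x. F x $ i) x) ** H (F x)
   ** (\<chi> i j. partial j (\<lambda>x. F x $ i) x)"
begin

definition J :: "real^'n \<Rightarrow> real^'n^'n" where "J x = (\<chi> i j. partial j (\<lambda>x. F x $ i) x)"

lemma pullJ: "x \<in> U \<Longrightarrow> G x = transpose (J x) ** H (F x) ** J x"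
 unfolding J_def by (rule pull)

lemma Phi_diff: "x \<in> U \<Longrightarrow> (\<lambda>x. F x $ i) differentiable (at x)"
 using smooth_on_differentiable[OF smooth_Phi] .

lemma Phi_deriv: "x \<in> U \<Longrightarrow> (F has_derivative (\<lambda>h. J x *v h)) (at x)"
 unfolding J_def by (rule has_derivative_jacobian[OF Phi_diff])

lemma density_pull: "x \<in> U \<Longrightarrow> sqrt (det (G x)) = \<bar>det (J x)\<bar> * sqrt (det (H (F x)))"
proof -
 assume x: "x \<in> U"
 have "det (G x) = (det (J x))^2 * det (H (F x))"
  unfolding pullJ[OF x] by (simp add: det_mul power2_eq_square)
 then show ?thesis by (simp add: real_sqrt_mult)
qed

lemma det_J: "x \<in> U \<Longrightarrow> det (J x) \<noteq> 0"
 using src.det_ne[of x] by (auto simp: pullJ det_mul)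

lemma K_push:
 assumes x: "x \<in> U"
 shows "J x ** src.K x ** transpose (J x) = tgt.K (F x)"
proof -
 have "transpose (J x) ** (H (F x) ** J x ** src.K x) = mat 1"
  using matrix_inv_works(1)[OF src.det_ne[OF x]] pullJ[OF x] by (simp add: matrix_mul_assoc)
 then have "(H (F x) ** J x ** src.K x) ** transpose (J x) = mat 1"
  by (simp add: matrix_left_right_inverse)
 then have "H (F x) ** (J x ** src.K x ** transpose (J x)) = mat 1"
  by (simp add: matrix_mul_assoc)
 then have "(J x ** src.K x ** transpose (J x)) ** H (F x) = mat 1"
  by (simp add: matrix_left_right_inverse)
 then show ?thesis by (simp add: matrix_inv_unique_left)
qed

lemma covector_pull:
 assumes x: "x \<in> U" and u: "u differentiable (at (F x))"
 shows "(\<chi> i. partial i (\<lambda>x. u (F x)) x) = transpose (J x) *v (\<chi> i. partial i u (F x))"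
 by (simp add: vec_eq_iff partial_comp(2)[OF Phi_diff[OF x] u] matrix_vector_mult_def transpose_def J_def mult.commute)

lemma lgrad_push:
 assumes x: "x \<in> U" and u: "u differentiable (at (F x))"
 shows "J x *v lgrad G (\<lambda>x. u (F x)) x = lgrad H u (F x)"
 unfolding lgrad_def covector_pull[OF assms] K_push[OF x, symmetric]
 by (simp add: matrix_vector_mul_assoc matrix_mul_assoc del: transpose_matrix_vector)

lemma lgam_pull:
 assumes x: "x \<in> U" and u: "u differentiable (at (F x))" and v: "v differentiable (at (F x))"
 shows "lgam G (\<lambda>x. u (F x)) (\<lambda>x. v (F x)) x = lgam H u v (F x)"
proof -
 have "lgam G (\<lambda>x. u (F x)) (\<lambda>x. v (F x)) x = (\<chi> i. partial i (\<lambda>x. u (F x)) x) \<bullet> lgrad G (\<lambda>x. v (F x)) x"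
  by (simp add: lgam_def inner_vec_def)
 also have "\<dots> = (\<chi> i. partial i u (F x)) \<bullet> lgrad H v (F x)"
  unfolding covector_pull[OF x u] lgrad_push[OF x v, symmetric]
  by (metis dot_lmul_matrix inner_commute transpose_matrix_vector)
 finally show ?thesis by (simp add: lgam_def inner_vec_def)
qed

lemma smooth_pull: "smooth_on V u \<Longrightarrow> smooth_on U (\<lambda>x. u (F x))"
 using smooth_on_comp[OF src.open_U smooth_Phi, of V u] Phi_into by auto

lemma lgam_lgam_pull:
 assumes x: "x \<in> U" and s: "smooth_on V a" "smooth_on V u" "smooth_on V b"
 shows "lgam G (\<lambda>x. a (F x)) (lgam G (\<lambda>x. u (F x)) (\<lambda>x. b (F x))) x = lgam H a (lgam H u b) (F x)"
proof -
 note d = smooth_on_differentiable[OF _ Phi_into]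
 have "lgam G (\<lambda>x. a (F x)) (lgam G (\<lambda>x. u (F x)) (\<lambda>x. b (F x))) x
  = lgam G (\<lambda>x. a (F x)) (\<lambda>x. lgam H u b (F x)) x"
  unfolding lgam_def[of G "\<lambda>x. a (F x)"] src.lgrad_component
  by (intro sum.cong refl arg_cong2[where f="(*)"] partial_cong_open[OF src.open_U x] lgam_pull d s)
 also have "\<dots> = lgam H a (lgam H u b) (F x)"
  by (intro lgam_pull x d s tgt.smooth_lgam)
 finally show ?thesis .
qed

text \<open>By \<open>hess_formula\<close> both sides agree on gradients of linear functions
  composed with \<open>F\<close>, and such gradients fill the whole space because the Jacobian is
  invertible.\<close>

lemma hess_pull:
 assumes x: "x \<in> U" and u: "smooth_on V u"
 shows "hess G (\<lambda>x. u (F x)) x = transpose (J x) ** hess H u (F x) ** J x"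
proof -
 let ?A = "hess G (\<lambda>x. u (F x)) x" and ?B = "hess H u (F x)"
 let ?S = "src.K x ** transpose (J x)"
 have lin: "smooth_on S (\<lambda>y. \<xi> \<bullet> y)" if "open S" for \<xi> :: "real^'n" and S
  unfolding inner_vec_def inner_real_def
  by (intro smooth_on_sum smooth_on_mult smooth_on_const smooth_on_coord that) auto
 have plin: "partial i (\<lambda>y. \<xi> \<bullet> y) z = \<xi> $ i" for \<xi> z :: "real^'n" and i
  by (subst partial_unique[where D="\<lambda>h. \<xi> \<bullet> h"]) (auto intro!: derivative_eq_intros simp: inner_axis)
 have key: "(?S *v \<xi>) \<bullet> (?A *v (?S *v \<eta>)) = (tgt.K (F x) *v \<xi>) \<bullet> (?B *v (tgt.K (F x) *v \<eta>))" for \<xi> \<eta>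
 proof -
  let ?a = "\<lambda>y. \<xi> \<bullet> y" and ?b = "\<lambda>y. \<eta> \<bullet> y"
  have s: "smooth_on V ?a" "smooth_on V ?b" by (auto intro: lin tgt.open_U)
  have g: "lgrad G (\<lambda>x. \<zeta> \<bullet> F x) x = ?S *v \<zeta>" "lgrad H (\<lambda>y. \<zeta> \<bullet> y) (F x) = tgt.K (F x) *v \<zeta>" for \<zeta>
  proof -
   have "lgrad G (\<lambda>x. \<zeta> \<bullet> F x) x = src.K x *v (transpose (J x) *v (\<chi> i. partial i (\<lambda>y. \<zeta> \<bullet> y) (F x)))"
    unfolding lgrad_def
    by (subst covector_pull[OF x smooth_on_differentiable[OF lin[OF tgt.open_U] Phi_into[OF x]]]) simp
   then show "lgrad G (\<lambda>x. \<zeta> \<bullet> F x) x = ?S *v \<zeta>" by (simp add: plin matrix_vector_mul_assoc del: transpose_matrix_vector)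
   show "lgrad H (\<lambda>y. \<zeta> \<bullet> y) (F x) = tgt.K (F x) *v \<zeta>" by (simp add: lgrad_def plin)
  qed
  have "2 * ((?S *v \<xi>) \<bullet> (?A *v (?S *v \<eta>))) = 2 * ((tgt.K (F x) *v \<xi>) \<bullet> (?B *v (tgt.K (F x) *v \<eta>)))"
   using src.hess_formula[OF x smooth_pull[OF s(1)] smooth_pull[OF u] smooth_pull[OF s(2)]]
    tgt.hess_formula[OF Phi_into[OF x] s(1) u s(2)]
   by (simp add: lgam_lgam_pull[OF x] s u g)
  then show ?thesis by simp
 qed
 have inv: "\<exists>\<xi>. w = ?S *v \<xi>" for w
 proof -
  have "det ?S \<noteq> 0" using det_J[OF x] posdef_det_pos[OF posdef_matrix_inv[OF src.sym_G[OF x] src.pos_G[OF x]]]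
   by (simp add: det_mul)
  then have "w = ?S *v (matrix_inv ?S *v w)" by (simp add: matrix_vector_mul_assoc matrix_inv_works)
  then show ?thesis by blast
 qed
 have "w \<bullet> (?A *v w') = w \<bullet> ((transpose (J x) ** ?B ** J x) *v w')" for w w'
 proof -
  obtain \<xi> \<eta> where [simp]: "w = ?S *v \<xi>" "w' = ?S *v \<eta>" using inv by meson
  have JS: "J x *v (?S *v \<zeta>) = tgt.K (F x) *v \<zeta>" for \<zeta>
   by (simp add: matrix_vector_mul_assoc matrix_mul_assoc K_push[OF x])
  have "w \<bullet> ((transpose (J x) ** ?B ** J x) *v w') = (J x *v w) \<bullet> (?B *v (J x *v w'))"
  proof -
   have "w \<bullet> (transpose (J x) *v z) = (J x *v w) \<bullet> z" for z
    using dot_lmul_matrix[of z "J x" w] by (simp add: inner_commute)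
   then show ?thesis by (simp only: matrix_vector_mul_assoc[symmetric])
  qed
  also have "\<dots> = w \<bullet> (?A *v w')" using key by (simp only: \<open>w = _\<close> \<open>w' = _\<close> JS)
  finally show ?thesis by simp
 qed
 then have "?A *v w' = (transpose (J x) ** ?B ** J x) *v w'" for w'
  by (intro vector_eq_ldot[THEN iffD1]) blast
 then show ?thesis by (simp add: matrix_eq)
qed

lemma llap_pull:
 assumes x: "x \<in> U" and u: "smooth_on V u"
 shows "llap G (\<lambda>x. u (F x)) x = llap H u (F x)"
proof -
 have "llap G (\<lambda>x. u (F x)) x = trace (src.K x ** (transpose (J x) ** (transpose (hess H u (F x)) ** J x)))"
  by (simp add: src.llap_trace[OF x smooth_pull[OF u]] trace_matrix_pairing hess_pull[OF x u] matrix_transpose_mul)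
 also have "\<dots> = trace ((src.K x ** transpose (J x) ** transpose (hess H u (F x))) ** J x)"
  by (simp add: matrix_mul_assoc)
 also have "\<dots> = trace (J x ** (src.K x ** transpose (J x) ** transpose (hess H u (F x))))"
  by (rule trace_mul_sym)
 also have "\<dots> = trace (tgt.K (F x) ** transpose (hess H u (F x)))"
  by (simp add: matrix_mul_assoc K_push[OF x, symmetric])
 finally show ?thesis by (simp add: tgt.llap_trace[OF Phi_into[OF x] u] trace_matrix_pairing)
qed

lemma lhess_norm_pull:
 assumes x: "x \<in> U" and u: "smooth_on V u"
 shows "lhess_norm G (\<lambda>x. u (F x)) x = lhess_norm H u (F x)"
proof -
 let ?B = "hess H u (F x)"
 have KT: "transpose (src.K x) = src.K x" "transpose (tgt.K (F x)) = tgt.K (F x)"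
  using src.transpose_K[OF x] tgt.transpose_K[OF Phi_into[OF x]] by auto
 have "lhess_norm G (\<lambda>x. u (F x)) x
  = trace ((transpose (J x) ** (transpose ?B ** J x ** src.K x ** transpose (J x) ** ?B ** J x ** src.K x)))"
  by (simp add: lhess_norm_def Let_def trace_matrix_norm hess_pull[OF x u] matrix_transpose_mul KT matrix_mul_assoc)
 also have "\<dots> = trace ((transpose ?B ** J x ** src.K x ** transpose (J x) ** ?B ** J x ** src.K x) ** transpose (J x))"
  by (rule trace_mul_sym)
 also have "\<dots> = trace (transpose ?B ** ((J x ** src.K x ** transpose (J x)) ** (?B ** (J x ** src.K x ** transpose (J x)))))"
  by (simp add: matrix_mul_assoc)
 finally show ?thesis by (simp add: lhess_norm_def Let_def trace_matrix_norm KT K_push[OF x])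
qed

end

section \<open>A local estimate of the Hessian by the Laplacian\<close>

lemma compact_bounded_real:
 fixes f :: "'a::topological_space \<Rightarrow> real"
 assumes "compact K" "continuous_on K f"
 shows "\<exists>B\<ge>0. \<forall>x\<in>K. \<bar>f x\<bar> \<le> B"
proof -
 have "bounded (f ` K)" using assms by (intro compact_imp_bounded compact_continuous_image)
 then obtain B where "\<forall>y\<in>f ` K. norm y \<le> B" unfolding bounded_iff by blast
 then have "\<forall>x\<in>K. \<bar>f x\<bar> \<le> max B 0" by (auto simp: le_max_iff_disj)
 then show ?thesis by (intro exI[of _ "max B 0"]) auto
qed

lemma compact_bounded_family:
 fixes f :: "'i \<Rightarrow> 'a::topological_space \<Rightarrow> real"
 assumes "compact K" "finite I" "\<And>i. i \<in> I \<Longrightarrow> continuous_on K (f i)"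
 shows "\<exists>B\<ge>0. \<forall>i\<in>I. \<forall>x\<in>K. \<bar>f i x\<bar> \<le> B"
proof -
 have "\<forall>i\<in>I. \<exists>B\<ge>0. \<forall>x\<in>K. \<bar>f i x\<bar> \<le> B" using compact_bounded_real assms by blast
 then obtain b where b: "\<And>i. i \<in> I \<Longrightarrow> b i \<ge> 0" "\<And>i x. i \<in> I \<Longrightarrow> x \<in> K \<Longrightarrow> \<bar>f i x\<bar> \<le> b i" by metis
 have "\<bar>f i x\<bar> \<le> (\<Sum>i\<in>I. b i)" if "i \<in> I" "x \<in> K" for i x
  using b(2)[OF that] member_le_sum[of i I b] that assms(2) b(1) by force
 moreover have "(\<Sum>i\<in>I. b i) \<ge> 0" using b(1) by (simp add: sum_nonneg)
 ultimately show ?thesis by blast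
qed

text \<open>The sum is the trace of K P K P. Factoring one K as R^T R makes it a sum of values of
  the form K on the rows of R P; the lower bound of K applies once to these rows and once to the
  columns of P.\<close>

lemma double_trace_lower:
 fixes K P :: "real^'n^'n"
 assumes sym: "transpose K = K" and pos: "\<And>v. v \<bullet> (K *v v) \<ge> c * (v \<bullet> v)" and c: "c > 0"
  and symP: "\<And>i j. P $ i $ j = P $ j $ i"
 shows "(\<Sum>\<^sub>U i j k l. K $ i $ j * K $ k $ l * P $ j $ k * P $ l $ i)
  \<ge> c^2 * (\<Sum>\<^sub>U i j. (P $ i $ j)^2)"
proof -
 have quad: "v \<bullet> (K *v v) = (\<Sum>\<^sub>U i j. K $ i $ j * v $ i * v $ j)" for v
  by (simp add: inner_vec_def matrix_vector_mult_def sum_distrib_left mult_ac)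
 have "v \<bullet> (K *v v) > 0" if "v \<noteq> 0" for v
  by (rule less_le_trans[OF _ pos]) (use that c in simp)
 then obtain R :: "real^'n^'n" where R: "K = transpose R ** R"
  using posdef_matrix_factor[OF sym] by blast
 have KR: "K $ i $ j = (\<Sum>\<^sub>U m. R $ m $ i * R $ m $ j)" for i j
  by (simp add: R matrix_matrix_mult_def transpose_def)
 define v where "v m = (\<chi> k. \<Sum>\<^sub>U j. R $ m $ j * P $ j $ k)" for m
 have "c^2 * (\<Sum>\<^sub>U i j. (P $ i $ j)^2) = c * (\<Sum>\<^sub>U k. c * ((\<chi> i. P $ i $ k) \<bullet> (\<chi> i. P $ i $ k)))"
  by (subst sum.swap) (simp add: sum_distrib_left inner_vec_def power2_eq_square mult_ac)
 also have "\<dots> \<le> c * (\<Sum>\<^sub>U k. (\<chi> i. P $ i $ k) \<bullet> (K *v (\<chi> i. P $ i $ k)))"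
  using c by (intro mult_left_mono sum_mono pos) auto
 also have "(\<Sum>\<^sub>U k. (\<chi> i. P $ i $ k) \<bullet> (K *v (\<chi> i. P $ i $ k))) = (\<Sum>\<^sub>U k m. (v m $ k)^2)"
 proof (rule sum.cong[OF refl])
  fix k
  have "(\<Sum>\<^sub>U m. (v m $ k)^2) = (\<Sum>\<^sub>U m i j. R $ m $ i * R $ m $ j * P $ i $ k * P $ j $ k)"
   by (simp add: v_def power2_eq_square sum_product mult_ac)
  also have "\<dots> = (\<Sum>\<^sub>U i j m. R $ m $ i * R $ m $ j * P $ i $ k * P $ j $ k)"
   by (rule sum_rotate3)
  finally show "(\<chi> i. P $ i $ k) \<bullet> (K *v (\<chi> i. P $ i $ k)) = (\<Sum>\<^sub>U m. (v m $ k)^2)"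
   by (simp add: quad KR sum_distrib_right)
 qed
 also have "c * (\<Sum>\<^sub>U k m. (v m $ k)^2) = (\<Sum>\<^sub>U m. c * (v m \<bullet> v m))"
  by (subst sum.swap) (simp add: sum_distrib_left inner_vec_def power2_eq_square)
 also have "\<dots> \<le> (\<Sum>\<^sub>U m. v m \<bullet> (K *v v m))" by (intro sum_mono pos)
 also have "\<dots> = (\<Sum>\<^sub>U m k l i j. R $ m $ i * R $ m $ j * K $ k $ l * P $ j $ k * P $ l $ i)"
 proof -
  have "K $ k $ l * v m $ k * v m $ l = (\<Sum>\<^sub>U i j. R $ m $ i * R $ m $ j * K $ k $ l * P $ j $ k * P $ l $ i)" for k l m
  proof -
   have "v m $ k * v m $ l = (\<Sum>\<^sub>U j i. (R $ m $ j * P $ j $ k) * (R $ m $ i * P $ i $ l))"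
    by (simp add: v_def sum_product)
   also have "\<dots> = (\<Sum>\<^sub>U i j. (R $ m $ j * P $ j $ k) * (R $ m $ i * P $ l $ i))"
    by (subst sum.swap) (simp add: symP[of l])
   finally show ?thesis by (simp add: mult.assoc sum_distrib_left) (simp add: mult_ac)
  qed
  then show ?thesis by (simp add: quad)
 qed
 also have "\<dots> = (\<Sum>\<^sub>U m i j k l. R $ m $ i * R $ m $ j * K $ k $ l * P $ j $ k * P $ l $ i)"
  by (intro sum.cong[OF refl] sum_swap4)
 also have "\<dots> = (\<Sum>\<^sub>U i j m k l. R $ m $ i * R $ m $ j * K $ k $ l * P $ j $ k * P $ l $ i)"
  by (rule sum_rotate3)
 also have "\<dots> = (\<Sum>\<^sub>U i j k l. K $ i $ j * K $ k $ l * P $ j $ k * P $ l $ i)"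
  by (rule sum.cong[OF refl], rule sum.cong[OF refl], subst sum_rotate3) (simp add: KR sum_distrib_right)
 finally show ?thesis .
qed

lemma sum_abs_squared_le:
 fixes f :: "'i \<Rightarrow> real" assumes "finite I"
 shows "(\<Sum>i\<in>I. \<bar>f i\<bar>)^2 \<le> real (card I) * (\<Sum>i\<in>I. (f i)^2)"
 using Cauchy_Schwarz_ineq_sum[of "\<lambda>_. 1" "\<lambda>i. \<bar>f i\<bar>" I] by simp

context local_metric begin

lemma lower_bound_K:
 assumes "compact C" "C \<subseteq> U"
 obtains c where "c > 0" "\<And>x v. x \<in> C \<Longrightarrow> v \<bullet> (K x *v v) \<ge> c * (v \<bullet> v)"
proof (cases "C = {}")
 case True then show ?thesis using that[of 1] by simp
next
 case False
 let ?q = "\<lambda>p. snd p \<bullet> (K (fst p) *v snd p)"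
 let ?S = "C \<times> sphere (0::real^'n) 1"
 have cK: "continuous_on ?S (\<lambda>p. K (fst p) $ i $ j)" for i j
  by (rule continuous_on_compose2[OF smooth_on_continuous[OF smooth_K] continuous_on_fst[OF continuous_on_id]])
   (use assms(2) in auto)
 have "continuous_on ?S ?q"
  unfolding inner_vec_def matrix_vector_mult_def inner_real_def vec_lambda_beta
  by (intro continuous_on_sum continuous_on_mult cK continuous_on_component continuous_on_snd[OF continuous_on_id])
 \<comment> \<open>An arbitrary coordinate direction witnesses that the unit sphere is
   nonempty.\<close>
 moreover have "axis undefined 1 \<in> sphere (0::real^'n) 1" by (simp add: norm_axis_1)
 then have "?S \<noteq> {}" using False by blast
 ultimately obtain p where p: "p \<in> ?S" "\<And>q. q \<in> ?S \<Longrightarrow> ?q p \<le> ?q q"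
  using continuous_attains_inf[of ?S ?q] compact_Times[OF assms(1) compact_sphere] by blast
 show ?thesis
 proof (rule that[of "?q p"])
  have "snd p \<noteq> 0" "fst p \<in> U" using p(1) assms(2) by auto
  then show "?q p > 0" using posdef_matrix_inv(2)[OF sym_G[of "fst p"] pos_G[of "fst p"], of "snd p"] by simp
  fix x and v :: "real^'n" assume x: "x \<in> C"
  show "?q p * (v \<bullet> v) \<le> v \<bullet> (K x *v v)"
  proof (cases "v = 0")
   case False
   have "?q p \<le> ?q (x, v /\<^sub>R norm v)" using x False by (intro p(2)) auto
   also have "\<dots> = (v \<bullet> (K x *v v)) / (norm v)^2"
    by (simp add: matrix_vector_mult_scaleR power2_eq_square divide_inverse)
   finally show ?thesis using False by (simp add: field_simps power2_norm_eq_inner)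
  qed simp
 qed
qed

text \<open>The integrand is the coordinate divergence of \<open>\<psi>\<close> times the density
  times the gradient of \<open>u\<close>, a field that vanishes outside \<open>C\<close>.\<close>

lemma local_green:
 assumes C: "compact C" "C \<subseteq> U" and \<psi>: "smooth_on U \<psi>" "\<And>x. x \<notin> C \<Longrightarrow> \<psi> x = 0" and u: "smooth_on U u"
 shows "(LINT x|lborel. (\<psi> x * llap G u x + lgam G \<psi> u x) * sqrt (det (G x))) = 0"
proof -
 define w where "w i x = \<psi> x * (sqrt (det (G x)) * lgrad G u x $ i)" for i x
 have swU: "smooth_on U (w i)" for i unfolding w_def
  by (intro smooth_on_mult \<psi> smooth_density smooth_lgrad u open_U)
 have sw: "smooth_on UNIV (w i)" for i
  by (rule smooth_on_extend[OF open_U swU compact_imp_closed[OF C(1)] C(2)]) (simp add: w_def \<psi>(2))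
 have bw: "bounded {x. w i x \<noteq> 0}" for i
  by (rule bounded_subset[OF compact_imp_bounded[OF C(1)]]) (use \<psi>(2) in \<open>force simp: w_def\<close>)
 have z: "partial i f x = 0" if "x \<notin> C" "\<And>x. x \<notin> C \<Longrightarrow> f x = 0" for i f x
  using partial_cong_open[of "- C" x f "\<lambda>_. 0"] that compact_imp_closed[OF C(1)] by (simp add: open_Compl)
 have "(\<psi> x * llap G u x + lgam G \<psi> u x) * sqrt (det (G x)) = (\<Sum>\<^sub>U i. partial i (w i) x)" for x
 proof (cases "x \<in> C")
  case True
  then have x: "x \<in> U" using C by blast
  have "partial i (w i) x = \<psi> x * partial i (\<lambda>x. sqrt (det (G x)) * lgrad G u x $ i) x
    + partial i \<psi> x * (sqrt (det (G x)) * lgrad G u x $ i)" for i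
   unfolding w_def using x \<psi> u
   by (intro partial_mult smooth_on_differentiable[of U] smooth_on_mult smooth_density smooth_lgrad open_U)
  then have "(\<Sum>\<^sub>U i. partial i (w i) x) = \<psi> x * (\<Sum>\<^sub>U i. partial i (\<lambda>x. sqrt (det (G x)) * lgrad G u x $ i) x)
    + (\<Sum>\<^sub>U i. partial i \<psi> x * (sqrt (det (G x)) * lgrad G u x $ i))"
   by (simp only: sum.distrib sum_distrib_left)
  moreover have "(\<Sum>\<^sub>U i. partial i \<psi> x * (sqrt (det (G x)) * lgrad G u x $ i)) = lgam G \<psi> u x * sqrt (det (G x))"
   unfolding lgam_def sum_distrib_right by (intro sum.cong refl) simp
  moreover have "(\<Sum>\<^sub>U i. partial i (\<lambda>x. sqrt (det (G x)) * lgrad G u x $ i) x) = llap G u x * sqrt (det (G x))"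
   using det_pos[OF x] by (simp add: llap_def)
  ultimately show ?thesis by (simp add: distrib_right)
 next
  case False
  then show ?thesis using z[OF False, of "w _"] z[OF False, of \<psi>] \<psi>(2) by (simp add: w_def lgam_def)
 qed
 then have "(LINT x|lborel. (\<psi> x * llap G u x + lgam G \<psi> u x) * sqrt (det (G x)))
   = (LINT x|lborel. (\<Sum>\<^sub>U i. partial i (w i) x))" by simp
 also have "\<dots> = 0"
  using integral_partial_zero[OF smooth_on_Ck[OF sw] bw] by (subst Bochner_Integration.integral_sum) auto
 finally show ?thesis .
qed

lemma smooth_hess: "smooth_on U u \<Longrightarrow> smooth_on U (\<lambda>x. hess G u x $ i $ j)"
 unfolding hess_def christ_def vec_lambda_beta
 by (intro smooth_on_mult smooth_on_const smooth_on_sum smooth_on_diff smooth_on_add smooth_on_partial smooth_K smooth_G open_U)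
  auto

lemma smooth_lhess_norm: "smooth_on U u \<Longrightarrow> smooth_on U (lhess_norm G u)"
 unfolding lhess_norm_def[abs_def] Let_def
 by (intro smooth_on_sum smooth_on_mult smooth_K smooth_hess open_U) auto

text \<open>Interior elliptic estimate with a constant independent of \<open>h\<close>. Up to
  products of first and second derivatives, the squared trace of K D^2h minus the trace of (K
  D^2h)^2, weighted by e^2 and the density, is a sum \<open>E\<close> of derivatives of compactly
  supported functions, which integrates to 0. The second trace bounds all second derivatives by
  \<open>double_trace_lower\<close>.\<close>

lemma hess_local_estimate:
 assumes C: "compact C" "C \<subseteq> U" and e: "smooth_on U e" "\<And>x. x \<notin> C \<Longrightarrow> e x = 0"
 obtains B where "B \<ge> 0"
  "\<And>h. smooth_on U h \<Longrightarrow>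
   (LINT x|lborel. indicator C x * ((e x)^2 * lhess_norm G h x * sqrt (det (G x))))
   \<le> B * (LINT x|lborel. indicator C x * (((llap G h x)^2 + lgam G h h x) * sqrt (det (G x))))"
proof -
 let ?N = "real CARD('n)"
 let ?\<rho> = "\<lambda>x. sqrt (det (G x))"
 obtain c where c: "c > 0" "\<And>x v. x \<in> C \<Longrightarrow> v \<bullet> (K x *v v) \<ge> c * (v \<bullet> v)"
  using lower_bound_K[OF C] by blast
 have cont: "continuous_on C f" if "smooth_on U f" for f
  using continuous_on_subset[OF smooth_on_continuous[OF that] C(2)] .
 define q where "q i j k l x = ?\<rho> x * (K x $ i $ j * K x $ k $ l)" for i j k l x
 \<comment> \<open>The weight contains \<open>e\<close> twice, so that its derivatives
   \<open>e * b\<close> keep one factor \<open>e\<close>. This allows the error to be absorbed by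
   the main term with \<open>(e x)^2 * (P h x)^2\<close>.\<close>
 define a where "a i j k l x = e x * (e x * q i j k l x)" for i j k l x
 define b where "b m i j k l x = 2 * (partial m e x * q i j k l x) + e x * partial m (q i j k l) x" for m i j k l x
 have sq: "smooth_on U (q i j k l)" for i j k l
  unfolding q_def by (intro smooth_on_mult smooth_K smooth_density open_U)
 have sa: "smooth_on U (a i j k l)" for i j k l
  unfolding a_def by (intro smooth_on_mult sq e open_U)
 have sb: "smooth_on U (b m i j k l)" for m i j k l
  unfolding b_def by (intro smooth_on_add smooth_on_mult smooth_on_const smooth_on_partial sq e open_U)
 have pa: "partial m (a i j k l) x = e x * b m i j k l x" if "x \<in> U" for m i j k l x
  unfolding a_def b_def using smooth_on_differentiable[OF e(1) that] smooth_on_differentiable[OF sq that]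
  by (simp add: partial_mult differentiable_mult algebra_simps)
 have schr: "smooth_on U (christ G k i j)" for k i j
  unfolding christ_def[abs_def]
  by (intro smooth_on_mult smooth_on_const smooth_on_sum smooth_on_diff smooth_on_add smooth_on_partial smooth_K smooth_G open_U) auto
 obtain M1 where M1: "M1 \<ge> 0" "\<And>i j x. x \<in> C \<Longrightarrow> \<bar>K x $ i $ j\<bar> \<le> M1"
  using compact_bounded_family[OF C(1), of UNIV "\<lambda>p x. K x $ fst p $ snd p"] cont[OF smooth_K] by auto
 obtain M2 where M2: "M2 \<ge> 0" "\<And>k i j x. x \<in> C \<Longrightarrow> \<bar>christ G k i j x\<bar> \<le> M2"
  using compact_bounded_family[OF C(1), of UNIV "\<lambda>(k,i,j). christ G k i j"] cont[OF schr] by auto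
 obtain M3 where M3: "M3 \<ge> 0" "\<And>m i j k l x. x \<in> C \<Longrightarrow> \<bar>b m i j k l x\<bar> \<le> M3"
  using compact_bounded_family[OF C(1), of UNIV "\<lambda>(m,i,j,k,l). b m i j k l"] cont[OF sb] by auto
 obtain M4 where M4: "M4 \<ge> 0" "\<And>x. x \<in> C \<Longrightarrow> \<bar>e x\<bar> \<le> M4"
  using compact_bounded_real[OF C(1) cont[OF e(1)]] by auto
 obtain M5 where M5: "M5 \<ge> 0" "\<And>x. x \<in> C \<Longrightarrow> \<bar>inverse (?\<rho> x)\<bar> \<le> M5"
  using compact_bounded_real[OF C(1) cont[OF smooth_on_inverse[OF open_U smooth_density]]] det_ne by auto
 define D where "D h x = (\<Sum>\<^sub>U i. \<bar>partial i h x\<bar>)" for h :: "real^'n \<Rightarrow> real" and x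
 define P where "P h x = (\<Sum>\<^sub>U i j. \<bar>partial i (partial j h) x\<bar>)" for h :: "real^'n \<Rightarrow> real" and x
 define T where "T h x = (\<Sum>\<^sub>U i j. K x $ i $ j * partial i (partial j h) x)" for h x
 \<comment> \<open>Both terms contain the same third derivatives of \<open>h\<close> in a different
   order; they cancel because partial derivatives commute.\<close>
 define E where "E h x = (\<Sum>\<^sub>U i j k l. 
   partial i (\<lambda>x. a i j k l x * (partial j h x * partial k (partial l h) x) ) x
   - partial k (\<lambda>x. a i j k l x * (partial j h x * partial l (partial i h) x)) x)" for h x
 have D_le: "\<bar>partial i h x\<bar> \<le> D h x" for i h x
  unfolding D_def by (rule member_le_sum) auto
 have P_le: "\<bar>partial i (partial j h) x\<bar> \<le> P h x" for i j h x
 proof -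
  have "\<bar>partial i (partial j h) x\<bar> \<le> (\<Sum>\<^sub>U j. \<bar>partial i (partial j h) x\<bar>)" by (rule member_le_sum) auto
  also have "\<dots> \<le> P h x" unfolding P_def by (rule member_le_sum) (auto intro: sum_nonneg)
  finally show ?thesis .
 qed
 have D0: "D h x \<ge> 0" and P0: "P h x \<ge> 0" for h x by (auto simp: D_def P_def intro!: sum_nonneg)
 have gam: "(D h x)^2 \<le> ?N / c * lgam G h h x" if "x \<in> C" for h x
 proof -
  have "(D h x)^2 \<le> ?N * (\<Sum>\<^sub>U i. (partial i h x)^2)"
   unfolding D_def by (rule sum_abs_squared_le) simp
  also have "(\<Sum>\<^sub>U i. (partial i h x)^2) = (\<chi> i. partial i h x) \<bullet> (\<chi> i. partial i h x)"
   by (simp add: inner_vec_def power2_eq_square)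
  also have "\<dots> \<le> inverse c * ((\<chi> i. partial i h x) \<bullet> (K x *v (\<chi> i. partial i h x)))"
   using c(2)[OF that, of "\<chi> i. partial i h x"] c(1) by (simp add: field_simps)
  also have "(\<chi> i. partial i h x) \<bullet> (K x *v (\<chi> i. partial i h x)) = lgam G h h x"
   by (simp add: lgam_def lgrad_def inner_vec_def)
  finally show ?thesis by (simp add: divide_inverse mult_left_mono)
 qed
 have Cb: "\<bar>\<Sum>\<^sub>U k. christ G k i j x * partial k h x\<bar> \<le> M2 * D h x" if "x \<in> C" for h x i j
  unfolding D_def sum_distrib_left
  using M2(2)[OF that] by (intro order_trans[OF sum_abs] sum_mono) (auto simp: abs_mult intro: mult_right_mono)
 have Hb: "\<bar>hess G h x $ i $ j\<bar> \<le> P h x + M2 * D h x" if "x \<in> C" for h x i j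
  using P_le[of i j h x] Cb[OF that, of i j h] by (simp add: hess_def)
 have Nb: "lhess_norm G h x \<le> ?N^4 * (M1^2 * (P h x + M2 * D h x)^2)" if x: "x \<in> C" for h x
 proof -
  have "K x $ i $ k * K x $ j $ l * hess G h x $ i $ j * hess G h x $ k $ l \<le> M1^2 * (P h x + M2 * D h x)^2" for i j k l
  proof -
   have "\<bar>K x $ i $ k * K x $ j $ l * hess G h x $ i $ j * hess G h x $ k $ l\<bar>
     \<le> M1 * M1 * (P h x + M2 * D h x) * (P h x + M2 * D h x)"
    unfolding abs_mult using M1 M2 Hb[OF x] x P0 D0
    by (intro mult_mono) (auto intro!: mult_nonneg_nonneg add_nonneg_nonneg)
   then show ?thesis by (simp add: power2_eq_square mult_ac)
  qed
  then have "lhess_norm G h x \<le> (\<Sum>i::'n\<in>UNIV. \<Sum>j::'n\<in>UNIV. \<Sum>k::'n\<in>UNIV. \<Sum>l::'n\<in>UNIV. M1^2 * (P h x + M2 * D h x)^2)"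
   unfolding lhess_norm_def Let_def by (intro sum_mono)
  also have "\<dots> = ?N^4 * (M1^2 * (P h x + M2 * D h x)^2)" by (simp add: power4_eq_xxxx mult_ac)
  finally show ?thesis .
 qed
 have Tb: "\<bar>T h x\<bar> \<le> \<bar>llap G h x\<bar> + ?N^2 * (M1 * (M2 * D h x))" if x: "x \<in> C" and s: "smooth_on U h" for h x
 proof -
  have "T h x - llap G h x = (\<Sum>\<^sub>U i j. K x $ i $ j * (\<Sum>\<^sub>U k. christ G k i j x * partial k h x))"
   using x C(2) s by (subst llap_trace) (auto simp: T_def hess_def right_diff_distrib sum_subtractf)
  also have "\<bar>\<dots>\<bar> \<le> (\<Sum>i::'n\<in>UNIV. \<Sum>j::'n\<in>UNIV. M1 * (M2 * D h x))"
  proof (intro order_trans[OF sum_abs] sum_mono)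
   fix i j
   show "\<bar>K x $ i $ j * (\<Sum>\<^sub>U k. christ G k i j x * partial k h x)\<bar> \<le> M1 * (M2 * D h x)"
    unfolding abs_mult using M1 x Cb[OF x] by (intro mult_mono) auto
  qed
  finally show ?thesis by (simp add: power2_eq_square mult_ac)
 qed
 have key: "c^2 / ?N^2 * ((e x)^2 * ?\<rho> x * (P h x)^2)
   \<le> (e x)^2 * ?\<rho> x * (T h x)^2 - E h x + (2 * ?N^4 * M3) * \<bar>e x\<bar> * D h x * P h x"
  if x: "x \<in> C" and s: "smooth_on U h" for h x
 proof -
  have xU: "x \<in> U" using x C by blast
  let ?H = "\<lambda>i j. partial i (partial j h) x"
  let ?r = "\<lambda>i j k l. partial j h x * (e x * b i i j k l x * ?H k l - e x * b k i j k l x * ?H l i)"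
  have comm: "?H i j = ?H j i" for i j by (rule smooth_on_partial_commute[OF open_U s xU])
  have comm3: "partial k (partial l (partial i h)) x = partial i (partial k (partial l h)) x" for i k l
  proof -
   have "partial k (partial l (partial i h)) x = partial k (partial i (partial l h)) x"
    by (intro partial_cong_open[OF open_U xU] smooth_on_partial_commute[OF open_U s])
   also have "\<dots> = partial i (partial k (partial l h)) x"
    by (rule smooth_on_partial_commute[OF open_U smooth_on_partial[OF s] xU])
   finally show ?thesis .
  qed
  note d = smooth_on_differentiable[OF _ xU]
  have dd: "partial i h differentiable (at x)" "partial i (partial j h) differentiable (at x)" for i j
   by (intro d smooth_on_partial s)+
  have "E h x = (\<Sum>\<^sub>U i j k l. 
    a i j k l x * (?H i j * ?H k l) - a i j k l x * (?H k j * ?H l i)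
    + ?r i j k l)"
  proof -
   have t: "partial i (\<lambda>x. a i j k l x * (partial j h x * partial k (partial l h) x) ) x
    - partial k (\<lambda>x. a i j k l x * (partial j h x * partial l (partial i h) x)) x
    = a i j k l x * (?H i j * ?H k l) - a i j k l x * (?H k j * ?H l i)
    + ?r i j k l" for i j k l
    using d[OF sa, of i j k l] dd comm3[of k l i]
    by (simp add: partial_mult differentiable_mult pa[OF xU] algebra_simps)
   show ?thesis unfolding E_def t ..
  qed
  also have "\<dots> = (\<Sum>\<^sub>U i j k l. a i j k l x * (?H i j * ?H k l))
    - (\<Sum>\<^sub>U i j k l. a i j k l x * (?H k j * ?H l i))
    + (\<Sum>\<^sub>U i j k l. ?r i j k l)"
   by (simp only: sum.distrib sum_subtractf)
  also have "(\<Sum>\<^sub>U i j k l. a i j k l x * (?H i j * ?H k l))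
    = (e x)^2 * ?\<rho> x * (T h x)^2"
  proof -
   have "(T h x)^2 = (\<Sum>\<^sub>U i j. K x $ i $ j * ?H i j * T h x)"
    unfolding power2_eq_square by (subst T_def) (simp only: sum_distrib_right)
   also have "\<dots> = (\<Sum>\<^sub>U i j k l. K x $ i $ j * ?H i j * (K x $ k $ l * ?H k l))"
    by (simp only: T_def sum_distrib_left)
   finally show ?thesis by (simp add: a_def q_def sum_distrib_left power2_eq_square mult_ac)
  qed
  also have "(\<Sum>\<^sub>U i j k l. a i j k l x * (?H k j * ?H l i))
    = (e x)^2 * ?\<rho> x * (\<Sum>\<^sub>U i j k l. K x $ i $ j * K x $ k $ l * ?H j k * ?H l i)"
   by (simp add: a_def q_def sum_distrib_left power2_eq_square mult_ac comm[of _ _])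
  finally have Eeq: "(e x)^2 * ?\<rho> x * (\<Sum>\<^sub>U i j k l. K x $ i $ j * K x $ k $ l * ?H j k * ?H l i)
    = (e x)^2 * ?\<rho> x * (T h x)^2 - E h x
    + (\<Sum>\<^sub>U i j k l. ?r i j k l)"
   by linarith
  have "(\<Sum>\<^sub>U i j k l. ?r i j k l)
   \<le> (\<Sum>i::'n\<in>UNIV. \<Sum>j::'n\<in>UNIV. \<Sum>k::'n\<in>UNIV. \<Sum>l::'n\<in>UNIV. D h x * (\<bar>e x\<bar> * M3 * P h x + \<bar>e x\<bar> * M3 * P h x))"
  proof (intro sum_mono)
   fix i j k l
   have "\<bar>e x * b i i j k l x * ?H k l\<bar> \<le> \<bar>e x\<bar> * M3 * P h x" "\<bar>e x * b k i j k l x * ?H l i\<bar> \<le> \<bar>e x\<bar> * M3 * P h x"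
    unfolding abs_mult using M3 x P_le by (auto intro!: mult_mono)
   then have "\<bar>e x * b i i j k l x * ?H k l - e x * b k i j k l x * ?H l i\<bar> \<le> \<bar>e x\<bar> * M3 * P h x + \<bar>e x\<bar> * M3 * P h x"
    by linarith
   then have "\<bar>?r i j k l\<bar>
     \<le> D h x * (\<bar>e x\<bar> * M3 * P h x + \<bar>e x\<bar> * M3 * P h x)"
    unfolding abs_mult[of "partial j h x"] using D_le D0 by (intro mult_mono) auto
   then show "?r i j k l
     \<le> D h x * (\<bar>e x\<bar> * M3 * P h x + \<bar>e x\<bar> * M3 * P h x)" by linarith
  qed
  also have "\<dots> = (2 * ?N^4 * M3) * \<bar>e x\<bar> * D h x * P h x" by (simp add: power4_eq_xxxx mult_ac)
  finally have R: "(\<Sum>\<^sub>U i j k l. ?r i j k l)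
   \<le> (2 * ?N^4 * M3) * \<bar>e x\<bar> * D h x * P h x" .
  have "(P h x)^2 = (\<Sum>\<^sub>U p. \<bar>?H (fst p) (snd p)\<bar>)^2"
   unfolding P_def by (simp add: sum.cartesian_product case_prod_unfold)
  also have "\<dots> \<le> real CARD('n \<times> 'n) * (\<Sum>\<^sub>U p. (?H (fst p) (snd p))^2)"
   by (rule sum_abs_squared_le) simp
  also have "\<dots> = ?N^2 * (\<Sum>\<^sub>U i j. (?H i j)^2)"
   by (simp add: sum.cartesian_product case_prod_unfold power2_eq_square)
  finally have "c^2 / ?N^2 * (P h x)^2 \<le> c^2 * (\<Sum>\<^sub>U i j. (?H i j)^2)"
   using c(1) by (simp add: field_simps mult_left_mono)
  also have "\<dots> \<le> (\<Sum>\<^sub>U i j k l. K x $ i $ j * K x $ k $ l * ?H j k * ?H l i)"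
   using double_trace_lower[OF transpose_K[OF xU] c(2)[OF x] c(1), of "\<chi> i j. ?H i j"] comm by simp
  finally have "(e x)^2 * ?\<rho> x * (c^2 / ?N^2 * (P h x)^2) \<le> (e x)^2 * ?\<rho> x *
    (\<Sum>\<^sub>U i j k l. K x $ i $ j * K x $ k $ l * ?H j k * ?H l i)"
   using det_pos[OF xU] by (intro mult_left_mono) auto
  then show ?thesis using R unfolding Eeq by (simp add: mult_ac)
 qed
 \<comment> \<open>\<open>c1\<close> is the coercivity constant of \<open>key\<close>. The 2 in
   \<open>M7\<close> comes from (p + q)^2 <= 2 p^2 + 2 q^2, \<open>M8\<close> bounds squared first
   derivatives by \<open>lgam\<close>, and \<open>B1\<close> collects first order errors: those of
   the Christoffel terms and those left by the absorption step \<open>Y\<close>.\<close>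
 define c1 where "c1 = c^2 / ?N^2"
 define M where "M = 2 * ?N^4 * M3"
 define M6 where "M6 = ?N^2 * (M1 * M2)"
 define M7 where "M7 = 2 * (?N^4 * M1^2)"
 define M8 where "M8 = ?N / c"
 define B1 where "B1 = 2 * M4^2 * M6^2 + M^2 * M5^2 / (2 * c1)"
 define B where "B = 2 * M7 / c1 * (2 * M4^2) + (2 * M7 / c1 * B1 + M7 * M2^2 * M4^2) * M8"
 have c1: "c1 > 0" using c(1) by (simp add: c1_def)
 have nn: "M \<ge> 0" "M6 \<ge> 0" "M7 \<ge> 0" "M8 \<ge> 0" "B1 \<ge> 0" "B \<ge> 0"
  using M1 M2 M3 c c1 by (auto simp: M_def M6_def M7_def M8_def B1_def B_def)
 have main: "(e x)^2 * lhess_norm G h x * ?\<rho> x \<le> B * (((llap G h x)^2 + lgam G h h x) * ?\<rho> x) - 2 * M7 / c1 * E h x"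
  if x: "x \<in> C" and s: "smooth_on U h" for h x
 proof -
  define r where "r = ?\<rho> x"
  define p where "p = P h x"
  define d where "d = D h x"
  define L where "L = llap G h x"
  have "?\<rho> x > 0" using det_pos x C by auto
  then have r: "r > 0" "1 / r \<le> M5" using det_pos[of x] x C M5(2)[OF x] by (auto simp: r_def inverse_eq_divide)
  have eM: "(e x)^2 \<le> M4^2" using M4(2)[OF x] M4(1) by (simp add: abs_le_square_iff[symmetric])
  have L0: "d \<ge> 0" "p \<ge> 0" using D0 P0 by (auto simp: d_def p_def)
  have T2: "(T h x)^2 \<le> 2 * L^2 + 2 * (M6^2 * d^2)"
  proof -
   have "\<bar>T h x\<bar> \<le> \<bar>L\<bar> + M6 * d" using Tb[OF x s] by (simp add: L_def M6_def d_def mult_ac)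
   then have "(T h x)^2 \<le> (\<bar>L\<bar> + M6 * d)^2" using L0 nn by (simp add: abs_le_square_iff[symmetric])
   also have "\<dots> \<le> 2 * L^2 + 2 * (M6^2 * d^2)"
    using sum_squares_bound[of "\<bar>L\<bar>" "M6 * d"] by (simp add: power2_sum power_mult_distrib)
   finally show ?thesis .
  qed
  \<comment> \<open>Young's inequality, weighted so that the error consumes only half of the
    coercive term \<open>c1 * ((e x)^2 * r * p^2)\<close>.\<close>
  have Y: "M * \<bar>e x\<bar> * d * p \<le> c1 / 2 * ((e x)^2 * r * p^2) + M^2 * M5^2 / (2 * c1) * (r * d^2)"
  proof -
   have "2 * (c1 * r * (\<bar>e x\<bar> * p)) * (M * d) \<le> (c1 * r * (\<bar>e x\<bar> * p))^2 + (M * d)^2"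
    by (rule sum_squares_bound)
   then have "M * \<bar>e x\<bar> * d * p \<le> ((c1 * r * (\<bar>e x\<bar> * p))^2 + (M * d)^2) / (2 * c1 * r)"
    using c1 r by (simp add: field_simps)
   also have "\<dots> = c1 / 2 * ((e x)^2 * r * p^2) + M^2 / (2 * c1) * ((1 / r)^2 * (r * d^2))"
    using c1 r by (simp add: field_simps power2_eq_square)
   also have "\<dots> \<le> c1 / 2 * ((e x)^2 * r * p^2) + M^2 / (2 * c1) * (M5^2 * (r * d^2))"
    using c1 r by (intro add_left_mono mult_left_mono mult_right_mono power_mono) auto
   finally show ?thesis by simp
  qed
  have k: "c1 * ((e x)^2 * r * p^2) \<le> (e x)^2 * r * (T h x)^2 - E h x + M * \<bar>e x\<bar> * d * p"
   using key[OF x s] by (simp add: c1_def r_def p_def M_def d_def)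
  have "(e x)^2 * r * (T h x)^2 \<le> M4^2 * r * (2 * L^2 + 2 * (M6^2 * d^2))"
   using eM T2 r by (intro mult_mono) auto
  with k Y have p1: "c1 / 2 * ((e x)^2 * r * p^2) \<le> 2 * M4^2 * (r * L^2) + B1 * (r * d^2) - E h x"
   by (simp add: B1_def algebra_simps)
  have g: "d^2 \<le> M8 * lgam G h h x" using gam[OF x] by (simp add: d_def M8_def)
  have "lhess_norm G h x \<le> ?N^4 * (M1^2 * (p + M2 * d)^2)" using Nb[OF x] by (simp add: p_def d_def)
  also have "\<dots> \<le> ?N^4 * (M1^2 * (2 * p^2 + 2 * (M2^2 * d^2)))"
   using sum_squares_bound[of p "M2 * d"] by (intro mult_left_mono) (auto simp: power2_sum power_mult_distrib)
  also have "\<dots> = M7 * p^2 + M7 * M2^2 * d^2" by (simp add: M7_def algebra_simps)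
  finally have "(e x)^2 * r * lhess_norm G h x \<le> (e x)^2 * r * (M7 * p^2 + M7 * M2^2 * d^2)"
   using r by (intro mult_left_mono) auto
  also have "\<dots> = 2 * M7 / c1 * (c1 / 2 * ((e x)^2 * r * p^2)) + (e x)^2 * (r * (M7 * M2^2 * d^2))"
   using c1 by (simp add: field_simps)
  also have "\<dots> \<le> 2 * M7 / c1 * (2 * M4^2 * (r * L^2) + B1 * (r * d^2) - E h x) + M4^2 * (r * (M7 * M2^2 * d^2))"
   using p1 nn c1 r eM by (intro add_mono mult_left_mono mult_right_mono) auto
  also have "\<dots> = 2 * M7 / c1 * (2 * M4^2) * (r * L^2) + (2 * M7 / c1 * B1 + M7 * M2^2 * M4^2) * (r * d^2) - 2 * M7 / c1 * E h x"
   by (simp add: algebra_simps)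
  also have "\<dots> \<le> B * (r * L^2) + (2 * M7 / c1 * B1 + M7 * M2^2 * M4^2) * (r * (M8 * lgam G h h x)) - 2 * M7 / c1 * E h x"
   using nn c1 r g by (intro diff_right_mono add_mono mult_left_mono mult_right_mono) (auto simp: B_def)
  also have "\<dots> \<le> B * (r * L^2) + B * (r * lgam G h h x) - 2 * M7 / c1 * E h x"
  proof -
   have "lgam G h h x \<ge> 0" using lgam_nonneg x C by blast
   then have "(2 * M7 / c1 * B1 + M7 * M2^2 * M4^2) * M8 * (r * lgam G h h x) \<le> B * (r * lgam G h h x)"
    using nn c1 r by (intro mult_right_mono) (auto simp: B_def)
   then show ?thesis by (simp add: mult_ac)
  qed
  finally show ?thesis by (simp add: r_def L_def algebra_simps)
 qed
 show ?thesis
 proof (rule that[of B])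
  show "B \<ge> 0" by (rule nn)
  fix h assume s: "smooth_on U h"
  have z: "partial i f x = 0" if "x \<notin> C" "\<And>x. x \<notin> C \<Longrightarrow> f x = 0" for i f x
   using partial_cong_open[of "- C" x f "\<lambda>_. 0"] that compact_imp_closed[OF C(1)] by (simp add: open_Compl)
  have az: "a i j k l x = 0" if "x \<notin> C" for i j k l x using e(2)[OF that] by (simp add: a_def)
  have E0: "E h x = 0" if "x \<notin> C" for x
   unfolding E_def by (intro sum.neutral ballI) (simp add: z[OF that] az)
  have ip: "integrable lborel (partial m (\<lambda>x. a i j k l x * w x)) \<and> integral\<^sup>L lborel (partial m (\<lambda>x. a i j k l x * w x)) = 0"
   if "smooth_on U w" for m i j k l w
  proof -
   have "smooth_on UNIV (\<lambda>x. a i j k l x * w x)"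
    by (rule smooth_on_extend[OF open_U smooth_on_mult[OF open_U sa that] compact_imp_closed[OF C(1)] C(2)])
     (simp add: az)
   moreover have "bounded {x. a i j k l x * w x \<noteq> 0}"
    by (rule bounded_subset[OF compact_imp_bounded[OF C(1)]]) (use az in force)
   ultimately show ?thesis using integral_partial_zero smooth_on_Ck by blast
  qed
  have iE: "integrable lborel (E h) \<and> integral\<^sup>L lborel (E h) = 0"
   unfolding E_def
   by (simp add: Bochner_Integration.integral_sum Bochner_Integration.integral_diff ip smooth_on_mult[OF open_U]
     smooth_on_partial s)
  have int: "integrable lborel (\<lambda>x. indicator C x * f x)" if "smooth_on U f" for f :: "real^'n \<Rightarrow> real"
   using borel_integrable_compact[OF C(1) cont[OF that]] by simp
  have "(LINT x|lborel. indicator C x * ((e x)^2 * lhess_norm G h x * ?\<rho> x))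
   \<le> (LINT x|lborel. B * (indicator C x * (((llap G h x)^2 + lgam G h h x) * ?\<rho> x)) - 2 * M7 / c1 * E h x)"
  proof (rule integral_mono)
   show "integrable lborel (\<lambda>x. indicator C x * ((e x)^2 * lhess_norm G h x * ?\<rho> x))"
    unfolding power2_eq_square by (intro int smooth_on_mult e(1) smooth_lhess_norm smooth_density s open_U)
   show "integrable lborel (\<lambda>x. B * (indicator C x * (((llap G h x)^2 + lgam G h h x) * ?\<rho> x)) - 2 * M7 / c1 * E h x)"
    unfolding power2_eq_square using iE
    by (intro Bochner_Integration.integrable_diff integrable_mult_right int smooth_on_mult smooth_on_add smooth_llap smooth_lgam
      smooth_density s open_U) auto
   fix x
   show "indicator C x * ((e x)^2 * lhess_norm G h x * ?\<rho> x)
    \<le> B * (indicator C x * (((llap G h x)^2 + lgam G h h x) * ?\<rho> x)) - 2 * M7 / c1 * E h x"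
    using main[OF _ s, of x] E0[of x] by (cases "x \<in> C") (simp_all add: indicator_def)
  qed
  also have "\<dots> = B * (LINT x|lborel. indicator C x * (((llap G h x)^2 + lgam G h h x) * ?\<rho> x))"
  proof -
   have "integrable lborel (\<lambda>x. indicator C x * (((llap G h x)^2 + lgam G h h x) * ?\<rho> x))"
    unfolding power2_eq_square
    by (intro int smooth_on_mult smooth_on_add smooth_llap smooth_lgam smooth_density s open_U)
   then show ?thesis using iE by simp
  qed
  finally show "(LINT x|lborel. indicator C x * ((e x)^2 * lhess_norm G h x * ?\<rho> x))
   \<le> B * (LINT x|lborel. indicator C x * (((llap G h x)^2 + lgam G h h x) * ?\<rho> x))" .
 qed
qed

end

section \<open>The Poincare inequality on boxes\<close>

lemma nn_integral_affine:
 fixes F :: "'a::euclidean_space \<Rightarrow> ennreal"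
 assumes [measurable]: "F \<in> borel_measurable borel" and c: "c \<noteq> 0"
 shows "(\<integral>\<^sup>+x. F (t + c *\<^sub>R x) \<partial>lborel) * ennreal (\<bar>c\<bar> ^ DIM('a)) = (\<integral>\<^sup>+x. F x \<partial>lborel)"
proof -
 have "(\<integral>\<^sup>+x. F x \<partial>lborel) = (\<integral>\<^sup>+x. F x \<partial>density (distr lborel borel (\<lambda>x. t + c *\<^sub>R x)) (\<lambda>_. ennreal (\<bar>c\<bar>^DIM('a))))"
  using lborel_affine[OF c, of t] by simp
 also have "\<dots> = (\<integral>\<^sup>+x. ennreal (\<bar>c\<bar>^DIM('a)) * F (t + c *\<^sub>R x) \<partial>lborel)"
  by (subst nn_integral_density) (auto simp: nn_integral_distr)
 also have "\<dots> = (\<integral>\<^sup>+x. F (t + c *\<^sub>R x) \<partial>lborel) * ennreal (\<bar>c\<bar> ^ DIM('a))"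
  by (subst nn_integral_cmult) (auto simp: mult.commute)
 finally show ?thesis by simp
qed

text \<open>A scaling ratio of at least 1/2 costs at most the factor \<open>2 ^ DIM('a)\<close>. In
  \<open>poincare_convex\<close> one of \<open>t\<close> and \<open>1 - t\<close> is always such a
  ratio.\<close>

lemma nn_integral_affine_le:
 fixes F :: "'a::euclidean_space \<Rightarrow> ennreal"
 assumes F: "F \<in> borel_measurable borel" and c: "c \<ge> 1/2"
 shows "(\<integral>\<^sup>+x. F (t + c *\<^sub>R x) \<partial>lborel) \<le> ennreal (2 ^ DIM('a)) * (\<integral>\<^sup>+x. F x \<partial>lborel)"
proof -
 have "1 \<le> (2 * c) ^ DIM('a)" using c by (intro one_le_power) auto
 then have "(\<integral>\<^sup>+x. F (t + c *\<^sub>R x) \<partial>lborel) \<le> (\<integral>\<^sup>+x. F (t + c *\<^sub>R x) \<partial>lborel) * ennreal ((2 * c) ^ DIM('a))"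
  using mult_left_mono[of 1 "ennreal ((2 * c) ^ DIM('a))"] by (simp add: ennreal_ge_1)
 also have "\<dots> = ennreal (2 ^ DIM('a)) * ((\<integral>\<^sup>+x. F (t + c *\<^sub>R x) \<partial>lborel) * ennreal (\<bar>c\<bar> ^ DIM('a)))"
  using c by (simp add: power_mult_distrib ennreal_mult mult_ac)
 also have "\<dots> = ennreal (2 ^ DIM('a)) * (\<integral>\<^sup>+x. F x \<partial>lborel)"
  using c by (subst nn_integral_affine[OF F]) auto
 finally show ?thesis .
qed

lemma segment_difference_bound:
 fixes u :: "real^'n \<Rightarrow> real"
 assumes U: "open U" and u: "Ck_on 1 U u" and B: "convex B" "B \<subseteq> U" and xy: "x \<in> B" "y \<in> B"
 shows "ennreal ((u x - u y)^2) \<le> ennreal ((dist x y)^2) *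
  (\<integral>\<^sup>+t. indicator {0..1} t * ennreal (\<Sum>\<^sub>U i. (partial i u (y + t *\<^sub>R (x - y)))^2) \<partial>lborel)"
proof -
 define \<gamma> where "\<gamma> t = y + t *\<^sub>R (x - y)" for t
 have \<gamma>: "\<gamma> t \<in> U" if "t \<in> {0..1}" for t
 proof -
  have "\<gamma> t = (1 - t) *\<^sub>R y + t *\<^sub>R x" by (simp add: \<gamma>_def algebra_simps)
  then have "\<gamma> t \<in> B" using B(1) xy that by (auto simp: convex_alt)
  then show ?thesis using B(2) by blast
 qed
 have cp: "continuous_on {0..1} (\<lambda>t. partial i u (\<gamma> t))" for i
 proof (rule continuous_on_compose2[of U "partial i u"])
  show "continuous_on U (partial i u)" using u by simp
  show "continuous_on {0..1} \<gamma>" unfolding \<gamma>_def by (intro continuous_intros)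
 qed (use \<gamma> in auto)
 define f where "f t = (\<Sum>\<^sub>U i. (x - y) $ i * partial i u (\<gamma> t))" for t
 define S where "S t = (\<Sum>\<^sub>U i. (partial i u (\<gamma> t))^2)" for t
 have cf: "continuous_on {0..1} f" and cS: "continuous_on {0..1} S"
  unfolding f_def S_def by (auto intro!: continuous_intros cp)
 have der: "((u \<circ> \<gamma>) has_real_derivative f t) (at t)" if "t \<in> {0..1}" for t
 proof -
  have "(u has_derivative (\<lambda>h. \<Sum>\<^sub>U i. h $ i * partial i u (\<gamma> t))) (at (\<gamma> t))"
   using u \<gamma>[OF that] by (intro has_derivative_partial) auto
  moreover have "(\<gamma> has_derivative (\<lambda>h. h *\<^sub>R (x - y))) (at t)"
   unfolding \<gamma>_def by (auto intro!: derivative_eq_intros)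
  ultimately have "((u \<circ> \<gamma>) has_derivative (\<lambda>h. \<Sum>\<^sub>U i. (h *\<^sub>R (x - y)) $ i * partial i u (\<gamma> t))) (at t)"
   by (auto dest: diff_chain_at simp: o_def)
  moreover have "(\<lambda>h. \<Sum>\<^sub>U i. (h *\<^sub>R (x - y)) $ i * partial i u (\<gamma> t)) = (*) (f t)"
   by (simp add: fun_eq_iff f_def sum_distrib_right sum_distrib_left mult_ac)
  ultimately show ?thesis by (simp add: has_field_derivative_def)
 qed
 define I where "I g = (LINT t|lborel. indicator {0..1} t *\<^sub>R g t)" for g :: "real \<Rightarrow> real"
 have int: "integrable lborel (\<lambda>t. indicator {0..1} t *\<^sub>R g t)" if "continuous_on {0..1} g" for g :: "real \<Rightarrow> real"
  using that by (intro borel_integrable_compact) auto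
 have eq: "I f = u x - u y"
  unfolding I_def using integral_FTC_atLeastAtMost[of 0 1 "u \<circ> \<gamma>" f] der cf
  by (auto simp: has_real_derivative_iff_has_vector_derivative \<gamma>_def intro: has_vector_derivative_at_within)
 \<comment> \<open>Nonnegativity of the variance on the unit interval: the square of the mean of
   \<open>f\<close> is at most the mean of its square.\<close>
 have "0 \<le> I (\<lambda>t. (f t - I f)^2)"
  unfolding I_def by (intro integral_nonneg_AE) auto
 also have "I (\<lambda>t. (f t - I f)^2) = I (\<lambda>t. (f t)^2) - 2 * I f * I f + (I f)^2"
 proof -
  have "I (\<lambda>t. (f t - I f)^2) = (LINT t|lborel. indicator {0..1} t *\<^sub>R (f t)^2 - 2 * I f * (indicator {0..1} t *\<^sub>R f t) + (I f)^2 * indicator {0..1} t)"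
   unfolding I_def[of "\<lambda>t. (f t - I f)^2"]
   by (intro Bochner_Integration.integral_cong refl) (auto simp: power2_diff indicator_def)
  also have "\<dots> = I (\<lambda>t. (f t)^2) - 2 * I f * I f + (I f)^2"
  proof -
   have i1: "integrable lborel (\<lambda>t. indicator {0..1} t *\<^sub>R (f t)^2)" by (intro int continuous_intros cf)
   have i2: "integrable lborel (\<lambda>t. 2 * I f * (indicator {0..1} t *\<^sub>R f t))" by (intro integrable_mult_right int cf)
   have i3: "integrable lborel (\<lambda>t. (I f)^2 * indicator {0..1::real} t)" by simp
   show ?thesis using i1 i2 i3
    by (subst Bochner_Integration.integral_add, simp, simp, subst Bochner_Integration.integral_diff) (simp_all add: I_def)
  qed
  finally show ?thesis .
 qed
 finally have "(u x - u y)^2 \<le> I (\<lambda>t. (f t)^2)" unfolding eq by (simp add: power2_eq_square algebra_simps)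
 also have "\<dots> \<le> I (\<lambda>t. (dist x y)^2 * S t)"
  unfolding I_def
 proof (rule integral_mono)
  show "integrable lborel (\<lambda>t. indicator {0..1} t *\<^sub>R (f t)^2)" by (intro int continuous_intros cf)
  show "integrable lborel (\<lambda>t. indicator {0..1} t *\<^sub>R ((dist x y)^2 * S t))" by (intro int continuous_intros cS)
  fix t
  have "(f t)^2 \<le> (\<Sum>\<^sub>U i. ((x - y) $ i)^2) * S t"
   unfolding f_def S_def by (rule Cauchy_Schwarz_ineq_sum)
  also have "(\<Sum>\<^sub>U i. ((x - y) $ i)^2) = (dist x y)^2"
   by (simp add: dist_norm norm_vec_def L2_set_def sum_nonneg)
  finally show "indicator {0..1} t *\<^sub>R (f t)^2 \<le> indicator {0..1} t *\<^sub>R ((dist x y)^2 * S t)"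
   by (simp add: indicator_def)
 qed
 also have "\<dots> = (dist x y)^2 * I S"
  unfolding I_def using integral_mult_right_zero[of lborel "(dist x y)^2" "\<lambda>t. indicator {0..1} t *\<^sub>R S t"]
  by (simp add: mult.left_commute)
 finally have "ennreal ((u x - u y)^2) \<le> ennreal ((dist x y)^2) * ennreal (I S)"
  by (simp flip: ennreal_mult' add: ennreal_leI)
 also have "ennreal (I S) = (\<integral>\<^sup>+t. ennreal (indicator {0..1} t *\<^sub>R S t) \<partial>lborel)"
  unfolding I_def by (rule nn_integral_eq_integral[symmetric, OF int[OF cS]]) (auto simp: S_def sum_nonneg)
 also have "\<dots> = (\<integral>\<^sup>+t. indicator {0..1} t * ennreal (S t) \<partial>lborel)"
  by (intro nn_integral_cong) (auto simp: indicator_def)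
 finally show ?thesis by (simp add: S_def \<gamma>_def)
qed

text \<open>The double integral of (u x - u y)^2 over pairs of points of \<open>B\<close> is twice
  the difference of the two terms in \<open>u\<close>. The increment is also bounded by the gradient
  along the segment. For fixed \<open>t\<close> the point y + t (x - y) is integrated over
  \<open>x\<close> if t >= 1/2 and over \<open>y\<close> otherwise, so that the substitution never
  degenerates.\<close>

lemma poincare_convex:
 fixes u :: "real^'n \<Rightarrow> real"
 assumes U: "open U" and u: "Ck_on 1 U u" and B: "compact B" "convex B" "B \<subseteq> U"
  and d: "\<And>x y. x \<in> B \<Longrightarrow> y \<in> B \<Longrightarrow> dist x y \<le> d"
 shows "measure lborel B * (LINT x|lborel. indicator B x * (u x)^2) \<le> (LINT x|lborel. indicator B x * u x)^2
  + 2 ^ CARD('n) * d^2 * measure lborel B * (LINT x|lborel. indicator B x * (\<Sum>\<^sub>U i. (partial i u x)^2))"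
proof -
 let ?m = "measure lborel B" let ?n = "CARD('n)"
 have Bm[measurable]: "B \<in> sets borel" using B(1) by (simp add: compact_imp_closed borel_closed)
 have emB: "emeasure lborel B = ennreal ?m"
  using emeasure_compact_finite[OF B(1)] by (simp add: emeasure_eq_ennreal_measure)
 have cu: "continuous_on B u" using Ck_on_SucD[of 0 U u] u continuous_on_subset[OF _ B(3)] by auto
 have cg: "continuous_on B (\<lambda>x. \<Sum>\<^sub>U i. (partial i u x)^2)"
  using u continuous_on_subset[OF _ B(3)] by (intro continuous_intros) auto
 have int: "integrable lborel (\<lambda>x. indicator B x * f x)" if "continuous_on B f" for f :: "real^'n \<Rightarrow> real"
  using borel_integrable_compact[OF B(1) that] by simp
 define S where "S = (LINT x|lborel. indicator B x * (u x)^2)"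
 define I where "I = (LINT x|lborel. indicator B x * u x)"
 define R where "R = (LINT x|lborel. indicator B x * (\<Sum>\<^sub>U i. (partial i u x)^2))"
 have iS: "integrable lborel (\<lambda>x. indicator B x * (u x)^2)" by (intro int continuous_intros cu)
 have iI: "integrable lborel (\<lambda>x. indicator B x * u x)" by (intro int cu)
 have iB: "integrable lborel (indicator B :: _ \<Rightarrow> real)" using emB by (simp add: integrable_indicator_iff)
 define F where "F x = ennreal (indicator B x * (\<Sum>\<^sub>U i. (partial i u x)^2))" for x
 have Fm[measurable]: "F \<in> borel_measurable borel"
  unfolding F_def using int[OF cg] by (intro measurable_compose[OF _ measurable_ennreal]) auto
 have F_int: "(\<integral>\<^sup>+x. F x \<partial>lborel) = ennreal R"
  unfolding F_def R_def by (intro nn_integral_eq_integral int cg) (auto simp: sum_nonneg)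
 define D where "D x y = ennreal (indicator B x * (indicator B y * (u x - u y)^2))" for x y
 have Dint: "(\<integral>\<^sup>+x. \<integral>\<^sup>+y. D x y \<partial>lborel \<partial>lborel) = ennreal (2 * (?m * S) - 2 * I^2)"
 proof -
  have in1: "integrable lborel (\<lambda>y. indicator B x * (indicator B y * (u x - u y)^2))" for x
   by (intro integrable_mult_right int continuous_intros cu)
  have i1: "(\<integral>\<^sup>+y. D x y \<partial>lborel) = ennreal (LINT y|lborel. indicator B x * (indicator B y * (u x - u y)^2))" for x
   unfolding D_def by (intro nn_integral_eq_integral in1) auto
  have i2: "(LINT y|lborel. indicator B x * (indicator B y * (u x - u y)^2))
    = indicator B x * ((u x)^2 * ?m - 2 * u x * I + S)" for x
  proof -
   have "(LINT y|lborel. indicator B y * (u x - u y)^2)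
     = (LINT y|lborel. (u x)^2 * indicator B y - 2 * u x * (indicator B y * u y) + indicator B y * (u y)^2)"
    by (intro Bochner_Integration.integral_cong refl) (auto simp: power2_diff indicator_def)
   also have "\<dots> = (u x)^2 * ?m - 2 * u x * I + S"
    using iS iI iB by (simp add: S_def I_def)
   finally show ?thesis by simp
  qed
  have "(\<integral>\<^sup>+x. \<integral>\<^sup>+y. D x y \<partial>lborel \<partial>lborel) = (\<integral>\<^sup>+x. ennreal (indicator B x * ((u x)^2 * ?m - 2 * u x * I + S)) \<partial>lborel)"
   unfolding i1 i2 ..
  also have "\<dots> = ennreal (LINT x|lborel. indicator B x * ((u x)^2 * ?m - 2 * u x * I + S))"
  proof (intro nn_integral_eq_integral int continuous_intros cu AE_I2)
   fix x
   have "0 \<le> (LINT y|lborel. indicator B x * (indicator B y * (u x - u y)^2))"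
    by (intro integral_nonneg_AE) auto
   then show "0 \<le> indicator B x * ((u x)^2 * ?m - 2 * u x * I + S)"
    unfolding i2 .
  qed
  also have "(LINT x|lborel. indicator B x * ((u x)^2 * ?m - 2 * u x * I + S))
    = (LINT x|lborel. ?m * (indicator B x * (u x)^2) - 2 * I * (indicator B x * u x) + S * indicator B x)"
   by (intro Bochner_Integration.integral_cong refl) (auto simp: algebra_simps)
  also have "\<dots> = ?m * S - 2 * I * I + S * ?m"
   using iS iI iB by (simp add: S_def I_def)
  finally show ?thesis by (simp add: power2_eq_square mult_ac)
 qed
 define H where "H x y t = indicator B x * (indicator B y * (indicator {0..1} t * F (y + t *\<^sub>R (x - y))))"
  for x y and t :: real
 have DH: "D x y \<le> ennreal (d^2) * (\<integral>\<^sup>+t. H x y t \<partial>lborel)" for x y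
 proof (cases "x \<in> B \<and> y \<in> B")
  case True
  then have x: "x \<in> B" and y: "y \<in> B" by auto
  have inB: "y + t *\<^sub>R (x - y) \<in> B" if "t \<in> {0..1}" for t
  proof -
   have "y + t *\<^sub>R (x - y) = (1 - t) *\<^sub>R y + t *\<^sub>R x" by (simp add: algebra_simps)
   then show ?thesis using B(2) x y that by (auto simp: convex_alt)
  qed
  have "D x y \<le> ennreal ((dist x y)^2) *
   (\<integral>\<^sup>+t. indicator {0..1} t * ennreal (\<Sum>\<^sub>U i. (partial i u (y + t *\<^sub>R (x - y)))^2) \<partial>lborel)"
   using segment_difference_bound[OF U u B(2,3) x y] x y by (simp add: D_def)
  also have "(\<integral>\<^sup>+t. indicator {0..1} t * ennreal (\<Sum>\<^sub>U i. (partial i u (y + t *\<^sub>R (x - y)))^2) \<partial>lborel) = (\<integral>\<^sup>+t. H x y t \<partial>lborel)"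
   using x y inB by (intro nn_integral_cong) (auto simp: H_def F_def indicator_def)
  also have "ennreal ((dist x y)^2) * (\<integral>\<^sup>+t. H x y t \<partial>lborel) \<le> ennreal (d^2) * (\<integral>\<^sup>+t. H x y t \<partial>lborel)"
   using d[OF x y] by (intro mult_right_mono ennreal_leI power_mono) auto
  finally show ?thesis .
 qed (auto simp: D_def indicator_def)
 have slice: "(\<integral>\<^sup>+x. \<integral>\<^sup>+y. H x y t \<partial>lborel \<partial>lborel) \<le> indicator {0..1} t * (ennreal (2 ^ ?n) * ennreal R * ennreal ?m)" for t
 proof (cases "t \<in> {0..1}")
  case True
  have HG: "(\<integral>\<^sup>+x. \<integral>\<^sup>+y. H x y t \<partial>lborel \<partial>lborel) \<le> (\<integral>\<^sup>+x. indicator B x * (ennreal (2 ^ ?n) * ennreal R) \<partial>lborel)"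
  proof (cases "t \<ge> 1/2")
   case False
   have "(\<integral>\<^sup>+y. H x y t \<partial>lborel) \<le> indicator B x * (ennreal (2 ^ ?n) * ennreal R)" for x
   proof -
    have "(\<integral>\<^sup>+y. H x y t \<partial>lborel) \<le> (\<integral>\<^sup>+y. indicator B x * F (t *\<^sub>R x + (1 - t) *\<^sub>R y) \<partial>lborel)"
     by (intro nn_integral_mono) (auto simp: H_def indicator_def algebra_simps)
    also have "\<dots> = indicator B x * (\<integral>\<^sup>+y. F (t *\<^sub>R x + (1 - t) *\<^sub>R y) \<partial>lborel)"
     by (rule nn_integral_cmult) measurable
    also have "\<dots> \<le> indicator B x * (ennreal (2 ^ ?n) * (\<integral>\<^sup>+y. F y \<partial>lborel))"
     using nn_integral_affine_le[OF Fm, of "1 - t" "t *\<^sub>R x"] False by (intro mult_left_mono) auto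
    finally show ?thesis by (simp add: F_int)
   qed
   then show ?thesis by (intro nn_integral_mono)
  next
   case half: True
   have "(\<integral>\<^sup>+x. \<integral>\<^sup>+y. H x y t \<partial>lborel \<partial>lborel) = (\<integral>\<^sup>+y. \<integral>\<^sup>+x. H x y t \<partial>lborel \<partial>lborel)"
    by (rule lborel_pair.Fubini'[symmetric]) (simp add: H_def case_prod_unfold)
   also have "\<dots> \<le> (\<integral>\<^sup>+y. indicator B y * (ennreal (2 ^ ?n) * ennreal R) \<partial>lborel)"
   proof (rule nn_integral_mono)
    fix y
    have "(\<integral>\<^sup>+x. H x y t \<partial>lborel) \<le> (\<integral>\<^sup>+x. indicator B y * F ((1 - t) *\<^sub>R y + t *\<^sub>R x) \<partial>lborel)"
     by (intro nn_integral_mono) (auto simp: H_def indicator_def algebra_simps)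
    also have "\<dots> = indicator B y * (\<integral>\<^sup>+x. F ((1 - t) *\<^sub>R y + t *\<^sub>R x) \<partial>lborel)"
     by (rule nn_integral_cmult) measurable
    also have "\<dots> \<le> indicator B y * (ennreal (2 ^ ?n) * (\<integral>\<^sup>+x. F x \<partial>lborel))"
     using nn_integral_affine_le[OF Fm, of t "(1 - t) *\<^sub>R y"] half by (intro mult_left_mono) auto
    finally show "(\<integral>\<^sup>+x. H x y t \<partial>lborel) \<le> indicator B y * (ennreal (2 ^ ?n) * ennreal R)" by (simp add: F_int)
   qed
   finally show ?thesis .
  qed
  also have "\<dots> = ennreal ?m * (ennreal (2 ^ ?n) * ennreal R)"
   by (subst nn_integral_multc) (auto simp: emB)
  finally show ?thesis using True by (simp add: mult_ac)
 qed (simp add: H_def)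
 have "(\<integral>\<^sup>+x. \<integral>\<^sup>+y. D x y \<partial>lborel \<partial>lborel) \<le> (\<integral>\<^sup>+x. \<integral>\<^sup>+y. ennreal (d^2) * (\<integral>\<^sup>+t. H x y t \<partial>lborel) \<partial>lborel \<partial>lborel)"
  by (intro nn_integral_mono DH)
 also have "\<dots> = ennreal (d^2) * (\<integral>\<^sup>+x. \<integral>\<^sup>+y. \<integral>\<^sup>+t. H x y t \<partial>lborel \<partial>lborel \<partial>lborel)"
 proof -
  have "(\<integral>\<^sup>+y. ennreal (d^2) * (\<integral>\<^sup>+t. H x y t \<partial>lborel) \<partial>lborel) = ennreal (d^2) * (\<integral>\<^sup>+y. \<integral>\<^sup>+t. H x y t \<partial>lborel \<partial>lborel)" for x
   by (rule nn_integral_cmult) (unfold H_def, measurable)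
  moreover have "(\<integral>\<^sup>+x. ennreal (d^2) * (\<integral>\<^sup>+y. \<integral>\<^sup>+t. H x y t \<partial>lborel \<partial>lborel) \<partial>lborel)
    = ennreal (d^2) * (\<integral>\<^sup>+x. \<integral>\<^sup>+y. \<integral>\<^sup>+t. H x y t \<partial>lborel \<partial>lborel \<partial>lborel)"
   by (rule nn_integral_cmult) (unfold H_def, measurable)
  ultimately show ?thesis by simp
 qed
 also have "(\<integral>\<^sup>+x. \<integral>\<^sup>+y. \<integral>\<^sup>+t. H x y t \<partial>lborel \<partial>lborel \<partial>lborel) = (\<integral>\<^sup>+x. \<integral>\<^sup>+t. \<integral>\<^sup>+y. H x y t \<partial>lborel \<partial>lborel \<partial>lborel)"
  by (intro nn_integral_cong lborel_pair.Fubini'[symmetric]) (simp add: H_def case_prod_unfold)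
 also have "\<dots> = (\<integral>\<^sup>+t. \<integral>\<^sup>+x. \<integral>\<^sup>+y. H x y t \<partial>lborel \<partial>lborel \<partial>lborel)"
  by (intro lborel_pair.Fubini'[symmetric]) (simp add: H_def case_prod_unfold)
 also have "\<dots> \<le> (\<integral>\<^sup>+t. indicator {0..1::real} t * (ennreal (2 ^ ?n) * ennreal R * ennreal ?m) \<partial>lborel)"
  by (intro nn_integral_mono slice)
 also have "\<dots> = ennreal (2 ^ ?n) * ennreal R * ennreal ?m"
  by (subst nn_integral_multc) auto
 finally have "ennreal (2 * (?m * S) - 2 * I^2) \<le> ennreal (d^2) * (ennreal (2 ^ ?n) * ennreal R * ennreal ?m)"
  unfolding Dint by (simp add: mult_left_mono)
 also have "\<dots> = ennreal (2 ^ ?n * d^2 * ?m * R)"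
  by (simp flip: ennreal_mult' ennreal_mult'' add: mult_ac)
 finally have "2 * (?m * S) - 2 * I^2 \<le> 2 ^ ?n * d^2 * ?m * R"
  by (subst (asm) ennreal_le_iff) (auto simp: R_def intro!: mult_nonneg_nonneg integral_nonneg_AE sum_nonneg)
 moreover have "0 \<le> 2 ^ ?n * d^2 * ?m * R"
  by (auto simp: R_def intro!: mult_nonneg_nonneg integral_nonneg_AE sum_nonneg)
 ultimately show ?thesis unfolding S_def[symmetric] I_def[symmetric] R_def[symmetric] by linarith
qed

lemma poincare_box:
 fixes u :: "real^'n \<Rightarrow> real"
 assumes U: "open U" and u: "Ck_on 1 U u" and B: "cbox a b \<subseteq> U" "cbox a b \<subseteq> ball z e"
 shows "integral (cbox a b) (\<lambda>x. (u x)^2) \<le> inverse (measure lborel (cbox a b)) * (integral (cbox a b) u)^2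
  + 2 ^ CARD('n) * (2 * e)^2 * integral (cbox a b) (\<lambda>x. \<Sum>\<^sub>U i. (partial i u x)^2)"
proof (cases "measure lborel (cbox a b) = 0")
 case True then show ?thesis by (simp add: integral_null)
next
 case False
 let ?B = "cbox a b"
 have cu: "continuous_on ?B u" using Ck_on_SucD[of 0 U u] u continuous_on_subset[OF _ B(1)] by auto
 have cg: "continuous_on ?B (\<lambda>x. \<Sum>\<^sub>U i. (partial i u x)^2)"
  using u continuous_on_subset[OF _ B(1)] by (intro continuous_intros) auto
 have eq: "(LINT x|lborel. indicator ?B x * f x) = integral ?B f" if "continuous_on ?B f" for f :: "real^'n \<Rightarrow> real"
  using set_borel_integral_eq_integral(2)[of ?B f] borel_integrable_compact[OF compact_cbox that]
  by (simp add: set_integrable_def set_lebesgue_integral_def)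
 have dist: "dist x y \<le> 2 * e" if "x \<in> ?B" "y \<in> ?B" for x y
 proof -
  have "dist x z < e" "dist y z < e" using that B(2) by (auto simp: dist_commute subset_iff)
  then show ?thesis using dist_triangle2[of x y z] by linarith
 qed
 have "measure lborel ?B * integral ?B (\<lambda>x. (u x)^2) \<le> (integral ?B u)^2
  + 2 ^ CARD('n) * (2 * e)^2 * measure lborel ?B * integral ?B (\<lambda>x. \<Sum>\<^sub>U i. (partial i u x)^2)"
  using poincare_convex[OF U u compact_cbox convex_box(1) B(1) dist] eq[OF cu] eq[OF cg] eq[of "\<lambda>x. (u x)^2"] cu
  by (simp add: continuous_intros)
 moreover have "measure lborel ?B > 0" using False by (simp add: less_le)
 ultimately show ?thesis by (simp add: field_simps)
qed

context local_metric begin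

text \<open>The gradient term in the Poincare inequality scales with the square of the diameter, so
  a fine subdivision makes its coefficient as small as desired. What remains are the integrals over
  finitely many pieces; this finite rank remainder is the source of compactness.\<close>

lemma poincare_local:
 assumes ab: "cbox a b \<subseteq> U" and \<delta>: "\<delta> > 0"
 obtains \<K> M where "finite \<K>" "\<And>Q. Q \<in> \<K> \<Longrightarrow> compact Q \<and> Q \<subseteq> cbox a b" "M \<ge> 0"
  "\<And>u. smooth_on U u \<Longrightarrow> (LINT x|lborel. indicator (cbox a b) x * ((u x)^2 * sqrt (det (G x))))
   \<le> \<delta> * (LINT x|lborel. indicator (cbox a b) x * (lgam G u u x * sqrt (det (G x))))
    + M * (\<Sum>Q\<in>\<K>. (LINT x|lborel. indicator Q x * u x)^2)"
proof -
 let ?B = "cbox a b" and ?\<rho> = "\<lambda>x. sqrt (det (G x))"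
 have cont: "continuous_on C f" if "smooth_on U f" "C \<subseteq> ?B" for f C
  using continuous_on_subset[OF smooth_on_continuous[OF that(1)]] that(2) ab by blast
 have eq: "(LINT x|lborel. indicator C x * f x) = integral C f" "f integrable_on C"
  if "compact C" "continuous_on C f" for f :: "real^'n \<Rightarrow> real" and C
  using set_borel_integral_eq_integral[of C f] borel_integrable_compact[OF that]
  by (simp_all add: set_integrable_def set_lebesgue_integral_def)
 obtain R1 where R1: "R1 \<ge> 0" "\<And>x. x \<in> ?B \<Longrightarrow> \<bar>?\<rho> x\<bar> \<le> R1"
  using compact_bounded_real[OF compact_cbox cont[OF smooth_density order_refl]] by auto
 obtain R2 where R2: "R2 \<ge> 0" "\<And>x. x \<in> ?B \<Longrightarrow> \<bar>inverse (?\<rho> x)\<bar> \<le> R2"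
  using compact_bounded_real[OF compact_cbox cont[OF smooth_on_inverse[OF open_U smooth_density] order_refl]] det_ne by auto
 obtain c where c: "c > 0" "\<And>x v. x \<in> ?B \<Longrightarrow> v \<bullet> (K x *v v) \<ge> c * (v \<bullet> v)"
  using lower_bound_K[OF compact_cbox ab] by blast
 define R3 where "R3 = R2 / c"
 have R3: "R3 \<ge> 0" using R2 c by (simp add: R3_def)
 have grad: "(\<Sum>\<^sub>U i. (partial i u x)^2) \<le> R3 * (lgam G u u x * ?\<rho> x)" if x: "x \<in> ?B" for u x
 proof -
  let ?v = "\<chi> i. partial i u x"
  have pos: "?\<rho> x > 0" using det_pos x ab by auto
  have "(\<Sum>\<^sub>U i. (partial i u x)^2) = ?v \<bullet> ?v" by (simp add: inner_vec_def power2_eq_square)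
  also have "\<dots> \<le> (?v \<bullet> (K x *v ?v)) / c" using c(2)[OF x, of ?v] c(1) by (simp add: field_simps)
  also have "?v \<bullet> (K x *v ?v) = lgam G u u x" by (simp add: lgam_def lgrad_def inner_vec_def)
  finally have 1: "(\<Sum>\<^sub>U i. (partial i u x)^2) \<le> lgam G u u x / c" .
  have "lgam G u u x / c \<ge> 0" using lgam_nonneg[of x u] x ab c(1) by auto
  then have "1 * (lgam G u u x / c) \<le> (R2 * ?\<rho> x) * (lgam G u u x / c)"
   using R2(2)[OF x] pos by (intro mult_right_mono) (auto simp: field_simps)
  with 1 show ?thesis by (simp add: R3_def mult_ac)
 qed
 \<comment> \<open>Chosen for the estimate \<open>e2\<close>; the 1 added to \<open>R1 * R3\<close>
   keeps the denominator positive.\<close>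
 define e where "e = sqrt (\<delta> / (R1 * R3 + 1)) / (2 * 2 ^ CARD('n))"
 have e: "e > 0" using \<delta> R1 R3 by (simp add: e_def add_nonneg_pos)
 have e2: "R1 * (2 ^ CARD('n) * (2 * e)^2 * R3) \<le> \<delta>"
 proof -
  have p: "R1 * R3 + 1 > 0" using R1 R3 by (simp add: add_nonneg_pos)
  have "2 ^ CARD('n) * (2 * e)^2 = \<delta> / (R1 * R3 + 1) / 2 ^ CARD('n)"
   using \<delta> p by (simp add: e_def power_mult_distrib power_divide power2_eq_square)
  also have "\<dots> \<le> \<delta> / (R1 * R3 + 1)"
   using \<delta> p divide_left_mono[of 1 "2 ^ CARD('n)" "\<delta> / (R1 * R3 + 1)"] by simp
  finally have "R1 * (2 ^ CARD('n) * (2 * e)^2 * R3) \<le> (R1 * R3) * (\<delta> / (R1 * R3 + 1))"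
   using R1 R3 mult_left_mono[of "2 ^ CARD('n) * (2 * e)^2" "\<delta> / (R1 * R3 + 1)" "R1 * R3"] by (simp add: mult_ac)
  also have "\<dots> \<le> (R1 * R3 + 1) * (\<delta> / (R1 * R3 + 1))" using \<delta> p by (intro mult_right_mono) auto
  also have "\<dots> = \<delta>" using p by simp
  finally show ?thesis .
 qed
 obtain p where p: "p tagged_division_of ?B" "(\<lambda>x. ball x e) fine p"
  using fine_division_exists[OF gauge_ball[OF e]] by blast
 define M where "M = R1 * (\<Sum>(x,Q)\<in>p. inverse (measure lborel Q))"
 have fin: "finite p" using p(1) by (simp add: tagged_division_of_def tagged_partial_division_of_def)
 have pQ: "\<exists>c d. Q = cbox c d" "Q \<subseteq> ?B" "Q \<subseteq> ball x e" if "(x, Q) \<in> p" for x Q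
  using tagged_division_ofD(3,4)[OF p(1) that] p(2) that by (auto simp: fine_def)
 show ?thesis
 proof (rule that[of "snd ` p" M])
  show "finite (snd ` p)" using fin by simp
  show "compact Q \<and> Q \<subseteq> ?B" if "Q \<in> snd ` p" for Q using that pQ by force
  show "M \<ge> 0" unfolding M_def using R1(1)
   by (intro mult_nonneg_nonneg sum_nonneg) (simp_all add: case_prod_unfold)
  fix u assume u: "smooth_on U u"
  define g where "g x = (\<Sum>\<^sub>U i. (partial i u x)^2)" for x
  have sg: "smooth_on U g"
   unfolding g_def by (intro smooth_on_sum smooth_on_power smooth_on_partial u open_U) auto
  have su2: "smooth_on U (\<lambda>x. (u x)^2)" by (intro smooth_on_power u open_U)
  \<comment> \<open>Each squared integral is bounded by the whole sum over distinct pieces, since a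
    degenerate piece may occur in \<open>p\<close> with several tags.\<close>
  let ?S = "\<Sum>Q\<in>snd ` p. (LINT x|lborel. indicator Q x * u x)^2"
  have box: "integral Q (\<lambda>x. (u x)^2) \<le> inverse (measure lborel Q) * ?S + 2 ^ CARD('n) * (2 * e)^2 * integral Q g"
   if xQ: "(x, Q) \<in> p" for x Q
  proof -
   obtain c d where Q: "Q = cbox c d" using pQ(1)[OF xQ] by blast
   have QB: "Q \<subseteq> ?B" by (rule pQ(2)[OF xQ])
   have "integral Q (\<lambda>x. (u x)^2) \<le> inverse (measure lborel Q) * (integral Q u)^2 + 2 ^ CARD('n) * (2 * e)^2 * integral Q g"
    unfolding Q g_def using QB pQ(3)[OF xQ] ab
    by (intro poincare_box[OF open_U smooth_on_Ck[OF u]]) (auto simp: Q)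
   also have "integral Q u = (LINT x|lborel. indicator Q x * u x)"
    using eq(1)[OF _ cont[OF u QB]] by (simp add: Q)
   also have "(LINT x|lborel. indicator Q x * u x)^2 \<le> ?S"
    using member_le_sum[of Q "snd ` p" "\<lambda>Q. (LINT x|lborel. indicator Q x * u x)^2"] xQ fin by force
   finally show ?thesis by (simp add: Q mult_left_mono)
  qed
  have "(LINT x|lborel. indicator ?B x * ((u x)^2 * ?\<rho> x)) \<le> (LINT x|lborel. R1 * (indicator ?B x * (u x)^2))"
  proof (rule integral_mono)
   show "integrable lborel (\<lambda>x. indicator ?B x * ((u x)^2 * ?\<rho> x))"
    using borel_integrable_compact[OF compact_cbox cont[OF smooth_on_mult[OF open_U su2 smooth_density] order_refl]] by simp
   show "integrable lborel (\<lambda>x. R1 * (indicator ?B x * (u x)^2))"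
    using borel_integrable_compact[OF compact_cbox cont[OF su2 order_refl]] by simp
   fix x show "indicator ?B x * ((u x)^2 * ?\<rho> x) \<le> R1 * (indicator ?B x * (u x)^2)"
    using R1(2)[of x] by (auto simp: indicator_def mult.commute[of R1] intro!: mult_left_mono)
  qed
  also have "\<dots> = R1 * integral ?B (\<lambda>x. (u x)^2)"
   using eq(1)[OF compact_cbox cont[OF su2 order_refl]] by simp
  also have "integral ?B (\<lambda>x. (u x)^2) = (\<Sum>(x,Q)\<in>p. integral Q (\<lambda>x. (u x)^2))"
   by (rule integral_combine_tagged_division_topdown[OF eq(2)[OF compact_cbox cont[OF su2 order_refl]] p(1)])
  also have "R1 * \<dots> \<le> R1 * (\<Sum>(x,Q)\<in>p. inverse (measure lborel Q) * ?S + 2 ^ CARD('n) * (2 * e)^2 * integral Q g)"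
   using R1(1) box by (intro mult_left_mono sum_mono) auto
  also have "\<dots> = M * ?S + R1 * (2 ^ CARD('n) * (2 * e)^2 * (\<Sum>(x,Q)\<in>p. integral Q g))"
  proof -
   have "R1 * (\<Sum>(x,Q)\<in>p. inverse (measure lborel Q) * s + t * integral Q g)
     = M * s + R1 * (t * (\<Sum>(x,Q)\<in>p. integral Q g))" for s t
    by (simp add: M_def case_prod_unfold sum.distrib sum_distrib_left sum_distrib_right distrib_left mult_ac)
   then show ?thesis .
  qed
  also have "(\<Sum>(x,Q)\<in>p. integral Q g) = integral ?B g"
   by (rule integral_combine_tagged_division_topdown[OF eq(2)[OF compact_cbox cont[OF sg order_refl]] p(1), symmetric])
  also have "\<dots> = (LINT x|lborel. indicator ?B x * g x)"
   by (rule eq(1)[OF compact_cbox cont[OF sg order_refl], symmetric])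
  also have "\<dots> \<le> (LINT x|lborel. R3 * (indicator ?B x * (lgam G u u x * ?\<rho> x)))"
  proof (rule integral_mono)
   show "integrable lborel (\<lambda>x. indicator ?B x * g x)"
    using borel_integrable_compact[OF compact_cbox cont[OF sg order_refl]] by simp
   show "integrable lborel (\<lambda>x. R3 * (indicator ?B x * (lgam G u u x * ?\<rho> x)))"
    using borel_integrable_compact[OF compact_cbox cont[OF smooth_on_mult[OF open_U smooth_lgam[OF u u] smooth_density] order_refl]]
    by simp
   fix x show "indicator ?B x * g x \<le> R3 * (indicator ?B x * (lgam G u u x * ?\<rho> x))"
    using grad[of x u] by (auto simp: indicator_def g_def)
  qed
  finally have "(LINT x|lborel. indicator ?B x * ((u x)^2 * ?\<rho> x))
   \<le> M * ?S + R1 * (2 ^ CARD('n) * (2 * e)^2 * (R3 * (LINT x|lborel. indicator ?B x * (lgam G u u x * ?\<rho> x))))"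
   using R1(1) by (simp add: mult_left_mono)
  also have "R1 * (2 ^ CARD('n) * (2 * e)^2 * (R3 * (LINT x|lborel. indicator ?B x * (lgam G u u x * ?\<rho> x))))
   = (R1 * (2 ^ CARD('n) * (2 * e)^2 * R3)) * (LINT x|lborel. indicator ?B x * (lgam G u u x * ?\<rho> x))"
   by simp
  also have "\<dots> \<le> \<delta> * (LINT x|lborel. indicator ?B x * (lgam G u u x * ?\<rho> x))"
  proof (rule mult_right_mono[OF e2])
   have "0 \<le> indicator ?B x * (lgam G u u x * ?\<rho> x)" for x
    using lgam_nonneg[of x u] det_pos[of x] ab by (auto simp: indicator_def subset_iff)
   then show "0 \<le> (LINT x|lborel. indicator ?B x * (lgam G u u x * ?\<rho> x))" by (intro integral_nonneg_AE) auto
  qed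
  finally show "(LINT x|lborel. indicator ?B x * ((u x)^2 * ?\<rho> x))
   \<le> \<delta> * (LINT x|lborel. indicator ?B x * (lgam G u u x * ?\<rho> x)) + M * ?S" by simp
 qed
qed

end

section \<open>Change of variables for arbitrary finite index types\<close>

text \<open>The change of variables theorem of the library is restricted to well-ordered index types; a
 copy of the index type that carries an arbitrary linear order removes this restriction.\<close>

typedef 'n ordered_copy = "UNIV :: 'n set" morphisms of_copy to_copy by auto

lemma bij_of_copy: "bij of_copy"
 by (metis bijI' of_copy_inject to_copy_inverse UNIV_I)

instance ordered_copy :: (finite) finite
 by standard (metis bij_of_copy bij_betw_finite finite_code)

instantiation ordered_copy :: (finite) wellorder
begin

definition copy_index :: "'a ordered_copy \<Rightarrow> nat" where
 "copy_index = (SOME f. inj f)"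

definition less_eq_ordered_copy :: "'a ordered_copy \<Rightarrow> 'a ordered_copy \<Rightarrow> bool" where
 "x \<le> y \<longleftrightarrow> copy_index x \<le> copy_index y"

definition less_ordered_copy :: "'a ordered_copy \<Rightarrow> 'a ordered_copy \<Rightarrow> bool" where
 "x < y \<longleftrightarrow> copy_index x < copy_index y"

instance
proof
 have "\<exists>f :: 'a ordered_copy \<Rightarrow> nat. inj f" using finite_imp_inj_to_nat_seg[of UNIV] by auto
 then have inj: "inj (copy_index :: 'a ordered_copy \<Rightarrow> nat)" unfolding copy_index_def by (rule someI_ex)
 fix x y z :: "'a ordered_copy"
 show "x < y \<longleftrightarrow> x \<le> y \<and> \<not> y \<le> x" by (auto simp: less_eq_ordered_copy_def less_ordered_copy_def)
 show "x \<le> x" by (simp add: less_eq_ordered_copy_def)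
 show "x \<le> y \<Longrightarrow> y \<le> z \<Longrightarrow> x \<le> z" by (simp add: less_eq_ordered_copy_def)
 show "x \<le> y \<Longrightarrow> y \<le> x \<Longrightarrow> x = y" using inj by (simp add: less_eq_ordered_copy_def inj_eq)
 show "x \<le> y \<or> y \<le> x" by (auto simp: less_eq_ordered_copy_def)
next
 fix P :: "'a ordered_copy \<Rightarrow> bool" and a :: "'a ordered_copy"
 assume step: "\<And>x. (\<And>y. y < x \<Longrightarrow> P y) \<Longrightarrow> P x"
 show "P a"
 proof (induction "copy_index a" arbitrary: a rule: less_induct)
  case less
  show ?case by (rule step, rule less) (simp add: less_ordered_copy_def)
 qed
qed

end

text \<open>Conjugation by \<open>r\<close> maps transpositions to transpositions. This preserves
  signs when the index type of a determinant is relabelled.\<close>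

lemma swapidseq_conj:
 assumes r: "bij (r :: 'm \<Rightarrow> 'n)"
 shows "swapidseq k p \<Longrightarrow> swapidseq k (r \<circ> p \<circ> inv r)"
proof (induction rule: swapidseq.induct)
 case id
 have "r \<circ> inv r = id" using r by (metis bij_is_surj surj_iff)
 then show ?case by (simp add: id_def)
next
 case (comp_Suc n p a b)
 have "r \<circ> (Transposition.transpose a b \<circ> p) \<circ> inv r = Transposition.transpose (r a) (r b) \<circ> (r \<circ> p \<circ> inv r)"
  using r by (auto simp: fun_eq_iff Transposition.transpose_def bij_is_inj inj_eq)
 moreover have "r a \<noteq> r b" using comp_Suc(2) r by (simp add: bij_is_inj inj_eq)
 ultimately show ?case using swapidseq.comp_Suc[OF comp_Suc(3)] by metis
qed

lemma det_reindex:
 fixes M :: "real^'n^'n" and r :: "'m::finite \<Rightarrow> 'n"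
 assumes r: "bij r"
 shows "det (\<chi> i j. M $ r i $ r j) = det M"
proof -
 have inv: "inv r (r i) = i" "r (inv r j) = j" for i j
  using r by (auto simp: bij_is_inj bij_is_surj surj_f_inv_f)
 have perm: "p permutes UNIV \<longleftrightarrow> bij p" for p :: "'a \<Rightarrow> 'a"
  by (auto intro: permutes_bij bij_imp_permutes)
 have bp: "bij_betw (\<lambda>p. r \<circ> p \<circ> inv r) {p. p permutes UNIV} {p. p permutes UNIV}"
 proof (rule bij_betwI[where g="\<lambda>q. inv r \<circ> q \<circ> r"])
  show "(\<lambda>p. r \<circ> p \<circ> inv r) \<in> {p. p permutes UNIV} \<rightarrow> {p. p permutes UNIV}"
   using r by (auto simp: perm bij_imp_bij_inv intro!: bij_comp)
  show "(\<lambda>q. inv r \<circ> q \<circ> r) \<in> {p. p permutes UNIV} \<rightarrow> {p. p permutes UNIV}"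
   using r by (auto simp: perm bij_imp_bij_inv intro!: bij_comp)
 qed (auto simp: fun_eq_iff inv)
 have sgn: "sign (r \<circ> p \<circ> inv r) = sign p" if p: "p permutes UNIV" for p
 proof -
  obtain k where k: "swapidseq k p"
   using permutes_imp_permutation[OF finite p] by (auto simp: permutation_def)
  have "evenperm p = even k" "evenperm (r \<circ> p \<circ> inv r) = even k"
   using evenperm_unique[OF k] evenperm_unique[OF swapidseq_conj[OF r k]] by auto
  then show ?thesis by (simp add: sign_def)
 qed
 have "det M = (\<Sum>p | p permutes UNIV. of_int (sign (r \<circ> p \<circ> inv r)) * (\<Prod>i\<in>UNIV. M $ i $ (r \<circ> p \<circ> inv r) i))"
  unfolding det_def by (rule sum.reindex_bij_betw[OF bp, symmetric])
 also have "\<dots> = (\<Sum>p | p permutes UNIV. of_int (sign p) * (\<Prod>i\<in>UNIV. M $ r i $ r (p i)))"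
 proof (intro sum.cong refl arg_cong2[where f="(*)"])
  fix p assume "p \<in> {p. p permutes (UNIV :: 'm set)}"
  then show "of_int (sign (r \<circ> p \<circ> inv r)) = (of_int (sign p) :: real)" by (simp add: sgn)
  show "(\<Prod>i\<in>UNIV. M $ i $ (r \<circ> p \<circ> inv r) i) = (\<Prod>i\<in>UNIV. M $ r i $ r (p i))"
   by (subst prod.reindex_bij_betw[OF r, symmetric]) (simp add: inv)
 qed
 finally show ?thesis by (simp add: det_def)
qed

lemma prod_Basis_cart: "(\<Prod>b\<in>Basis. (x :: real^'n) \<bullet> b) = (\<Prod>i\<in>UNIV. x $ i)"
proof -
 have "(Basis :: (real^'n) set) = range (\<lambda>i. axis i 1)" by (auto simp: Basis_vec_def)
 moreover have "inj (\<lambda>i::'n. axis i (1::real))" by (auto simp: inj_def axis_eq_axis)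
 ultimately have "(\<Prod>b\<in>Basis. x \<bullet> b) = (\<Prod>i\<in>UNIV. x \<bullet> axis i 1)"
  using prod.reindex[of "\<lambda>i::'n. axis i (1::real)" UNIV "\<lambda>b. x \<bullet> b"] by (simp only: o_def)
 then show ?thesis by (simp add: inner_axis)
qed

definition reindex :: "('m \<Rightarrow> 'n) \<Rightarrow> real^'n \<Rightarrow> real^'m" where
 "reindex r x = (\<chi> i. x $ r i)"

lemma linear_reindex: "linear (reindex r)"
 by (rule linearI) (simp_all add: reindex_def vec_eq_iff)

lemma bounded_linear_reindex: "bounded_linear (reindex r :: real^'n \<Rightarrow> real^'m::finite)"
 using linear_reindex by (simp add: linear_conv_bounded_linear)

lemma reindex_measurable [measurable]: "reindex r \<in> (borel :: (real^'n) measure) \<rightarrow>\<^sub>M (borel :: (real^'m::finite) measure)"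
 by (intro borel_measurable_continuous_onI linear_continuous_on bounded_linear_reindex)

lemma reindex_reindex: "bij r \<Longrightarrow> reindex (inv r) (reindex r x) = x" "bij r \<Longrightarrow> reindex r (reindex (inv r) y) = y"
 by (simp_all add: reindex_def vec_eq_iff bij_is_surj surj_f_inv_f bij_is_inj)

lemma lborel_reindex:
 assumes r: "bij (r :: 'm::finite \<Rightarrow> 'n::finite)"
 shows "distr lborel borel (reindex r) = (lborel :: (real^'m) measure)"
proof (rule lborel_eqI[symmetric])
 fix l u :: "real^'m"
 assume le: "\<And>b. b \<in> Basis \<Longrightarrow> l \<bullet> b \<le> u \<bullet> b"
 have le': "l $ i \<le> u $ i" for i using le[of "axis i 1"] by (simp add: inner_axis)
 have "reindex r -` box l u = box (reindex (inv r) l) (reindex (inv r) u)"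
 proof -
  have inv: "inv r (r i) = i" "r (inv r j) = j" for i j
   using r by (auto simp: bij_is_inj bij_is_surj surj_f_inv_f)
  show ?thesis
   by (auto simp: mem_box_cart reindex_def inv) (metis inv)+
 qed
 then have "emeasure (distr lborel borel (reindex r)) (box l u) = emeasure lborel (box (reindex (inv r) l) (reindex (inv r) u))"
  by (simp add: emeasure_distr)
 also have "\<dots> = (\<Prod>b\<in>Basis. (reindex (inv r) u - reindex (inv r) l) \<bullet> b)"
  using le' by (subst emeasure_lborel_box) (auto simp: Basis_vec_def inner_axis reindex_def)
 also have "(\<Prod>b\<in>Basis. (reindex (inv r) u - reindex (inv r) l) \<bullet> b) = (\<Prod>i\<in>UNIV. (u - l) $ inv r i)"
  by (simp add: prod_Basis_cart reindex_def)
 also have "\<dots> = (\<Prod>i\<in>UNIV. (u - l) $ i)"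
  by (rule prod.reindex_bij_betw[OF bij_imp_bij_inv[OF r]])
 finally show "emeasure (distr lborel borel (reindex r)) (box l u) = (\<Prod>b\<in>Basis. (u - l) \<bullet> b)"
  by (simp add: prod_Basis_cart)
qed simp

text \<open>The scalar function is read as one with values in \<open>real^1\<close>, for which
  absolute integrability of the two sides is equivalent. The nonnegative integrals therefore agree
  also in the infinite case.\<close>

lemma nn_integral_change_of_variables_wellorder:
 fixes T :: "real^'m::{finite,wellorder} \<Rightarrow> real^'m::_" and f :: "real^'m::_ \<Rightarrow> real"
 assumes S: "S \<in> sets borel" "T ` S \<in> sets borel"
  and der: "\<And>x. x \<in> S \<Longrightarrow> (T has_derivative T' x) (at x)" and inj: "inj_on T S"
  and f: "f \<in> borel_measurable borel" "\<And>x. f x \<ge> 0"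
  and meas: "(\<lambda>x. indicator S x * (\<bar>det (matrix (T' x))\<bar> * f (T x))) \<in> borel_measurable borel"
 shows "(\<integral>\<^sup>+x. ennreal (indicator S x * (\<bar>det (matrix (T' x))\<bar> * f (T x))) \<partial>lborel)
  = (\<integral>\<^sup>+y. ennreal (indicator (T ` S) y * f y) \<partial>lborel)"
proof -
 let ?d = "\<lambda>x. \<bar>det (matrix (T' x))\<bar>"
 let ?h1 = "\<lambda>x. indicator S x * (?d x * f (T x))" and ?h2 = "\<lambda>y. indicator (T ` S) y * f y"
 have m2: "?h2 \<in> borel_measurable borel" using S f by measurable
 define F where "F y = (\<chi> i::1. f y)" for y
 have SL: "S \<in> sets lebesgue" using S(1) by simp
 have absF: "(\<lambda>x. \<chi> i::1. g x) absolutely_integrable_on A \<longleftrightarrow> integrable lborel (\<lambda>x. indicator A x * g x)"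
  if "(\<lambda>x. indicator A x * g x) \<in> borel_measurable borel" for g :: "real^'m::_ \<Rightarrow> real" and A
 proof -
  have "(\<lambda>x. \<chi> i::1. g x) absolutely_integrable_on A \<longleftrightarrow> g absolutely_integrable_on A"
   by (subst absolutely_integrable_componentwise_iff) (simp add: Basis_vec_def inner_axis)
  also have "\<dots> \<longleftrightarrow> integrable lebesgue (\<lambda>x. indicator A x * g x)" by (simp add: set_integrable_def)
  also have "\<dots> \<longleftrightarrow> integrable lborel (\<lambda>x. indicator A x * g x)"
   using that by (intro integrable_completion) simp
  finally show ?thesis .
 qed
 have intF: "integral A (\<lambda>x. \<chi> i::1. g x) $ 1 = (LINT x|lborel. indicator A x * g x)"
  if i: "integrable lborel (\<lambda>x. indicator A x * g x)" for g :: "real^'m::_ \<Rightarrow> real" and A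
 proof -
  have m: "(\<lambda>x. indicator A x * g x) \<in> borel_measurable borel" using i by simp
  have F: "(\<lambda>x. \<chi> i::1. g x) integrable_on A"
   by (intro set_lebesgue_integral_eq_integral(1)) (simp only: absF[OF m] i)
  have "integral A (\<lambda>x. \<chi> i::1. g x) $ 1 = integral A (\<lambda>x. (\<chi> i::1. g x) $ 1)"
   using integral_linear[OF F bounded_linear_vec_nth[of 1]] by (simp add: o_def)
  also have "\<dots> = integral A g" by simp
  also have "\<dots> = (LINT x|lborel. indicator A x * g x)"
   using set_borel_integral_eq_integral(2)[of A g] i by (simp add: set_integrable_def set_lebesgue_integral_def)
  finally show ?thesis .
 qed
 have cv: "(\<lambda>x. ?d x *\<^sub>R F (T x)) absolutely_integrable_on S \<and> integral S (\<lambda>x. ?d x *\<^sub>R F (T x)) = b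
  \<longleftrightarrow> F absolutely_integrable_on (T ` S) \<and> integral (T ` S) F = b" for b
  by (rule has_absolute_integral_change_of_variables[OF SL has_derivative_at_withinI[OF der] inj])
 have Feq: "(\<lambda>x. ?d x *\<^sub>R F (T x)) = (\<lambda>x. \<chi> i::1. ?d x * f (T x))" by (simp add: F_def fun_eq_iff vec_eq_iff)
 have F2: "F = (\<lambda>x. \<chi> i::1. f x)" by (simp add: F_def fun_eq_iff)
 \<comment> \<open>An equivalence that holds for every value \<open>b\<close> yields both the
   equivalence of integrability and the equality of the values.\<close>
 have aux: "P \<longleftrightarrow> Q" "Q \<Longrightarrow> x = y" if "\<And>b. (P \<and> x = b) \<longleftrightarrow> (Q \<and> y = b)" for P Q and x y :: "real^1"
  by (metis that)+
 have iff: "integrable lborel ?h1 \<longleftrightarrow> integrable lborel ?h2"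
 proof -
  have "(\<lambda>x. ?d x *\<^sub>R F (T x)) absolutely_integrable_on S \<longleftrightarrow> integrable lborel ?h1"
   unfolding Feq by (rule absF[OF meas])
  moreover have "F absolutely_integrable_on (T ` S) \<longleftrightarrow> integrable lborel ?h2"
   unfolding F2 by (rule absF[OF m2])
  ultimately show ?thesis using aux(1)[OF cv] by simp
 qed
 show ?thesis
 proof (cases "integrable lborel ?h2")
  case True
  then have i1: "integrable lborel ?h1" using iff by simp
  have "integral S (\<lambda>x. ?d x *\<^sub>R F (T x)) = integral (T ` S) F"
   by (intro aux(2)[OF cv]) (simp only: F2 absF[OF m2] True)
  then have "(LINT x|lborel. ?h1 x) = (LINT x|lborel. ?h2 x)"
   using intF[OF i1, folded Feq] intF[OF True, folded F2] by simp
  then show ?thesis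
   using nn_integral_eq_integral[OF i1] nn_integral_eq_integral[OF True] f(2) by simp
 next
  case False
  have "(\<integral>\<^sup>+x. ennreal (h x) \<partial>lborel) = \<infinity>"
   if "\<not> integrable lborel h" "h \<in> borel_measurable borel" "\<And>x. h x \<ge> 0" for h :: "real^'m::_ \<Rightarrow> real"
   by (rule ccontr) (use integrableI_nonneg[of h lborel] that in \<open>auto simp: less_top\<close>)
  from this[of ?h1] this[of ?h2] show ?thesis using False iff meas m2 f(2) by simp
 qed
qed

text \<open>Conjugation with the mutually inverse relabelling maps \<open>\<rho>\<close> and
  \<open>\<sigma>\<close>, which preserve Lebesgue measure and the Jacobian determinant.\<close>

lemma nn_integral_change_of_variables:
 fixes T :: "real^'n::finite \<Rightarrow> real^'n" and f :: "real^'n \<Rightarrow> real"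
 assumes S: "S \<in> sets borel" "T ` S \<in> sets borel"
  and der: "\<And>x. x \<in> S \<Longrightarrow> (T has_derivative (\<lambda>h. J x *v h)) (at x)" and inj: "inj_on T S"
  and f: "f \<in> borel_measurable borel" "\<And>x. f x \<ge> 0"
  and meas: "(\<lambda>x. indicator S x * (\<bar>det (J x)\<bar> * f (T x))) \<in> borel_measurable borel"
 shows "(\<integral>\<^sup>+x. ennreal (indicator S x * (\<bar>det (J x)\<bar> * f (T x))) \<partial>lborel)
  = (\<integral>\<^sup>+y. ennreal (indicator (T ` S) y * f y) \<partial>lborel)"
proof -
 let ?r = "of_copy :: 'n ordered_copy \<Rightarrow> 'n"
 define \<rho> where "\<rho> = (reindex ?r :: real^'n \<Rightarrow> real^'n ordered_copy)"
 define \<sigma> where "\<sigma> = (reindex (inv ?r) :: real^'n ordered_copy \<Rightarrow> real^'n)"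
 have \<sigma>\<rho>: "\<sigma> (\<rho> x) = x" "\<rho> (\<sigma> y) = y" for x y
  unfolding \<sigma>_def \<rho>_def by (simp_all add: reindex_reindex bij_of_copy)
 have m: "\<rho> \<in> borel \<rightarrow>\<^sub>M borel" "\<sigma> \<in> borel \<rightarrow>\<^sub>M borel" unfolding \<rho>_def \<sigma>_def by measurable
 have bl: "bounded_linear \<rho>" "bounded_linear \<sigma>" unfolding \<rho>_def \<sigma>_def by (intro bounded_linear_reindex)+
 have dist: "distr lborel borel \<rho> = lborel"
  unfolding \<rho>_def by (rule lborel_reindex[OF bij_of_copy])
 define J' where "J' y = (\<chi> i j. J (\<sigma> y) $ ?r i $ ?r j)" for y
 have det: "det (J' y) = det (J (\<sigma> y))" for y unfolding J'_def by (rule det_reindex[OF bij_of_copy])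
 let ?T = "\<lambda>y. \<rho> (T (\<sigma> y))"
 have img: "\<rho> ` A = \<sigma> -` A" for A using \<sigma>\<rho> by (auto simp: image_iff) (metis \<sigma>\<rho>)
 have imT: "?T ` (\<rho> ` S) = \<rho> ` (T ` S)" by (simp add: image_image \<sigma>\<rho>)
 have sets: "\<rho> ` A \<in> sets borel" if "A \<in> sets borel" for A
  unfolding img using measurable_sets[OF m(2) that] by simp
 have J'v: "J' y *v h = \<rho> (J (\<sigma> y) *v \<sigma> h)" for y h
 proof -
  have "(\<Sum>\<^sub>U j. J (\<sigma> y) $ ?r i $ ?r j * h $ j) = (\<Sum>\<^sub>U j. J (\<sigma> y) $ ?r i $ j * h $ inv ?r j)" for i
   by (subst sum.reindex_bij_betw[OF bij_of_copy, symmetric])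
    (simp add: bij_of_copy bij_is_inj)
  then show ?thesis by (simp add: J'_def vec_eq_iff matrix_vector_mult_def \<rho>_def \<sigma>_def reindex_def)
 qed
 have ind: "indicator (\<rho> ` A) y = (indicator A (\<sigma> y) :: real)" for A y unfolding img by (simp add: indicator_def)
 have tr: "(\<integral>\<^sup>+y. g (\<sigma> y) \<partial>lborel) = (\<integral>\<^sup>+x. g x \<partial>lborel)" if "g \<in> borel_measurable borel" for g
 proof -
  have "(\<integral>\<^sup>+y. g (\<sigma> y) \<partial>lborel) = (\<integral>\<^sup>+y. g (\<sigma> y) \<partial>distr lborel borel \<rho>)" by (simp add: dist)
  also have "\<dots> = (\<integral>\<^sup>+x. g (\<sigma> (\<rho> x)) \<partial>lborel)"
   using m that by (intro nn_integral_distr) simp_all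
  finally show ?thesis by (simp add: \<sigma>\<rho>)
 qed
 have "(\<integral>\<^sup>+y. ennreal (indicator (\<rho> ` S) y * (\<bar>det (matrix (\<lambda>h. J' y *v h))\<bar> * f (\<sigma> (?T y)))) \<partial>lborel)
  = (\<integral>\<^sup>+y. ennreal (indicator (?T ` (\<rho> ` S)) y * f (\<sigma> y)) \<partial>lborel)"
 proof (rule nn_integral_change_of_variables_wellorder)
  show "\<rho> ` S \<in> sets borel" "?T ` (\<rho> ` S) \<in> sets borel" unfolding imT using S by (auto intro: sets)
  show "(?T has_derivative (\<lambda>h. J' y *v h)) (at y)" if "y \<in> \<rho> ` S" for y
  proof -
   have "\<sigma> y \<in> S" using that \<sigma>\<rho> by auto
   from diff_chain_at[OF diff_chain_at[OF bounded_linear_imp_has_derivative[OF bl(2)] der[OF this]]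
     bounded_linear_imp_has_derivative[OF bl(1)]]
   show ?thesis by (simp add: o_def J'v)
  qed
  show "inj_on ?T (\<rho> ` S)" using inj \<sigma>\<rho> by (auto simp: inj_on_def) (metis \<sigma>\<rho>)
  show "(\<lambda>x. f (\<sigma> x)) \<in> borel_measurable borel" using f(1) m(2) by simp
  show "(\<lambda>y. indicator (\<rho> ` S) y * (\<bar>det (matrix (\<lambda>h. J' y *v h))\<bar> * f (\<sigma> (?T y)))) \<in> borel_measurable borel"
   using measurable_compose[OF m(2) meas] by (simp add: ind det \<sigma>\<rho>)
 qed (use f in auto)
 also have "(\<integral>\<^sup>+y. ennreal (indicator (?T ` (\<rho> ` S)) y * f (\<sigma> y)) \<partial>lborel) = (\<integral>\<^sup>+y. ennreal (indicator (T ` S) y * f y) \<partial>lborel)"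
  unfolding imT ind
  by (intro tr[of "\<lambda>y. ennreal (indicator (T ` S) y * f y)"] measurable_compose[OF _ measurable_ennreal]
    borel_measurable_times borel_measurable_indicator S f)
 also have "(\<integral>\<^sup>+y. ennreal (indicator (\<rho> ` S) y * (\<bar>det (matrix (\<lambda>h. J' y *v h))\<bar> * f (\<sigma> (?T y)))) \<partial>lborel)
  = (\<integral>\<^sup>+x. ennreal (indicator S x * (\<bar>det (J x)\<bar> * f (T x))) \<partial>lborel)"
  using tr[of "\<lambda>x. ennreal (indicator S x * (\<bar>det (J x)\<bar> * f (T x)))"] meas by (simp add: ind det \<sigma>\<rho>)
 finally show ?thesis .
qed

section \<open>Operators on the manifold\<close>

lemma lgrad_cong:
 assumes "open W" "x \<in> W" "\<And>y. y \<in> W \<Longrightarrow> u y = v y"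
 shows "lgrad G u x = lgrad G v x"
 unfolding lgrad_def using partial_cong_open[of W x u v] assms by simp

lemma lgam_cong:
 assumes "open W" "x \<in> W" "\<And>y. y \<in> W \<Longrightarrow> u y = u' y" "\<And>y. y \<in> W \<Longrightarrow> v y = v' y"
 shows "lgam G u v x = lgam G u' v' x"
 unfolding lgam_def using lgrad_cong[of W x v v' G] partial_cong_open[of W x u u'] assms by simp

lemma llap_cong:
 assumes "open W" "x \<in> W" "\<And>y. y \<in> W \<Longrightarrow> u y = v y"
 shows "llap G u x = llap G v x"
proof -
 have "lgrad G u y = lgrad G v y" if "y \<in> W" for y
  using lgrad_cong[of W y u v G] assms(1,3) that by simp
 then have "partial i (\<lambda>x. sqrt (det (G x)) * lgrad G u x $ i) x = partial i (\<lambda>x. sqrt (det (G x)) * lgrad G v x $ i) x" for i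
  by (intro partial_cong_open[OF assms(1,2)]) simp
 then show ?thesis by (simp add: llap_def)
qed

lemma hess_cong:
 assumes "open W" "x \<in> W" "\<And>y. y \<in> W \<Longrightarrow> u y = v y"
 shows "hess G u x = hess G v x"
proof -
 have p: "partial j u y = partial j v y" if "y \<in> W" for j y
  using partial_cong_open[of W y u v] assms(1,3) that by simp
 then have "partial i (partial j u) x = partial i (partial j v) x" for i j
  using partial_cong_open[of W x "partial j u" "partial j v"] assms(1,2) by simp
 then show ?thesis by (simp add: hess_def p[OF assms(2)])
qed

lemma lhess_norm_cong:
 assumes "open W" "x \<in> W" "\<And>y. y \<in> W \<Longrightarrow> u y = v y"
 shows "lhess_norm G u x = lhess_norm G v x"
 unfolding lhess_norm_def using hess_cong[of W x u v G] assms by simp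

section \<open>Product rules and the trace bound for the coordinate operators\<close>

context local_metric begin

lemma llap_add:
 assumes "x \<in> U" "smooth_on U u" "smooth_on U v"
 shows "llap G (\<lambda>x. u x + v x) x = llap G u x + llap G v x"
proof -
 have p: "partial i (\<lambda>x. u x + v x) y = partial i u y + partial i v y" if "y \<in> U" for i y
  using that assms by (simp add: partial_add smooth_on_differentiable)
 have pp: "partial i (partial j (\<lambda>x. u x + v x)) x = partial i (partial j u) x + partial i (partial j v) x" for i j
 proof -
  have "partial i (partial j (\<lambda>x. u x + v x)) x = partial i (\<lambda>x. partial j u x + partial j v x) x"
   by (rule partial_cong_open[OF open_U assms(1)]) (simp add: p)
  then show ?thesis
   using assms by (simp add: partial_add smooth_on_differentiable[OF _ assms(1)] smooth_on_partial)
 qed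
 have "hess G (\<lambda>x. u x + v x) x $ i $ j = hess G u x $ i $ j + hess G v x $ i $ j" for i j
  by (simp add: hess_def p[OF assms(1)] pp distrib_left sum.distrib)
 then show ?thesis using assms
  by (simp add: llap_trace smooth_on_add open_U distrib_left sum.distrib)
qed

lemma llap_mult:
 assumes "x \<in> U" "smooth_on U u" "smooth_on U v"
 shows "llap G (\<lambda>x. u x * v x) x = u x * llap G v x + v x * llap G u x + 2 * lgam G u v x"
proof -
 have p: "partial i (\<lambda>x. u x * v x) y = u y * partial i v y + partial i u y * v y" if "y \<in> U" for i y
  using that assms by (simp add: partial_mult smooth_on_differentiable)
 have pp: "partial i (partial j (\<lambda>x. u x * v x)) x = u x * partial i (partial j v) x + partial i (partial j u) x * v x
   + (partial i u x * partial j v x + partial j u x * partial i v x)" for i j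
 proof -
  have "partial i (partial j (\<lambda>x. u x * v x)) x = partial i (\<lambda>x. u x * partial j v x + partial j u x * v x) x"
   by (rule partial_cong_open[OF open_U assms(1)]) (simp add: p)
  then show ?thesis using assms
   by (simp add: partial_add partial_mult smooth_on_differentiable[OF _ assms(1)] smooth_on_partial differentiable_mult)
 qed
 have "hess G (\<lambda>x. u x * v x) x $ i $ j = u x * hess G v x $ i $ j + v x * hess G u x $ i $ j
   + (partial i u x * partial j v x + partial j u x * partial i v x)" for i j
  by (simp add: hess_def p[OF assms(1)] pp algebra_simps sum.distrib sum_distrib_left)
 then have "llap G (\<lambda>x. u x * v x) x = (\<Sum>\<^sub>U i j. u x * (K x $ i $ j * hess G v x $ i $ j)
   + v x * (K x $ i $ j * hess G u x $ i $ j) + K x $ i $ j * (partial i u x * partial j v x) + K x $ i $ j * (partial j u x * partial i v x))"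
  using assms by (simp add: llap_trace smooth_on_mult open_U algebra_simps)
 also have "\<dots> = u x * llap G v x + v x * llap G u x
   + (\<Sum>\<^sub>U i j. K x $ i $ j * (partial i u x * partial j v x))
   + (\<Sum>\<^sub>U i j. K x $ i $ j * (partial j u x * partial i v x))"
  using assms by (simp add: llap_trace sum.distrib sum_distrib_left)
 also have "(\<Sum>\<^sub>U i j. K x $ i $ j * (partial i u x * partial j v x)) = lgam G u v x"
  by (simp add: lgam_def lgrad_component sum_distrib_left mult_ac)
 also have "(\<Sum>\<^sub>U i j. K x $ i $ j * (partial j u x * partial i v x)) = lgam G v u x"
  by (simp add: lgam_def lgrad_component sum_distrib_left mult_ac)
 also have "lgam G v u x = lgam G u v x" by (rule lgam_commute[OF assms(1)])
 finally show ?thesis by simp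
qed

lemma lgam_add:
 assumes "x \<in> U" "smooth_on U u" "smooth_on U v"
 shows "lgam G (\<lambda>x. u x + v x) w x = lgam G u w x + lgam G v w x"
 using assms by (simp add: lgam_def partial_add smooth_on_differentiable distrib_right sum.distrib)

lemma lgam_mult:
 assumes "x \<in> U" "smooth_on U u" "smooth_on U v"
 shows "lgam G (\<lambda>x. u x * v x) w x = u x * lgam G v w x + v x * lgam G u w x"
 using assms by (simp add: lgam_def partial_mult smooth_on_differentiable algebra_simps sum.distrib sum_distrib_left)

lemma lgam_const: "lgam G (\<lambda>x. c) w x = 0"
 by (simp add: lgam_def)

text \<open>With K = R^T R, the matrix \<open>Q\<close> represents the Hessian in an orthonormal
  frame: the norm becomes the sum of the squares of all entries and the Laplacian the trace, to
  which Cauchy-Schwarz applies.\<close>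

lemma lhess_norm_nonneg_and_trace_bound:
 assumes x: "x \<in> U" and u: "smooth_on U u"
 shows "lhess_norm G u x \<ge> 0" "(llap G u x)^2 \<le> real CARD('n) * lhess_norm G u x"
proof -
 obtain R :: "real^'n^'n" where R: "K x = transpose R ** R"
  by (rule posdef_matrix_factor[OF transpose_K[OF x] posdef_matrix_inv(2)[OF sym_G[OF x] pos_G[OF x]]])
   (use x in auto)
 have KR: "K x $ i $ j = (\<Sum>\<^sub>U m. R $ m $ i * R $ m $ j)" for i j
  by (simp add: R matrix_matrix_mult_def transpose_def)
 let ?H = "hess G u x"
 define Q where "Q m n = (\<Sum>\<^sub>U i j. R $ m $ i * R $ n $ j * ?H $ i $ j)" for m n
 have "trace (R ** (?H ** transpose R)) = (\<Sum>\<^sub>U m. Q m m)"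
  by (simp add: trace_def matrix_matrix_mult_def transpose_def Q_def sum_distrib_left mult_ac)
 moreover have "llap G u x = trace ((transpose R ** R) ** transpose ?H)"
  by (simp add: llap_trace[OF x u] trace_matrix_pairing R)
 moreover have HT: "transpose ?H = ?H" by (simp add: vec_eq_iff transpose_def hess_sym[OF u x])
 moreover have "trace ((transpose R ** R) ** ?H) = trace (R ** (?H ** transpose R))"
  using trace_mul_sym[of "transpose R" "R ** ?H"] by (simp add: matrix_mul_assoc)
 ultimately have L: "llap G u x = (\<Sum>\<^sub>U m. Q m m)" by simp
 have Qm: "(R ** (?H ** transpose R)) $ m $ n = Q m n" for m n
  by (simp add: matrix_matrix_mult_def transpose_def Q_def sum_distrib_left mult_ac)
 have "lhess_norm G u x = trace (transpose R ** (R ** (?H ** (transpose R ** (R ** ?H)))))"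
  unfolding lhess_norm_def Let_def trace_matrix_norm HT transpose_K[OF x]
  using trace_mul_sym[of ?H "K x ** (?H ** K x)"] by (simp add: R matrix_mul_assoc)
 also have "\<dots> = trace ((R ** (?H ** transpose R)) ** (R ** (?H ** transpose R)))"
  using trace_mul_sym[of "transpose R" "R ** (?H ** (transpose R ** (R ** ?H)))"] by (simp add: matrix_mul_assoc)
 also have "\<dots> = (\<Sum>\<^sub>U m n. Q m n * Q n m)"
  unfolding trace_def matrix_matrix_mult_def[of "R ** (?H ** transpose R)"] by (simp add: Qm)
 also have "\<dots> = (\<Sum>\<^sub>U m n. (Q m n)^2)"
 proof -
  have "Q n m = Q m n" for m n
   unfolding Q_def by (subst sum.swap) (simp add: hess_sym[OF u x] mult_ac)
  then show ?thesis by (simp add: power2_eq_square)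
 qed
 finally have N: "lhess_norm G u x = (\<Sum>\<^sub>U m n. (Q m n)^2)" .
 show "lhess_norm G u x \<ge> 0" unfolding N by (intro sum_nonneg) auto
 have "(llap G u x)^2 \<le> (\<Sum>\<^sub>U m. \<bar>Q m m\<bar>)^2"
  unfolding L using sum_abs[of "\<lambda>m. Q m m" UNIV] by (simp add: abs_le_square_iff[symmetric] sum_nonneg)
 also have "\<dots> \<le> real CARD('n) * (\<Sum>\<^sub>U m. (Q m m)^2)" by (rule sum_abs_squared_le) simp
 also have "(\<Sum>\<^sub>U m. (Q m m)^2) \<le> (\<Sum>\<^sub>U m n. (Q m n)^2)"
  by (intro sum_mono member_le_sum) auto
 finally show "(llap G u x)^2 \<le> real CARD('n) * lhess_norm G u x" by (simp add: N)
qed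

end

section \<open>Charts, isometries and the invariant operators of the manifold\<close>

locale riem =
 fixes A :: "('a::{t2_space,second_countable_topology}, 'n::finite) chart set" and g :: "('a, 'n) metric_coeffs"
 assumes mfd: "riemannian_manifold A g"
begin

abbreviation img :: "('a, 'n) chart \<Rightarrow> (real^'n) set" where "img c \<equiv> coord c ` chart_dom c"
definition G :: "('a, 'n) chart \<Rightarrow> real^'n \<Rightarrow> real^'n^'n" where "G c x = g c (param c x)"

lemma chartD:
 assumes "c \<in> A"
 shows "open (chart_dom c)" "open (img c)" "continuous_on (chart_dom c) (coord c)" "continuous_on (img c) (param c)"
  "inj_on (coord c) (chart_dom c)"
proof -
 have c: "is_chart c" using mfd assms by (simp add: riemannian_manifold_def smooth_atlas_def)
 then show "open (chart_dom c)" "open (img c)" "continuous_on (chart_dom c) (coord c)" "continuous_on (img c) (param c)"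
  by (auto simp: is_chart_def homeomorphism_def)
 have "param c (coord c p) = p" if "p \<in> chart_dom c" for p
  using c that by (simp add: is_chart_def homeomorphism_def)
 then show "inj_on (coord c) (chart_dom c)" by (metis inj_on_inverseI)
qed

lemma param_coord [simp]: "c \<in> A \<Longrightarrow> p \<in> chart_dom c \<Longrightarrow> param c (coord c p) = p"
 using chartD(5) by simp

lemma coord_param [simp]: "x \<in> img c \<Longrightarrow> coord c (param c x) = x"
 by (simp add: f_inv_into_f)

lemma param_in [simp]: "x \<in> img c \<Longrightarrow> param c x \<in> chart_dom c"
 by (simp add: inv_into_into)

lemma chart_at: "chart_at A p \<in> A" "p \<in> chart_dom (chart_at A p)"
proof -
 have "\<exists>c. c \<in> A \<and> p \<in> chart_dom c"
 proof -
  have "p \<in> (\<Union>c\<in>A. chart_dom c)" using mfd by (simp add: riemannian_manifold_def smooth_atlas_def)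
  then show ?thesis by blast
 qed
 from someI_ex[OF this] show "chart_at A p \<in> A" "p \<in> chart_dom (chart_at A p)"
  by (auto simp: chart_at_def)
qed

lemma local_metric:
 assumes c: "c \<in> A"
 shows "local_metric (img c) (G c)"
proof
 have m: "riemannian_metric A g" using mfd by (simp add: riemannian_manifold_def)
 show "open (img c)" by (rule chartD(2)[OF c])
 show "smooth_on (img c) (\<lambda>x. G c x $ i $ j)" for i j
  using m c unfolding riemannian_metric_def G_def by blast
 have "transpose (g c p) = g c p \<and> (\<forall>v. v \<noteq> 0 \<longrightarrow> v \<bullet> (g c p *v v) > 0)" if "p \<in> chart_dom c" for p
  using m c that unfolding riemannian_metric_def by blast
 then show "transpose (G c x) = G c x" "v \<noteq> 0 \<Longrightarrow> v \<bullet> (G c x *v v) > 0" if "x \<in> img c" for x v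
  using param_in[OF that] unfolding G_def by blast+
qed

text \<open>Turns independence of the chart into a special case of the statements about
  isometries.\<close>

lemma isometry_id: "riemannian_isometry A g (\<lambda>p. p)"
proof -
 have i: "inv (\<lambda>p::'a. p) = (\<lambda>p. p)" by (rule inv_equality) auto
 have s: "smooth_map A (\<lambda>p. p)" and m: "riemannian_metric A g"
  using mfd by (auto simp: riemannian_manifold_def smooth_atlas_def)
 have "g c p = transpose (jacobian c d (\<lambda>p. p) p) ** g d p ** jacobian c d (\<lambda>p. p) p"
  if "c \<in> A" "d \<in> A" "p \<in> chart_dom c" "p \<in> chart_dom d" for c d p
  using m that unfolding riemannian_metric_def by blast
 then show ?thesis
  unfolding riemannian_isometry_def i using s bij_id unfolding id_def by blast
qed

lemma isometry_continuous: "riemannian_isometry A g F \<Longrightarrow> continuous_on UNIV F"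
 by (simp add: riemannian_isometry_def smooth_map_def)

lemma overlap_open:
 assumes "riemannian_isometry A g F" "c \<in> A" "d \<in> A"
 shows "open (chart_dom c \<inter> F -` chart_dom d)" "open (coord c ` (chart_dom c \<inter> F -` chart_dom d))"
proof -
 show o: "open (chart_dom c \<inter> F -` chart_dom d)"
  using open_vimage[OF chartD(1)[OF assms(3)] isometry_continuous[OF assms(1)]] chartD(1)[OF assms(2)] by blast
 have "coord c ` (chart_dom c \<inter> F -` chart_dom d) = param c -` (chart_dom c \<inter> F -` chart_dom d) \<inter> img c"
 proof (intro set_eqI iffI)
  fix x assume "x \<in> param c -` (chart_dom c \<inter> F -` chart_dom d) \<inter> img c"
  then show "x \<in> coord c ` (chart_dom c \<inter> F -` chart_dom d)"
   by (intro image_eqI[of _ _ "param c x"]) simp_all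
 qed (use assms(2) in auto)
 moreover have "open (param c -` (chart_dom c \<inter> F -` chart_dom d) \<inter> img c)"
  using continuous_on_open_vimage[OF chartD(2)[OF assms(2)]] chartD(4)[OF assms(2)] o by blast
 ultimately show "open (coord c ` (chart_dom c \<inter> F -` chart_dom d))" by simp
qed

lemma metric_map:
 assumes F: "riemannian_isometry A g F" and c: "c \<in> A" and d: "d \<in> A"
 shows "metric_map (coord c ` (chart_dom c \<inter> F -` chart_dom d)) (G c) (img d) (G d) (\<lambda>x. coord d (F (param c x)))"
proof -
 interpret lc: local_metric "img c" "G c" by (rule local_metric[OF c])
 interpret ld: local_metric "img d" "G d" by (rule local_metric[OF d])
 let ?W = "coord c ` (chart_dom c \<inter> F -` chart_dom d)"
 have W: "?W \<subseteq> img c" by blast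
 have x: "coord c (param c x) = x" "param c x \<in> chart_dom c" "F (param c x) \<in> chart_dom d" if "x \<in> ?W" for x
  using that c by auto
 show ?thesis
 proof unfold_locales
  show "open ?W" by (rule overlap_open(2)[OF F c d])
  show "smooth_on ?W (\<lambda>x. G c x $ i $ j)" for i j using smooth_on_subset[OF lc.smooth_G W] .
  show "transpose (G c x) = G c x" if "x \<in> ?W" for x using lc.sym_G W that by blast
  show "0 < v \<bullet> (G c x *v v)" if "x \<in> ?W" "v \<noteq> 0" for x v using lc.pos_G W that by blast
  show "smooth_on ?W (\<lambda>x. coord d (F (param c x)) $ i)" for i
   using F c d by (auto simp: riemannian_isometry_def smooth_map_def)
  show "coord d (F (param c x)) \<in> img d" if "x \<in> ?W" for x using x[OF that] by blast
  show "G c x = transpose (\<chi> i j. partial j (\<lambda>x. coord d (F (param c x)) $ i) x) ** G d (coord d (F (param c x)))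
    ** (\<chi> i j. partial j (\<lambda>x. coord d (F (param c x)) $ i) x)" if "x \<in> ?W" for x
  proof -
   have "g c (param c x) = transpose (jacobian c d F (param c x)) ** g d (F (param c x)) ** jacobian c d F (param c x)"
    using F c d x[OF that] by (auto simp: riemannian_isometry_def)
   then show ?thesis using x[OF that] d by (simp add: jacobian_def G_def)
  qed
 qed
qed

abbreviation loc :: "('a, 'n) chart \<Rightarrow> ('a \<Rightarrow> real) \<Rightarrow> real^'n \<Rightarrow> real" where
 "loc c u \<equiv> (\<lambda>x. u (param c x))"

lemma smooth_loc: "smooth_fun A u \<Longrightarrow> c \<in> A \<Longrightarrow> smooth_on (img c) (loc c u)"
 by (simp add: smooth_fun_def)

lemma
 assumes F: "riemannian_isometry A g F" and c: "c \<in> A" and d: "d \<in> A" and p: "p \<in> chart_dom c" "F p \<in> chart_dom d"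
  and u: "smooth_fun A u"
 shows llap_isometry: "llap (G c) (loc c (\<lambda>p. u (F p))) (coord c p) = llap (G d) (loc d u) (coord d (F p))"
  and lhess_norm_isometry: "lhess_norm (G c) (loc c (\<lambda>p. u (F p))) (coord c p) = lhess_norm (G d) (loc d u) (coord d (F p))"
  and lgam_isometry: "smooth_fun A v \<Longrightarrow> lgam (G c) (loc c (\<lambda>p. u (F p))) (loc c (\<lambda>p. v (F p))) (coord c p)
   = lgam (G d) (loc d u) (loc d v) (coord d (F p))"
proof -
 let ?W = "coord c ` (chart_dom c \<inter> F -` chart_dom d)"
 interpret metric_map ?W "G c" "img d" "G d" "\<lambda>x. coord d (F (param c x))" by (rule metric_map[OF F c d])
 have x: "coord c p \<in> ?W" using p by blast
 have W: "u (F (param c x)) = loc d u (coord d (F (param c x)))" if "x \<in> ?W" for x u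
  using that c d by auto
 note s = smooth_loc[OF u d]
 let ?\<Phi> = "\<lambda>x. coord d (F (param c x))"
 have \<Phi>: "?\<Phi> (coord c p) = coord d (F p)" using c p by simp
 have "llap (G c) (loc c (\<lambda>p. u (F p))) (coord c p) = llap (G c) (\<lambda>x. loc d u (?\<Phi> x)) (coord c p)"
  by (rule llap_cong[OF src.open_U x]) (rule W)
 also have "\<dots> = llap (G d) (loc d u) (coord d (F p))" unfolding llap_pull[OF x s] \<Phi> ..
 finally show "llap (G c) (loc c (\<lambda>p. u (F p))) (coord c p) = llap (G d) (loc d u) (coord d (F p))" .
 have "lhess_norm (G c) (loc c (\<lambda>p. u (F p))) (coord c p) = lhess_norm (G c) (\<lambda>x. loc d u (?\<Phi> x)) (coord c p)"
  by (rule lhess_norm_cong[OF src.open_U x]) (rule W)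
 also have "\<dots> = lhess_norm (G d) (loc d u) (coord d (F p))" unfolding lhess_norm_pull[OF x s] \<Phi> ..
 finally show "lhess_norm (G c) (loc c (\<lambda>p. u (F p))) (coord c p) = lhess_norm (G d) (loc d u) (coord d (F p))" .
 assume v: "smooth_fun A v"
 have in_d: "?\<Phi> (coord c p) \<in> img d" using p c by auto
 have "lgam (G c) (loc c (\<lambda>p. u (F p))) (loc c (\<lambda>p. v (F p))) (coord c p)
   = lgam (G c) (\<lambda>x. loc d u (?\<Phi> x)) (\<lambda>x. loc d v (?\<Phi> x)) (coord c p)"
  by (rule lgam_cong[OF src.open_U x]) (rule W, assumption)+
 also have "\<dots> = lgam (G d) (loc d u) (loc d v) (coord d (F p))"
  unfolding lgam_pull[OF x smooth_on_differentiable[OF s in_d] smooth_on_differentiable[OF smooth_loc[OF v d] in_d]] \<Phi> ..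
 finally show "lgam (G c) (loc c (\<lambda>p. u (F p))) (loc c (\<lambda>p. v (F p))) (coord c p) = lgam (G d) (loc d u) (loc d v) (coord d (F p))" .
qed

lemma smooth_fun_isometry:
 assumes F: "riemannian_isometry A g F" and u: "smooth_fun A u"
 shows "smooth_fun A (\<lambda>p. u (F p))"
 unfolding smooth_fun_def
proof (intro ballI smooth_on_local)
 fix c x assume c: "c \<in> A" and x: "x \<in> img c"
 define d where "d = chart_at A (F (param c x))"
 have d: "d \<in> A" "F (param c x) \<in> chart_dom d" using chart_at unfolding d_def by blast+
 let ?W = "coord c ` (chart_dom c \<inter> F -` chart_dom d)"
 interpret metric_map ?W "G c" "img d" "G d" "\<lambda>x. coord d (F (param c x))" by (rule metric_map[OF F c d(1)])
 have "smooth_on ?W (\<lambda>x. loc d u (coord d (F (param c x))))" by (rule smooth_pull[OF smooth_loc[OF u d(1)]])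
 then have "smooth_on ?W (\<lambda>x. u (F (param c x)))"
  by (rule smooth_on_cong[OF src.open_U]) (use c d in auto)
 moreover have "x \<in> ?W" using d(2) x c by (intro image_eqI[of _ _ "param c x"]) auto
 ultimately show "\<exists>T. open T \<and> x \<in> T \<and> smooth_on T (\<lambda>x. u (F (param c x)))" using src.open_U by blast
qed

abbreviation L :: "('a \<Rightarrow> real) \<Rightarrow> 'a \<Rightarrow> real" where "L \<equiv> laplacian A g"

definition Gam :: "('a \<Rightarrow> real) \<Rightarrow> ('a \<Rightarrow> real) \<Rightarrow> 'a \<Rightarrow> real" where
 "Gam u v p = (let c = chart_at A p in lgam (G c) (loc c u) (loc c v) (coord c p))"

lemma laplacian_chart:
 assumes c: "c \<in> A" "p \<in> chart_dom c" and u: "smooth_fun A u"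
 shows "L u p = llap (G c) (loc c u) (coord c p)"
proof -
 define d where "d = chart_at A p"
 have d: "d \<in> A" "p \<in> chart_dom d" using chart_at unfolding d_def by blast+
 have "L u p = llap (G d) (loc d u) (coord d p)"
 proof -
  have "grad g d u (param d x) $ i = lgrad (G d) (loc d u) x $ i" if "x \<in> img d" for x i
   using that by (simp add: grad_def lgrad_def G_def)
  then have "partial i (\<lambda>x. sqrt (det (g d (param d x))) * grad g d u (param d x) $ i) (coord d p)
    = partial i (\<lambda>x. sqrt (det (G d x)) * lgrad (G d) (loc d u) x $ i) (coord d p)" for i
   using d by (intro partial_cong_open[OF chartD(2)[OF d(1)]]) (auto simp: G_def)
  then show ?thesis using d by (simp add: laplacian_def d_def[symmetric] divergence_def llap_def G_def)
 qed
 also have "\<dots> = llap (G c) (loc c u) (coord c p)"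
  by (rule llap_isometry[OF isometry_id d(1) c(1) d(2) c(2) u])
 finally show ?thesis .
qed

lemma Gam_chart:
 assumes c: "c \<in> A" "p \<in> chart_dom c" and u: "smooth_fun A u" "smooth_fun A v"
 shows "Gam u v p = lgam (G c) (loc c u) (loc c v) (coord c p)"
 unfolding Gam_def Let_def by (rule lgam_isometry[OF isometry_id chart_at(1) c(1) chart_at(2) c(2) u])

lemma grad_norm_sq_Gam: "grad_norm_sq A g u p = Gam u u p"
proof -
 define c where "c = chart_at A p"
 have c: "c \<in> A" "p \<in> chart_dom c" using chart_at unfolding c_def by blast+
 interpret local_metric "img c" "G c" by (rule local_metric[OF c(1)])
 have d: "det (g c p) \<noteq> 0" using det_ne[of "coord c p"] c by (simp add: G_def)
 let ?v = "\<chi> j. partial j (loc c u) (coord c p)"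
 have "grad_norm_sq A g u p = (matrix_inv (g c p) *v ?v) \<bullet> (g c p *v (matrix_inv (g c p) *v ?v))"
  by (simp add: grad_norm_sq_def c_def[symmetric] grad_def)
 also have "g c p *v (matrix_inv (g c p) *v ?v) = ?v"
  by (simp add: matrix_vector_mul_assoc matrix_inv_works[OF d])
 finally show ?thesis
  using c by (simp add: Gam_def c_def[symmetric] lgam_def lgrad_def G_def inner_vec_def mult.commute)
qed

lemma hess_norm_sq_chart:
 assumes c: "c \<in> A" "p \<in> chart_dom c" and u: "smooth_fun A u"
 shows "hess_norm_sq A g u p = lhess_norm (G c) (loc c u) (coord c p)"
proof -
 define d where "d = chart_at A p"
 have d: "d \<in> A" "p \<in> chart_dom d" using chart_at unfolding d_def by blast+
 have "hess_norm_sq A g u p = lhess_norm (G d) (loc d u) (coord d p)"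
  using d by (simp add: hess_norm_sq_def lhess_norm_def Let_def d_def[symmetric] hessian_def hess_def
    christoffel_def christ_def G_def)
 also have "\<dots> = lhess_norm (G c) (loc c u) (coord c p)"
  by (rule lhess_norm_isometry[OF isometry_id d(1) c(1) d(2) c(2) u])
 finally show ?thesis .
qed

lemma smooth_fun_chartI:
 assumes "\<And>c. c \<in> A \<Longrightarrow> \<exists>f. smooth_on (img c) f \<and> (\<forall>p\<in>chart_dom c. u p = f (coord c p))"
 shows "smooth_fun A u"
 unfolding smooth_fun_def
proof
 fix c assume c: "c \<in> A"
 then obtain f where f: "smooth_on (img c) f" "\<forall>p\<in>chart_dom c. u p = f (coord c p)" using assms by blast
 show "smooth_on (img c) (loc c u)"
  by (rule smooth_on_cong[OF chartD(2)[OF c] f(1)]) (use f(2) c in auto)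
qed

lemma smooth_L: "smooth_fun A u \<Longrightarrow> smooth_fun A (L u)"
 using local_metric.smooth_llap[OF local_metric smooth_loc] laplacian_chart by (intro smooth_fun_chartI) metis

lemma smooth_Gam: "smooth_fun A u \<Longrightarrow> smooth_fun A v \<Longrightarrow> smooth_fun A (Gam u v)"
 using local_metric.smooth_lgam[OF local_metric smooth_loc smooth_loc] Gam_chart by (intro smooth_fun_chartI) metis

lemma smooth_hess_norm: "smooth_fun A u \<Longrightarrow> smooth_fun A (hess_norm_sq A g u)"
 using local_metric.smooth_lhess_norm[OF local_metric smooth_loc] hess_norm_sq_chart by (intro smooth_fun_chartI) metis

lemma smooth_fun_const: "smooth_fun A (\<lambda>p. c)"
 by (simp add: smooth_fun_def smooth_on_const)

lemma smooth_fun_add: "smooth_fun A u \<Longrightarrow> smooth_fun A v \<Longrightarrow> smooth_fun A (\<lambda>p. u p + v p)"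
 using chartD(2) by (simp add: smooth_fun_def smooth_on_add)

lemma smooth_fun_mult: "smooth_fun A u \<Longrightarrow> smooth_fun A v \<Longrightarrow> smooth_fun A (\<lambda>p. u p * v p)"
 using chartD(2) by (simp add: smooth_fun_def smooth_on_mult)

lemma smooth_fun_cmult: "smooth_fun A u \<Longrightarrow> smooth_fun A (\<lambda>p. c * u p)"
 using smooth_fun_mult[OF smooth_fun_const] .

lemma smooth_fun_diff: "smooth_fun A u \<Longrightarrow> smooth_fun A v \<Longrightarrow> smooth_fun A (\<lambda>p. u p - v p)"
 using smooth_fun_add[OF _ smooth_fun_cmult[of v "-1"], of u] by simp

lemma smooth_fun_sum: "finite I \<Longrightarrow> (\<And>i. i \<in> I \<Longrightarrow> smooth_fun A (u i)) \<Longrightarrow> smooth_fun A (\<lambda>p. \<Sum>i\<in>I. u i p)"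
 by (induction I rule: finite_induct) (auto intro: smooth_fun_const smooth_fun_add)

lemma smooth_fun_divide:
 "smooth_fun A u \<Longrightarrow> smooth_fun A v \<Longrightarrow> (\<And>p. v p \<noteq> 0) \<Longrightarrow> smooth_fun A (\<lambda>p. u p / v p)"
 using chartD(2) by (simp add: smooth_fun_def smooth_on_divide)

lemma L_add: "smooth_fun A u \<Longrightarrow> smooth_fun A v \<Longrightarrow> L (\<lambda>p. u p + v p) p = L u p + L v p"
 using local_metric.llap_add[OF local_metric, of "chart_at A p" "coord (chart_at A p) p"] chart_at
 by (simp add: laplacian_chart[of "chart_at A p"] smooth_fun_add smooth_loc)

lemma L_mult: "smooth_fun A u \<Longrightarrow> smooth_fun A v \<Longrightarrow> L (\<lambda>p. u p * v p) p = u p * L v p + v p * L u p + 2 * Gam u v p"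
 using local_metric.llap_mult[OF local_metric, of "chart_at A p" "coord (chart_at A p) p"] chart_at
 by (simp add: laplacian_chart[of "chart_at A p"] Gam_chart[of "chart_at A p"] smooth_fun_mult smooth_loc)

lemma Gam_commute: "smooth_fun A u \<Longrightarrow> smooth_fun A v \<Longrightarrow> Gam u v p = Gam v u p"
 using local_metric.lgam_commute[OF local_metric, of "chart_at A p" "coord (chart_at A p) p"] chart_at
 by (simp add: Gam_chart[of "chart_at A p"])

lemma Gam_add: "smooth_fun A u \<Longrightarrow> smooth_fun A v \<Longrightarrow> smooth_fun A w \<Longrightarrow> Gam (\<lambda>p. u p + v p) w p = Gam u w p + Gam v w p"
 using local_metric.lgam_add[OF local_metric, of "chart_at A p" "coord (chart_at A p) p"] chart_at
 by (simp add: Gam_chart[of "chart_at A p"] smooth_fun_add smooth_loc)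

lemma Gam_mult: "smooth_fun A u \<Longrightarrow> smooth_fun A v \<Longrightarrow> smooth_fun A w \<Longrightarrow>
  Gam (\<lambda>p. u p * v p) w p = u p * Gam v w p + v p * Gam u w p"
 using local_metric.lgam_mult[OF local_metric, of "chart_at A p" "coord (chart_at A p) p"] chart_at
 by (simp add: Gam_chart[of "chart_at A p"] smooth_fun_mult smooth_loc)

lemma Gam_const: "Gam (\<lambda>p. c) w p = 0"
 unfolding Gam_def Let_def by (simp add: lgam_def)

lemma Gam_nonneg: "Gam u u p \<ge> 0"
 unfolding Gam_def Let_def using chart_at by (intro local_metric.lgam_nonneg[OF local_metric]) auto

lemma L_const: "L (\<lambda>p. c) p = 0"
proof -
 have "(\<chi> i. 0) = (0 :: real^'n)" by (simp add: vec_eq_iff)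
 then show ?thesis
  unfolding laplacian_chart[OF chart_at smooth_fun_const] by (simp add: llap_def lgrad_def)
qed

lemma L_isometry:
 assumes F: "riemannian_isometry A g F" and u: "smooth_fun A u"
 shows "L (\<lambda>p. u (F p)) p = L u (F p)"
 using llap_isometry[OF F chart_at(1) chart_at(1) chart_at(2) chart_at(2) u]
 by (simp add: laplacian_chart[OF chart_at] smooth_fun_isometry[OF F] u)

end

section \<open>The Riemannian volume\<close>

context riem begin

definition dens :: "('a, 'n) chart \<Rightarrow> real^'n \<Rightarrow> real" where
 "dens c x = sqrt (det (G c x))"

lemma dens_pos: "c \<in> A \<Longrightarrow> x \<in> img c \<Longrightarrow> dens c x > 0"
 unfolding dens_def using local_metric.det_pos[OF local_metric] by simp

lemma smooth_dens: "c \<in> A \<Longrightarrow> smooth_on (img c) (dens c)"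
 unfolding dens_def[abs_def] by (rule local_metric.smooth_density[OF local_metric])

lemma dens_measurable [measurable]: "c \<in> A \<Longrightarrow> dens c \<in> borel_measurable (restrict_space lborel (img c))"
 using borel_measurable_continuous_on_restrict[OF smooth_on_continuous[OF smooth_dens]]
 by (simp add: measurable_cong_sets[OF sets_restrict_space_cong[OF sets_lborel] refl])

lemma param_measurable [measurable]: "c \<in> A \<Longrightarrow> param c \<in> restrict_space lborel (img c) \<rightarrow>\<^sub>M borel"
 using borel_measurable_continuous_on_restrict[OF chartD(4)]
 by (simp add: measurable_cong_sets[OF sets_restrict_space_cong[OF sets_lborel] refl])

text \<open>A measure on all of \<open>'a\<close> that is concentrated on the domain of
  \<open>c\<close>, so that it can be compared with the volume restricted by an indicator
  density.\<close>

definition chart_measure :: "('a, 'n) chart \<Rightarrow> 'a measure" where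
 "chart_measure c = distr (density (restrict_space lborel (img c)) (\<lambda>x. ennreal (dens c x))) borel (param c)"

lemma sets_chart_measure [simp, measurable_cong]: "sets (chart_measure c) = sets borel"
 by (simp add: chart_measure_def)

lemma img_borel [measurable]: "c \<in> A \<Longrightarrow> img c \<in> sets borel"
 using chartD(2) by simp

lemma img_space [simp]: "c \<in> A \<Longrightarrow> img c \<inter> space lborel \<in> sets lborel"
 using img_borel by simp

lemma nn_integral_chart_measure:
 assumes c: "c \<in> A" and f: "f \<in> borel_measurable borel"
 shows "(\<integral>\<^sup>+p. f p \<partial>chart_measure c) = (\<integral>\<^sup>+x. indicator (img c) x * (ennreal (dens c x) * f (param c x)) \<partial>lborel)"
proof -
 have "(\<integral>\<^sup>+p. f p \<partial>chart_measure c)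
  = (\<integral>\<^sup>+x. f (param c x) \<partial>density (restrict_space lborel (img c)) (\<lambda>x. ennreal (dens c x)))"
  unfolding chart_measure_def using c f by (intro nn_integral_distr) simp_all
 also have "\<dots> = (\<integral>\<^sup>+x. ennreal (dens c x) * f (param c x) \<partial>restrict_space lborel (img c))"
  using c measurable_compose[OF param_measurable[OF c] f] by (intro nn_integral_density) auto
 also have "\<dots> = (\<integral>\<^sup>+x. ennreal (dens c x) * f (param c x) * indicator (img c) x \<partial>lborel)"
  using c by (intro nn_integral_restrict_space) simp
 finally show ?thesis by (simp add: mult_ac)
qed

lemma emeasure_chart_measure:
 assumes c: "c \<in> A" and B: "B \<in> sets borel" "B \<subseteq> chart_dom c"
 shows "emeasure (chart_measure c) B = (\<integral>\<^sup>+x. ennreal (indicator (coord c ` B) x * dens c x) \<partial>lborel)"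
proof -
 have "emeasure (chart_measure c) B = (\<integral>\<^sup>+p. indicator B p \<partial>chart_measure c)"
  using B by (simp add: nn_integral_indicator)
 also have "\<dots> = (\<integral>\<^sup>+x. indicator (img c) x * (ennreal (dens c x) * indicator B (param c x)) \<partial>lborel)"
  using B by (intro nn_integral_chart_measure c) simp
 also have "\<dots> = (\<integral>\<^sup>+x. ennreal (indicator (coord c ` B) x * dens c x) \<partial>lborel)"
 proof (rule nn_integral_cong)
  fix x
  have "x \<in> coord c ` B \<longleftrightarrow> x \<in> img c \<and> param c x \<in> B"
   using c B(2) by (auto intro!: image_eqI[of x _ "param c x"])
  then show "indicator (img c) x * (ennreal (dens c x) * indicator B (param c x)) = ennreal (indicator (coord c ` B) x * dens c x)"
   by (auto simp: indicator_def)
 qed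
 finally show ?thesis .
qed

lemma emeasure_chart_measure_Int:
 assumes c: "c \<in> A" and B: "B \<in> sets borel"
 shows "emeasure (chart_measure c) (B \<inter> chart_dom c) = emeasure (chart_measure c) B"
proof -
 have o: "chart_dom c \<in> sets borel" using chartD(1)[OF c] by simp
 have "emeasure (chart_measure c) (B \<inter> chart_dom c) = (\<integral>\<^sup>+p. indicator (B \<inter> chart_dom c) p \<partial>chart_measure c)"
  using B o by (simp add: nn_integral_indicator)
 also have "\<dots> = (\<integral>\<^sup>+p. indicator B p \<partial>chart_measure c)"
  using B o c by (subst (1 2) nn_integral_chart_measure[OF c]) (auto intro!: nn_integral_cong simp: indicator_def)
 also have "\<dots> = emeasure (chart_measure c) B" using B by (simp add: nn_integral_indicator)
 finally show ?thesis .
qed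

lemma isometry_inv:
 assumes F: "riemannian_isometry A g F"
 shows "inj F" "surj F" "F ` B = inv F -` B" "inv F \<in> borel \<rightarrow>\<^sub>M borel" "F \<in> borel \<rightarrow>\<^sub>M borel"
proof -
 have b: "bij F" and s: "continuous_on UNIV F" "continuous_on UNIV (inv F)"
  using F by (auto simp: riemannian_isometry_def smooth_map_def)
 show "inj F" "surj F" using b by (auto simp: bij_def)
 show "F ` B = inv F -` B" using bij_vimage_eq_inv_image[OF bij_imp_bij_inv[OF b], of B] b by (simp add: inv_inv_eq)
 show "inv F \<in> borel \<rightarrow>\<^sub>M borel" "F \<in> borel \<rightarrow>\<^sub>M borel" by (auto intro: borel_measurable_continuous_onI s)
qed

lemma isometry_image_borel: "riemannian_isometry A g F \<Longrightarrow> B \<in> sets borel \<Longrightarrow> F ` B \<in> sets borel"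
 using measurable_sets[OF isometry_inv(4), of F B] isometry_inv(3)[of F B] by simp

lemma coord_image_borel:
 assumes c: "c \<in> A" and B: "B \<in> sets borel" "B \<subseteq> chart_dom c"
 shows "coord c ` B \<in> sets borel"
proof -
 have "coord c ` B = param c -` B \<inter> space (restrict_space lborel (img c))"
 proof (intro set_eqI iffI)
  fix x assume "x \<in> param c -` B \<inter> space (restrict_space lborel (img c))"
  then show "x \<in> coord c ` B" by (intro image_eqI[of _ _ "param c x"]) (simp_all add: space_restrict_space)
 qed (use c B(2) in \<open>auto simp: space_restrict_space\<close>)
 also have "\<dots> \<in> sets (restrict_space lborel (img c))" by (rule measurable_sets[OF param_measurable[OF c] B(1)])
 finally show ?thesis using c by (subst (asm) sets_restrict_space_iff) auto
qed

text \<open>In the change of variables formula the Jacobian determinant is matched by the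
  transformation of the density in \<open>density_pull\<close>. For the identity this says that two
  charts measure a common subset alike.\<close>

lemma chart_measure_isometry:
 assumes F: "riemannian_isometry A g F" and c: "c \<in> A" and d: "d \<in> A"
  and B: "B \<in> sets borel" "B \<subseteq> chart_dom c" "F ` B \<subseteq> chart_dom d"
 shows "emeasure (chart_measure c) B = emeasure (chart_measure d) (F ` B)"
proof -
 let ?W = "coord c ` (chart_dom c \<inter> F -` chart_dom d)" and ?\<Phi> = "\<lambda>x. coord d (F (param c x))"
 interpret metric_map ?W "G c" "img d" "G d" ?\<Phi> by (rule metric_map[OF F c d])
 let ?S = "coord c ` B"
 \<comment> \<open>Extension by zero makes the density Borel and nonnegative on the whole coordinate
   space.\<close>
 define f where "f y = indicator (img d) y * dens d y" for y
 have SW: "?S \<subseteq> ?W" using B by blast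
 have im: "?\<Phi> ` ?S = coord d ` (F ` B)"
  unfolding image_image by (rule image_cong[OF refl]) (use B(2) c in \<open>simp add: subset_iff\<close>)
 have FB: "F ` B \<in> sets borel" by (rule isometry_image_borel[OF F B(1)])
 have f_meas: "f \<in> borel_measurable borel"
  unfolding f_def using borel_measurable_continuous_on_indicator[OF img_borel[OF d] smooth_on_continuous[OF smooth_dens[OF d]]]
  by simp
 have eq: "indicator ?S x * (\<bar>det (J x)\<bar> * f (?\<Phi> x)) = indicator ?S x * dens c x" for x
 proof (cases "x \<in> ?S")
  case True
  then have x: "x \<in> ?W" using SW by blast
  show ?thesis using density_pull[OF x] Phi_into[OF x] by (simp add: f_def dens_def)
 qed simp
 have m: "(\<lambda>x. indicator ?S x * dens c x) \<in> borel_measurable borel"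
  using borel_measurable_continuous_on_indicator[OF coord_image_borel[OF c B(1,2)]
    continuous_on_subset[OF smooth_on_continuous[OF smooth_dens[OF c]]]] B(2) by (auto simp: image_mono)
 have "(\<integral>\<^sup>+x. ennreal (indicator ?S x * (\<bar>det (J x)\<bar> * f (?\<Phi> x))) \<partial>lborel)
  = (\<integral>\<^sup>+y. ennreal (indicator (?\<Phi> ` ?S) y * f y) \<partial>lborel)"
 proof (rule nn_integral_change_of_variables)
  show "?S \<in> sets borel" by (rule coord_image_borel[OF c B(1,2)])
  show "?\<Phi> ` ?S \<in> sets borel" unfolding im by (rule coord_image_borel[OF d FB B(3)])
  show "(?\<Phi> has_derivative (\<lambda>h. J x *v h)) (at x)" if "x \<in> ?S" for x using Phi_deriv SW that by blast
  show "inj_on ?\<Phi> ?S"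
  proof (rule inj_onI)
   fix x y assume xy: "x \<in> ?S" "y \<in> ?S" "?\<Phi> x = ?\<Phi> y"
   then obtain p q where pq: "x = coord c p" "p \<in> B" "y = coord c q" "q \<in> B" by blast
   then have "p \<in> chart_dom c" "q \<in> chart_dom c" using B(2) by auto
   then have "coord d (F p) = coord d (F q)" using xy(3) c unfolding pq by simp
   then have "F p = F q" using chartD(5)[OF d] pq B(3) by (auto dest: inj_onD)
   then show "x = y" using isometry_inv(1)[OF F] pq by (simp add: inj_eq)
  qed
  show "f x \<ge> 0" for x using dens_pos[OF d] by (simp add: f_def indicator_def less_imp_le)
  show "(\<lambda>x. indicator ?S x * (\<bar>det (J x)\<bar> * f (?\<Phi> x))) \<in> borel_measurable borel" unfolding eq by (rule m)
 qed (rule f_meas)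
 moreover have "indicator (?\<Phi> ` ?S) y * f y = indicator (coord d ` (F ` B)) y * dens d y" for y
  using B(3) unfolding im f_def by (auto simp: indicator_def)
 ultimately show ?thesis
  unfolding eq emeasure_chart_measure[OF c B(1,2)] emeasure_chart_measure[OF d FB B(3)] by simp
qed

end

section \<open>Existence, uniqueness and invariance of the volume\<close>

locale compact_riem = riem A g
 for A :: "('a::{t2_space,second_countable_topology}, 'n::finite) chart set" and g :: "('a, 'n) metric_coeffs" +
 assumes compact_UNIV: "compact (UNIV :: 'a set)"
begin

abbreviation V :: "'a measure" where "V \<equiv> riemannian_volume A g"

definition is_volume :: "'a measure \<Rightarrow> bool" where
 "is_volume N \<longleftrightarrow> sets N = sets borel \<and>
  (\<forall>c\<in>A. \<forall>B\<in>sets borel. B \<subseteq> chart_dom c \<longrightarrow> emeasure N B = emeasure (chart_measure c) B)"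

text \<open>Take the domains of a finite subcover, each with the preceding ones removed. A Borel
  measure is determined by its values on subsets of the pieces, and each piece lies in a single
  chart.\<close>

lemma chart_partition:
 obtains n :: nat and cs :: "nat \<Rightarrow> ('a, 'n) chart" and D :: "nat \<Rightarrow> 'a set"
 where "\<And>k. k < n \<Longrightarrow> cs k \<in> A" "\<And>k. k < n \<Longrightarrow> D k \<subseteq> chart_dom (cs k)" "\<And>k. k < n \<Longrightarrow> D k \<in> sets borel"
  "disjoint_family_on D {..<n}" "(\<Union>k<n. D k) = UNIV"
proof -
 have "UNIV \<subseteq> \<Union>(chart_dom ` A)" using chart_at by blast
 then obtain C where C: "C \<subseteq> chart_dom ` A" "finite C" "UNIV \<subseteq> \<Union>C"
  using compactE[OF compact_UNIV, of "chart_dom ` A"] chartD(1) by (metis imageE)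
 then obtain C' where C': "C' \<subseteq> A" "finite C'" "C = chart_dom ` C'" by (meson finite_subset_image)
 obtain n :: nat and cs where cs: "C' = cs ` {i. i < n}" using finite_imp_nat_seg_image_inj_on[OF C'(2)] by blast
 define D where "D k = chart_dom (cs k) - (\<Union>l<k. chart_dom (cs l))" for k
 show ?thesis
 proof (rule that[of n cs D])
  show A: "cs k \<in> A" if "k < n" for k using cs C'(1) that by blast
  show "D k \<subseteq> chart_dom (cs k)" for k by (auto simp: D_def)
  show "D k \<in> sets borel" if "k < n" for k
   unfolding D_def using A that chartD(1) by (intro sets.Diff sets.finite_UN) auto
  show "disjoint_family_on D {..<n}"
   unfolding disjoint_family_on_def
  proof (intro ballI impI)
   fix k l :: nat assume "k \<noteq> l"
   then show "D k \<inter> D l = {}" by (cases "k < l") (auto simp: D_def)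
  qed
  show "(\<Union>k<n. D k) = UNIV"
  proof (intro set_eqI iffI UNIV_I)
   fix p :: 'a
   have ex: "\<exists>k. k < n \<and> p \<in> chart_dom (cs k)" using C(3) C'(3) cs by auto
   define k where "k = (LEAST k. k < n \<and> p \<in> chart_dom (cs k))"
   have "k < n \<and> p \<in> chart_dom (cs k)" unfolding k_def using ex by (rule LeastI_ex)
   moreover have "p \<notin> chart_dom (cs l)" if "l < k" for l
    using not_less_Least[of l "\<lambda>k. k < n \<and> p \<in> chart_dom (cs k)"] that \<open>k < n \<and> _\<close> unfolding k_def by auto
   ultimately show "p \<in> (\<Union>k<n. D k)" by (auto simp: D_def)
  qed
 qed
qed

lemma emeasure_partition:
 assumes "disjoint_family_on D {..<n::nat}" "(\<Union>k<n. D k) = UNIV" "\<And>k. k < n \<Longrightarrow> D k \<in> sets borel"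
  and N: "sets N = sets borel" and B: "B \<in> sets borel"
 shows "emeasure N B = (\<Sum>k<n. emeasure N (B \<inter> D k))"
proof -
 have "disjoint_family_on (\<lambda>k. B \<inter> D k) {..<n}" using assms(1) by (auto simp: disjoint_family_on_def)
 then have "(\<Sum>k<n. emeasure N (B \<inter> D k)) = emeasure N (\<Union>k<n. B \<inter> D k)"
  using assms by (intro sum_emeasure) auto
 moreover have "(\<Union>k<n. B \<inter> D k) = B" using assms(2) by blast
 ultimately show ?thesis by simp
qed

lemma chart_measure_eq:
 assumes "c \<in> A" "d \<in> A" "B \<in> sets borel" "B \<subseteq> chart_dom c" "B \<subseteq> chart_dom d"
 shows "emeasure (chart_measure c) B = emeasure (chart_measure d) B"
 using chart_measure_isometry[OF isometry_id assms(1-4)] assms(5) by simp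

text \<open>By \<open>chart_measure_eq\<close> a piece may be measured in any chart that contains
  it, so the sum over the partition has the prescribed value on every chart domain.\<close>

lemma volume_exists: "\<exists>N. is_volume N"
proof -
 obtain n :: nat and cs :: "nat \<Rightarrow> ('a, 'n) chart" and D where
  p: "\<And>k. k < n \<Longrightarrow> cs k \<in> A" "\<And>k. k < n \<Longrightarrow> D k \<subseteq> chart_dom (cs k)" "\<And>k. k < n \<Longrightarrow> D k \<in> sets borel"
  "disjoint_family_on D {..<n}" "(\<Union>k<n. D k) = UNIV"
  by (rule chart_partition) (rule that; assumption)
 define \<mu> where "\<mu> B = (\<Sum>k<n. emeasure (chart_measure (cs k)) (B \<inter> D k))" for B
 define N where "N = measure_of UNIV (sets borel) \<mu>"
 have sN: "sets N = sets borel"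
  unfolding N_def using sets.sigma_sets_eq[of borel] by (simp add: sets_measure_of)
 have eN: "emeasure N B = \<mu> B" if "B \<in> sets borel" for B
 proof (rule emeasure_measure_of[OF N_def])
  show "positive (sets N) \<mu>" by (simp add: positive_def \<mu>_def)
  show "countably_additive (sets N) \<mu>"
  proof (rule countably_additiveI)
   fix X :: "nat \<Rightarrow> 'a set"
   assume X: "range X \<subseteq> sets N" "disjoint_family X"
   have "(\<Sum>i. \<mu> (X i)) = (\<Sum>k<n. \<Sum>i. emeasure (chart_measure (cs k)) (X i \<inter> D k))"
    unfolding \<mu>_def by (rule suminf_sum) simp
   also have "\<dots> = (\<Sum>k<n. emeasure (chart_measure (cs k)) (\<Union>i. X i \<inter> D k))"
    using X p(3) sN by (intro sum.cong refl suminf_emeasure) (auto simp: disjoint_family_on_def)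
   also have "\<dots> = \<mu> (\<Union>i. X i)" by (simp add: \<mu>_def)
   finally show "(\<Sum>i. \<mu> (X i)) = \<mu> (\<Union>i. X i)" .
  qed
 qed (use that sN in auto)
 have "emeasure N B = emeasure (chart_measure c) B" if "c \<in> A" "B \<in> sets borel" "B \<subseteq> chart_dom c" for c B
 proof -
  have "emeasure N B = (\<Sum>k<n. emeasure (chart_measure (cs k)) (B \<inter> D k))" using eN[OF that(2)] by (simp add: \<mu>_def)
  also have "\<dots> = (\<Sum>k<n. emeasure (chart_measure c) (B \<inter> D k))"
   using that p by (intro sum.cong refl chart_measure_eq) auto
  also have "\<dots> = emeasure (chart_measure c) B"
   by (rule emeasure_partition[OF p(4,5,3), symmetric]) (use that in auto)
  finally show ?thesis .
 qed
 then show ?thesis using sN unfolding is_volume_def by blast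
qed

lemma volume_unique:
 assumes "is_volume N" "is_volume N'"
 shows "N = N'"
proof -
 obtain n :: nat and cs :: "nat \<Rightarrow> ('a, 'n) chart" and D where
  p: "\<And>k. k < n \<Longrightarrow> cs k \<in> A" "\<And>k. k < n \<Longrightarrow> D k \<subseteq> chart_dom (cs k)" "\<And>k. k < n \<Longrightarrow> D k \<in> sets borel"
  "disjoint_family_on D {..<n}" "(\<Union>k<n. D k) = UNIV"
  by (rule chart_partition) (rule that; assumption)
 show ?thesis
 proof (rule measure_eqI)
  show "sets N = sets N'" using assms by (simp add: is_volume_def)
  fix B assume "B \<in> sets N"
  then have B: "B \<in> sets borel" using assms by (simp add: is_volume_def)
  have eq: "emeasure N' B = (\<Sum>k<n. emeasure (chart_measure (cs k)) (B \<inter> D k))" if "is_volume N'" for N'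
  proof -
   have "emeasure N' B = (\<Sum>k<n. emeasure N' (B \<inter> D k))"
    using that by (intro emeasure_partition[OF p(4,5,3) _ B]) (auto simp: is_volume_def)
   also have "\<dots> = (\<Sum>k<n. emeasure (chart_measure (cs k)) (B \<inter> D k))"
   proof (rule sum.cong[OF refl])
    fix k assume k: "k \<in> {..<n}"
    have "B \<inter> D k \<in> sets borel" "B \<inter> D k \<subseteq> chart_dom (cs k)" using B p(2,3) k by auto
    then show "emeasure N' (B \<inter> D k) = emeasure (chart_measure (cs k)) (B \<inter> D k)"
     using that p(1) k unfolding is_volume_def by blast
   qed
   finally show ?thesis .
  qed
  show "emeasure N B = emeasure N' B" unfolding eq[OF assms(1)] eq[OF assms(2)] ..
 qed
qed

text \<open>Existence and uniqueness give the definite description in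
  \<open>riemannian_volume\<close> its meaning.\<close>

lemma volume: "is_volume V"
proof -
 have "V = (THE N. is_volume N)"
 proof -
  have "(\<forall>c\<in>A. \<forall>B\<in>sets borel. B \<subseteq> chart_dom c \<longrightarrow>
    emeasure N B = (\<integral>\<^sup>+x\<in>coord c ` B. ennreal (sqrt (det (g c (param c x)))) \<partial>lborel))
   \<longleftrightarrow> (\<forall>c\<in>A. \<forall>B\<in>sets borel. B \<subseteq> chart_dom c \<longrightarrow> emeasure N B = emeasure (chart_measure c) B)" for N
  proof (intro ball_cong refl imp_cong)
   fix c B assume cB: "c \<in> A" "B \<in> sets borel" "B \<subseteq> chart_dom c"
   have "(\<integral>\<^sup>+x\<in>coord c ` B. ennreal (sqrt (det (g c (param c x)))) \<partial>lborel) = emeasure (chart_measure c) B"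
    unfolding emeasure_chart_measure[OF cB] by (intro nn_integral_cong) (auto simp: dens_def G_def indicator_def)
   then show "emeasure N B = (\<integral>\<^sup>+x\<in>coord c ` B. ennreal (sqrt (det (g c (param c x)))) \<partial>lborel)
    \<longleftrightarrow> emeasure N B = emeasure (chart_measure c) B" by simp
  qed
  then show ?thesis unfolding riemannian_volume_def is_volume_def by simp
 qed
 moreover obtain N where "is_volume N" using volume_exists by blast
 ultimately show ?thesis using theI[of is_volume] volume_unique by metis
qed

lemma sets_V [simp, measurable_cong]: "sets V = sets borel"
 using volume by (simp add: is_volume_def)

lemma space_V [simp]: "space V = UNIV"
 using sets_eq_imp_space_eq[OF sets_V] by simp

lemma density_V:
 assumes c: "c \<in> A"
 shows "density V (indicator (chart_dom c)) = chart_measure c"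
proof (rule measure_eqI)
 show "sets (density V (indicator (chart_dom c))) = sets (chart_measure c)" by simp
 fix B assume "B \<in> sets (density V (indicator (chart_dom c)))"
 then have B: "B \<in> sets borel" by simp
 have o: "chart_dom c \<in> sets borel" using chartD(1)[OF c] by simp
 have "emeasure (density V (indicator (chart_dom c))) B = (\<integral>\<^sup>+p. indicator (chart_dom c) p * indicator B p \<partial>V)"
  using B o by (intro emeasure_density) auto
 also have "\<dots> = (\<integral>\<^sup>+p. indicator (B \<inter> chart_dom c) p \<partial>V)"
  by (intro nn_integral_cong) (auto simp: indicator_def)
 also have "\<dots> = emeasure V (B \<inter> chart_dom c)" by (rule nn_integral_indicator) (use B o in simp)
 also have "\<dots> = emeasure (chart_measure c) (B \<inter> chart_dom c)"
  using volume c B o unfolding is_volume_def by blast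
 also have "\<dots> = emeasure (chart_measure c) B" by (rule emeasure_chart_measure_Int[OF c B])
 finally show "emeasure (density V (indicator (chart_dom c))) B = emeasure (chart_measure c) B" .
qed

lemma integral_chart:
 fixes f :: "'a \<Rightarrow> real"
 assumes c: "c \<in> A" and f: "f \<in> borel_measurable borel" and supp: "\<And>p. p \<notin> chart_dom c \<Longrightarrow> f p = 0"
 shows "(LINT p|V. f p) = (LINT x|lborel. indicator (img c) x * (f (param c x) * dens c x))"
proof -
 have o: "chart_dom c \<in> sets borel" using chartD(1)[OF c] by simp
 have "(LINT p|V. f p) = (LINT p|V. indicator (chart_dom c) p *\<^sub>R f p)"
  using supp by (intro Bochner_Integration.integral_cong) (auto simp: indicator_def)
 also have "\<dots> = (LINT p|density V (\<lambda>p. ennreal (indicator (chart_dom c) p)). f p)"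
  using f o by (intro integral_density[symmetric]) auto
 also have "density V (\<lambda>p. ennreal (indicator (chart_dom c) p)) = chart_measure c"
  using density_V[OF c] by (simp add: ennreal_indicator)
 also have "(LINT p|chart_measure c. f p) = (LINT x|density (restrict_space lborel (img c)) (\<lambda>x. ennreal (dens c x)). f (param c x))"
  unfolding chart_measure_def using c f by (intro integral_distr) simp_all
 also have "\<dots> = (LINT x|restrict_space lborel (img c). dens c x *\<^sub>R f (param c x))"
  using c measurable_compose[OF param_measurable[OF c] f] dens_pos[OF c]
  by (intro integral_density) (auto simp: less_imp_le AE_restrict_space_iff)
 also have "\<dots> = (LINT x|lborel. indicator (img c) x *\<^sub>R (dens c x *\<^sub>R f (param c x)))"
  using c by (intro integral_restrict_space) simp
 finally show ?thesis by (simp add: mult_ac)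
qed

text \<open>The image measure has the defining property of the volume, so uniqueness identifies the
  two.\<close>

lemma isometry_volume:
 assumes F: "riemannian_isometry A g F"
 shows "distr V borel F = V"
proof (rule volume_unique[OF _ volume])
 obtain n :: nat and cs :: "nat \<Rightarrow> ('a, 'n) chart" and D where
  p: "\<And>k. k < n \<Longrightarrow> cs k \<in> A" "\<And>k. k < n \<Longrightarrow> D k \<subseteq> chart_dom (cs k)" "\<And>k. k < n \<Longrightarrow> D k \<in> sets borel"
  "disjoint_family_on D {..<n}" "(\<Union>k<n. D k) = UNIV"
  by (rule chart_partition) (rule that; assumption)
 have Fm: "F \<in> V \<rightarrow>\<^sub>M borel" using isometry_inv(5)[OF F] by (simp add: measurable_cong_sets[OF sets_V refl])
 have "emeasure (distr V borel F) B = emeasure (chart_measure d) B" if d: "d \<in> A" and B: "B \<in> sets borel" "B \<subseteq> chart_dom d" for d B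
 proof -
  have FB: "F -` B \<in> sets borel" using measurable_sets[OF isometry_inv(5)[OF F] B(1)] by simp
  have im: "F ` (F -` B \<inter> D k) = B \<inter> F ` D k" for k using isometry_inv(2)[OF F] by blast
  have "emeasure (distr V borel F) B = emeasure V (F -` B)" using Fm B by (simp add: emeasure_distr)
  also have "\<dots> = (\<Sum>k<n. emeasure V (F -` B \<inter> D k))" by (rule emeasure_partition[OF p(4,5,3) sets_V FB])
  also have "\<dots> = (\<Sum>k<n. emeasure (chart_measure d) (B \<inter> F ` D k))"
  proof (rule sum.cong[OF refl])
   fix k assume k: "k \<in> {..<n}"
   have s: "F -` B \<inter> D k \<in> sets borel" "F -` B \<inter> D k \<subseteq> chart_dom (cs k)" "F ` (F -` B \<inter> D k) \<subseteq> chart_dom d"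
    using FB p(2,3) k B(2) by auto
   have "emeasure V (F -` B \<inter> D k) = emeasure (chart_measure (cs k)) (F -` B \<inter> D k)"
    using volume p(1) k s unfolding is_volume_def by blast
   also have "\<dots> = emeasure (chart_measure d) (F ` (F -` B \<inter> D k))"
    using k by (intro chart_measure_isometry[OF F p(1) d s]) auto
   finally show "emeasure V (F -` B \<inter> D k) = emeasure (chart_measure d) (B \<inter> F ` D k)" unfolding im .
  qed
  also have "\<dots> = emeasure (chart_measure d) B"
  proof (rule emeasure_partition[symmetric])
   show "disjoint_family_on (\<lambda>k. F ` D k) {..<n}"
    using p(4) unfolding disjoint_family_on_def image_Int[OF isometry_inv(1)[OF F], symmetric] by simp
   show "(\<Union>k<n. F ` D k) = UNIV" unfolding image_UN[symmetric] p(5) by (rule isometry_inv(2)[OF F])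
   show "F ` D k \<in> sets borel" if "k < n" for k by (rule isometry_image_borel[OF F p(3)[OF that]])
  qed (use B in auto)
  finally show ?thesis .
 qed
 then show "is_volume (distr V borel F)" unfolding is_volume_def by simp
qed

end

section \<open>Integration and Green's formula\<close>

context riem begin

definition patch_bump :: "('a, 'n) chart \<Rightarrow> real^'n \<Rightarrow> real \<Rightarrow> 'a \<Rightarrow> real" where
 "patch_bump c a r p = (if p \<in> chart_dom c then ball_bump a r (coord c p) else 0)"

lemma smooth_fun_continuous:
 assumes "smooth_fun A u"
 shows "continuous_on UNIV u"
proof (rule continuous_at_imp_continuous_on, rule ballI)
 fix p
 define c where "c = chart_at A p"
 have c: "c \<in> A" "p \<in> chart_dom c" using chart_at unfolding c_def by blast+
 have "continuous_on (chart_dom c) (\<lambda>q. loc c u (coord c q))"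
  by (rule continuous_on_compose2[OF smooth_on_continuous[OF smooth_loc[OF assms c(1)]] chartD(3)[OF c(1)]]) simp
 then have "continuous_on (chart_dom c) u"
  by (rule continuous_on_eq) (use c in auto)
 then show "isCont u p" using chartD(1)[OF c(1)] c(2) by (simp add: continuous_on_eq_continuous_at)
qed

lemma smooth_fun_measurable: "smooth_fun A u \<Longrightarrow> u \<in> borel_measurable borel"
 by (intro borel_measurable_continuous_onI smooth_fun_continuous)

lemma patch_compact:
 assumes c: "c \<in> A" and C: "compact C" "C \<subseteq> img c"
 shows "compact (param c ` C)" "param c ` C \<subseteq> chart_dom c"
proof -
 show "compact (param c ` C)"
  by (rule compact_continuous_image[OF continuous_on_subset[OF chartD(4)[OF c] C(2)] C(1)])
 show "param c ` C \<subseteq> chart_dom c" using C(2) by (auto intro: param_in)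
qed

lemma patch_mem:
 assumes "c \<in> A" "p \<in> chart_dom c" "C \<subseteq> img c"
 shows "p \<in> param c ` C \<longleftrightarrow> coord c p \<in> C"
proof
 assume "p \<in> param c ` C"
 then obtain x where "x \<in> C" "p = param c x" by blast
 then show "coord c p \<in> C" using assms(3) by auto
next
 assume "coord c p \<in> C"
 then show "p \<in> param c ` C" using assms(1,2) by (intro image_eqI[of _ _ "coord c p"]) simp_all
qed

lemma patch_bump_zero:
 assumes c: "c \<in> A" "cball a r \<subseteq> img c" and r: "r > 0" and p: "p \<notin> param c ` cball a r"
 shows "patch_bump c a r p = 0"
proof (cases "p \<in> chart_dom c")
 case True
 then have "coord c p \<notin> ball a r" using p patch_mem[OF c(1) True c(2)] by auto
 then have "\<not> ball_bump a r (coord c p) > 0" using ball_bump_pos_iff[OF r] by blast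
 then show ?thesis using ball_bump_nonneg[of a r "coord c p"] by (simp add: patch_bump_def)
qed (simp add: patch_bump_def)

lemma smooth_patch_bump:
 assumes c: "c \<in> A" "cball a r \<subseteq> img c" and r: "r > 0"
 shows "smooth_fun A (patch_bump c a r)"
 unfolding smooth_fun_def
proof (intro ballI smooth_on_local)
 fix d x assume d: "d \<in> A" and x: "x \<in> img d"
 show "\<exists>T. open T \<and> x \<in> T \<and> smooth_on T (\<lambda>x. patch_bump c a r (param d x))"
 proof (cases "param d x \<in> chart_dom c")
  case True
  let ?W = "coord d ` (chart_dom d \<inter> (\<lambda>p. p) -` chart_dom c)"
  interpret metric_map ?W "G d" "img c" "G c" "\<lambda>x. coord c (param d x)" by (rule metric_map[OF isometry_id d c(1)])
  have "smooth_on ?W (\<lambda>x. ball_bump a r (coord c (param d x)))"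
   by (rule smooth_pull[OF smooth_on_ball_bump[OF chartD(2)[OF c(1)]]])
  then have "smooth_on ?W (\<lambda>x. patch_bump c a r (param d x))"
   by (rule smooth_on_cong[OF src.open_U]) (use d in \<open>auto simp: patch_bump_def\<close>)
  moreover have "x \<in> ?W" using True x by (intro image_eqI[of _ _ "param d x"]) auto
  ultimately show ?thesis using src.open_U by blast
 next
  case False
  let ?S = "param c ` cball a r"
  \<comment> \<open>A compact subset of a Hausdorff space is closed, so the bump vanishes in a whole
    neighbourhood of each point outside the chart.\<close>
  have S: "closed ?S" "?S \<subseteq> chart_dom c"
   using patch_compact[OF c(1) compact_cball c(2)] compact_imp_closed by auto
  have o: "open (img d \<inter> param d -` (- ?S))"
   using continuous_on_open_vimage[OF chartD(2)[OF d]] chartD(4)[OF d] S(1) by (metis Int_commute open_Compl)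
  have "smooth_on (img d \<inter> param d -` (- ?S)) (\<lambda>x. patch_bump c a r (param d x))"
   by (rule smooth_on_cong[OF o smooth_on_const[of _ 0]]) (use patch_bump_zero[OF c r] in auto)
  moreover have "x \<in> img d \<inter> param d -` (- ?S)" using False x S(2) by blast
  ultimately show ?thesis using o by blast
 qed
qed

lemma Gam_local_zero:
 assumes S: "closed S" and p: "p \<notin> S" and z: "\<And>p. p \<notin> S \<Longrightarrow> u p = 0"
 shows "Gam u v p = 0"
proof -
 define c where "c = chart_at A p"
 have c: "c \<in> A" "p \<in> chart_dom c" using chart_at unfolding c_def by blast+
 have o: "open (img c \<inter> param c -` (- S))"
  using continuous_on_open_vimage[OF chartD(2)[OF c(1)]] chartD(4)[OF c(1)] S by (metis Int_commute open_Compl)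
 have "lgam (G c) (loc c u) (loc c v) (coord c p) = lgam (G c) (\<lambda>x. 0) (loc c v) (coord c p)"
  by (rule lgam_cong[OF o]) (use c p z in auto)
 then show ?thesis by (simp add: Gam_def c_def[symmetric] lgam_def)
qed

end

context compact_riem begin

section \<open>Finite covers by bumps and finiteness of the volume\<close>

lemma finite_subcover_points:
 assumes "\<And>p. open (N p)" "\<And>p. p \<in> N p"
 obtains P :: "'a set" where "finite P" "(\<Union>p\<in>P. N p) = UNIV"
proof -
 have "UNIV \<subseteq> (\<Union>p\<in>UNIV. N p)" using assms(2) by auto
 from compactE_image[OF compact_UNIV assms(1) this]
 obtain P where "finite P" "UNIV \<subseteq> (\<Union>p\<in>P. N p)" .
 then show ?thesis using that[of P] by auto
qed

lemma chart_nbhd: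
 obtains r where "\<And>p. r p > 0" "\<And>p. cball (coord (chart_at A p) p) (r p) \<subseteq> img (chart_at A p)"
proof -
 have "\<exists>r>0. cball (coord (chart_at A p) p) r \<subseteq> img (chart_at A p)" for p
  using chartD(2)[OF chart_at(1)] chart_at(2) by (simp add: open_contains_cball)
 then show ?thesis using that by metis
qed

lemma bump_cover:
 obtains P :: "'a set" and c a r where "finite P" "\<And>p. p \<in> P \<Longrightarrow> c p \<in> A" "\<And>p. p \<in> P \<Longrightarrow> r p > 0"
  "\<And>p. p \<in> P \<Longrightarrow> cball (a p) (r p) \<subseteq> img (c p)"
  "\<And>q. \<exists>p\<in>P. patch_bump (c p) (a p) (r p) q > 0"
proof -
 obtain r where r: "\<And>p. r p > 0" "\<And>p. cball (coord (chart_at A p) p) (r p) \<subseteq> img (chart_at A p)" by (rule chart_nbhd) (rule that; assumption)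
 define N where "N p = {q \<in> chart_dom (chart_at A p). coord (chart_at A p) q \<in> ball (coord (chart_at A p) p) (r p)}" for p
 have o: "open (N p)" for p
 proof -
  have "N p = coord (chart_at A p) -` ball (coord (chart_at A p) p) (r p) \<inter> chart_dom (chart_at A p)"
   by (auto simp: N_def)
  moreover have "open \<dots>"
   using continuous_on_open_vimage[OF chartD(1)[OF chart_at(1)]] chartD(3)[OF chart_at(1)] open_ball by blast
  ultimately show ?thesis by simp
 qed
 have i: "p \<in> N p" for p using r(1) chart_at(2) by (simp add: N_def)
 obtain P where P: "finite P" "(\<Union>p\<in>P. N p) = UNIV" by (rule finite_subcover_points[OF o i])
 show ?thesis
 proof (rule that[of P "chart_at A" r "\<lambda>p. coord (chart_at A p) p"])
  fix q
  have "q \<in> (\<Union>p\<in>P. N p)" using P(2) by simp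
  then obtain p where "p \<in> P" "q \<in> N p" by blast
  then show "\<exists>p\<in>P. patch_bump (chart_at A p) (coord (chart_at A p) p) (r p) q > 0"
   using ball_bump_pos_iff[OF r(1)] by (intro bexI[of _ p]) (auto simp: patch_bump_def N_def)
 qed (use P r chart_at in auto)
qed

lemma emeasure_patch_finite:
 assumes c: "c \<in> A" and C: "compact C" "C \<subseteq> img c"
 shows "emeasure V (param c ` C) < \<infinity>"
proof -
 have S: "param c ` C \<in> sets borel" "param c ` C \<subseteq> chart_dom c"
  using patch_compact[OF c C] by (auto simp: compact_imp_closed borel_closed)
 have "coord c ` (param c ` C) = C" using C(2) by (force simp: image_image)
 then have "emeasure V (param c ` C) = (\<integral>\<^sup>+x. ennreal (indicator C x * dens c x) \<partial>lborel)"
  using volume c S emeasure_chart_measure[OF c S] unfolding is_volume_def by simp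
 also have "\<dots> = ennreal (LINT x|lborel. indicator C x * dens c x)"
 proof (rule nn_integral_eq_integral)
  show "integrable lborel (\<lambda>x. indicator C x * dens c x)"
   using borel_integrable_compact[OF C(1) continuous_on_subset[OF smooth_on_continuous[OF smooth_dens[OF c]] C(2)]] by simp
  show "AE x in lborel. 0 \<le> indicator C x * dens c x"
   using dens_pos[OF c] C(2) by (intro AE_I2) (auto simp: indicator_def less_imp_le subset_iff)
 qed
 finally show ?thesis by simp
qed

lemma finite_V: "finite_measure V"
proof
 obtain P :: "'a set" and c a r where P: "finite P" "\<And>p. p \<in> P \<Longrightarrow> c p \<in> A" "\<And>p. p \<in> P \<Longrightarrow> r p > 0"
  "\<And>p. p \<in> P \<Longrightarrow> cball (a p) (r p) \<subseteq> img (c p)" "\<And>q. \<exists>p\<in>P. patch_bump (c p) (a p) (r p) q > 0"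
  by (rule bump_cover) (rule that; assumption)
 have cov: "UNIV = (\<Union>p\<in>P. param (c p) ` cball (a p) (r p))"
 proof (intro set_eqI iffI UNIV_I)
  fix q
  obtain p where p: "p \<in> P" "patch_bump (c p) (a p) (r p) q > 0" using P(5) by blast
  then have "q \<in> param (c p) ` cball (a p) (r p)" using patch_bump_zero[OF P(2,4,3)] by fastforce
  then show "q \<in> (\<Union>p\<in>P. param (c p) ` cball (a p) (r p))" using p(1) by blast
 qed
 have "emeasure V (\<Union>p\<in>P. param (c p) ` cball (a p) (r p)) \<le> (\<Sum>p\<in>P. emeasure V (param (c p) ` cball (a p) (r p)))"
  using patch_compact[OF P(2) compact_cball P(4)] by (intro emeasure_subadditive_finite P(1)) (auto simp: compact_imp_closed borel_closed)
 also have "\<dots> < \<infinity>" using emeasure_patch_finite[OF P(2) compact_cball P(4)] P(1) by (simp add: less_top)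
 finally show "emeasure V (space V) \<noteq> \<infinity>" using cov by simp
qed

lemma smooth_bounded: "smooth_fun A u \<Longrightarrow> \<exists>B\<ge>0. \<forall>p. \<bar>u p\<bar> \<le> B"
 using compact_bounded_real[OF compact_UNIV smooth_fun_continuous] by auto

lemma continuous_integrable:
 assumes "continuous_on UNIV (u :: 'a \<Rightarrow> real)"
 shows "integrable V u"
proof -
 obtain B where "\<forall>p. \<bar>u p\<bar> \<le> B" using compact_bounded_real[OF compact_UNIV assms] by auto
 then show ?thesis using finite_measure.integrable_const_bound[OF finite_V, of u B] borel_measurable_continuous_onI[OF assms]
  by auto
qed

lemma smooth_integrable: "smooth_fun A u \<Longrightarrow> integrable V u"
 by (rule continuous_integrable[OF smooth_fun_continuous])

lemma green_local:
 assumes c: "c \<in> A" "cball a r \<subseteq> img c" and w: "smooth_fun A w" "\<And>p. p \<notin> param c ` cball a r \<Longrightarrow> w p = 0"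
  and v: "smooth_fun A v"
 shows "(LINT p|V. w p * L v p + Gam w v p) = 0"
proof -
 interpret local_metric "img c" "G c" by (rule local_metric[OF c(1)])
 let ?S = "param c ` cball a r"
 have S: "closed ?S" "?S \<subseteq> chart_dom c"
  using patch_compact[OF c(1) compact_cball c(2)] compact_imp_closed by auto
 define w0 where "w0 x = (if x \<in> img c then w (param c x) else 0)" for x
 have w0: "smooth_on (img c) w0"
  by (rule smooth_on_cong[OF open_U smooth_loc[OF w(1) c(1)]]) (simp add: w0_def)
 have z: "w0 x = 0" if "x \<notin> cball a r" for x
 proof (cases "x \<in> img c")
  case True
  then have "param c x \<notin> ?S" using that patch_mem[OF c(1) param_in[OF True] c(2)] by simp
  then show ?thesis using w(2) by (simp add: w0_def)
 qed (simp add: w0_def)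
 have "(LINT p|V. w p * L v p + Gam w v p)
  = (LINT x|lborel. indicator (img c) x * ((w (param c x) * L v (param c x) + Gam w v (param c x)) * dens c x))"
 proof (rule integral_chart[OF c(1)])
  show "(\<lambda>p. w p * L v p + Gam w v p) \<in> borel_measurable borel"
   by (intro smooth_fun_measurable smooth_fun_add smooth_fun_mult smooth_L smooth_Gam w(1) v)
  fix p assume "p \<notin> chart_dom c"
  then have "p \<notin> ?S" using S(2) by blast
  then show "w p * L v p + Gam w v p = 0" using w(2) Gam_local_zero[OF S(1) _ w(2)] by simp
 qed
 also have "\<dots> = (LINT x|lborel. (w0 x * llap (G c) (loc c v) x + lgam (G c) w0 (loc c v) x) * sqrt (det (G c x)))"
 proof (rule Bochner_Integration.integral_cong[OF refl])
  fix x
  show "indicator (img c) x * ((w (param c x) * L v (param c x) + Gam w v (param c x)) * dens c x)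
   = (w0 x * llap (G c) (loc c v) x + lgam (G c) w0 (loc c v) x) * sqrt (det (G c x))"
  proof (cases "x \<in> img c")
   case True
   have "lgam (G c) w0 (loc c v) x = lgam (G c) (loc c w) (loc c v) x"
    by (rule lgam_cong[OF open_U True]) (simp_all add: w0_def)
   then show ?thesis using True
    by (simp add: laplacian_chart[OF c(1) param_in v] Gam_chart[OF c(1) param_in w(1) v] w0_def dens_def)
  next
   case False
   then have "x \<in> - cball a r" using c(2) by blast
   then have "lgam (G c) w0 (loc c v) x = lgam (G c) (\<lambda>x. 0) (loc c v) x"
    by (intro lgam_cong[of "- cball a r"]) (auto simp: z open_Compl)
   then show ?thesis using False by (simp add: w0_def lgam_const)
  qed
 qed
 also have "\<dots> = 0"
  by (rule local_green[OF compact_cball c(2) w0 z smooth_loc[OF v c(1)]])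
 finally show ?thesis .
qed

text \<open>The formula is linear in \<open>w\<close>, so it suffices to localise \<open>w\<close>
  by the partition of unity \<open>\<beta> p / s\<close>, leaving \<open>v\<close> as it is.\<close>

lemma green:
 assumes w: "smooth_fun A w" and v: "smooth_fun A v"
 shows "(LINT p|V. w p * L v p) = - (LINT p|V. Gam w v p)"
proof -
 obtain P :: "'a set" and c a r where P: "finite P" "\<And>p. p \<in> P \<Longrightarrow> c p \<in> A" "\<And>p. p \<in> P \<Longrightarrow> r p > 0"
  "\<And>p. p \<in> P \<Longrightarrow> cball (a p) (r p) \<subseteq> img (c p)" "\<And>q. \<exists>p\<in>P. patch_bump (c p) (a p) (r p) q > 0"
  by (rule bump_cover) (rule that; assumption)
 define \<beta> where "\<beta> p = patch_bump (c p) (a p) (r p)" for p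
 have \<beta>: "smooth_fun A (\<beta> p)" if "p \<in> P" for p unfolding \<beta>_def using P that by (intro smooth_patch_bump) auto
 have \<beta>0: "\<beta> p q \<ge> 0" for p q by (simp add: \<beta>_def patch_bump_def ball_bump_nonneg)
 define s where "s q = (\<Sum>p\<in>P. \<beta> p q)" for q
 have s: "smooth_fun A s" unfolding s_def by (intro smooth_fun_sum P(1) \<beta>)
 have spos: "s q > 0" for q
 proof -
  obtain p where "p \<in> P" "\<beta> p q > 0" using P(5) by (auto simp: \<beta>_def)
  then show ?thesis unfolding s_def using P(1) \<beta>0 by (intro sum_pos2[of P p]) auto
 qed
 define w' where "w' p q = (w q * \<beta> p q) / s q" for p q
 have w': "smooth_fun A (w' p)" if "p \<in> P" for p
  unfolding w'_def using spos by (intro smooth_fun_divide smooth_fun_mult w \<beta> that s) (simp add: less_imp_neq[symmetric])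
 have sum: "w = (\<lambda>q. \<Sum>p\<in>P. w' p q)"
  using spos by (auto simp: fun_eq_iff w'_def sum_divide_distrib[symmetric] sum_distrib_left[symmetric] s_def less_imp_neq[symmetric])
 have Gsum: "Gam (\<lambda>q. \<Sum>p\<in>Q. w' p q) v q = (\<Sum>p\<in>Q. Gam (w' p) v q)" if "Q \<subseteq> P" for Q q
  using finite_subset[OF that P(1)] that
 proof (induction Q rule: finite_induct)
  case (insert x F)
  have "Gam (\<lambda>q. w' x q + (\<Sum>p\<in>F. w' p q)) v q = Gam (w' x) v q + Gam (\<lambda>q. \<Sum>p\<in>F. w' p q) v q"
   using insert.prems by (intro Gam_add v smooth_fun_sum insert.hyps w') auto
  then show ?case using insert by simp
 qed (simp add: Gam_const)
 have "(LINT q|V. w q * L v q + Gam w v q) = (LINT q|V. (\<Sum>p\<in>P. w' p q * L v q + Gam (w' p) v q))"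
  by (subst (1 2) sum) (simp add: Gsum sum_distrib_right sum.distrib)
 also have "\<dots> = (\<Sum>p\<in>P. (LINT q|V. w' p q * L v q + Gam (w' p) v q))"
  by (intro Bochner_Integration.integral_sum smooth_integrable smooth_fun_add smooth_fun_mult smooth_Gam smooth_L w' v)
 also have "\<dots> = 0"
 proof (intro sum.neutral ballI)
  fix p assume p: "p \<in> P"
  show "(LINT q|V. w' p q * L v q + Gam (w' p) v q) = 0"
   using patch_bump_zero[OF P(2,4,3)[OF p]]
   by (intro green_local[OF P(2,4)[OF p] w'[OF p] _ v]) (simp add: w'_def \<beta>_def)
 qed
 finally show ?thesis
  using w v by (subst (asm) Bochner_Integration.integral_add)
   (auto intro!: smooth_integrable smooth_fun_mult smooth_L smooth_Gam)
qed

lemma L_symmetric: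
 assumes "smooth_fun A u" "smooth_fun A v"
 shows "(LINT p|V. u p * L v p) = (LINT p|V. L u p * v p)"
proof -
 have "Gam u v = Gam v u" using Gam_commute[OF assms] by blast
 then show ?thesis using green[OF assms] green[OF assms(2,1)] by (simp add: mult.commute)
qed

text \<open>The points of a chart where \<open>u\<close> is nonzero form an open set of volume 0. As
  the density is positive, the image in coordinates is open and Lebesgue null, hence empty.\<close>

lemma smooth_zero_of_integral:
 assumes u: "smooth_fun A u" and z: "(LINT p|V. (u p)^2) = 0"
 shows "u p = 0"
proof (rule ccontr)
 assume p: "u p \<noteq> 0"
 have su: "smooth_fun A (\<lambda>p. u p * u p)" by (intro smooth_fun_mult u)
 have "AE p in V. (u p)^2 = 0"
  using integral_nonneg_eq_0_iff_AE[of V "\<lambda>p. (u p)^2"] smooth_integrable[OF su] z by (simp add: power2_eq_square)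
 then have ae: "AE p in V. u p = 0" by simp
 define c where "c = chart_at A p"
 have c: "c \<in> A" "p \<in> chart_dom c" using chart_at unfolding c_def by blast+
 let ?N = "{q \<in> chart_dom c. u q \<noteq> 0}"
 have oN: "open ?N"
 proof -
  have "open (u -` (- {0}))" using smooth_fun_continuous[OF u] by (simp add: continuous_on_open_vimage open_Compl open_vimage)
  moreover have "?N = chart_dom c \<inter> u -` (- {0})" by auto
  ultimately show ?thesis using chartD(1)[OF c(1)] by auto
 qed
 have "AE p in V. p \<notin> ?N" using ae by (rule AE_mp) auto
 then have "?N \<in> null_sets V" using oN by (subst AE_iff_null_sets) auto
 then have "emeasure V ?N = 0" by (rule null_setsD1)
 then have "(\<integral>\<^sup>+x. ennreal (indicator (coord c ` ?N) x * dens c x) \<partial>lborel) = 0"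
  using volume c(1) oN emeasure_chart_measure[OF c(1), of ?N] unfolding is_volume_def by auto
 moreover have "(\<lambda>x. ennreal (indicator (coord c ` ?N) x * dens c x)) \<in> borel_measurable lborel"
 proof -
  have "coord c ` ?N \<in> sets borel" using oN by (intro coord_image_borel c) auto
  from borel_measurable_continuous_on_indicator[OF this continuous_on_subset[OF smooth_on_continuous[OF smooth_dens[OF c(1)]]]]
  show ?thesis by (auto simp: image_mono)
 qed
 ultimately have "AE x in lborel. ennreal (indicator (coord c ` ?N) x * dens c x) = 0"
  by (simp add: nn_integral_0_iff_AE)
 then have "AE x in lborel. x \<notin> coord c ` ?N"
 proof (rule AE_mp, intro AE_I2 impI)
  fix x assume e: "ennreal (indicator (coord c ` ?N) x * dens c x) = 0"
  show "x \<notin> coord c ` ?N"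
  proof
   assume x: "x \<in> coord c ` ?N"
   then have "x \<in> img c" by blast
   then show False using e x dens_pos[OF c(1), of x] by simp
  qed
 qed
 then have "coord c ` ?N \<in> null_sets lborel" using oN coord_image_borel[OF c(1), of ?N]
  by (subst AE_iff_null_sets) auto
 moreover have "open (coord c ` ?N)"
 proof -
  have "coord c ` ?N = param c -` ?N \<inter> img c"
  proof (intro set_eqI iffI)
   fix x assume "x \<in> param c -` ?N \<inter> img c"
   then show "x \<in> coord c ` ?N" by (intro image_eqI[of _ _ "param c x"]) simp_all
  qed (use c in auto)
  moreover have "open \<dots>"
   using continuous_on_open_vimage[OF chartD(2)[OF c(1)]] chartD(4)[OF c(1)] oN by blast
  ultimately show ?thesis by simp
 qed
 moreover have "coord c ` ?N \<noteq> {}" using c p by blast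
 ultimately show False using open_not_negligible null_sets_completionI by (auto simp: negligible_iff_null_sets)
qed

end

section \<open>Global estimates\<close>

context compact_riem begin

lemma integral_patch_le:
 assumes c: "c \<in> A" and C: "compact C" "C \<subseteq> img c"
  and f: "smooth_fun A f" "\<And>p. f p \<ge> 0"
 shows "(LINT x|lborel. indicator C x * (f (param c x) * dens c x)) \<le> (LINT p|V. f p)"
proof -
 let ?S = "param c ` C"
 have S: "?S \<in> sets borel" "?S \<subseteq> chart_dom c"
  using patch_compact[OF c C] by (auto simp: compact_imp_closed borel_closed)
 have fm: "f \<in> borel_measurable borel" by (rule smooth_fun_measurable[OF f(1)])
 have "(LINT p|V. indicator ?S p * f p) = (LINT x|lborel. indicator (img c) x * ((indicator ?S (param c x) * f (param c x)) * dens c x))"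
  using S fm by (intro integral_chart[OF c]) (auto simp: indicator_def)
 also have "\<dots> = (LINT x|lborel. indicator C x * (f (param c x) * dens c x))"
  using patch_mem[OF c param_in C(2)] C(2)
  by (intro Bochner_Integration.integral_cong refl) (auto simp: indicator_def)
 finally have "(LINT x|lborel. indicator C x * (f (param c x) * dens c x)) = (LINT p|V. indicator ?S p * f p)" by simp
 also have "\<dots> \<le> (LINT p|V. f p)"
 proof (rule integral_mono)
  show "integrable V (\<lambda>p. indicator ?S p * f p)"
   using integrable_real_mult_indicator[OF _ smooth_integrable[OF f(1)], of ?S] S by (simp add: mult.commute)
  show "integrable V f" by (rule smooth_integrable[OF f(1)])
  show "indicator ?S p * f p \<le> f p" for p using f(2) by (simp add: indicator_def)
 qed
 finally show ?thesis .
qed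

lemma hess_estimate_patch:
 assumes c: "c \<in> A" "cball a r \<subseteq> img c" and r: "r > 0"
 shows "\<exists>B\<ge>0. \<forall>w. smooth_fun A w \<longrightarrow>
  (LINT p|V. (patch_bump c a r p)^2 * hess_norm_sq A g w p) \<le> B * (LINT p|V. (L w p)^2 + Gam w w p)"
proof -
 interpret local_metric "img c" "G c" by (rule local_metric[OF c(1)])
 have z: "ball_bump a r x = 0" if "x \<notin> cball a r" for x
  using that ball_bump_pos_iff[OF r, of a x] ball_bump_nonneg[of a r x] by auto
 obtain B where B: "B \<ge> 0" "\<And>w. smooth_on (img c) w \<Longrightarrow>
   (LINT x|lborel. indicator (cball a r) x * ((ball_bump a r x)^2 * lhess_norm (G c) w x * sqrt (det (G c x))))
   \<le> B * (LINT x|lborel. indicator (cball a r) x * (((llap (G c) w x)^2 + lgam (G c) w w x) * sqrt (det (G c x))))"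
  by (rule hess_local_estimate[OF compact_cball c(2) smooth_on_ball_bump[OF open_U] z]) (assumption | rule that)+
 have "(LINT p|V. (patch_bump c a r p)^2 * hess_norm_sq A g w p) \<le> B * (LINT p|V. (L w p)^2 + Gam w w p)"
  if w: "smooth_fun A w" for w
 proof -
  have "(LINT p|V. (patch_bump c a r p)^2 * hess_norm_sq A g w p)
   = (LINT x|lborel. indicator (img c) x * (((patch_bump c a r (param c x))^2 * hess_norm_sq A g w (param c x)) * dens c x))"
  proof (rule integral_chart[OF c(1)])
   show "(\<lambda>p. (patch_bump c a r p)^2 * hess_norm_sq A g w p) \<in> borel_measurable borel"
    using smooth_fun_measurable[OF smooth_patch_bump[OF c r]] smooth_fun_measurable[OF smooth_hess_norm[OF w]] by simp
  qed (simp add: patch_bump_def)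
  also have "\<dots> = (LINT x|lborel. indicator (cball a r) x * ((ball_bump a r x)^2 * lhess_norm (G c) (loc c w) x * sqrt (det (G c x))))"
  proof (rule Bochner_Integration.integral_cong[OF refl])
   fix x
   show "indicator (img c) x * (((patch_bump c a r (param c x))^2 * hess_norm_sq A g w (param c x)) * dens c x)
    = indicator (cball a r) x * ((ball_bump a r x)^2 * lhess_norm (G c) (loc c w) x * sqrt (det (G c x)))"
   proof (cases "x \<in> img c")
    case True
    then show ?thesis using z[of x] hess_norm_sq_chart[OF c(1) param_in[OF True] w]
     by (cases "x \<in> cball a r") (simp_all add: patch_bump_def dens_def)
   next
    case False
    then have "x \<notin> cball a r" using c(2) by blast
    then show ?thesis using False by simp
   qed
  qed
  also have "\<dots> \<le> B * (LINT x|lborel. indicator (cball a r) x * (((llap (G c) (loc c w) x)^2 + lgam (G c) (loc c w) (loc c w) x) * sqrt (det (G c x))))"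
   by (rule B(2)[OF smooth_loc[OF w c(1)]])
  also have "(LINT x|lborel. indicator (cball a r) x * (((llap (G c) (loc c w) x)^2 + lgam (G c) (loc c w) (loc c w) x) * sqrt (det (G c x))))
   = (LINT x|lborel. indicator (cball a r) x * (((L w (param c x))^2 + Gam w w (param c x)) * dens c x))"
  proof (rule Bochner_Integration.integral_cong[OF refl])
   fix x
   show "indicator (cball a r) x * (((llap (G c) (loc c w) x)^2 + lgam (G c) (loc c w) (loc c w) x) * sqrt (det (G c x)))
    = indicator (cball a r) x * (((L w (param c x))^2 + Gam w w (param c x)) * dens c x)"
   proof (cases "x \<in> cball a r")
    case True
    then have "x \<in> img c" using c(2) by blast
    then show ?thesis
     by (simp add: laplacian_chart[OF c(1) param_in w] Gam_chart[OF c(1) param_in w w] dens_def)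
   qed simp
  qed
  also have "\<dots> \<le> (LINT p|V. (L w p)^2 + Gam w w p)"
   using integral_patch_le[OF c(1) compact_cball c(2) smooth_fun_add[OF smooth_fun_mult[OF smooth_L[OF w] smooth_L[OF w]] smooth_Gam[OF w w]]]
    Gam_nonneg by (simp add: power2_eq_square)
  finally show ?thesis using B(1) by (simp add: mult_left_mono)
 qed
 then show ?thesis using B(1) by blast
qed

lemma hess_estimate:
 obtains C where "C \<ge> 0" "\<And>w. smooth_fun A w \<Longrightarrow>
  (LINT p|V. hess_norm_sq A g w p) \<le> C * (LINT p|V. (L w p)^2 + Gam w w p)"
proof -
 obtain P :: "'a set" and c a r where P: "finite P" "\<And>p. p \<in> P \<Longrightarrow> c p \<in> A" "\<And>p. p \<in> P \<Longrightarrow> r p > 0"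
  "\<And>p. p \<in> P \<Longrightarrow> cball (a p) (r p) \<subseteq> img (c p)" "\<And>q. \<exists>p\<in>P. patch_bump (c p) (a p) (r p) q > 0"
  by (rule bump_cover) (rule that; assumption)
 define \<beta> where "\<beta> p = patch_bump (c p) (a p) (r p)" for p
 have \<beta>: "smooth_fun A (\<beta> p)" if "p \<in> P" for p unfolding \<beta>_def using P that by (intro smooth_patch_bump) auto
 \<comment> \<open>Squares are summed because \<open>hess_estimate_patch\<close> controls the
   Hessian with a squared weight; the bound \<open>m\<close> of \<open>1 / s\<close> then removes
   the weight.\<close>
 define s where "s q = (\<Sum>p\<in>P. (\<beta> p q)^2)" for q
 have s: "smooth_fun A s"
  unfolding s_def power2_eq_square by (intro smooth_fun_sum P(1) smooth_fun_mult \<beta>)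
 have spos: "s q > 0" for q
 proof -
  obtain p where "p \<in> P" "\<beta> p q > 0" using P(5) by (auto simp: \<beta>_def)
  then show ?thesis unfolding s_def using P(1) by (intro sum_pos2[of P p]) auto
 qed
 have "smooth_fun A (\<lambda>q. 1 / s q)"
  by (rule smooth_fun_divide[OF smooth_fun_const s]) (simp add: spos less_imp_neq[OF spos, symmetric])
 from smooth_bounded[OF this] obtain m where m0: "m \<ge> 0" "\<And>q. \<bar>1 / s q\<bar> \<le> m" by blast
 have m: "m \<ge> 0" "1 / s q \<le> m" for q
  by (rule m0(1)) (rule abs_le_D1[OF m0(2)])
 have m': "1 \<le> m * s q" for q
 proof -
  have "1 / s q * s q \<le> m * s q" by (rule mult_right_mono[OF m(2) less_imp_le[OF spos]])
  then show ?thesis using spos[of q] by simp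
 qed
 define R where "R p B \<longleftrightarrow> B \<ge> 0 \<and> (\<forall>w. smooth_fun A w \<longrightarrow>
  (LINT q|V. (\<beta> p q)^2 * hess_norm_sq A g w q) \<le> B * (LINT q|V. (L w q)^2 + Gam w w q))" for p B
 have "\<exists>B. R p B" if p: "p \<in> P" for p
  using hess_estimate_patch[OF P(2,4,3)[OF p]] unfolding R_def \<beta>_def .
 then obtain B where R: "\<And>p. p \<in> P \<Longrightarrow> R p (B p)" by metis
 have B: "B p \<ge> 0" "\<And>w. smooth_fun A w \<Longrightarrow>
  (LINT q|V. (\<beta> p q)^2 * hess_norm_sq A g w q) \<le> B p * (LINT q|V. (L w q)^2 + Gam w w q)" if "p \<in> P" for p
  using R[OF that] unfolding R_def by simp_all
 show ?thesis
 proof (rule that[of "m * (\<Sum>p\<in>P. B p)"])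
  show "m * (\<Sum>p\<in>P. B p) \<ge> 0" using m(1) B(1) by (intro mult_nonneg_nonneg sum_nonneg) auto
  fix w assume w: "smooth_fun A w"
  have hn: "hess_norm_sq A g w q \<ge> 0" for q
   unfolding hess_norm_sq_chart[OF chart_at w]
   using local_metric.lhess_norm_nonneg_and_trace_bound(1)[OF local_metric[OF chart_at(1)] _ smooth_loc[OF w chart_at(1)]] chart_at
   by simp
  have "(LINT q|V. hess_norm_sq A g w q) \<le> (LINT q|V. m * (s q * hess_norm_sq A g w q))"
  proof (rule integral_mono)
   show "integrable V (hess_norm_sq A g w)" by (intro smooth_integrable smooth_hess_norm w)
   show "integrable V (\<lambda>q. m * (s q * hess_norm_sq A g w q))"
    by (intro smooth_integrable smooth_fun_cmult smooth_fun_mult s smooth_hess_norm w)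
   show "hess_norm_sq A g w q \<le> m * (s q * hess_norm_sq A g w q)" for q
    using mult_right_mono[OF m'[of q] hn[of q]] by (simp add: mult_ac)
  qed
  also have "\<dots> = m * (LINT q|V. (\<Sum>p\<in>P. (\<beta> p q)^2 * hess_norm_sq A g w q))"
   by (simp add: s_def sum_distrib_right)
  also have "(LINT q|V. (\<Sum>p\<in>P. (\<beta> p q)^2 * hess_norm_sq A g w q)) = (\<Sum>p\<in>P. (LINT q|V. (\<beta> p q)^2 * hess_norm_sq A g w q))"
   unfolding power2_eq_square
   by (intro Bochner_Integration.integral_sum smooth_integrable smooth_fun_mult \<beta> smooth_hess_norm w)
  also have "\<dots> \<le> (\<Sum>p\<in>P. B p * (LINT q|V. (L w q)^2 + Gam w w q))" by (intro sum_mono B(2) w)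
  also have "\<dots> = (\<Sum>p\<in>P. B p) * (LINT q|V. (L w q)^2 + Gam w w q)" by (simp add: sum_distrib_right)
  finally show "(LINT q|V. hess_norm_sq A g w q) \<le> m * (\<Sum>p\<in>P. B p) * (LINT q|V. (L w q)^2 + Gam w w q)"
   using m(1) by (simp add: mult_left_mono mult.assoc)
 qed
qed

text \<open>The second part is the easy half of the comparison with the graph norm: the Laplacian is
  a trace of the Hessian.\<close>

lemma H2_norm_squared:
 assumes w: "smooth_fun A w"
 shows "(H2_norm A g w)^2 = (LINT p|V. (w p)^2) + (LINT p|V. Gam w w p) + (LINT p|V. hess_norm_sq A g w p)"
  and "(LINT p|V. (L w p)^2) \<le> real CARD('n) * (H2_norm A g w)^2"
proof -
 have hn: "hess_norm_sq A g w q \<ge> 0" "(L w q)^2 \<le> real CARD('n) * hess_norm_sq A g w q" for q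
  unfolding hess_norm_sq_chart[OF chart_at w] laplacian_chart[OF chart_at w]
  using local_metric.lhess_norm_nonneg_and_trace_bound[OF local_metric[OF chart_at(1)] _ smooth_loc[OF w chart_at(1)]] chart_at
  by simp_all
 have i: "integrable V (\<lambda>p. (w p)^2)" "integrable V (Gam w w)" "integrable V (hess_norm_sq A g w)" "integrable V (\<lambda>p. (L w p)^2)"
  unfolding power2_eq_square by (intro smooth_integrable smooth_fun_mult smooth_Gam smooth_L smooth_hess_norm w)+
 have n: "0 \<le> (LINT p|V. (w p)^2)" "0 \<le> (LINT p|V. Gam w w p)" "0 \<le> (LINT p|V. hess_norm_sq A g w p)"
  by (auto intro!: integral_nonneg_AE simp: Gam_nonneg hn)
 show 1: "(H2_norm A g w)^2 = (LINT p|V. (w p)^2) + (LINT p|V. Gam w w p) + (LINT p|V. hess_norm_sq A g w p)"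
  unfolding H2_norm_def grad_norm_sq_Gam using i n by simp
 have "(LINT p|V. (L w p)^2) \<le> (LINT p|V. real CARD('n) * hess_norm_sq A g w p)"
  using i hn by (intro integral_mono) auto
 also have "\<dots> \<le> real CARD('n) * (H2_norm A g w)^2"
  using n by (simp add: 1)
 finally show "(LINT p|V. (L w p)^2) \<le> real CARD('n) * (H2_norm A g w)^2" .
qed

lemma Gam_integral_bound:
 assumes w: "smooth_fun A w"
 shows "(LINT p|V. Gam w w p) \<le> (LINT p|V. (w p)^2) + (LINT p|V. (L w p)^2)"
proof -
 have i: "integrable V (\<lambda>p. (w p)^2)" "integrable V (\<lambda>p. (L w p)^2)" "integrable V (\<lambda>p. w p * L w p)"
  unfolding power2_eq_square by (intro smooth_integrable smooth_fun_mult smooth_L w)+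
 have "(LINT p|V. Gam w w p) = (LINT p|V. - (w p * L w p))" using green[OF w w] by simp
 also have "\<dots> \<le> (LINT p|V. (w p)^2 + (L w p)^2)"
 proof (rule integral_mono)
  fix p
  have "0 \<le> (w p + L w p)^2 + (w p)^2 + (L w p)^2" by simp
  then show "- (w p * L w p) \<le> (w p)^2 + (L w p)^2" by (simp add: power2_sum)
 qed (use i in auto)
 finally show ?thesis using i by simp
qed

text \<open>With \<open>H2_norm_squared(2)\<close> this makes the H^2 norm equivalent to the graph
  norm of the Laplacian on smooth functions. The Hessian is bounded by \<open>hess_estimate\<close>
  and the gradient by Green's formula.\<close>

lemma H2_norm_bound:
 obtains C where "C \<ge> 0" "\<And>w. smooth_fun A w \<Longrightarrow>
  (H2_norm A g w)^2 \<le> C * ((LINT p|V. (w p)^2) + (LINT p|V. (L w p)^2))"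
proof -
 obtain C where C: "C \<ge> 0" "\<And>w. smooth_fun A w \<Longrightarrow>
  (LINT p|V. hess_norm_sq A g w p) \<le> C * (LINT p|V. (L w p)^2 + Gam w w p)"
  by (rule hess_estimate) (rule that; assumption)
 show ?thesis
 proof (rule that[of "2 * C + 2"])
  fix w assume w: "smooth_fun A w"
  have i: "integrable V (\<lambda>p. (L w p)^2)" "integrable V (Gam w w)"
   unfolding power2_eq_square by (intro smooth_integrable smooth_fun_mult smooth_L smooth_Gam w)+
  let ?a = "LINT p|V. (w p)^2" and ?b = "LINT p|V. (L w p)^2" and ?c = "LINT p|V. Gam w w p"
  have n: "0 \<le> ?a" "0 \<le> ?b" by (auto intro!: integral_nonneg_AE)
  have cab: "?c \<le> ?a + ?b" by (rule Gam_integral_bound[OF w])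
  have "(LINT p|V. hess_norm_sq A g w p) \<le> C * (?b + ?c)" using C(2)[OF w] i by simp
  also have "\<dots> \<le> C * (?b + (?a + ?b))" using C(1) cab by (intro mult_left_mono) auto
  also have "\<dots> \<le> C * (2 * (?a + ?b))" using C(1) n by (intro mult_left_mono) auto
  finally have h: "(LINT p|V. hess_norm_sq A g w p) \<le> C * (2 * (?a + ?b))" .
  have "(2 * C + 2) * (?a + ?b) = C * (2 * (?a + ?b)) + 2 * ?a + 2 * ?b" by (simp add: algebra_simps)
  then show "(H2_norm A g w)^2 \<le> (2 * C + 2) * (?a + ?b)"
   unfolding H2_norm_squared(1)[OF w] using h cab n by linarith
 qed (use C(1) in simp)
qed

text \<open>Boxes take the place of balls because \<open>poincare_local\<close> subdivides
  them.\<close>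

lemma box_cover:
 obtains P :: "'a set" and c a b where "finite P" "\<And>p. p \<in> P \<Longrightarrow> c p \<in> A"
  "\<And>p. p \<in> P \<Longrightarrow> cbox (a p) (b p) \<subseteq> img (c p)"
  "\<And>q. \<exists>p\<in>P. q \<in> param (c p) ` cbox (a p) (b p)"
proof -
 have "\<exists>a b. cbox a b \<subseteq> img (chart_at A p) \<and> coord (chart_at A p) p \<in> box a b" for p
 proof -
  have "open (img (chart_at A p))" "coord (chart_at A p) p \<in> img (chart_at A p)"
   using chartD(2)[OF chart_at(1)] chart_at(2) by blast+
  then obtain a b where "cbox a b \<subseteq> img (chart_at A p)" "coord (chart_at A p) p \<in> box a b"
   by (rule open_contains_cbox)
  then show ?thesis by blast
 qed
 then obtain a b where ab: "\<And>p. cbox (a p) (b p) \<subseteq> img (chart_at A p)" "\<And>p. coord (chart_at A p) p \<in> box (a p) (b p)"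
  by metis
 define N where "N p = coord (chart_at A p) -` box (a p) (b p) \<inter> chart_dom (chart_at A p)" for p
 have o: "open (N p)" for p
  using continuous_on_open_vimage[OF chartD(1)[OF chart_at(1)]] chartD(3)[OF chart_at(1)] open_box unfolding N_def by blast
 have i: "p \<in> N p" for p using ab(2) chart_at(2) by (simp add: N_def)
 obtain P where P: "finite P" "(\<Union>p\<in>P. N p) = UNIV" by (rule finite_subcover_points[OF o i])
 show ?thesis
 proof (rule that[of P "chart_at A" a b])
  fix q
  have "q \<in> (\<Union>p\<in>P. N p)" using P(2) by simp
  then obtain p where p: "p \<in> P" "q \<in> N p" by blast
  then have "coord (chart_at A p) q \<in> cbox (a p) (b p)" "q \<in> chart_dom (chart_at A p)"
   using box_subset_cbox by (auto simp: N_def)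
  then show "\<exists>p\<in>P. q \<in> param (chart_at A p) ` cbox (a p) (b p)"
   using patch_mem[OF chart_at(1) _ ab(1)] p(1) by blast
 qed (use P ab chart_at in auto)
qed

text \<open>The functionals \<open>l j\<close> are the integrals over the boxes of a fine decomposition.\<close>

lemma poincare_global:
 assumes \<delta>: "\<delta> > 0"
 obtains J :: "('a \<times> (real^'n) set) set" and l M B where "finite J" "M \<ge> 0" "B \<ge> 0"
  "\<And>u. smooth_fun A u \<Longrightarrow> (LINT p|V. (u p)^2) \<le> \<delta> * (LINT p|V. Gam u u p) + M * (\<Sum>j\<in>J. (l j u)^2)"
  "\<And>u v j. smooth_fun A u \<Longrightarrow> smooth_fun A v \<Longrightarrow> j \<in> J \<Longrightarrow> l j (\<lambda>p. u p - v p) = l j u - (l j v :: real)"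
  "\<And>u j. smooth_fun A u \<Longrightarrow> j \<in> J \<Longrightarrow> \<bar>l j u\<bar> \<le> B * (1 + (LINT p|V. (u p)^2))"
proof -
 obtain P :: "'a set" and c a b where P: "finite P" "\<And>p. p \<in> P \<Longrightarrow> c p \<in> A"
  "\<And>p. p \<in> P \<Longrightarrow> cbox (a p) (b p) \<subseteq> img (c p)" "\<And>q. \<exists>p\<in>P. q \<in> param (c p) ` cbox (a p) (b p)"
  by (rule box_cover) (rule that; assumption)
 have ne: "P \<noteq> {}" using P(4) by blast
 \<comment> \<open>The tolerance is shared equally among the finitely many boxes.\<close>
 define \<epsilon> where "\<epsilon> = \<delta> / real (card P)"
 have \<epsilon>: "\<epsilon> > 0" "\<epsilon> * real (card P) = \<delta>" using \<delta> ne P(1) by (auto simp: \<epsilon>_def card_gt_0_iff)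
 define R where "R p K m \<longleftrightarrow> finite K \<and> (\<forall>Q\<in>K. compact Q \<and> Q \<subseteq> cbox (a p) (b p)) \<and> m \<ge> 0 \<and>
  (\<forall>u. smooth_on (img (c p)) u \<longrightarrow> (LINT x|lborel. indicator (cbox (a p) (b p)) x * ((u x)^2 * dens (c p) x))
   \<le> \<epsilon> * (LINT x|lborel. indicator (cbox (a p) (b p)) x * (lgam (G (c p)) u u x * dens (c p) x))
    + m * (\<Sum>Q\<in>K. (LINT x|lborel. indicator Q x * u x)^2))" for p K m
 have "\<exists>K m. R p K m" if p: "p \<in> P" for p
  unfolding dens_def R_def
  by (rule local_metric.poincare_local[OF local_metric[OF P(2)[OF p]] P(3)[OF p] \<epsilon>(1)]) blast
 then obtain K m where R: "\<And>p. p \<in> P \<Longrightarrow> R p (K p) (m p)" by metis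
 have K: "finite (K p)" "\<And>Q. Q \<in> K p \<Longrightarrow> compact Q \<and> Q \<subseteq> cbox (a p) (b p)" "m p \<ge> 0"
  "\<And>u. smooth_on (img (c p)) u \<Longrightarrow>
   (LINT x|lborel. indicator (cbox (a p) (b p)) x * ((u x)^2 * dens (c p) x))
   \<le> \<epsilon> * (LINT x|lborel. indicator (cbox (a p) (b p)) x * (lgam (G (c p)) u u x * dens (c p) x))
    + m p * (\<Sum>Q\<in>K p. (LINT x|lborel. indicator Q x * u x)^2)" if p: "p \<in> P" for p
  using R[OF p] unfolding R_def by simp_all
 define J where "J = Sigma P K"
 define l where "l j u = (LINT x|lborel. indicator (snd j) x * u (param (c (fst j)) x))" for j :: "'a \<times> (real^'n) set" and u :: "'a \<Rightarrow> real"
 define M where "M = (\<Sum>p\<in>P. m p)"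
 have finJ: "finite J" unfolding J_def using P(1) K(1) by auto
 have int: "integrable lborel (\<lambda>x. indicator Q x * u (param (c p) x))"
  if "p \<in> P" "Q \<in> K p" "smooth_fun A u" for p Q u
  using borel_integrable_compact[of Q "\<lambda>x. u (param (c p) x)"] K(2)[OF that(1,2)] P(3)[OF that(1)]
   continuous_on_subset[OF smooth_on_continuous[OF smooth_loc[OF that(3) P(2)[OF that(1)]]]] by auto
 have bound: "\<exists>B\<ge>0. \<forall>u. smooth_fun A u \<longrightarrow> \<bar>l j u\<bar> \<le> B * (1 + (LINT p|V. (u p)^2))" if j: "j \<in> J" for j
 proof -
  obtain p Q where [simp]: "j = (p, Q)" and p: "p \<in> P" and Q: "Q \<in> K p" using j by (auto simp: J_def)
  have cQ: "compact Q" "Q \<subseteq> img (c p)" using K(2)[OF p Q] P(3)[OF p] by auto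
  note cA = P(2)[OF p]
  have "continuous_on Q (\<lambda>x. inverse (dens (c p) x))"
   using dens_pos[OF cA] cQ(2)
   by (intro continuous_on_inverse continuous_on_subset[OF smooth_on_continuous[OF smooth_dens[OF cA]] cQ(2)]) force
  from compact_bounded_real[OF cQ(1) this]
  obtain R where R: "R \<ge> 0" "\<And>x. x \<in> Q \<Longrightarrow> \<bar>inverse (dens (c p) x)\<bar> \<le> R" by blast
  \<comment> \<open>A bound affine in the square integral is enough to keep the functionals bounded
    along a sequence; it comes from |t| <= 1 + t^2.\<close>
  have "\<bar>l j u\<bar> \<le> max (measure lborel Q) R * (1 + (LINT p|V. (u p)^2))" if u: "smooth_fun A u" for u
  proof -
   have su2: "smooth_fun A (\<lambda>p. (u p)^2)" unfolding power2_eq_square by (intro smooth_fun_mult u)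
   have iQ: "integrable lborel (indicator Q :: _ \<Rightarrow> real)"
    using emeasure_compact_finite[OF cQ(1)] cQ(1) by (simp add: integrable_indicator_iff compact_imp_closed borel_closed)
   have id: "integrable lborel (\<lambda>x. indicator Q x * ((u (param (c p) x))^2 * dens (c p) x))"
   proof -
    have "continuous_on Q (\<lambda>x. (u (param (c p) x))^2 * dens (c p) x)"
     by (intro continuous_on_subset[OF smooth_on_continuous[OF smooth_on_mult[OF chartD(2)[OF cA] smooth_loc[OF su2 cA] smooth_dens[OF cA]]] cQ(2)])
    from borel_integrable_compact[OF cQ(1) this] show ?thesis by simp
   qed
   have "\<bar>l j u\<bar> \<le> (LINT x|lborel. \<bar>indicator Q x * u (param (c p) x)\<bar>)"
    unfolding l_def by simp
   also have "\<dots> \<le> (LINT x|lborel. indicator Q x + R * (indicator Q x * ((u (param (c p) x))^2 * dens (c p) x)))"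
   proof (rule integral_mono)
    show "integrable lborel (\<lambda>x. \<bar>indicator Q x * u (param (c p) x)\<bar>)" using int[OF p Q u] by simp
    show "integrable lborel (\<lambda>x. indicator Q x + R * (indicator Q x * ((u (param (c p) x))^2 * dens (c p) x)))"
     using iQ id by simp
    fix x
    show "\<bar>indicator Q x * u (param (c p) x)\<bar> \<le> indicator Q x + R * (indicator Q x * ((u (param (c p) x))^2 * dens (c p) x))"
    proof (cases "x \<in> Q")
     case True
     let ?t = "u (param (c p) x)"
     have d: "dens (c p) x > 0" using dens_pos[OF cA] cQ(2) True by blast
     have "1 \<le> R * dens (c p) x" using R(2)[OF True] d by (simp add: field_simps)
     then have "?t^2 * 1 \<le> ?t^2 * (R * dens (c p) x)" by (intro mult_left_mono) auto
     moreover have "\<bar>?t\<bar> \<le> 1 + ?t^2"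
     proof -
      have "0 \<le> (\<bar>?t\<bar> - 1)^2" by simp
      then have "2 * \<bar>?t\<bar> \<le> 1 + ?t^2" by (simp add: power2_diff)
      then show ?thesis by linarith
     qed
     ultimately show ?thesis using True by (simp add: mult_ac)
    qed simp
   qed
   also have "\<dots> = measure lborel Q + R * (LINT x|lborel. indicator Q x * ((u (param (c p) x))^2 * dens (c p) x))"
    using iQ id by simp
   also have "\<dots> \<le> measure lborel Q * 1 + R * (LINT p|V. (u p)^2)"
    using integral_patch_le[OF cA cQ su2] R(1) by (simp add: mult_left_mono)
   also have "\<dots> \<le> max (measure lborel Q) R * 1 + max (measure lborel Q) R * (LINT p|V. (u p)^2)"
    by (intro add_mono mult_right_mono) (auto intro!: integral_nonneg_AE)
   finally show ?thesis by (simp add: distrib_left)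
  qed
  then show ?thesis using R(1) by (intro exI[of _ "max (measure lborel Q) R"]) auto
 qed
 define R' where "R' j B \<longleftrightarrow> B \<ge> 0 \<and> (\<forall>u. smooth_fun A u \<longrightarrow> \<bar>l j u\<bar> \<le> B * (1 + (LINT p|V. (u p)^2)))" for j B
 have "\<exists>B. R' j B" if "j \<in> J" for j using bound[OF that] unfolding R'_def .
 then obtain Bj where R': "\<And>j. j \<in> J \<Longrightarrow> R' j (Bj j)" by metis
 have Bj: "Bj j \<ge> 0" "\<And>u. smooth_fun A u \<Longrightarrow> \<bar>l j u\<bar> \<le> Bj j * (1 + (LINT p|V. (u p)^2))" if "j \<in> J" for j
  using R'[OF that] unfolding R'_def by simp_all
 show ?thesis
 proof (rule that[of J M "\<Sum>j\<in>J. Bj j" l])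
  show "finite J" by (rule finJ)
  show "M \<ge> 0" unfolding M_def using K(3) by (simp add: sum_nonneg)
  show "(\<Sum>j\<in>J. Bj j) \<ge> 0" using Bj(1) by (simp add: sum_nonneg)
  show "l j (\<lambda>p. u p - v p) = l j u - l j v" if uv: "smooth_fun A u" "smooth_fun A v" and jJ: "j \<in> J" for u v j
  proof -
   obtain p Q where j: "j = (p, Q)" "p \<in> P" "Q \<in> K p" using jJ by (auto simp: J_def)
   show ?thesis using int[OF j(2,3) uv(1)] int[OF j(2,3) uv(2)]
    by (simp add: l_def j(1) right_diff_distrib)
  qed
  show "\<bar>l j u\<bar> \<le> (\<Sum>j\<in>J. Bj j) * (1 + (LINT p|V. (u p)^2))" if u: "smooth_fun A u" and j: "j \<in> J" for u j
  proof -
   have "\<bar>l j u\<bar> \<le> Bj j * (1 + (LINT p|V. (u p)^2))" by (rule Bj(2)[OF j u])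
   also have "\<dots> \<le> (\<Sum>j\<in>J. Bj j) * (1 + (LINT p|V. (u p)^2))"
    using member_le_sum[of j J Bj] j Bj(1) finJ by (intro mult_right_mono) (auto intro!: add_nonneg_nonneg integral_nonneg_AE)
   finally show ?thesis .
  qed
  fix u assume u: "smooth_fun A u"
  have su2: "smooth_fun A (\<lambda>p. (u p)^2)" unfolding power2_eq_square by (intro smooth_fun_mult u)
  let ?S = "\<Sum>j\<in>J. (l j u)^2"
  have part: "(LINT q|V. indicator (param (c p) ` cbox (a p) (b p)) q * (u q)^2) \<le> \<epsilon> * (LINT q|V. Gam u u q) + m p * ?S"
   if p: "p \<in> P" for p
  proof -
   note cA = P(2)[OF p] and cb = P(3)[OF p]
   let ?B = "cbox (a p) (b p)"
   have S: "param (c p) ` ?B \<in> sets borel" "param (c p) ` ?B \<subseteq> chart_dom (c p)"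
    using patch_compact[OF cA compact_cbox cb] by (auto simp: compact_imp_closed borel_closed)
   have "(LINT q|V. indicator (param (c p) ` ?B) q * (u q)^2)
    = (LINT x|lborel. indicator (img (c p)) x * ((indicator (param (c p) ` ?B) (param (c p) x) * (u (param (c p) x))^2) * dens (c p) x))"
    using S smooth_fun_measurable[OF su2] by (intro integral_chart[OF cA]) (auto simp: indicator_def)
   also have "\<dots> = (LINT x|lborel. indicator ?B x * ((u (param (c p) x))^2 * dens (c p) x))"
    using patch_mem[OF cA param_in cb] cb
    by (intro Bochner_Integration.integral_cong refl) (auto simp: indicator_def)
   also have "\<dots> \<le> \<epsilon> * (LINT x|lborel. indicator ?B x * (lgam (G (c p)) (loc (c p) u) (loc (c p) u) x * dens (c p) x))
    + m p * (\<Sum>Q\<in>K p. (LINT x|lborel. indicator Q x * u (param (c p) x))^2)"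
    by (rule K(4)[OF p smooth_loc[OF u cA]])
   also have "(LINT x|lborel. indicator ?B x * (lgam (G (c p)) (loc (c p) u) (loc (c p) u) x * dens (c p) x))
    = (LINT x|lborel. indicator ?B x * (Gam u u (param (c p) x) * dens (c p) x))"
   proof (rule Bochner_Integration.integral_cong[OF refl])
    fix x show "indicator ?B x * (lgam (G (c p)) (loc (c p) u) (loc (c p) u) x * dens (c p) x)
     = indicator ?B x * (Gam u u (param (c p) x) * dens (c p) x)"
    proof (cases "x \<in> ?B")
     case True
     then have "x \<in> img (c p)" using cb by blast
     then show ?thesis by (simp add: Gam_chart[OF cA param_in u u])
    qed simp
   qed
   also have "\<dots> \<le> (LINT q|V. Gam u u q)"
    by (rule integral_patch_le[OF cA compact_cbox cb smooth_Gam[OF u u] Gam_nonneg])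
   also have "(\<Sum>Q\<in>K p. (LINT x|lborel. indicator Q x * u (param (c p) x))^2) = (\<Sum>j\<in>{p} \<times> K p. (l j u)^2)"
    unfolding l_def by (rule sum.reindex_bij_witness[of _ snd "Pair p"]) auto
   also have "\<dots> \<le> ?S"
    using finJ p by (intro sum_mono2) (auto simp: J_def)
   finally show ?thesis using \<epsilon>(1) K(3)[OF p] by (simp add: mult_left_mono add_mono)
  qed
  have i: "integrable V (\<lambda>q. indicator (param (c p) ` cbox (a p) (b p)) q * (u q)^2)" if p: "p \<in> P" for p
  proof -
   have "param (c p) ` cbox (a p) (b p) \<in> sets V"
    using patch_compact[OF P(2)[OF p] compact_cbox P(3)[OF p]] by (auto simp: compact_imp_closed borel_closed)
   from integrable_real_mult_indicator[OF this smooth_integrable[OF su2]]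
   show ?thesis by (simp add: mult.commute)
  qed
  have "(LINT q|V. (u q)^2) \<le> (LINT q|V. (\<Sum>p\<in>P. indicator (param (c p) ` cbox (a p) (b p)) q * (u q)^2))"
  proof (rule integral_mono)
   show "integrable V (\<lambda>q. (u q)^2)" by (rule smooth_integrable[OF su2])
   show "integrable V (\<lambda>q. \<Sum>p\<in>P. indicator (param (c p) ` cbox (a p) (b p)) q * (u q)^2)"
    by (intro Bochner_Integration.integrable_sum i)
   fix q
   obtain p where p: "p \<in> P" "q \<in> param (c p) ` cbox (a p) (b p)" using P(4) by blast
   then have "(u q)^2 = indicator (param (c p) ` cbox (a p) (b p)) q * (u q)^2" by simp
   also have "\<dots> \<le> (\<Sum>p\<in>P. indicator (param (c p) ` cbox (a p) (b p)) q * (u q)^2)"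
    using p(1) P(1) by (intro member_le_sum) auto
   finally show "(u q)^2 \<le> (\<Sum>p\<in>P. indicator (param (c p) ` cbox (a p) (b p)) q * (u q)^2)" .
  qed
  also have "\<dots> = (\<Sum>p\<in>P. (LINT q|V. indicator (param (c p) ` cbox (a p) (b p)) q * (u q)^2))"
   by (intro Bochner_Integration.integral_sum i)
  also have "\<dots> \<le> (\<Sum>p\<in>P. \<epsilon> * (LINT q|V. Gam u u q) + m p * ?S)" by (intro sum_mono part)
  also have "\<dots> = \<delta> * (LINT q|V. Gam u u q) + M * ?S"
   using \<epsilon>(2) by (simp add: sum.distrib M_def sum_distrib_right mult.commute[of "real (card P)"] flip: mult.assoc)
  finally show "(LINT q|V. (u q)^2) \<le> \<delta> * (LINT q|V. Gam u u q) + M * ?S" .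
 qed
qed

end

section \<open>Compactness\<close>

lemma bounded_family_convergent_subseq:
 fixes f :: "'j \<Rightarrow> nat \<Rightarrow> real"
 assumes "finite J" "\<And>j. j \<in> J \<Longrightarrow> Bseq (f j)"
 shows "\<exists>r. strict_mono r \<and> (\<forall>j\<in>J. convergent (\<lambda>n. f j (r n)))"
 using assms
proof (induction J rule: finite_induct)
 case empty
 show ?case by (intro exI[of _ id]) (simp add: strict_mono_def)
next
 case (insert x F)
 then obtain r where r: "strict_mono r" "\<And>j. j \<in> F \<Longrightarrow> convergent (\<lambda>n. f j (r n))" by auto
 have "Bseq (\<lambda>n. f x (r n))" using insert.prems[of x] by (auto intro: Bseq_subseq)
 then have "bounded (range (\<lambda>n. f x (r n)))" by (simp add: Bseq_eq_bounded)
 then obtain l s where s: "strict_mono s" "((\<lambda>n. f x (r n)) \<circ> s) \<longlonglongrightarrow> l"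
  using bounded_imp_convergent_subsequence by blast
 have "convergent (\<lambda>n. f j (r (s n)))" if "j \<in> F" for j
  using convergent_subseq_convergent[OF r(2)[OF that] s(1)] by (simp add: o_def)
 moreover have "convergent (\<lambda>n. f x (r (s n)))" using s(2) by (auto simp: o_def convergent_def)
 ultimately show ?case using r(1) s(1) by (intro exI[of _ "r \<circ> s"]) (auto simp: strict_mono_def)
qed

context compact_riem begin

lemma Gam_diff_le:
 assumes u: "smooth_fun A u" and v: "smooth_fun A v"
 shows "Gam (\<lambda>p. u p - v p) (\<lambda>p. u p - v p) p \<le> 2 * Gam u u p + 2 * Gam v v p"
proof -
 have m: "Gam (\<lambda>p. -1 * v p) w p = - Gam v w p" if "smooth_fun A w" for w
  using Gam_mult[OF smooth_fun_const[of "-1"] v that] by (simp add: Gam_const)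
 have sv: "smooth_fun A (\<lambda>p. -1 * v p)" by (rule smooth_fun_cmult[OF v])
 have s: "smooth_fun A (\<lambda>p. u p + v p)" "smooth_fun A (\<lambda>p. u p - v p)" by (intro smooth_fun_add smooth_fun_diff u v)+
 have d: "Gam (\<lambda>p. u p - v p) w p = Gam u w p - Gam v w p" if "smooth_fun A w" for w
  using Gam_add[OF u sv that, of p] m[OF that] by simp
 have "Gam (\<lambda>p. u p - v p) (\<lambda>p. u p - v p) p = Gam u u p - Gam v u p - (Gam u v p - Gam v v p)"
  using d[OF s(2)] Gam_commute[OF u s(2)] Gam_commute[OF v s(2)] d[OF u] d[OF v] by simp
 moreover have "Gam (\<lambda>p. u p + v p) (\<lambda>p. u p + v p) p = Gam u u p + Gam v u p + (Gam u v p + Gam v v p)"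
  using Gam_add[OF u v s(1)] Gam_commute[OF u s(1)] Gam_commute[OF v s(1)] Gam_add[OF u v u] Gam_add[OF u v v] by simp
 ultimately show ?thesis using Gam_nonneg[of "\<lambda>p. u p + v p" p] by linarith
qed

text \<open>For each tolerance 1/(m+1), \<open>poincare_global\<close> supplies finitely many
  functionals, which are bounded on the sequence. A diagonal subsequence makes all of them converge.
  Applied to differences, the inequality then has a gradient part that is small by the choice of
  \<open>m\<close> and a functional part that tends to 0.\<close>

lemma rellich:
 fixes h :: "nat \<Rightarrow> 'a \<Rightarrow> real"
 assumes h: "\<And>n. smooth_fun A (h n)" and b: "\<And>n. (LINT p|V. (h n p)^2) \<le> C" "\<And>n. (LINT p|V. Gam (h n) (h n) p) \<le> C"
 shows "\<exists>r :: nat \<Rightarrow> nat. strict_mono r \<and> (\<forall>e>0. \<exists>N. \<forall>i\<ge>N. \<forall>j\<ge>N. (LINT p|V. (h (r i) p - h (r j) p)^2) < e)"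
proof -
 define Q where "Q \<delta> J l M B \<longleftrightarrow> finite J \<and> M \<ge> 0 \<and> B \<ge> 0 \<and>
  (\<forall>u. smooth_fun A u \<longrightarrow> (LINT p|V. (u p)^2) \<le> \<delta> * (LINT p|V. Gam u u p) + M * (\<Sum>j\<in>J. (l j u)^2)) \<and>
  (\<forall>u v. \<forall>j\<in>J. smooth_fun A u \<longrightarrow> smooth_fun A v \<longrightarrow> l j (\<lambda>p. u p - v p) = l j u - l j v) \<and>
  (\<forall>u. \<forall>j\<in>J. smooth_fun A u \<longrightarrow> \<bar>l j u\<bar> \<le> B * (1 + (LINT p|V. (u p)^2)))"
  for \<delta> M B :: real and J :: "('a \<times> (real^'n) set) set" and l :: "'a \<times> (real^'n) set \<Rightarrow> ('a \<Rightarrow> real) \<Rightarrow> real"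
 have "\<exists>J l M B. Q \<delta> J l M B" if "\<delta> > 0" for \<delta>
  by (rule poincare_global[OF that]) (unfold Q_def, blast)
 then have "\<exists>J l M B. Q (1 / real (Suc m)) J l M B" for m by simp
 then obtain J l M B where Q: "\<And>m. Q (1 / real (Suc m)) (J m) (l m) (M m) (B m)" by metis
 have fin: "finite (J m)" and M0: "M m \<ge> 0" and B0: "B m \<ge> 0" for m using Q[of m] unfolding Q_def by blast+
 have P: "(LINT p|V. (u p)^2) \<le> 1 / real (Suc m) * (LINT p|V. Gam u u p) + M m * (\<Sum>j\<in>J m. (l m j u)^2)"
  if "smooth_fun A u" for m u
  using Q[of m] that unfolding Q_def by blast
 have lin: "l m j (\<lambda>p. u p - v p) = l m j u - l m j v" if "smooth_fun A u" "smooth_fun A v" "j \<in> J m" for m u v j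
  using Q[of m] that unfolding Q_def by blast
 have bd: "\<bar>l m j u\<bar> \<le> B m * (1 + (LINT p|V. (u p)^2))" if "smooth_fun A u" "j \<in> J m" for m u j
  using Q[of m] that unfolding Q_def by blast
 have Bs: "Bseq (\<lambda>n. l m j (h (s n)))" if "j \<in> J m" for m j s
 proof (rule BseqI')
  fix n
  have "\<bar>l m j (h (s n))\<bar> \<le> B m * (1 + (LINT p|V. (h (s n) p)^2))" by (rule bd[OF h that])
  also have "\<dots> \<le> B m * (1 + C)" using B0 b(1) by (intro mult_left_mono) auto
  finally show "norm (l m j (h (s n))) \<le> B m * (1 + C)" by simp
 qed
 interpret subseqs "\<lambda>m s. \<forall>j\<in>J m. convergent (\<lambda>n. l m j (h (s n)))"
 proof
  fix m and s :: "nat \<Rightarrow> nat"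
  show "\<exists>r'. strict_mono r' \<and> (\<forall>j\<in>J m. convergent (\<lambda>n. l m j (h ((s \<circ> r') n))))"
   using bounded_family_convergent_subseq[OF fin, of m "\<lambda>j n. l m j (h (s n))"] Bs[of _ m s] by simp
 qed
 have conv: "convergent (\<lambda>n. l m j (h (diagseq n)))" if "j \<in> J m" for m j
 proof -
  \<comment> \<open>From index \<open>Suc m\<close> on, the diagonal sequence is a subsequence of
    the one chosen at stage \<open>m\<close>.\<close>
  have "\<forall>j\<in>J m. convergent (\<lambda>n. l m j (h ((diagseq \<circ> (+) (Suc m)) n)))"
  proof (rule diagseq_holds)
   fix r s :: "nat \<Rightarrow> nat" and m
   assume r: "strict_mono r" and c: "\<forall>j\<in>J m. convergent (\<lambda>n. l m j (h (s n)))"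
   show "\<forall>j\<in>J m. convergent (\<lambda>n. l m j (h ((s \<circ> r) n)))"
   proof
    fix j assume "j \<in> J m"
    then show "convergent (\<lambda>n. l m j (h ((s \<circ> r) n)))"
     using convergent_subseq_convergent[OF _ r, of "\<lambda>n. l m j (h (s n))"] c by (simp add: o_def)
   qed
  qed
  then have "convergent (\<lambda>n. l m j (h (diagseq (n + Suc m))))" using that by (simp add: add.commute o_def)
  then show ?thesis by (subst (asm) convergent_ignore_initial_segment)
 qed
 have "\<exists>N. \<forall>i\<ge>N. \<forall>j\<ge>N. (LINT p|V. (h (diagseq i) p - h (diagseq j) p)^2) < e" if e: "e > 0" for e
 proof -
  \<comment> \<open>The gradient pairing of a difference integrates to at most
    \<open>4 * \<bar>C\<bar>\<close>; this \<open>m\<close> brings its share of the estimate below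
    \<open>e / 2\<close>.\<close>
  obtain m :: nat where m: "4 * \<bar>C\<bar> / (e / 2) < real (Suc m)" by (metis reals_Archimedean2 lessI less_trans of_nat_less_iff)
  have m': "1 / real (Suc m) * (4 * \<bar>C\<bar>) < e / 2" using m e by (simp add: field_simps)
  \<comment> \<open>Functionals that differ by less than \<open>t\<close> contribute at most
    \<open>e / 2\<close>; each summand 1 keeps a factor of the denominator positive.\<close>
  define t where "t = sqrt (e / (2 * (M m + 1) * (real (card (J m)) + 1)))"
  have t: "t > 0" "t^2 = e / (2 * (M m + 1) * (real (card (J m)) + 1))" using e M0[of m] by (auto simp: t_def)
  have "\<exists>N. \<forall>k\<in>J m. \<forall>i\<ge>N. \<forall>j\<ge>N. \<bar>l m k (h (diagseq i)) - l m k (h (diagseq j))\<bar> < t"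
  proof -
   define W where "W k N \<longleftrightarrow> (\<forall>i\<ge>N. \<forall>j\<ge>N. \<bar>l m k (h (diagseq i)) - l m k (h (diagseq j))\<bar> < t)" for k N
   have "\<exists>N. W k N" if "k \<in> J m" for k
    using CauchyD[OF convergent_Cauchy[OF conv[OF that]] t(1)] by (simp add: W_def)
   then obtain N where W: "\<And>k. k \<in> J m \<Longrightarrow> W k (N k)" by metis
   show ?thesis
   proof (intro exI[of _ "\<Sum>k\<in>J m. N k"] ballI allI impI)
    fix k i j assume k: "k \<in> J m" and ij: "i \<ge> (\<Sum>k\<in>J m. N k)" "j \<ge> (\<Sum>k\<in>J m. N k)"
    have "N k \<le> (\<Sum>k\<in>J m. N k)" using k fin by (intro member_le_sum) auto
    then show "\<bar>l m k (h (diagseq i)) - l m k (h (diagseq j))\<bar> < t" using W[OF k] ij by (auto simp: W_def)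
   qed
  qed
  then obtain N where N: "\<And>k i j. k \<in> J m \<Longrightarrow> i \<ge> N \<Longrightarrow> j \<ge> N \<Longrightarrow> \<bar>l m k (h (diagseq i)) - l m k (h (diagseq j))\<bar> < t" by blast
  have "(LINT p|V. (h (diagseq i) p - h (diagseq j) p)^2) < e" if ij: "i \<ge> N" "j \<ge> N" for i j
  proof -
   let ?u = "h (diagseq i)" and ?v = "h (diagseq j)"
   have s: "smooth_fun A (\<lambda>p. ?u p - ?v p)" by (intro smooth_fun_diff h)
   have "(LINT p|V. Gam (\<lambda>p. ?u p - ?v p) (\<lambda>p. ?u p - ?v p) p) \<le> (LINT p|V. 2 * Gam ?u ?u p + 2 * Gam ?v ?v p)"
   proof (rule integral_mono)
    show "integrable V (Gam (\<lambda>p. ?u p - ?v p) (\<lambda>p. ?u p - ?v p))" by (intro smooth_integrable smooth_Gam s)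
    show "integrable V (\<lambda>p. 2 * Gam ?u ?u p + 2 * Gam ?v ?v p)"
     by (intro smooth_integrable smooth_fun_add smooth_fun_cmult smooth_Gam h)
   qed (rule Gam_diff_le[OF h h])
   also have "\<dots> = 2 * (LINT p|V. Gam ?u ?u p) + 2 * (LINT p|V. Gam ?v ?v p)"
    using smooth_integrable[OF smooth_Gam[OF h h]] by simp
   also have "\<dots> \<le> 4 * \<bar>C\<bar>" using b(2)[of "diagseq i"] b(2)[of "diagseq j"] by linarith
   finally have 1: "1 / real (Suc m) * (LINT p|V. Gam (\<lambda>p. ?u p - ?v p) (\<lambda>p. ?u p - ?v p) p) < e / 2"
    using m' mult_left_mono[of _ "4 * \<bar>C\<bar>" "1 / real (Suc m)"] by (meson le_less_trans divide_nonneg_nonneg of_nat_0_le_iff zero_le_one)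
   have "(\<Sum>k\<in>J m. (l m k (\<lambda>p. ?u p - ?v p))^2) \<le> (\<Sum>k\<in>J m. t^2)"
   proof (rule sum_mono)
    fix k assume k: "k \<in> J m"
    have "\<bar>l m k (\<lambda>p. ?u p - ?v p)\<bar> \<le> \<bar>t\<bar>" using N[OF k ij] lin[OF h h k] t(1) by simp
    then show "(l m k (\<lambda>p. ?u p - ?v p))^2 \<le> t^2" by (simp add: abs_le_square_iff)
   qed
   also have "\<dots> \<le> (real (card (J m)) + 1) * t^2" by (simp add: distrib_right)
   finally have "M m * (\<Sum>k\<in>J m. (l m k (\<lambda>p. ?u p - ?v p))^2) \<le> (M m + 1) * ((real (card (J m)) + 1) * t^2)"
    using M0[of m] by (intro mult_mono) (auto intro: sum_nonneg)
   also have "\<dots> = e / 2"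
   proof -
    have "M m + 1 > 0" "real (card (J m)) + 1 > 0" using M0[of m] by auto
    moreover have "X * (Y * (e / (2 * X * Y))) = e / 2" if "X > 0" "Y > 0" for X Y
     using that by simp
    ultimately show ?thesis unfolding t(2) by blast
   qed
   finally show ?thesis using P[OF s, of m] 1 by linarith
  qed
  then show ?thesis by blast
 qed
 with subseq_diagseq show ?thesis by blast
qed

end

section \<open>Square integrable functions\<close>

text \<open>Functions are not identified up to null sets: on these functions \<open>ip\<close> is
  only a semi-inner product, and \<open>nsq M u = 0\<close> means that \<open>u\<close> vanishes
  almost everywhere.\<close>

definition sqi :: "'a measure \<Rightarrow> ('a \<Rightarrow> real) \<Rightarrow> bool" where
 "sqi M u \<longleftrightarrow> u \<in> borel_measurable M \<and> integrable M (\<lambda>x. (u x)^2)"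

definition ip :: "'a measure \<Rightarrow> ('a \<Rightarrow> real) \<Rightarrow> ('a \<Rightarrow> real) \<Rightarrow> real" where
 "ip M u v = (LINT x|M. u x * v x)"

abbreviation nsq :: "'a measure \<Rightarrow> ('a \<Rightarrow> real) \<Rightarrow> real" where "nsq M u \<equiv> ip M u u"

lemma nsq_eq: "nsq M u = (LINT x|M. (u x)^2)" by (simp add: ip_def power2_eq_square)

lemma sqi_mult_integrable:
 assumes "sqi M u" "sqi M v"
 shows "integrable M (\<lambda>x. u x * v x)"
proof (rule Bochner_Integration.integrable_bound)
 show "integrable M (\<lambda>x. (u x)^2 + (v x)^2)" using assms by (auto simp: sqi_def)
 show "(\<lambda>x. u x * v x) \<in> borel_measurable M" using assms by (auto simp: sqi_def)
 show "AE x in M. norm (u x * v x) \<le> norm ((u x)^2 + (v x)^2)"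
 proof (rule AE_I2)
  fix x
  have "2 * \<bar>u x\<bar> * \<bar>v x\<bar> \<le> (u x)^2 + (v x)^2" using sum_squares_bound[of "\<bar>u x\<bar>" "\<bar>v x\<bar>"] by simp
  moreover have "0 \<le> \<bar>u x\<bar> * \<bar>v x\<bar>" by simp
  ultimately have "\<bar>u x\<bar> * \<bar>v x\<bar> \<le> (u x)^2 + (v x)^2" by linarith
  then show "norm (u x * v x) \<le> norm ((u x)^2 + (v x)^2)" by (simp add: abs_mult)
 qed
qed

lemma sqi_zero: "sqi M (\<lambda>x. 0)" by (simp add: sqi_def)

lemma sqi_add: assumes "sqi M u" "sqi M v" shows "sqi M (\<lambda>x. u x + v x)"
 using assms sqi_mult_integrable[OF assms] by (auto simp: sqi_def power2_sum mult.assoc)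

lemma sqi_cmult: "sqi M u \<Longrightarrow> sqi M (\<lambda>x. c * u x)"
 by (auto simp: sqi_def power_mult_distrib)

lemma sqi_diff: "sqi M u \<Longrightarrow> sqi M v \<Longrightarrow> sqi M (\<lambda>x. u x - v x)"
 using sqi_add[OF _ sqi_cmult[of M v "-1"], of u] by simp

lemma sqi_sum: "finite I \<Longrightarrow> (\<And>i. i \<in> I \<Longrightarrow> sqi M (u i)) \<Longrightarrow> sqi M (\<lambda>x. \<Sum>i\<in>I. u i x)"
 by (induction I rule: finite_induct) (auto intro: sqi_zero sqi_add)

lemma ip_commute: "ip M u v = ip M v u" by (simp add: ip_def mult.commute)

lemma ip_add: "sqi M u \<Longrightarrow> sqi M v \<Longrightarrow> sqi M w \<Longrightarrow> ip M (\<lambda>x. u x + v x) w = ip M u w + ip M v w"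
 "sqi M u \<Longrightarrow> sqi M v \<Longrightarrow> sqi M w \<Longrightarrow> ip M w (\<lambda>x. u x + v x) = ip M w u + ip M w v"
 using sqi_mult_integrable[of M] by (simp_all add: ip_def distrib_right distrib_left)

lemma ip_diff: "sqi M u \<Longrightarrow> sqi M v \<Longrightarrow> sqi M w \<Longrightarrow> ip M (\<lambda>x. u x - v x) w = ip M u w - ip M v w"
 "sqi M u \<Longrightarrow> sqi M v \<Longrightarrow> sqi M w \<Longrightarrow> ip M w (\<lambda>x. u x - v x) = ip M w u - ip M w v"
 using sqi_mult_integrable[of M] by (simp_all add: ip_def right_diff_distrib left_diff_distrib)

lemma ip_cmult: "ip M (\<lambda>x. c * u x) w = c * ip M u w" "ip M w (\<lambda>x. c * u x) = c * ip M w u"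
 unfolding ip_def by (simp_all add: mult.assoc mult.left_commute[of _ c])

lemma ip_sum:
 assumes "finite I" "\<And>i. i \<in> I \<Longrightarrow> sqi M (u i)" "sqi M w"
 shows "ip M (\<lambda>x. \<Sum>i\<in>I. u i x) w = (\<Sum>i\<in>I. ip M (u i) w)" "ip M w (\<lambda>x. \<Sum>i\<in>I. u i x) = (\<Sum>i\<in>I. ip M w (u i))"
 using assms sqi_mult_integrable[of M]
 by (auto simp: ip_def sum_distrib_right sum_distrib_left intro!: Bochner_Integration.integral_sum)

lemma nsq_nonneg: "nsq M u \<ge> 0"
 unfolding nsq_eq by (intro integral_nonneg_AE) auto

lemma nsq_add: "sqi M u \<Longrightarrow> sqi M v \<Longrightarrow> nsq M (\<lambda>x. u x + v x) = nsq M u + 2 * ip M u v + nsq M v"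
 by (simp add: ip_add sqi_add ip_commute[of M v u])

lemma nsq_diff: "sqi M u \<Longrightarrow> sqi M v \<Longrightarrow> nsq M (\<lambda>x. u x - v x) = nsq M u - 2 * ip M u v + nsq M v"
 by (simp add: ip_diff sqi_diff ip_commute[of M v u])

lemma nsq_add_le: "sqi M u \<Longrightarrow> sqi M v \<Longrightarrow> nsq M (\<lambda>x. u x + v x) \<le> 2 * nsq M u + 2 * nsq M v"
 using nsq_nonneg[of M "\<lambda>x. u x - v x"] by (simp add: nsq_add nsq_diff)

lemma nsq_diff_le: "sqi M u \<Longrightarrow> sqi M v \<Longrightarrow> nsq M (\<lambda>x. u x - v x) \<le> 2 * nsq M u + 2 * nsq M v"
 using nsq_nonneg[of M "\<lambda>x. u x + v x"] by (simp add: nsq_add nsq_diff)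

lemma nsq_diff_commute: "nsq M (\<lambda>x. u x - v x) = nsq M (\<lambda>x. v x - u x)"
 by (simp add: nsq_eq power2_commute)

lemma ip_cauchy_schwarz:
 assumes "sqi M u" "sqi M v"
 shows "(ip M u v)^2 \<le> nsq M u * nsq M v"
proof (cases "nsq M v = 0")
 case False
 then have v: "nsq M v > 0" using nsq_nonneg[of M v] by simp
 have "0 \<le> nsq M (\<lambda>x. u x - (ip M u v / nsq M v) * v x)" by (rule nsq_nonneg)
 also have "\<dots> = nsq M u - (ip M u v)^2 / nsq M v"
  using assms v by (simp only: nsq_diff sqi_cmult ip_cmult) (simp add: power2_eq_square)
 finally show ?thesis using v by (simp add: field_simps)
next
 case True
 \<comment> \<open>With \<open>nsq M v = 0\<close> the expansion is affine in \<open>t\<close>;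
   since it is nonnegative for all \<open>t\<close>, its slope vanishes.\<close>
 have "0 \<le> nsq M (\<lambda>x. u x - (t * ip M u v) * v x)" for t by (rule nsq_nonneg)
 then have *: "0 \<le> nsq M u - 2 * t * (ip M u v)^2" for t
  using assms True by (simp only: nsq_diff sqi_cmult ip_cmult) (simp add: power2_eq_square mult_ac)
 have "(ip M u v)^2 = 0"
 proof (rule ccontr)
  assume "(ip M u v)^2 \<noteq> 0"
  then show False using *[of "(nsq M u + 1) / (2 * (ip M u v)^2)"] by simp
 qed
 then show ?thesis using True by simp
qed

lemma ip_abs_le: "sqi M u \<Longrightarrow> sqi M v \<Longrightarrow> \<bar>ip M u v\<bar> \<le> sqrt (nsq M u) * sqrt (nsq M v)"
 using ip_cauchy_schwarz[of M u v] by (metis real_sqrt_abs real_sqrt_le_mono real_sqrt_mult)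

lemma nsq_AE_zero:
 assumes "sqi M u" "nsq M u = 0"
 shows "AE x in M. u x = 0"
proof -
 have "AE x in M. (u x)^2 = 0"
  using assms integral_nonneg_eq_0_iff_AE[of M "\<lambda>x. (u x)^2"] by (auto simp: sqi_def nsq_eq)
 then show ?thesis by simp
qed

lemma ip_cong_AE:
 assumes "AE x in M. u x = u' x" "sqi M u" "sqi M u'" "sqi M v"
 shows "ip M u v = ip M u' v"
 unfolding ip_def using assms by (intro integral_cong_AE) (auto simp: sqi_def elim: AE_mp)

section \<open>Convergence and completeness in L^2\<close>

definition conv2 :: "'a measure \<Rightarrow> (nat \<Rightarrow> 'a \<Rightarrow> real) \<Rightarrow> ('a \<Rightarrow> real) \<Rightarrow> bool" where
 "conv2 M s u \<longleftrightarrow> (\<forall>n. sqi M (s n)) \<and> sqi M u \<and> (\<lambda>n. nsq M (\<lambda>x. s n x - u x)) \<longlonglongrightarrow> 0"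

definition cauchy2 :: "'a measure \<Rightarrow> (nat \<Rightarrow> 'a \<Rightarrow> real) \<Rightarrow> bool" where
 "cauchy2 M s \<longleftrightarrow> (\<forall>n. sqi M (s n)) \<and> (\<forall>e>0. \<exists>N. \<forall>i\<ge>N. \<forall>j\<ge>N. nsq M (\<lambda>x. s i x - s j x) < e)"

lemma conv2_ip_const:
 assumes "conv2 M s u" "sqi M v"
 shows "(\<lambda>n. ip M (s n) v) \<longlonglongrightarrow> ip M u v"
proof -
 have s: "sqi M (s n)" "sqi M u" for n using assms(1) by (auto simp: conv2_def)
 have "(\<lambda>n. sqrt (nsq M (\<lambda>x. s n x - u x)) * sqrt (nsq M v)) \<longlonglongrightarrow> sqrt 0 * sqrt (nsq M v)"
  using assms(1) by (intro tendsto_intros) (simp add: conv2_def)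
 then have lim: "(\<lambda>n. sqrt (nsq M (\<lambda>x. s n x - u x)) * sqrt (nsq M v)) \<longlonglongrightarrow> 0" by simp
 have le: "norm (ip M (s n) v - ip M u v) \<le> sqrt (nsq M (\<lambda>x. s n x - u x)) * sqrt (nsq M v)" for n
  using ip_abs_le[OF sqi_diff[OF s] assms(2), of n] by (simp add: ip_diff s assms(2))
 have "(\<lambda>n. ip M (s n) v - ip M u v) \<longlonglongrightarrow> 0"
  by (rule Lim_null_comparison[OF always_eventually lim]) (use le in blast)
 then show ?thesis by (simp add: LIM_zero_iff)
qed

lemma conv2_nsq:
 assumes "conv2 M s u"
 shows "(\<lambda>n. nsq M (s n)) \<longlonglongrightarrow> nsq M u"
proof -
 have s: "sqi M (s n)" "sqi M u" for n using assms(1) by (auto simp: conv2_def)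
 have "(\<lambda>n. nsq M (\<lambda>x. s n x - u x) + 2 * ip M (s n) u - nsq M u) \<longlonglongrightarrow> 0 + 2 * ip M u u - nsq M u"
  using assms by (intro tendsto_intros conv2_ip_const s) (simp add: conv2_def)
 then show ?thesis by (simp add: nsq_diff s)
qed

lemma conv2_add:
 assumes "conv2 M s u" "conv2 M t v"
 shows "conv2 M (\<lambda>n x. s n x + t n x) (\<lambda>x. u x + v x)"
 unfolding conv2_def
proof (intro conjI allI)
 have s: "sqi M (s n)" "sqi M u" "sqi M (t n)" "sqi M v" for n using assms by (auto simp: conv2_def)
 show "sqi M (\<lambda>x. s n x + t n x)" "sqi M (\<lambda>x. u x + v x)" for n by (intro sqi_add s)+
 have "(\<lambda>n. 2 * nsq M (\<lambda>x. s n x - u x) + 2 * nsq M (\<lambda>x. t n x - v x)) \<longlonglongrightarrow> 2 * 0 + 2 * 0"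
  using assms by (intro tendsto_intros) (auto simp: conv2_def)
 then have lim: "(\<lambda>n. 2 * nsq M (\<lambda>x. s n x - u x) + 2 * nsq M (\<lambda>x. t n x - v x)) \<longlonglongrightarrow> 0" by simp
 show "(\<lambda>n. nsq M (\<lambda>x. s n x + t n x - (u x + v x))) \<longlonglongrightarrow> 0"
 proof (rule tendsto_sandwich[OF _ _ tendsto_const lim])
  show "\<forall>\<^sub>F n in sequentially. nsq M (\<lambda>x. s n x + t n x - (u x + v x)) \<le> 2 * nsq M (\<lambda>x. s n x - u x) + 2 * nsq M (\<lambda>x. t n x - v x)"
  proof (rule always_eventually, rule allI)
   fix n
   show "nsq M (\<lambda>x. s n x + t n x - (u x + v x)) \<le> 2 * nsq M (\<lambda>x. s n x - u x) + 2 * nsq M (\<lambda>x. t n x - v x)"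
    using nsq_add_le[OF sqi_diff[OF s(1,2)] sqi_diff[OF s(3,4)], of n n] by (simp add: algebra_simps)
  qed
 qed (simp add: nsq_nonneg)
qed

lemma conv2_cmult:
 assumes "conv2 M s u"
 shows "conv2 M (\<lambda>n x. c * s n x) (\<lambda>x. c * u x)"
proof -
 have "nsq M (\<lambda>x. c * s n x - c * u x) = c^2 * nsq M (\<lambda>x. s n x - u x)" for n
  by (simp add: ip_cmult power2_eq_square flip: right_diff_distrib)
 moreover have "(\<lambda>n. c^2 * nsq M (\<lambda>x. s n x - u x)) \<longlonglongrightarrow> c^2 * 0"
  using assms by (intro tendsto_intros) (simp add: conv2_def)
 ultimately show ?thesis using assms by (simp add: conv2_def sqi_cmult)
qed

lemma conv2_ip:
 assumes "conv2 M s u" "conv2 M t v"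
 shows "(\<lambda>n. ip M (s n) (t n)) \<longlonglongrightarrow> ip M u v"
proof -
 have s: "sqi M (s n)" "sqi M u" "sqi M (t n)" "sqi M v" for n using assms by (auto simp: conv2_def)
 have "(\<lambda>n. (nsq M (\<lambda>x. s n x + t n x) - nsq M (s n) - nsq M (t n)) / 2)
   \<longlonglongrightarrow> (nsq M (\<lambda>x. u x + v x) - nsq M u - nsq M v) / 2"
  by (intro tendsto_intros conv2_nsq conv2_add assms) auto
 then show ?thesis by (simp add: nsq_add s)
qed

lemma conv2_const: "sqi M u \<Longrightarrow> conv2 M (\<lambda>n. u) u"
 by (simp add: conv2_def nsq_eq)

lemma conv2_cauchy2:
 assumes "conv2 M s u"
 shows "cauchy2 M s"
 unfolding cauchy2_def
proof (intro conjI allI impI)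
 have s: "sqi M (s n)" "sqi M u" for n using assms(1) by (auto simp: conv2_def)
 show "sqi M (s n)" for n by (rule s)
 fix e :: real assume e: "e > 0"
 have "(\<lambda>n. nsq M (\<lambda>x. s n x - u x)) \<longlonglongrightarrow> 0" using assms by (simp add: conv2_def)
 then have "\<forall>\<^sub>F n in sequentially. nsq M (\<lambda>x. s n x - u x) < e / 4"
  by (rule order_tendstoD(2)) (use e in simp)
 then obtain N where N: "\<And>n. n \<ge> N \<Longrightarrow> nsq M (\<lambda>x. s n x - u x) < e / 4" by (auto simp: eventually_sequentially)
 show "\<exists>N. \<forall>i\<ge>N. \<forall>j\<ge>N. nsq M (\<lambda>x. s i x - s j x) < e"
 proof (intro exI[of _ N] allI impI)
  fix i j assume "i \<ge> N" "j \<ge> N"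
  then show "nsq M (\<lambda>x. s i x - s j x) < e"
   using nsq_diff_le[OF sqi_diff[OF s] sqi_diff[OF s], of i j] N[of i] N[of j] by simp
 qed
qed

text \<open>On a finite measure space an L^2 Cauchy sequence is L^1 Cauchy, so a subsequence
  converges almost everywhere; Fatou's lemma along it transfers the Cauchy bounds to the
  limit.\<close>

lemma L2_complete:
 assumes fin: "finite_measure M" and c: "cauchy2 M s"
 shows "\<exists>u. conv2 M s u"
proof -
 interpret finite_measure M by (rule fin)
 have s: "sqi M (s n)" for n using c by (simp add: cauchy2_def)
 have sm[measurable]: "s n \<in> borel_measurable M" for n using s by (simp add: sqi_def)
 have one: "sqi M (\<lambda>x. 1)" by (simp add: sqi_def)
 have abs: "sqi M (\<lambda>x. \<bar>u x\<bar>)" if "sqi M u" for u using that by (simp add: sqi_def borel_measurable_abs)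
 have int: "integrable M (s n)" for n using sqi_mult_integrable[OF s one] by simp
 define m where "m = nsq M (\<lambda>x. 1)"
 have m: "m \<ge> 0" by (simp add: m_def nsq_nonneg)
 have L1: "\<exists>N. \<forall>i\<ge>N. \<forall>j\<ge>N. (LINT x|M. norm (s i x - s j x)) < e" if e: "e > 0" for e
 proof -
  have "e^2 / (m + 1) > 0" using e m by (simp add: add_nonneg_pos)
  then obtain N where N: "\<forall>i\<ge>N. \<forall>j\<ge>N. nsq M (\<lambda>x. s i x - s j x) < e^2 / (m + 1)" using c by (auto simp: cauchy2_def)
  have "(LINT x|M. norm (s i x - s j x)) < e" if "i \<ge> N" "j \<ge> N" for i j
  proof -
   have "(ip M (\<lambda>x. \<bar>s i x - s j x\<bar>) (\<lambda>x. 1))^2 \<le> nsq M (\<lambda>x. \<bar>s i x - s j x\<bar>) * m"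
    unfolding m_def by (rule ip_cauchy_schwarz[OF abs[OF sqi_diff[OF s s]] one])
   also have "\<dots> \<le> nsq M (\<lambda>x. s i x - s j x) * (m + 1)"
    using nsq_nonneg[of M "\<lambda>x. s i x - s j x"] by (simp add: nsq_eq mult_left_mono)
   also have "\<dots> < e^2" using N that m by (simp add: field_simps add_nonneg_pos)
   finally show ?thesis using e by (simp add: ip_def power2_less_imp_less)
  qed
  then show ?thesis by blast
 qed
 obtain r where r: "strict_mono r" "AE x in M. Cauchy (\<lambda>i. s (r i) x)"
  by (rule cauchy_L1_AE_cauchy_subseq[OF int L1])
 define u where "u x = lim (\<lambda>i. s (r i) x)" for x
 have um[measurable]: "u \<in> borel_measurable M" unfolding u_def by measurable
 have lim: "AE x in M. (\<lambda>i. s (r i) x) \<longlonglongrightarrow> u x"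
  using r(2) by (rule AE_mp) (auto simp: u_def convergent_LIMSEQ_iff[symmetric] Cauchy_convergent_iff)
 have fatou: "(\<integral>\<^sup>+x. ennreal ((s n x - u x)^2) \<partial>M) \<le> ennreal e"
  if e: "\<And>j. j \<ge> N \<Longrightarrow> nsq M (\<lambda>x. s n x - s j x) \<le> e" for n N e
 proof -
  have "(\<integral>\<^sup>+x. ennreal ((s n x - u x)^2) \<partial>M) = (\<integral>\<^sup>+x. liminf (\<lambda>i. ennreal ((s n x - s (r i) x)^2)) \<partial>M)"
  proof (rule nn_integral_cong_AE, rule AE_mp[OF lim], intro AE_I2 impI)
   fix x assume "(\<lambda>i. s (r i) x) \<longlonglongrightarrow> u x"
   then have "(\<lambda>i. ennreal ((s n x - s (r i) x)^2)) \<longlonglongrightarrow> ennreal ((s n x - u x)^2)"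
    by (intro tendsto_ennrealI tendsto_intros)
   then show "ennreal ((s n x - u x)^2) = liminf (\<lambda>i. ennreal ((s n x - s (r i) x)^2))"
    by (intro lim_imp_Liminf[symmetric]) auto
  qed
  also have "\<dots> \<le> liminf (\<lambda>i. \<integral>\<^sup>+x. ennreal ((s n x - s (r i) x)^2) \<partial>M)" by (rule nn_integral_liminf) simp
  also have "\<dots> \<le> liminf (\<lambda>i. ennreal e)"
  proof (rule Liminf_mono, rule eventually_mono[OF eventually_ge_at_top[of N]])
   fix i assume "i \<ge> N"
   then have "r i \<ge> N" using seq_suble[OF r(1), of i] by linarith
   have "(\<integral>\<^sup>+x. ennreal ((s n x - s (r i) x)^2) \<partial>M) = ennreal (nsq M (\<lambda>x. s n x - s (r i) x))"
    unfolding nsq_eq using sqi_diff[OF s s] by (intro nn_integral_eq_integral) (auto simp: sqi_def)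
   then show "(\<integral>\<^sup>+x. ennreal ((s n x - s (r i) x)^2) \<partial>M) \<le> ennreal e"
    using e[OF \<open>r i \<ge> N\<close>] by (simp add: ennreal_leI)
  qed
  also have "\<dots> = ennreal e" by (simp add: Liminf_const)
  finally show ?thesis .
 qed
 have int_diff: "sqi M (\<lambda>x. s n x - u x)" "nsq M (\<lambda>x. s n x - u x) \<le> e"
  if e: "\<And>j. j \<ge> N \<Longrightarrow> nsq M (\<lambda>x. s n x - s j x) \<le> e" for n N e
 proof -
  have e0: "e \<ge> 0" using e[OF order_refl] nsq_nonneg[of M] order_trans by blast
  have i: "integrable M (\<lambda>x. (s n x - u x)^2)"
   by (rule integrableI_nonneg) (use le_less_trans[OF fatou[OF e] ennreal_less_top] in auto)
  then show "sqi M (\<lambda>x. s n x - u x)" by (simp add: sqi_def)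
  have "ennreal (nsq M (\<lambda>x. s n x - u x)) \<le> ennreal e"
   using fatou[OF e] nn_integral_eq_integral[OF i] by (simp add: nsq_eq)
  then show "nsq M (\<lambda>x. s n x - u x) \<le> e" using e0 by (simp add: ennreal_le_iff)
 qed
 have small: "\<exists>N. \<forall>n\<ge>N. sqi M (\<lambda>x. s n x - u x) \<and> nsq M (\<lambda>x. s n x - u x) < e" if e: "e > 0" for e
 proof -
  obtain N where N: "\<And>i j. i \<ge> N \<Longrightarrow> j \<ge> N \<Longrightarrow> nsq M (\<lambda>x. s i x - s j x) < e / 2"
   using c e unfolding cauchy2_def by (meson half_gt_zero)
  have "sqi M (\<lambda>x. s n x - u x) \<and> nsq M (\<lambda>x. s n x - u x) < e" if "n \<ge> N" for n
  proof -
   have *: "nsq M (\<lambda>x. s n x - s j x) \<le> e / 2" if "j \<ge> N" for j using N[OF \<open>n \<ge> N\<close> that] by simp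
   show ?thesis using int_diff[of N n "e / 2"] * e by fastforce
  qed
  then show ?thesis by blast
 qed
 obtain N where "sqi M (\<lambda>x. s N x - u x)" using small[of 1] by auto
 from sqi_diff[OF s[of N] this] have u: "sqi M u" by simp
 have "(\<lambda>n. nsq M (\<lambda>x. s n x - u x)) \<longlonglongrightarrow> 0"
 proof (rule LIMSEQ_I)
  fix e :: real assume "e > 0"
  then obtain N where "\<And>n. n \<ge> N \<Longrightarrow> nsq M (\<lambda>x. s n x - u x) < e" using small by blast
  then show "\<exists>N. \<forall>n\<ge>N. norm (nsq M (\<lambda>x. s n x - u x) - 0) < e" using nsq_nonneg[of M] by auto
 qed
 then show ?thesis using s u unfolding conv2_def by blast
qed

section \<open>Minimisers for the square of a symmetric operator\<close>

text \<open>A quadratic polynomial with its minimum at 0 has no linear term. This is the vanishing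
  of the first variation in \<open>minimiser\<close>.\<close>

lemma linear_nonneg_imp_zero:
 assumes "\<And>t::real. 0 \<le> 2 * t * a + t^2 * b"
 shows "a = 0"
proof (rule ccontr)
 assume a: "a \<noteq> 0"
 define B where "B = \<bar>b\<bar> + 1"
 have B: "B > 0" "b \<le> B" by (auto simp: B_def)
 have "(- a / B)^2 * b \<le> (- a / B)^2 * B" by (intro mult_left_mono B) auto
 also have "\<dots> = a^2 / B" using B by (simp add: power2_eq_square)
 finally have "0 \<le> 2 * (- a / B) * a + a^2 / B" using assms[of "- a / B"] by simp
 also have "\<dots> = - (a^2 / B)" by (simp add: power2_eq_square)
 finally have "\<not> a^2 / B > 0" by linarith
 then show False using a B by (simp add: divide_pos_pos)
qed

text \<open>Abstracts the Laplacian on test functions; the last assumption is Rellich compactness in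
  the graph norm.\<close>

locale symmetric_operator =
 fixes M :: "'a measure" and T :: "('a \<Rightarrow> real) set" and L :: "('a \<Rightarrow> real) \<Rightarrow> 'a \<Rightarrow> real"
 assumes fin: "finite_measure M"
  and T_sqi: "w \<in> T \<Longrightarrow> sqi M w"
  and T_zero: "(\<lambda>x. 0) \<in> T"
  and T_add: "w \<in> T \<Longrightarrow> \<psi> \<in> T \<Longrightarrow> (\<lambda>x. w x + \<psi> x) \<in> T"
  and T_cmult: "w \<in> T \<Longrightarrow> (\<lambda>x. c * w x) \<in> T"
  and T_L: "w \<in> T \<Longrightarrow> L w \<in> T"
  and L_add: "w \<in> T \<Longrightarrow> \<psi> \<in> T \<Longrightarrow> L (\<lambda>x. w x + \<psi> x) = (\<lambda>x. L w x + L \<psi> x)"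
  and L_cmult: "w \<in> T \<Longrightarrow> L (\<lambda>x. c * w x) = (\<lambda>x. c * L w x)"
  and L_sym: "w \<in> T \<Longrightarrow> \<psi> \<in> T \<Longrightarrow> ip M (L w) \<psi> = ip M w (L \<psi>)"
  and T_compact: "(\<And>n::nat. s n \<in> T) \<Longrightarrow> (\<And>n. nsq M (s n) \<le> C) \<Longrightarrow> (\<And>n. nsq M (L (s n)) \<le> C) \<Longrightarrow>
   \<exists>r. strict_mono (r :: nat \<Rightarrow> nat) \<and> cauchy2 M (\<lambda>n. s (r n))"
begin

text \<open>The graph of the L^2 closure of \<open>L\<close>: \<open>u\<close> lies in the domain
  and \<open>v\<close> is a value at \<open>u\<close>. A relation is used because such a value is
  determined at most up to null sets.\<close>

definition W :: "('a \<Rightarrow> real) \<Rightarrow> ('a \<Rightarrow> real) \<Rightarrow> bool" where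
 "W u v \<longleftrightarrow> (\<exists>w. (\<forall>n. w n \<in> T) \<and> conv2 M w u \<and> conv2 M (\<lambda>n. L (w n)) v)"

lemma W_sqi: assumes "W u v" shows "sqi M u" "sqi M v"
 using assms by (auto simp: W_def conv2_def)

lemma W_T: assumes "w \<in> T" shows "W w (L w)"
 unfolding W_def using assms by (intro exI[of _ "\<lambda>_. w"]) (auto intro!: conv2_const T_sqi T_L)

lemma W_zero: "W (\<lambda>x. 0) (\<lambda>x. 0)"
 using W_T[OF T_zero] L_cmult[OF T_zero, of 0] by simp

lemma W_add: assumes "W u v" "W u' v'" shows "W (\<lambda>x. u x + u' x) (\<lambda>x. v x + v' x)"
proof -
 obtain w \<psi> where "\<forall>n. w n \<in> T" "conv2 M w u" "conv2 M (\<lambda>n. L (w n)) v"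
  "\<forall>n. \<psi> n \<in> T" "conv2 M \<psi> u'" "conv2 M (\<lambda>n. L (\<psi> n)) v'"
  using assms unfolding W_def by metis
 then show ?thesis
  unfolding W_def by (intro exI[of _ "\<lambda>n x. w n x + \<psi> n x"]) (simp add: conv2_add T_add L_add)
qed

lemma W_cmult: assumes "W u v" shows "W (\<lambda>x. c * u x) (\<lambda>x. c * v x)"
proof -
 obtain w where "\<forall>n. w n \<in> T" "conv2 M w u" "conv2 M (\<lambda>n. L (w n)) v"
  using assms unfolding W_def by metis
 then show ?thesis
  unfolding W_def by (intro exI[of _ "\<lambda>n x. c * w n x"]) (simp add: conv2_cmult T_cmult L_cmult)
qed

lemma W_diff: "W u v \<Longrightarrow> W u' v' \<Longrightarrow> W (\<lambda>x. u x - u' x) (\<lambda>x. v x - v' x)"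
 using W_add[OF _ W_cmult[of u' v' "-1"], of u v] by simp

lemma W_sum: "finite I \<Longrightarrow> (\<And>i. i \<in> I \<Longrightarrow> W (u i) (v i)) \<Longrightarrow> W (\<lambda>x. \<Sum>i\<in>I. u i x) (\<lambda>x. \<Sum>i\<in>I. v i x)"
 by (induction I rule: finite_induct) (auto intro: W_zero W_add)

lemma T_diff: "w \<in> T \<Longrightarrow> \<psi> \<in> T \<Longrightarrow> (\<lambda>x. w x - \<psi> x) \<in> T"
 "w \<in> T \<Longrightarrow> \<psi> \<in> T \<Longrightarrow> L (\<lambda>x. w x - \<psi> x) = (\<lambda>x. L w x - L \<psi> x)"
 using T_add[OF _ T_cmult[of \<psi> "-1"], of w] L_add[OF _ T_cmult[of \<psi> "-1"], of w] L_cmult[of \<psi> "-1"] by simp_all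

lemma W_sym: assumes "W u v" "W u' v'" shows "ip M v u' = ip M u v'"
proof -
 obtain w \<psi> where *: "\<forall>n. w n \<in> T" "conv2 M w u" "conv2 M (\<lambda>n. L (w n)) v"
  "\<forall>n. \<psi> n \<in> T" "conv2 M \<psi> u'" "conv2 M (\<lambda>n. L (\<psi> n)) v'"
  using assms unfolding W_def by metis
 have "(\<lambda>n. ip M (L (w n)) (\<psi> n)) \<longlonglongrightarrow> ip M v u'" by (rule conv2_ip[OF *(3,5)])
 moreover have "(\<lambda>n. ip M (L (w n)) (\<psi> n)) \<longlonglongrightarrow> ip M u v'" using conv2_ip[OF *(2,6)] * by (simp add: L_sym)
 ultimately show ?thesis by (rule LIMSEQ_unique)
qed

lemma W_approx:
 assumes "W u v" "e > 0"
 obtains w where "w \<in> T" "nsq M (\<lambda>x. w x - u x) < e" "nsq M (\<lambda>x. L w x - v x) < e"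
proof -
 obtain w where w: "\<forall>n. w n \<in> T" "conv2 M w u" "conv2 M (\<lambda>n. L (w n)) v" using assms(1) unfolding W_def by metis
 have "\<forall>\<^sub>F n in sequentially. nsq M (\<lambda>x. w n x - u x) < e" "\<forall>\<^sub>F n in sequentially. nsq M (\<lambda>x. L (w n) x - v x) < e"
  using w assms(2) unfolding conv2_def by (auto intro: order_tendstoD(2))
 from eventually_happens[OF eventually_conj[OF this]] w(1) show ?thesis by (auto intro: that)
qed

lemma conv2_perturb:
 assumes "conv2 M s u" "\<And>n. sqi M (t n)" "\<And>n. nsq M (\<lambda>x. t n x - s n x) < 1 / real (Suc n)"
 shows "conv2 M t u"
proof -
 have s: "sqi M (s n)" for n using assms(1) by (simp add: conv2_def)
 have "(\<lambda>n. nsq M (\<lambda>x. t n x - s n x)) \<longlonglongrightarrow> 0"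
  by (rule tendsto_sandwich[OF _ _ tendsto_const LIMSEQ_Suc[OF lim_const_over_n[of 1]]])
   (use assms(3) in \<open>auto intro!: always_eventually less_imp_le simp: nsq_nonneg simp del: of_nat_Suc\<close>)
 then have "conv2 M (\<lambda>n x. t n x - s n x) (\<lambda>x. 0)" using assms(2) s by (simp add: conv2_def sqi_diff sqi_zero)
 from conv2_add[OF assms(1) this] show ?thesis by simp
qed

text \<open>Replaces elements of the closure by elements of \<open>T\<close> with errors tending to
  0, which reduces closedness and compactness to sequences in \<open>T\<close>.\<close>

lemma W_sequence:
 assumes "\<And>n. W (u n) (v n)"
 obtains w where "\<And>n. w n \<in> T" "\<And>n. nsq M (\<lambda>x. w n x - u n x) < 1 / real (Suc n)"
  "\<And>n. nsq M (\<lambda>x. L (w n) x - v n x) < 1 / real (Suc n)"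
proof -
 define R where "R n w \<longleftrightarrow> w \<in> T \<and> nsq M (\<lambda>x. w x - u n x) < 1 / real (Suc n) \<and> nsq M (\<lambda>x. L w x - v n x) < 1 / real (Suc n)" for n w
 have "\<exists>w. R n w" for n
  by (rule W_approx[OF assms[of n], of "1 / real (Suc n)"]) (auto simp: R_def)
 then obtain w where R: "\<And>n. R n (w n)" by metis
 show ?thesis by (rule that[of w]) (use R in \<open>auto simp: R_def\<close>)
qed

lemma W_closed:
 assumes W: "\<And>n. W (u n) (v n)" and u: "conv2 M u x" and v: "conv2 M v y"
 shows "W x y"
proof -
 obtain w where w: "\<And>n. w n \<in> T" "\<And>n. nsq M (\<lambda>x. w n x - u n x) < 1 / real (Suc n)"
  "\<And>n. nsq M (\<lambda>x. L (w n) x - v n x) < 1 / real (Suc n)" by (rule W_sequence[of u v, OF W]) (rule that; assumption)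
 have "conv2 M w x" by (rule conv2_perturb[OF u T_sqi[OF w(1)] w(2)])
 moreover have "conv2 M (\<lambda>n. L (w n)) y" by (rule conv2_perturb[OF v T_sqi[OF T_L[OF w(1)]] w(3)])
 ultimately show ?thesis using w(1) unfolding W_def by blast
qed

lemma W_compact:
 assumes W: "\<And>n. W (u n) (v n)" and b: "\<And>n. nsq M (u n) \<le> C" "\<And>n. nsq M (v n) \<le> C"
 shows "\<exists>r. strict_mono (r :: nat \<Rightarrow> nat) \<and> (\<exists>x. conv2 M (\<lambda>n. u (r n)) x)"
proof -
 obtain w where w: "\<And>n. w n \<in> T" "\<And>n. nsq M (\<lambda>x. w n x - u n x) < 1 / real (Suc n)"
  "\<And>n. nsq M (\<lambda>x. L (w n) x - v n x) < 1 / real (Suc n)" by (rule W_sequence[of u v, OF W]) (rule that; assumption)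
 note s = W_sqi[OF W]
 have le: "nsq M p \<le> 2 + 2 * C" if "sqi M p" "sqi M q" "nsq M (\<lambda>x. p x - q x) < 1 / real (Suc n)" "nsq M q \<le> C" for p q n
 proof -
  have "1 / real (Suc n) \<le> 1" by simp
  moreover have "nsq M p \<le> 2 * nsq M (\<lambda>x. p x - q x) + 2 * nsq M q" using nsq_add_le[OF sqi_diff[OF that(1,2)] that(2)] by simp
  ultimately show ?thesis using that(3,4) by linarith
 qed
 have "\<exists>r. strict_mono (r :: nat \<Rightarrow> nat) \<and> cauchy2 M (\<lambda>n. w (r n))"
  by (rule T_compact[where s = w and C = "2 + 2 * C", OF w(1)]) (rule le[OF T_sqi[OF w(1)] s(1) w(2) b(1)] le[OF T_sqi[OF T_L[OF w(1)]] s(2) w(3) b(2)])+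
 then obtain r x where r: "strict_mono (r :: nat \<Rightarrow> nat)" and x: "conv2 M (\<lambda>n. w (r n)) x" using L2_complete[OF fin] by blast
 have "conv2 M (\<lambda>n. u (r n)) x"
 proof (rule conv2_perturb[OF x s(1)])
  fix n
  have "nsq M (\<lambda>x. u (r n) x - w (r n) x) < 1 / real (Suc (r n))" using w(2)[of "r n"] by (subst nsq_diff_commute)
  also have "\<dots> \<le> 1 / real (Suc n)" using seq_suble[OF r, of n] by (simp add: frac_le)
  finally show "nsq M (\<lambda>x. u (r n) x - w (r n) x) < 1 / real (Suc n)" .
 qed
 with r show ?thesis by blast
qed

text \<open>The direct method. If a pair orthogonal to the \<open>e i\<close> has a quotient below
  \<open>\<Lambda>\<close>, the infimum \<open>m\<close> of the quotient over the orthogonal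
  complement is attained by compactness, and the minimiser solves the eigenvalue equation there.
  Since the \<open>e i\<close> are eigenfunctions themselves, the equation extends to all
  pairs.\<close>

lemma minimiser:
 fixes e f :: "'i \<Rightarrow> 'a \<Rightarrow> real"
 assumes I: "finite I" and ef: "\<And>i. i \<in> I \<Longrightarrow> W (e i) (f i)"
  and orth: "\<And>i j. i \<in> I \<Longrightarrow> j \<in> I \<Longrightarrow> ip M (e i) (e j) = (if i = j then 1 else 0)"
  and eig: "\<And>i u v. i \<in> I \<Longrightarrow> W u v \<Longrightarrow> ip M (f i) v = l i * ip M (e i) u"
  and uv: "W u0 v0" "\<And>i. i \<in> I \<Longrightarrow> ip M (e i) u0 = 0" "nsq M v0 < \<Lambda> * nsq M u0"
 obtains x y \<mu> where "\<mu> < \<Lambda>" "W x y" "nsq M x = 1" "\<And>i. i \<in> I \<Longrightarrow> ip M (e i) x = 0"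
  "\<And>u v. W u v \<Longrightarrow> ip M y v = \<mu> * ip M x u"
proof -
 define S where "S u v \<longleftrightarrow> W u v \<and> (\<forall>i\<in>I. ip M (e i) u = 0)" for u v
 note s = W_sqi
 have es: "sqi M (e i)" if "i \<in> I" for i using s(1)[OF ef[OF that]] .
 have S_add: "S (\<lambda>x. u x + u' x) (\<lambda>x. v x + v' x)" if "S u v" "S u' v'" for u v u' v'
  using that es by (auto simp: S_def ip_add s(1) intro!: W_add)
 have S_cmult: "S (\<lambda>x. c * u x) (\<lambda>x. c * v x)" if "S u v" for c u v
  using that by (auto simp: S_def ip_cmult intro!: W_cmult)
 define Z where "Z = {nsq M v |u v. S u v \<and> nsq M u = 1}"
 define m where "m = Inf Z"
 have bdd: "bdd_below Z" by (rule bdd_belowI[of _ 0]) (auto simp: Z_def nsq_nonneg)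
 have u0: "nsq M u0 > 0"
 proof (rule ccontr)
  assume "\<not> nsq M u0 > 0"
  then have "nsq M u0 = 0" using nsq_nonneg[of M u0] by simp
  then show False using uv(3) nsq_nonneg[of M v0] by simp
 qed
 have norm: "S (\<lambda>x. (1 / sqrt (nsq M u)) * u x) (\<lambda>x. (1 / sqrt (nsq M u)) * v x)"
   "nsq M (\<lambda>x. (1 / sqrt (nsq M u)) * u x) = 1" "nsq M (\<lambda>x. (1 / sqrt (nsq M u)) * v x) = nsq M v / nsq M u"
   if "S u v" "nsq M u > 0" for u v
  by (rule S_cmult[OF that(1)], insert that(2), simp_all only: ip_cmult, simp_all)
 have inZ: "nsq M v / nsq M u \<in> Z" if "S u v" "nsq M u > 0" for u v
  unfolding Z_def mem_Collect_eq
  by (intro exI conjI) (rule norm(3)[OF that, symmetric], rule norm(1)[OF that], rule norm(2)[OF that])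
 have S0: "S u0 v0" using uv by (simp add: S_def)
 have m\<Lambda>: "m < \<Lambda>"
  using cInf_lower[OF inZ[OF S0 u0] bdd] uv(3) u0 by (simp add: m_def divide_less_eq order.strict_trans1)
 have low: "m * nsq M u \<le> nsq M v" if "S u v" for u v
 proof (cases "nsq M u > 0")
  case True
  then show ?thesis using cInf_lower[OF inZ[OF that True] bdd] by (simp add: m_def pos_le_divide_eq)
 next
  case False
  then have "nsq M u = 0" using nsq_nonneg[of M u] by simp
  then show ?thesis by (simp add: nsq_nonneg)
 qed
 define R where "R n p \<longleftrightarrow> S (fst p) (snd p) \<and> nsq M (fst p) = 1 \<and> nsq M (snd p) < m + 1 / real (Suc n)" for n p
 have "\<exists>p. R n p" for n
 proof -
  have "\<exists>z\<in>Z. z < m + 1 / real (Suc n)" using cInf_less_iff[OF _ bdd, of "m + 1 / real (Suc n)"] inZ[OF S0 u0] by (auto simp: m_def)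
  then show ?thesis unfolding Z_def R_def by auto
 qed
 then obtain p where p: "\<And>n. R n (p n)" by metis
 define u v where "u n = fst (p n)" and "v n = snd (p n)" for n
 have W: "S (u n) (v n)" "W (u n) (v n)" and u1: "nsq M (u n) = 1" and vm: "nsq M (v n) < m + 1 / real (Suc n)" for n
  using p[of n] by (auto simp: R_def u_def v_def S_def)
 have "nsq M (u n) \<le> \<bar>m\<bar> + 1" "nsq M (v n) \<le> \<bar>m\<bar> + 1" for n
 proof -
  have "1 / real (Suc n) \<le> 1" by simp
  then show "nsq M (u n) \<le> \<bar>m\<bar> + 1" "nsq M (v n) \<le> \<bar>m\<bar> + 1" using u1[of n] vm[of n] by linarith+
 qed
 from W_compact[of u v, OF W(2) this] obtain r x where r: "strict_mono r" and x: "conv2 M (\<lambda>n. u (r n)) x" by blast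
 have vr: "nsq M (v (r n)) < m + 1 / real (Suc n)" for n
 proof -
  have "1 / real (Suc (r n)) \<le> 1 / real (Suc n)" using seq_suble[OF r, of n] by (simp add: frac_le)
  then show ?thesis using vm[of "r n"] by linarith
 qed
 \<comment> \<open>Compactness makes only the \<open>u (r n)\<close> converge. The parallelogram law
   does the rest: the sum of two near-minimisers has a quotient of at least \<open>m\<close>, which
   leaves little room for the difference of their images.\<close>
 have "cauchy2 M (\<lambda>n. v (r n))"
  unfolding cauchy2_def
 proof (intro conjI allI impI)
  show "sqi M (v (r n))" for n using s(2)[OF W(2)] .
  fix t :: real assume t: "t > 0"
  \<comment> \<open>The two near-minimisers contribute less than 2 * t/8 each and the distance of
    the \<open>u (r n)\<close> contributes |m| c < t/2, which adds up to less than
    \<open>t\<close>.\<close>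
  define c where "c = t / (2 * (\<bar>m\<bar> + 1))"
  have c: "c > 0" "\<bar>m\<bar> * c < t / 2" using t by (auto simp: c_def field_simps)
  obtain N where N: "\<And>i j. i \<ge> N \<Longrightarrow> j \<ge> N \<Longrightarrow> nsq M (\<lambda>x. u (r i) x - u (r j) x) < c"
   using conv2_cauchy2[OF x] c(1) unfolding cauchy2_def by meson
  obtain K :: nat where K: "8 / t < real K" using reals_Archimedean2 by blast
  show "\<exists>N. \<forall>i\<ge>N. \<forall>j\<ge>N. nsq M (\<lambda>x. v (r i) x - v (r j) x) < t"
  proof (intro exI[of _ "N + K"] allI impI)
   fix i j assume ij: "i \<ge> N + K" "j \<ge> N + K"
   note si = s[OF W(2)[of "r i"]] and sj = s[OF W(2)[of "r j"]]
   have small: "1 / real (Suc n) < t / 8" if "n \<ge> N + K" for n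
   proof -
    have "8 / t < real (Suc n)" using K that by linarith
    then show ?thesis using t by (simp add: field_simps)
   qed
   have "m * nsq M (\<lambda>x. u (r i) x + u (r j) x) \<le> nsq M (\<lambda>x. v (r i) x + v (r j) x)"
    by (rule low[OF S_add[OF W(1) W(1)]])
   moreover have "nsq M (\<lambda>x. u (r i) x + u (r j) x) = 4 - nsq M (\<lambda>x. u (r i) x - u (r j) x)"
    by (simp add: nsq_add nsq_diff si sj u1)
   moreover have "nsq M (\<lambda>x. v (r i) x - v (r j) x) = 2 * nsq M (v (r i)) + 2 * nsq M (v (r j)) - nsq M (\<lambda>x. v (r i) x + v (r j) x)"
    by (simp add: nsq_add nsq_diff si sj)
   moreover have "m * nsq M (\<lambda>x. u (r i) x - u (r j) x) \<le> \<bar>m\<bar> * c"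
    using N[of i j] ij nsq_nonneg[of M "\<lambda>x. u (r i) x - u (r j) x"] by (intro mult_mono) auto
   ultimately show "nsq M (\<lambda>x. v (r i) x - v (r j) x) < t"
    using vr[of i] vr[of j] small[OF ij(1)] small[OF ij(2)] c(2) by (simp add: right_diff_distrib)
  qed
 qed
 from L2_complete[OF fin this] obtain y where y: "conv2 M (\<lambda>n. v (r n)) y" by blast
 have Wxy: "W x y" by (rule W_closed[OF W(2) x y])
 have ex: "ip M (e i) x = 0" if "i \<in> I" for i
 proof -
  have "ip M (u (r n)) (e i) = 0" for n using W(1)[of "r n"] that by (simp add: S_def ip_commute[of M _ "e i"])
  then show ?thesis using conv2_ip_const[OF x es[OF that]] by (simp add: LIMSEQ_const_iff ip_commute[of M _ "e i"])
 qed
 have x1: "nsq M x = 1" using conv2_nsq[OF x] by (simp add: u1 LIMSEQ_const_iff)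
 have "(\<lambda>n. m + 1 / real (Suc n)) \<longlonglongrightarrow> m + 0" by (intro tendsto_intros LIMSEQ_Suc[OF lim_const_over_n[of 1]])
 then have ym: "nsq M y \<le> m"
  using LIMSEQ_le[OF conv2_nsq[OF y], of "\<lambda>n. m + 1 / real (Suc n)" m] vr by (auto intro: less_imp_le)
 have Sxy: "S x y" using Wxy ex by (simp add: S_def)
 note sx = s[OF Wxy]
 have EL: "ip M y v = m * ip M x u" if "S u v" for u v
 proof -
  have su: "sqi M u" "sqi M v" using that s by (auto simp: S_def)
  have "0 \<le> 2 * t * (ip M y v - m * ip M x u) + t^2 * (nsq M v - m * nsq M u)" for t
  proof -
   have "m * nsq M (\<lambda>z. x z + t * u z) \<le> nsq M (\<lambda>z. y z + t * v z)" by (rule low[OF S_add[OF Sxy S_cmult[OF that]]])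
   moreover have "nsq M (\<lambda>z. x z + t * u z) = 1 + 2 * t * ip M x u + t^2 * nsq M u"
    using nsq_add[OF sx(1) sqi_cmult[OF su(1)], of t] by (simp add: x1 ip_cmult power2_eq_square)
   moreover have "nsq M (\<lambda>z. y z + t * v z) = nsq M y + 2 * t * ip M y v + t^2 * nsq M v"
    using nsq_add[OF sx(2) sqi_cmult[OF su(2)], of t] by (simp add: ip_cmult power2_eq_square)
   ultimately show ?thesis using ym by (simp add: algebra_simps)
  qed
  from linear_nonneg_imp_zero[OF this] show ?thesis by simp
 qed
 have "ip M y v = m * ip M x u" if uv: "W u v" for u v
 proof -
  \<comment> \<open>Subtracting the projection onto the \<open>e i\<close> makes the pair
    admissible. The projection contributes 0 to both sides, by \<open>eig\<close> and by the
    orthogonality of \<open>x\<close>.\<close>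
  define a where "a i = ip M (e i) u" for i
  have Wp: "W (\<lambda>z. \<Sum>i\<in>I. a i * e i z) (\<lambda>z. \<Sum>i\<in>I. a i * f i z)" by (intro W_sum I W_cmult ef)
  have "S (\<lambda>z. u z - (\<Sum>i\<in>I. a i * e i z)) (\<lambda>z. v z - (\<Sum>i\<in>I. a i * f i z))"
   unfolding S_def
  proof (intro conjI ballI W_diff uv Wp)
   fix j assume j: "j \<in> I"
   have "ip M (e j) (\<lambda>z. \<Sum>i\<in>I. a i * e i z) = (\<Sum>i\<in>I. a i * ip M (e j) (e i))"
    using ip_sum(2)[OF I _ es[OF j], of "\<lambda>i z. a i * e i z"] es by (simp add: sqi_cmult ip_cmult)
   also have "\<dots> = (\<Sum>i\<in>I. if i = j then a i else 0)" using orth[OF j] by (intro sum.cong) auto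
   also have "\<dots> = a j" using I j by simp
   finally show "ip M (e j) (\<lambda>z. u z - (\<Sum>i\<in>I. a i * e i z)) = 0"
    using ip_diff(2)[OF s(1)[OF uv] s(1)[OF Wp] es[OF j]] by (simp add: a_def)
  qed
  note E = EL[OF this]
  have "ip M y (\<lambda>z. \<Sum>i\<in>I. a i * f i z) = 0"
   using ip_sum(2)[OF I _ sx(2), of "\<lambda>i z. a i * f i z"] s(2)[OF ef] eig[OF _ Wxy] ex
   by (simp add: sqi_cmult ip_cmult ip_commute[of M y])
  moreover have "ip M x (\<lambda>z. \<Sum>i\<in>I. a i * e i z) = 0"
   using ip_sum(2)[OF I _ sx(1), of "\<lambda>i z. a i * e i z"] es ex
   by (simp add: sqi_cmult ip_cmult ip_commute[of M x])
  ultimately show ?thesis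
   using E ip_diff(2)[OF s(2)[OF uv] s(2)[OF Wp] sx(2)] ip_diff(2)[OF s(1)[OF uv] s(1)[OF Wp] sx(1)] by simp
 qed
 with m\<Lambda> Wxy x1 ex show ?thesis by (rule that)
qed

end

section \<open>Eigenfunctions of the Laplacian on a homogeneous manifold\<close>

definition orthonormal2 :: "'a measure \<Rightarrow> 'i set \<Rightarrow> ('i \<Rightarrow> 'a \<Rightarrow> real) \<Rightarrow> bool" where
 "orthonormal2 M J e \<longleftrightarrow> (\<forall>i\<in>J. \<forall>j\<in>J. ip M (e i) (e j) = (if i = j then 1 else 0))"

lemma orthonormal2_sum:
 assumes "finite J" "orthonormal2 M J e" "\<And>i. i \<in> J \<Longrightarrow> sqi M (e i)" "j \<in> J"
 shows "ip M (e j) (\<lambda>x. \<Sum>i\<in>J. a i * e i x) = a j"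
proof -
 have "ip M (e j) (\<lambda>x. \<Sum>i\<in>J. a i * e i x) = (\<Sum>i\<in>J. a i * ip M (e j) (e i))"
  using ip_sum(2)[OF assms(1) _ assms(3)[OF assms(4)], of "\<lambda>i x. a i * e i x"] assms(3) by (simp add: sqi_cmult ip_cmult)
 also have "\<dots> = (\<Sum>i\<in>J. if i = j then a i else 0)" using assms(2,4) by (intro sum.cong) (auto simp: orthonormal2_def)
 also have "\<dots> = a j" using assms(1,4) by simp
 finally show ?thesis .
qed

text \<open>Dependent families are allowed: a vector without a new component is dropped, and the
  spanned space is recorded through its orthogonal complement. If the family is independent modulo
  null sets, nothing is dropped and \<open>J = I\<close>.\<close>

lemma gram_schmidt:
 assumes "finite I" "\<forall>i\<in>I. sqi M (u i)"
 shows "\<exists>J e. J \<subseteq> I \<and> (\<forall>j\<in>J. \<exists>a. e j = (\<lambda>x. \<Sum>i\<in>I. a i * u i x)) \<and> orthonormal2 M J e \<and>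
  (\<forall>w. sqi M w \<longrightarrow> (\<forall>j\<in>J. ip M (e j) w = 0) \<longrightarrow> (\<forall>i\<in>I. ip M (u i) w = 0)) \<and>
  ((\<forall>a. (AE x in M. (\<Sum>i\<in>I. a i * u i x) = 0) \<longrightarrow> (\<forall>i\<in>I. a i = 0)) \<longrightarrow> J = I)"
 using assms
proof (induction I rule: finite_induct)
 case empty
 show ?case by (intro exI[of _ "{}"]) (auto simp: orthonormal2_def)
next
 case (insert y I)
 from insert.IH insert.prems obtain J e where J: "J \<subseteq> I" and span: "\<And>j. j \<in> J \<Longrightarrow> \<exists>a. e j = (\<lambda>x. \<Sum>i\<in>I. a i * u i x)"
  and on: "orthonormal2 M J e" and perp: "\<And>w i. sqi M w \<Longrightarrow> (\<And>j. j \<in> J \<Longrightarrow> ip M (e j) w = 0) \<Longrightarrow> i \<in> I \<Longrightarrow> ip M (u i) w = 0"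
  and ind: "(\<forall>a. (AE x in M. (\<Sum>i\<in>I. a i * u i x) = 0) \<longrightarrow> (\<forall>i\<in>I. a i = 0)) \<Longrightarrow> J = I"
  by (smt (verit) insertCI)
 have fJ: "finite J" using J insert.hyps(1) by (rule finite_subset)
 obtain b where b: "\<And>j. j \<in> J \<Longrightarrow> e j = (\<lambda>x. \<Sum>i\<in>I. b j i * u i x)" using span by metis
 have u: "sqi M (u i)" if "i \<in> insert y I" for i using insert.prems that by blast
 have es: "sqi M (e j)" if "j \<in> J" for j
  unfolding b[OF that] using insert.hyps u by (intro sqi_sum sqi_cmult) auto
 have b': "e j = (\<lambda>x. \<Sum>i\<in>insert y I. (if i = y then 0 else b j i) * u i x)" if "j \<in> J" for j
  unfolding b[OF that] using insert.hyps by (auto intro!: sum.cong)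
 define c where "c j = ip M (e j) (u y)" for j
 define r where "r x = u y x - (\<Sum>j\<in>J. c j * e j x)" for x
 have sqs: "sqi M (\<lambda>x. \<Sum>j\<in>J. c j * e j x)" using fJ es by (intro sqi_sum sqi_cmult)
 have rs: "sqi M r" unfolding r_def using u sqs by (intro sqi_diff) auto
 have er: "ip M (e j) r = 0" if "j \<in> J" for j
  unfolding r_def using ip_diff(2)[OF u[of y] sqs es[OF that]] orthonormal2_sum[OF fJ on es that] by (simp add: c_def)
 define d where "d i = (if i = y then 1 else (-1) * (\<Sum>j\<in>J. c j * b j i))" for i
 have r: "r = (\<lambda>x. \<Sum>i\<in>insert y I. d i * u i x)"
 proof
  fix x
  have "(\<Sum>j\<in>J. c j * e j x) = (\<Sum>j\<in>J. \<Sum>i\<in>I. c j * b j i * u i x)" by (simp add: b sum_distrib_left mult.assoc)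
  also have "\<dots> = (\<Sum>i\<in>I. (\<Sum>j\<in>J. c j * b j i) * u i x)" by (subst sum.swap) (simp add: sum_distrib_right)
  finally have "(\<Sum>j\<in>J. c j * e j x) = - (\<Sum>i\<in>I. d i * u i x)"
   using insert.hyps by (simp add: d_def sum_negf[symmetric]) (auto intro!: sum.cong simp del: sum_negf)
  then show "r x = (\<Sum>i\<in>insert y I. d i * u i x)" using insert.hyps by (simp add: r_def d_def)
 qed
 have uy: "ip M (u y) w = ip M r w" if "sqi M w" "\<And>j. j \<in> J \<Longrightarrow> ip M (e j) w = 0" for w
 proof -
  have "ip M (\<lambda>x. \<Sum>j\<in>J. c j * e j x) w = 0"
   using ip_sum(1)[OF fJ _ that(1), of "\<lambda>j x. c j * e j x"] es that(2) by (simp add: sqi_cmult ip_cmult)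
  then show ?thesis unfolding r_def using ip_diff(1)[OF u[of y] sqs that(1)] by simp
 qed
 show ?case
 proof (cases "nsq M r = 0")
  case True
  show ?thesis
  proof (intro exI[of _ J] exI[of _ e] conjI)
   show "J \<subseteq> insert y I" using J by blast
   show "\<forall>j\<in>J. \<exists>a. e j = (\<lambda>x. \<Sum>i\<in>insert y I. a i * u i x)"
   proof
    fix j assume "j \<in> J"
    from b'[OF this] show "\<exists>a. e j = (\<lambda>x. \<Sum>i\<in>insert y I. a i * u i x)"
     by (rule exI[of _ "\<lambda>i. if i = y then 0 else b j i"])
   qed
   show "orthonormal2 M J e" by (rule on)
   show "\<forall>w. sqi M w \<longrightarrow> (\<forall>j\<in>J. ip M (e j) w = 0) \<longrightarrow> (\<forall>i\<in>insert y I. ip M (u i) w = 0)"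
   proof (intro allI impI)
    fix w assume w: "sqi M w" "\<forall>j\<in>J. ip M (e j) w = 0"
    have "ip M r w = 0" using ip_cauchy_schwarz[OF rs w(1)] True by simp
    then show "\<forall>i\<in>insert y I. ip M (u i) w = 0" using perp[OF w(1)] uy[OF w(1)] w(2) by auto
   qed
   have "AE x in M. (\<Sum>i\<in>insert y I. d i * u i x) = 0" using nsq_AE_zero[OF rs True] by (simp only: r)
   moreover have "d y \<noteq> 0" by (simp add: d_def)
   ultimately show "(\<forall>a. (AE x in M. (\<Sum>i\<in>insert y I. a i * u i x) = 0) \<longrightarrow> (\<forall>i\<in>insert y I. a i = 0)) \<longrightarrow> J = insert y I"
    by blast
  qed
 next
  case False
  define N where "N = sqrt (nsq M r)"
  have N: "N \<noteq> 0" "N * N = nsq M r" using False nsq_nonneg[of M r] by (auto simp: N_def)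
  define e' where "e' = e(y := (\<lambda>x. (1 / N) * r x))"
  have yJ: "y \<notin> J" using J insert.hyps by blast
  have e'J: "e' j = e j" if "j \<in> J" for j using that yJ by (auto simp: e'_def)
  show ?thesis
  proof (intro exI[of _ "insert y J"] exI[of _ e'] conjI)
   show "insert y J \<subseteq> insert y I" using J by blast
   show "\<forall>j\<in>insert y J. \<exists>a. e' j = (\<lambda>x. \<Sum>i\<in>insert y I. a i * u i x)"
   proof
    fix j assume j: "j \<in> insert y J"
    show "\<exists>a. e' j = (\<lambda>x. \<Sum>i\<in>insert y I. a i * u i x)"
    proof (cases "j = y")
     case True
     have "e' y = (\<lambda>x. \<Sum>i\<in>insert y I. (1 / N * d i) * u i x)"
      by (simp only: e'_def fun_upd_same r sum_distrib_left mult.assoc)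
     then show ?thesis unfolding True by (rule exI[of _ "\<lambda>i. 1 / N * d i"])
    next
     case False
     then have "j \<in> J" using j by blast
     from b'[OF this] show ?thesis unfolding e'J[OF \<open>j \<in> J\<close>] by (rule exI[of _ "\<lambda>i. if i = y then 0 else b j i"])
    qed
   qed
   have "ip M (e' y) (e' y) = 1" unfolding e'_def fun_upd_same ip_cmult N(2)[symmetric] using N(1) by simp
   moreover have "ip M (e' j) (e' y) = 0" "ip M (e' y) (e' j) = 0" if "j \<in> J" for j
    using er[OF that] yJ that ip_commute[of M r "e j"] by (auto simp: e'_def ip_cmult simp del: times_divide_eq_left)
   ultimately show "orthonormal2 M (insert y J) e'" using on yJ unfolding orthonormal2_def by (auto simp: e'_def)
   show "\<forall>w. sqi M w \<longrightarrow> (\<forall>j\<in>insert y J. ip M (e' j) w = 0) \<longrightarrow> (\<forall>i\<in>insert y I. ip M (u i) w = 0)"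
   proof (intro allI impI)
    fix w assume w: "sqi M w" "\<forall>j\<in>insert y J. ip M (e' j) w = 0"
    have *: "ip M (e j) w = 0" if "j \<in> J" for j using w(2) that unfolding e'J[OF that, symmetric] by blast
    have "ip M (e' y) w = 0" using w(2) by blast
    then have "ip M r w = 0" using N unfolding e'_def fun_upd_same ip_cmult by simp
    then show "\<forall>i\<in>insert y I. ip M (u i) w = 0" using perp[OF w(1) *] uy[OF w(1) *] by auto
   qed
   show "(\<forall>a. (AE x in M. (\<Sum>i\<in>insert y I. a i * u i x) = 0) \<longrightarrow> (\<forall>i\<in>insert y I. a i = 0)) \<longrightarrow> insert y J = insert y I"
   proof
    assume *: "\<forall>a. (AE x in M. (\<Sum>i\<in>insert y I. a i * u i x) = 0) \<longrightarrow> (\<forall>i\<in>insert y I. a i = 0)"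
    have "\<forall>a. (AE x in M. (\<Sum>i\<in>I. a i * u i x) = 0) \<longrightarrow> (\<forall>i\<in>I. a i = 0)"
    proof (intro allI impI)
     fix a assume "AE x in M. (\<Sum>i\<in>I. a i * u i x) = 0"
     moreover have "(\<Sum>i\<in>I. a i * u i x) = (\<Sum>i\<in>insert y I. (a(y := 0)) i * u i x)" for x
      using insert.hyps by (auto intro!: sum.cong)
     ultimately have "AE x in M. (\<Sum>i\<in>insert y I. (a(y := 0)) i * u i x) = 0" by simp
     with * have "\<forall>i\<in>insert y I. (a(y := 0)) i = 0" by blast
     then show "\<forall>i\<in>I. a i = 0" using insert.hyps by (metis fun_upd_other insertI2)
    qed
    then show "insert y J = insert y I" using ind by simp
   qed
  qed
 qed
qed

section \<open>Finite-dimensional eigenspaces and the eigenmap into a sphere\<close>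

context compact_riem begin

lemma smooth_sqi: assumes "smooth_fun A u" shows "sqi V u"
 using smooth_integrable[OF smooth_fun_mult[OF assms assms]] smooth_fun_measurable[OF assms]
 by (simp add: sqi_def power2_eq_square cong: measurable_cong_sets)

lemma Gam_cmult: assumes "smooth_fun A u" "smooth_fun A w" shows "Gam (\<lambda>p. c * u p) w p = c * Gam u w p"
 using Gam_mult[OF smooth_fun_const assms, of c p] Gam_const[of c w p] by simp

lemma Gam_cauchy_schwarz:
 assumes u: "smooth_fun A u" and v: "smooth_fun A v"
 shows "(Gam u v p)^2 \<le> Gam u u p * Gam v v p"
proof -
 have *: "0 \<le> Gam u u p + 2 * t * Gam u v p + t^2 * Gam v v p" for t
 proof -
  have tv: "smooth_fun A (\<lambda>p. t * v p)" and s: "smooth_fun A (\<lambda>p. u p + t * v p)" by (intro smooth_fun_add smooth_fun_cmult u v)+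
  have "Gam (\<lambda>p. u p + t * v p) (\<lambda>p. u p + t * v p) p = Gam u (\<lambda>p. u p + t * v p) p + t * Gam v (\<lambda>p. u p + t * v p) p"
   using Gam_add[OF u tv s] Gam_cmult[OF v s] by simp
  also have "\<dots> = Gam u u p + 2 * t * Gam u v p + t^2 * Gam v v p"
   using Gam_commute[OF u s] Gam_commute[OF v s] Gam_add[OF u tv u] Gam_add[OF u tv v] Gam_cmult[OF v u] Gam_cmult[OF v v] Gam_commute[OF v u]
   by (simp add: power2_eq_square algebra_simps)
  finally show ?thesis using Gam_nonneg by metis
 qed
 show ?thesis
 proof (cases "Gam v v p = 0")
  case True
  have "Gam u v p = 0"
  proof (rule ccontr)
   assume "Gam u v p \<noteq> 0"
   then show False using *[of "- (Gam u u p + 1) / (2 * Gam u v p)"] True by (simp add: field_simps)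
  qed
  then show ?thesis using True by simp
 next
  case False
  then have "Gam v v p > 0" using Gam_nonneg[of v p] by simp
  then show ?thesis using *[of "- Gam u v p / Gam v v p"] by (simp add: power2_eq_square field_simps)
 qed
qed

lemma eigenvalue_gradient_integral:
 assumes u: "smooth_fun A u" and eig: "\<And>p. L u p = - l * u p"
 shows "(LINT p|V. Gam u u p) = l * nsq V u"
 using green[OF u u] by (simp add: eig ip_def mult.left_commute)

lemma eigenvalue_nonneg:
 assumes u: "smooth_fun A u" and eig: "\<And>p. L u p = - l * u p" and nz: "u q \<noteq> 0"
 shows "l \<ge> 0"
proof -
 have "nsq V u \<noteq> 0" using smooth_zero_of_integral[OF u, of q] nz by (auto simp: nsq_eq)
 then have "nsq V u > 0" using nsq_nonneg[of V u] by simp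
 moreover have "0 \<le> l * nsq V u" unfolding eigenvalue_gradient_integral[OF u eig, symmetric]
  by (intro integral_nonneg_AE) (simp add: Gam_nonneg)
 ultimately show ?thesis by (simp add: zero_le_mult_iff)
qed

text \<open>An infinite orthonormal sequence in the eigenspace would have bounded gradient integrals
  but mutual squared distances 2, against Rellich compactness. Finite dimension is stated through a
  finite set with trivial orthogonal complement, the form that \<open>eigen_frame\<close>
  uses.\<close>

lemma eigenspace_finite:
 fixes l :: real
 defines "E \<equiv> {u. smooth_fun A u \<and> (\<forall>p. L u p = - l * u p)}"
 shows "\<exists>S. finite S \<and> S \<subseteq> E \<and> (\<forall>u\<in>E. (\<forall>s\<in>S. ip V s u = 0) \<longrightarrow> u = (\<lambda>p. 0))"
proof -
 have cm: "(\<lambda>p. c * u p) \<in> E" if "u \<in> E" for u c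
  using that L_mult[OF smooth_fun_const, of u c] by (auto simp: E_def smooth_fun_cmult L_const Gam_const)
 have "\<exists>S. finite S \<and> S \<subseteq> E \<and> (\<forall>u\<in>E. (\<forall>s\<in>S. ip V s u = 0) \<longrightarrow> nsq V u \<noteq> 1)"
 proof (rule ccontr)
  assume "\<not> ?thesis"
  then have ex: "\<And>S. finite S \<Longrightarrow> S \<subseteq> E \<Longrightarrow> \<exists>u. u \<in> E \<and> (\<forall>s\<in>S. ip V s u = 0) \<and> nsq V u = 1" by blast
  then obtain X where X: "\<And>S. finite S \<Longrightarrow> S \<subseteq> E \<Longrightarrow> X S \<in> E \<and> (\<forall>s\<in>S. ip V s (X S) = 0) \<and> nsq V (X S) = 1" by metis
  define s where "s = rec_nat {} (\<lambda>_ S. insert (X S) S)"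
  have s: "s 0 = {}" "s (Suc n) = insert (X (s n)) (s n)" for n by (simp_all add: s_def)
  have sE: "finite (s n) \<and> s n \<subseteq> E" for n by (induction n) (use X in \<open>auto simp: s\<close>)
  define e where "e n = X (s n)" for n
  have e: "e n \<in> E" "nsq V (e n) = 1" "\<And>w. w \<in> s n \<Longrightarrow> ip V w (e n) = 0" for n using X sE by (auto simp: e_def)
  have mem: "i < n \<Longrightarrow> e i \<in> s n" for i n by (induction n) (auto simp: s e_def less_Suc_eq)
  have sm: "smooth_fun A (e n)" for n using e(1)[of n] by (simp add: E_def)
  have far: "(LINT p|V. (e i p - e j p)^2) = 2" if "i \<noteq> j" for i j
  proof -
   have "ip V (e i) (e j) = 0"
    using that e(3)[OF mem, of i j] e(3)[OF mem, of j i] by (cases "i < j") (auto simp: ip_commute)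
   then show ?thesis using nsq_diff[OF smooth_sqi[OF sm] smooth_sqi[OF sm], of i j] e(2) by (simp add: nsq_eq)
  qed
  have "(LINT p|V. (e n p)^2) \<le> \<bar>l\<bar> + 1" "(LINT p|V. Gam (e n) (e n) p) \<le> \<bar>l\<bar> + 1" for n
   using e(1,2)[of n] eigenvalue_gradient_integral[OF sm[of n], of l] by (auto simp: E_def nsq_eq)
  from rellich[of e, OF sm this] obtain r :: "nat \<Rightarrow> nat" where r: "strict_mono r"
   and c: "\<forall>\<epsilon>>0. \<exists>N. \<forall>i\<ge>N. \<forall>j\<ge>N. (LINT p|V. (e (r i) p - e (r j) p)^2) < \<epsilon>" by (elim exE conjE) (rule that; assumption)
  obtain N where N: "\<forall>i\<ge>N. \<forall>j\<ge>N. (LINT p|V. (e (r i) p - e (r j) p)^2) < 1" using spec[OF c, of 1] by auto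
  have "r N \<noteq> r (Suc N)" using strict_mono_eq[OF r, of N "Suc N"] by simp
  then show False using N[rule_format, of N "Suc N"] far[of "r N" "r (Suc N)"] by simp
 qed
 then obtain S where S: "finite S" "S \<subseteq> E" "\<forall>u\<in>E. (\<forall>s\<in>S. ip V s u = 0) \<longrightarrow> nsq V u \<noteq> 1" by (elim exE conjE) (rule that)
 have "u = (\<lambda>p. 0)" if u: "u \<in> E" "\<And>s. s \<in> S \<Longrightarrow> ip V s u = 0" for u
 proof -
  have "nsq V u = 0"
  proof (rule ccontr)
   assume "nsq V u \<noteq> 0"
   then have "nsq V u > 0" using nsq_nonneg[of V u] by simp
   then have "nsq V (\<lambda>p. (1 / sqrt (nsq V u)) * u p) = 1" by (simp only: ip_cmult) simp
   moreover have "ip V s (\<lambda>p. (1 / sqrt (nsq V u)) * u p) = 0" if "s \<in> S" for s using u(2)[OF that] by (simp only: ip_cmult)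
   ultimately show False using S(3) cm[OF u(1), of "1 / sqrt (nsq V u)"] by blast
  qed
  then have "(LINT p|V. (u p)^2) = 0" by (simp add: nsq_eq)
  from smooth_zero_of_integral[OF _ this] show ?thesis using u(1) by (auto simp: E_def)
 qed
 then show ?thesis using S(1,2) by (intro exI[of _ S]) simp
qed

lemma eigen_frame:
 assumes hom: "homogeneous A g" and eig: "laplace_eigenvalue A g l"
 obtains J :: "('a \<Rightarrow> real) set" and h where "finite J" "\<And>a. a \<in> J \<Longrightarrow> smooth_fun A (h a)"
  "\<And>a p. a \<in> J \<Longrightarrow> L (h a) p = - l * h a p" "\<And>p. (\<Sum>a\<in>J. (h a p)^2) = 1"
proof -
 define E where "E = {u. smooth_fun A u \<and> (\<forall>p. L u p = - l * u p)}"
 have sm: "smooth_fun A u" and Lu: "L u p = - l * u p" if "u \<in> E" for u p using that by (auto simp: E_def)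
 have E0: "(\<lambda>p. 0) \<in> E" by (simp add: E_def smooth_fun_const L_const)
 have add: "(\<lambda>p. u p + v p) \<in> E" if "u \<in> E" "v \<in> E" for u v
  using that by (auto simp: E_def smooth_fun_add L_add algebra_simps)
 have cm: "(\<lambda>p. c * u p) \<in> E" if "u \<in> E" for u c
  using that L_mult[OF smooth_fun_const, of u c] by (auto simp: E_def smooth_fun_cmult L_const Gam_const)
 have comb: "(\<lambda>p. \<Sum>i\<in>I. a i * u i p) \<in> E" if "finite I" "\<And>i. i \<in> I \<Longrightarrow> u i \<in> E" for I and a :: "('a \<Rightarrow> real) \<Rightarrow> real" and u
  using that by (induction I rule: finite_induct) (auto intro!: E0 add cm)
 obtain S where S: "finite S" "S \<subseteq> E" "\<forall>u\<in>E. (\<forall>s\<in>S. ip V s u = 0) \<longrightarrow> u = (\<lambda>p. 0)"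
  using eigenspace_finite[of l, folded E_def] by (elim exE conjE) (rule that)
 have ids: "\<forall>i\<in>S. sqi V (id i)" using S(2) smooth_sqi[OF sm] by auto
 from gram_schmidt[OF S(1), of V id, OF ids] obtain J e where J: "J \<subseteq> S"
  and span: "\<forall>j\<in>J. \<exists>a. e j = (\<lambda>x. \<Sum>i\<in>S. a i * id i x)" and on: "orthonormal2 V J e"
  and perp: "\<forall>w. sqi V w \<longrightarrow> (\<forall>j\<in>J. ip V (e j) w = 0) \<longrightarrow> (\<forall>i\<in>S. ip V (id i) w = 0)"
  by (elim exE conjE) (rule that)
 have fJ: "finite J" using J S(1) by (rule finite_subset)
 have eE: "e j \<in> E" if "j \<in> J" for j
  using bspec[OF span that]
 proof
  fix a assume "e j = (\<lambda>x. \<Sum>i\<in>S. a i * id i x)"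
  then show ?thesis using comb[OF S(1), of id a] S(2) by auto
 qed
 have es: "sqi V (e j)" if "j \<in> J" for j by (rule smooth_sqi[OF sm[OF eE[OF that]]])
 define K where "K p q = (\<Sum>j\<in>J. e j p * e j q)" for p q
 have KE: "K p \<in> E" for p using comb[OF fJ, of e "\<lambda>j. e j p", OF eE] by (simp add: K_def[abs_def])
 have Ks: "sqi V (K p)" for p by (rule smooth_sqi[OF sm[OF KE]])
 have repr: "ip V (K p) w = w p" if w: "w \<in> E" for w p
 proof -
  define z where "z p = w p + (\<Sum>j\<in>J. (- ip V (e j) w) * e j p)" for p
  have cE: "(\<lambda>p. \<Sum>j\<in>J. (- ip V (e j) w) * e j p) \<in> E" by (rule comb[OF fJ, of e, OF eE])
  have zE: "z \<in> E" unfolding z_def by (rule add[OF w cE])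
  have "ip V (e j) z = 0" if j: "j \<in> J" for j
  proof -
   have "ip V (e j) (\<lambda>p. \<Sum>j\<in>J. (- ip V (e j) w) * e j p) = - ip V (e j) w"
    by (rule orthonormal2_sum[OF fJ on]) (use es j in auto)
   then show ?thesis
    unfolding z_def ip_add(2)[OF smooth_sqi[OF sm[OF w]] smooth_sqi[OF sm[OF cE]] es[OF j]] by linarith
  qed
  then have "z = (\<lambda>p. 0)" using bspec[OF S(3) zE] perp[rule_format, OF smooth_sqi[OF sm[OF zE]]] by simp
  then have "w p = (\<Sum>j\<in>J. ip V (e j) w * e j p)" by (auto simp: z_def sum_negf dest: fun_cong[of _ _ p])
  moreover have "ip V (K p) w = (\<Sum>j\<in>J. e j p * ip V (e j) w)"
   unfolding K_def using ip_sum(1)[OF fJ _ smooth_sqi[OF sm[OF w]], of "\<lambda>j q. e j p * e j q"] es by (simp add: sqi_cmult ip_cmult)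
  ultimately show ?thesis by (simp add: mult.commute)
 qed
 have Kpp: "nsq V (K p) = K p p" for p by (rule repr[OF KE])
 have bound: "(w p)^2 \<le> K p p * nsq V w" if "w \<in> E" for w p
  using ip_cauchy_schwarz[OF Ks smooth_sqi[OF sm[OF that]]] by (simp add: repr[OF that] Kpp)
 have K0: "K p p \<ge> 0" for p unfolding Kpp[symmetric] by (rule nsq_nonneg)
 \<comment> \<open>Apply \<open>bound\<close> at \<open>p\<close> to \<open>K q\<close> composed
   with an isometry that takes \<open>p\<close> to \<open>q\<close>: its norm is unchanged and its
   value at \<open>p\<close> is \<open>K q q\<close>. This gives K(q,q)^2 <= K(p,p) K(q,q), and
   exchanging the points makes the diagonal constant.\<close>
 have iso: "K q q \<le> K p p" for p q
 proof -
  obtain F where F: "riemannian_isometry A g F" "F p = q" using hom by (auto simp: homogeneous_def)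
  have wE: "(\<lambda>x. K q (F x)) \<in> E"
   using smooth_fun_isometry[OF F(1) sm[OF KE]] L_isometry[OF F(1) sm[OF KE]] Lu[OF KE] by (simp add: E_def)
  have "nsq V (\<lambda>x. K q (F x)) = (LINT x|distr V borel F. K q x * K q x)"
   unfolding ip_def using isometry_inv(5)[OF F(1)] smooth_fun_measurable[OF sm[OF KE]]
   by (subst integral_distr) (auto cong: measurable_cong_sets)
  also have "\<dots> = K q q" unfolding isometry_volume[OF F(1)] Kpp[of q, symmetric] ip_def ..
  finally have "(K q q)^2 \<le> K p p * K q q" using bound[OF wE, of p] F(2) by simp
  then show ?thesis using K0[of p] K0[of q] by (cases "K q q = 0") (auto simp: power2_eq_square)
 qed
 obtain \<phi> q where \<phi>: "\<phi> \<in> E" "\<phi> q \<noteq> 0" using eig by (auto simp: laplace_eigenvalue_def E_def)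
 define s where "s = K q q"
 have "s \<noteq> 0" using bound[OF \<phi>(1), of q] \<phi>(2) by (auto simp: s_def)
 then have s: "s > 0" using K0[of q] by (simp add: s_def)
 have Ks: "K p p = s" for p using iso[of p q] iso[of q p] by (simp add: s_def)
 have hE: "(\<lambda>p. (1 / sqrt s) * e a p) \<in> E" if "a \<in> J" for a by (rule cm[OF eE[OF that]])
 show ?thesis
 proof (rule that[OF fJ, of "\<lambda>a p. (1 / sqrt s) * e a p"])
  show "smooth_fun A (\<lambda>p. 1 / sqrt s * e a p)" if "a \<in> J" for a by (rule sm[OF hE[OF that]])
  show "L (\<lambda>p. 1 / sqrt s * e a p) p = - l * (1 / sqrt s * e a p)" if "a \<in> J" for a p by (rule Lu[OF hE[OF that]])
  fix p
  have "(\<Sum>a\<in>J. (1 / sqrt s * e a p)^2) = (1 / s) * K p p"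
   using s by (simp add: K_def sum_distrib_left power_mult_distrib power_divide power2_eq_square sum_divide_distrib)
  then show "(\<Sum>a\<in>J. (1 / sqrt s * e a p)^2) = 1" using s by (simp add: Ks)
 qed
qed

end

section \<open>The clamped plate problem\<close>

lemma conv2_bounded_mult:
 assumes s: "conv2 M s u" and h: "h \<in> borel_measurable M" "\<And>x. \<bar>h x\<bar> \<le> B"
 shows "conv2 M (\<lambda>n x. h x * s n x) (\<lambda>x. h x * u x)"
proof -
 have q: "sqi M (s n)" "sqi M u" for n using s by (auto simp: conv2_def)
 have le: "(h x * w x)^2 \<le> B^2 * (w x)^2" for x w
  using h(2)[of x] by (auto simp: power_mult_distrib abs_le_square_iff[symmetric] intro!: mult_right_mono)
 have m: "sqi M (\<lambda>x. h x * w x)" if w: "sqi M w" for w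
 proof -
  have "integrable M (\<lambda>x. (h x * w x)^2)"
  proof (rule Bochner_Integration.integrable_bound)
   show "integrable M (\<lambda>x. B^2 * (w x)^2)" using w by (simp add: sqi_def)
   show "(\<lambda>x. (h x * w x)^2) \<in> borel_measurable M" using w h(1) by (auto simp: sqi_def)
   show "AE x in M. norm ((h x * w x)^2) \<le> norm (B^2 * (w x)^2)" using le[of _ w] by (auto simp: abs_mult)
  qed
  then show ?thesis using w h(1) by (auto simp: sqi_def)
 qed
 have n: "nsq M (\<lambda>x. h x * w x) \<le> B^2 * nsq M w" if w: "sqi M w" for w
  unfolding nsq_eq using m[OF w] w le[of _ w]
  by (subst integral_mult_right_zero[symmetric], intro integral_mono) (auto simp: sqi_def)
 have "(\<lambda>n. B^2 * nsq M (\<lambda>x. s n x - u x)) \<longlonglongrightarrow> B^2 * 0"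
  using s by (intro tendsto_intros) (simp add: conv2_def)
 then have lim: "(\<lambda>n. B^2 * nsq M (\<lambda>x. s n x - u x)) \<longlonglongrightarrow> 0" by simp
 have "(\<lambda>n. nsq M (\<lambda>x. h x * s n x - h x * u x)) \<longlonglongrightarrow> 0"
 proof (rule tendsto_sandwich[OF _ _ tendsto_const lim])
  show "\<forall>\<^sub>F n in sequentially. nsq M (\<lambda>x. h x * s n x - h x * u x) \<le> B^2 * nsq M (\<lambda>x. s n x - u x)"
   using n[OF sqi_diff[OF q]] by (simp add: right_diff_distrib)
 qed (simp add: nsq_nonneg)
 then show ?thesis using m q by (simp add: conv2_def)
qed

locale clamped_plate = compact_riem A g
 for A :: "('a::{t2_space,second_countable_topology}, 'n::finite) chart set" and g :: "('a, 'n) metric_coeffs" +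
 fixes \<Omega> :: "'a set"
begin

abbreviation T :: "('a \<Rightarrow> real) set" where "T \<equiv> {f. test_function A \<Omega> f}"

lemma L_local_zero:
 assumes u: "smooth_fun A u" and S: "closed S" and p: "p \<notin> S" and z: "\<And>p. p \<notin> S \<Longrightarrow> u p = 0"
 shows "L u p = 0"
proof -
 define c where "c = chart_at A p"
 have c: "c \<in> A" "p \<in> chart_dom c" using chart_at unfolding c_def by blast+
 have o: "open (img c \<inter> param c -` (- S))"
  using continuous_on_open_vimage[OF chartD(2)[OF c(1)]] chartD(4)[OF c(1)] S by (metis Int_commute open_Compl)
 have "llap (G c) (loc c u) (coord c p) = llap (G c) (loc c (\<lambda>p. 0)) (coord c p)"
  by (rule llap_cong[OF o]) (use c p z in auto)
 then show ?thesis using laplacian_chart[OF c u] laplacian_chart[OF c smooth_fun_const] L_const by simp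
qed

lemma test_smooth: "f \<in> T \<Longrightarrow> smooth_fun A f"
 by (simp add: test_function_def)

lemma testI:
 assumes "f \<in> T" "f' \<in> T" "smooth_fun A \<psi>" "\<And>p. p \<notin> closure {p. f p \<noteq> 0} \<Longrightarrow> p \<notin> closure {p. f' p \<noteq> 0} \<Longrightarrow> \<psi> p = 0"
 shows "\<psi> \<in> T"
proof -
 have "{p. \<psi> p \<noteq> 0} \<subseteq> closure {p. f p \<noteq> 0} \<union> closure {p. f' p \<noteq> 0}" using assms(4) by auto
 then have "closure {p. \<psi> p \<noteq> 0} \<subseteq> closure {p. f p \<noteq> 0} \<union> closure {p. f' p \<noteq> 0}" by (intro closure_minimal closed_Un closed_closure)
 moreover have "compact (closure {p. \<psi> p \<noteq> 0})" using compact_Int_closed[OF compact_UNIV closed_closure] by simp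
 ultimately show ?thesis using assms(1-3) by (auto simp: test_function_def)
qed

lemma notin_closure_zero: "p \<notin> closure {p. f p \<noteq> 0} \<Longrightarrow> f p = (0::real)"
 using closure_subset[of "{p. f p \<noteq> 0}"] by auto

lemma test_mult: assumes "f \<in> T" "smooth_fun A h" shows "(\<lambda>p. h p * f p) \<in> T"
 by (rule testI[OF assms(1,1)]) (use assms test_smooth in \<open>auto intro: smooth_fun_mult dest: notin_closure_zero\<close>)

lemma test_L: assumes "f \<in> T" shows "L f \<in> T"
 using L_local_zero[of f "closure {p. f p \<noteq> 0}", OF test_smooth[OF assms] closed_closure] notin_closure_zero[of _ f]
 by (intro testI[OF assms assms smooth_L[OF test_smooth[OF assms]]]) blast

text \<open>Rellich's theorem asks for bounded gradients, whereas the graph norm bounds a function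
  and its Laplacian; \<open>Gam_integral_bound\<close> bridges the two.\<close>

sublocale symmetric_operator V T L
proof (rule symmetric_operator.intro)
 show "finite_measure V" by (rule finite_V)
 show sq: "sqi V f" if "f \<in> T" for f by (rule smooth_sqi[OF test_smooth[OF that]])
 show "(\<lambda>x. 0) \<in> T" by (simp add: test_function_def smooth_fun_const)
 show "(\<lambda>x. f x + \<psi> x) \<in> T" if "f \<in> T" "\<psi> \<in> T" for f \<psi>
  
 proof (rule testI[OF that smooth_fun_add[OF that[THEN test_smooth]]])
  fix p assume "p \<notin> closure {p. f p \<noteq> 0}" "p \<notin> closure {p. \<psi> p \<noteq> 0}"
  from this[THEN notin_closure_zero] show "f p + \<psi> p = 0" by linarith
 qed
 show "(\<lambda>x. c * f x) \<in> T" if "f \<in> T" for f c by (rule test_mult[OF that smooth_fun_const])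
 show "L f \<in> T" if "f \<in> T" for f by (rule test_L[OF that])
 show "L (\<lambda>x. f x + \<psi> x) = (\<lambda>x. L f x + L \<psi> x)" if "f \<in> T" "\<psi> \<in> T" for f \<psi>
  using L_add[OF test_smooth test_smooth] that by blast
 show "L (\<lambda>x. c * f x) = (\<lambda>x. c * L f x)" if "f \<in> T" for f c
  using L_mult[OF smooth_fun_const test_smooth[OF that], of c] by (intro ext) (simp add: L_const Gam_const)
 show "ip V (L f) \<psi> = ip V f (L \<psi>)" if "f \<in> T" "\<psi> \<in> T" for f \<psi>
  using L_symmetric[OF test_smooth test_smooth] that by (simp add: ip_def)
 fix s :: "nat \<Rightarrow> 'a \<Rightarrow> real" and C
 assume s: "\<And>n. s n \<in> T" and b: "\<And>n. nsq V (s n) \<le> C" "\<And>n. nsq V (L (s n)) \<le> C"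
 have sm: "smooth_fun A (s n)" for n by (rule test_smooth[OF s])
 have "(LINT p|V. (s n p)^2) \<le> 2 * C" "(LINT p|V. Gam (s n) (s n) p) \<le> 2 * C" for n
  using b[of n] Gam_integral_bound[OF sm[of n]] nsq_nonneg[of V "s n"] unfolding nsq_eq by linarith+
 from rellich[of s, OF sm this] show "\<exists>r. strict_mono r \<and> cauchy2 V (\<lambda>n. s (r n))"
 proof (elim exE conjE, intro exI conjI)
  fix r :: "nat \<Rightarrow> nat" assume "\<forall>e>0. \<exists>N. \<forall>i\<ge>N. \<forall>j\<ge>N. (LINT p|V. (s (r i) p - s (r j) p)^2) < e"
  then show "cauchy2 V (\<lambda>n. s (r n))" unfolding cauchy2_def nsq_eq using smooth_sqi[OF sm] by blast
 qed
qed

lemma hess_norm_sq_nonneg: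
 assumes "smooth_fun A u"
 shows "hess_norm_sq A g u p \<ge> 0"
 unfolding hess_norm_sq_chart[OF chart_at assms]
 using local_metric.lhess_norm_nonneg_and_trace_bound(1)[OF local_metric[OF chart_at(1)] _ smooth_loc[OF assms chart_at(1)]] chart_at
 by blast

text \<open>By \<open>H2_norm_squared(2)\<close> a sequence of test functions that is Cauchy in the
  H^2 norm is Cauchy in the graph norm, and by \<open>H2_norm_bound\<close> the converse holds, so
  the two completions coincide.\<close>

lemma H20_iff: "u \<in> H20 A g \<Omega> \<longleftrightarrow> (\<exists>v. W u v)"
proof
 assume "u \<in> H20 A g \<Omega>"
 then obtain f where u: "sqi V u" and f: "\<forall>j. test_function A \<Omega> (f j)"
  and lim: "(\<lambda>j. LINT p|V. (f j p - u p)^2) \<longlonglongrightarrow> 0"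
  and c: "\<forall>e>0. \<exists>N. \<forall>i\<ge>N. \<forall>j\<ge>N. H2_norm A g (\<lambda>p. f i p - f j p) < e"
  unfolding H20_def sqi_def mem_Collect_eq by (elim exE conjE) (rule that, simp_all add: sqi_def)
 have T: "f j \<in> T" for j using f by simp
 have "cauchy2 V (\<lambda>j. L (f j))"
  unfolding cauchy2_def
 proof (intro conjI allI impI)
  show "sqi V (L (f n))" for n by (rule T_sqi[OF T_L[OF T]])
  fix e :: real assume e: "e > 0"
  \<comment> \<open>The dimension enters through the bound of the Laplacian by the Hessian.\<close>
  define t where "t = sqrt (e / real CARD('n))"
  have t: "t > 0" "real CARD('n) * t^2 = e" using e by (auto simp: t_def)
  obtain N where N: "\<forall>i\<ge>N. \<forall>j\<ge>N. H2_norm A g (\<lambda>p. f i p - f j p) < t" using c[rule_format, OF t(1)] by (elim exE) (rule that)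
  show "\<exists>N. \<forall>i\<ge>N. \<forall>j\<ge>N. nsq V (\<lambda>p. L (f i) p - L (f j) p) < e"
  proof (intro exI[of _ N] allI impI)
   fix i j assume ij: "i \<ge> N" "j \<ge> N"
   have sm: "smooth_fun A (\<lambda>p. f i p - f j p)" by (intro smooth_fun_diff test_smooth T)
   have "nsq V (\<lambda>p. L (f i) p - L (f j) p) \<le> real CARD('n) * (H2_norm A g (\<lambda>p. f i p - f j p))^2"
    using H2_norm_squared(2)[OF sm] by (simp add: nsq_eq T_diff(2)[OF T T])
   also have "\<dots> < real CARD('n) * t^2"
   proof -
    have "H2_norm A g (\<lambda>p. f i p - f j p) \<ge> 0"
     using H2_norm_squared(1)[OF sm] unfolding H2_norm_def grad_norm_sq_Gam
     by (intro real_sqrt_ge_zero integral_nonneg_AE AE_I2 add_nonneg_nonneg Gam_nonneg)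
      (auto simp: hess_norm_sq_nonneg[OF sm])
    then show ?thesis using N ij by (intro mult_strict_left_mono power_strict_mono) auto
   qed
   finally show "nsq V (\<lambda>p. L (f i) p - L (f j) p) < e" by (simp add: t)
  qed
 qed
 from L2_complete[OF fin this] obtain v where "conv2 V (\<lambda>j. L (f j)) v" by blast
 moreover have "conv2 V f u" using u lim T_sqi[OF T] by (simp add: conv2_def nsq_eq)
 ultimately show "\<exists>v. W u v" using T unfolding W_def by blast
next
 assume "\<exists>v. W u v"
 then obtain v f where T: "\<forall>n. f n \<in> T" and u: "conv2 V f u" and v: "conv2 V (\<lambda>n. L (f n)) v" unfolding W_def by (elim exE conjE) (rule that)
 obtain C where C: "C \<ge> 0" "\<And>f. smooth_fun A f \<Longrightarrow> (H2_norm A g f)^2 \<le> C * ((LINT p|V. (f p)^2) + (LINT p|V. (L f p)^2))"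
  by (rule H2_norm_bound) blast
 have "\<exists>N. \<forall>i\<ge>N. \<forall>j\<ge>N. H2_norm A g (\<lambda>p. f i p - f j p) < e" if e: "e > 0" for e
 proof -
  define t where "t = e^2 / (2 * (C + 1))"
  have "X * (E / (2 * X) + E / (2 * X)) = E" if "X > 0" for X E :: real using that by simp
  from this[of "C + 1" "e^2"] have t: "t > 0" "(C + 1) * (t + t) = e^2" unfolding t_def using e C(1) by auto
  obtain N1 where N1: "\<forall>i\<ge>N1. \<forall>j\<ge>N1. nsq V (\<lambda>p. f i p - f j p) < t"
   using conv2_cauchy2[OF u] t(1) unfolding cauchy2_def by auto
  obtain N2 where N2: "\<forall>i\<ge>N2. \<forall>j\<ge>N2. nsq V (\<lambda>p. L (f i) p - L (f j) p) < t"
   using conv2_cauchy2[OF v] t(1) unfolding cauchy2_def by auto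
  show ?thesis
  proof (intro exI[of _ "N1 + N2"] allI impI)
   fix i j assume ij: "i \<ge> N1 + N2" "j \<ge> N1 + N2"
   have sm: "smooth_fun A (\<lambda>p. f i p - f j p)" by (intro smooth_fun_diff test_smooth T[rule_format])
   have "nsq V (\<lambda>p. f i p - f j p) + nsq V (\<lambda>p. L (f i) p - L (f j) p) < t + t"
    using N1 N2 ij by (intro add_strict_mono) auto
   then have "(C + 1) * (nsq V (\<lambda>p. f i p - f j p) + nsq V (\<lambda>p. L (f i) p - L (f j) p)) < e^2"
    using C(1) unfolding t(2)[symmetric] by (intro mult_strict_left_mono) auto
   moreover have "(H2_norm A g (\<lambda>p. f i p - f j p))^2 \<le> (C + 1) * (nsq V (\<lambda>p. f i p - f j p) + nsq V (\<lambda>p. L (f i) p - L (f j) p))"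
    using C(2)[OF sm] nsq_nonneg[of V "\<lambda>p. f i p - f j p"] nsq_nonneg[of V "\<lambda>p. L (f i) p - L (f j) p"] 
    unfolding nsq_eq T_diff(2)[OF T[rule_format] T[rule_format]] distrib_right mult_1 by linarith
   ultimately have "(H2_norm A g (\<lambda>p. f i p - f j p))^2 < e^2" by linarith
   then show "H2_norm A g (\<lambda>p. f i p - f j p) < e" by (rule power2_less_imp_less) (use e in simp)
  qed
 qed
 then show "u \<in> H20 A g \<Omega>"
  using u T unfolding H20_def conv2_def sqi_def nsq_eq mem_Collect_eq by blast
qed

text \<open>One Laplacian is moved from the test function to \<open>u\<close> by
  \<open>W_sym\<close>, and limits extend the class of test functions from \<open>T\<close> to the
  domain of the closure. In this form an eigenfunction can be tested with itself.\<close>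

lemma solutions_iff:
 "u \<in> clamped_plate_solutions A g \<Omega> \<mu> \<longleftrightarrow>
  (\<exists>v. W u v \<and> (\<forall>u' v'. W u' v' \<longrightarrow> ip V v v' = \<mu> * ip V u u'))"
proof
 assume "u \<in> clamped_plate_solutions A g \<Omega> \<mu>"
 then have u: "u \<in> H20 A g \<Omega>" and eq: "\<And>f. f \<in> T \<Longrightarrow> ip V u (L (L f)) = \<mu> * ip V u f"
  by (auto simp: clamped_plate_solutions_def ip_def)
 then obtain v where v: "W u v" using H20_iff by blast
 have "ip V v v' = \<mu> * ip V u u'" if w: "W u' v'" for u' v'
 proof -
  obtain f where f: "\<forall>n. f n \<in> T" "conv2 V f u'" "conv2 V (\<lambda>n. L (f n)) v'" using w unfolding W_def by (elim exE conjE) (rule that)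
  have *: "ip V (L (f n)) v = \<mu> * ip V (f n) u" for n
   using W_sym[OF v W_T[OF T_L]] eq f(1) by (simp add: ip_commute)
  have "(\<lambda>n. \<mu> * ip V (f n) u) \<longlonglongrightarrow> \<mu> * ip V u' u"
   using W_sqi[OF v] by (intro tendsto_intros conv2_ip_const f)
  then have "ip V v' v = \<mu> * ip V u' u"
   using conv2_ip_const[OF f(3) W_sqi(2)[OF v]] unfolding * by (metis LIMSEQ_unique)
  then show ?thesis by (simp add: ip_commute)
 qed
 with v show "\<exists>v. W u v \<and> (\<forall>u' v'. W u' v' \<longrightarrow> ip V v v' = \<mu> * ip V u u')" by blast
next
 assume "\<exists>v. W u v \<and> (\<forall>u' v'. W u' v' \<longrightarrow> ip V v v' = \<mu> * ip V u u')"
 then obtain v where v: "W u v" "\<And>u' v'. W u' v' \<Longrightarrow> ip V v v' = \<mu> * ip V u u'" by blast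
 have "ip V u (L (L f)) = \<mu> * ip V u f" if "f \<in> T" for f
  using W_sym[OF v(1) W_T[OF T_L[OF that]]] v(2)[OF W_T[OF that]] by simp
 then show "u \<in> clamped_plate_solutions A g \<Omega> \<mu>"
  using H20_iff v(1) by (auto simp: clamped_plate_solutions_def ip_def)
qed

end

section \<open>Commutators with an eigenmap into a sphere\<close>

context riem begin

lemma Gam_sum:
 assumes "finite I" "\<And>i. i \<in> I \<Longrightarrow> smooth_fun A (u i)" "smooth_fun A w"
 shows "Gam (\<lambda>p. \<Sum>i\<in>I. u i p) w p = (\<Sum>i\<in>I. Gam (u i) w p)"
 using assms by (induction I rule: finite_induct) (auto simp: Gam_const Gam_add smooth_fun_sum)

lemma L_sum:
 assumes "finite I" "\<And>i. i \<in> I \<Longrightarrow> smooth_fun A (u i)"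
 shows "L (\<lambda>p. \<Sum>i\<in>I. u i p) p = (\<Sum>i\<in>I. L (u i) p)"
 using assms by (induction I rule: finite_induct) (auto simp: L_const L_add smooth_fun_sum)

end

locale framed_plate = clamped_plate A g \<Omega>
 for A :: "('a::{t2_space,second_countable_topology}, 'n::finite) chart set" and g :: "('a, 'n) metric_coeffs"
  and \<Omega> :: "'a set" +
 fixes J :: "'j set" and h :: "'j \<Rightarrow> 'a \<Rightarrow> real" and l :: real
 assumes finite_J: "finite J" and h_smooth: "\<And>a. a \<in> J \<Longrightarrow> smooth_fun A (h a)"
  and h_eigen: "\<And>a p. a \<in> J \<Longrightarrow> L (h a) p = - l * h a p" and h_sphere: "\<And>p. (\<Sum>a\<in>J. (h a p)^2) = 1"
  and l_nonneg: "l \<ge> 0"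
begin

definition comm :: "'j \<Rightarrow> ('a \<Rightarrow> real) \<Rightarrow> 'a \<Rightarrow> real" where
 "comm a f p = L (\<lambda>p. h a p * f p) p - h a p * L f p"

lemma comm_Gam: "a \<in> J \<Longrightarrow> smooth_fun A f \<Longrightarrow> comm a f p = 2 * Gam (h a) f p - l * (h a p * f p)"
 by (simp add: comm_def L_mult h_smooth h_eigen)

lemma h_bound: "a \<in> J \<Longrightarrow> \<bar>h a p\<bar> \<le> 1"
 using member_le_sum[of a J "\<lambda>a. (h a p)^2"] finite_J by (simp add: h_sphere abs_square_le_1)

text \<open>Differentiate \<Sum> (h a)^2 = 1 in the direction of the gradient of
  \<open>f\<close>.\<close>

lemma h_Gam_zero: assumes f: "smooth_fun A f" shows "(\<Sum>a\<in>J. h a p * Gam (h a) f p) = 0"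
proof -
 have "Gam (\<lambda>p. \<Sum>a\<in>J. h a p * h a p) f p = (\<Sum>a\<in>J. Gam (\<lambda>p. h a p * h a p) f p)"
  by (intro Gam_sum finite_J smooth_fun_mult h_smooth f)
 also have "\<dots> = 2 * (\<Sum>a\<in>J. h a p * Gam (h a) f p)"
  unfolding sum_distrib_left by (intro sum.cong) (simp_all add: Gam_mult h_smooth f)
 finally show ?thesis using h_sphere by (simp add: power2_eq_square Gam_const)
qed

text \<open>Apply the Laplacian to \<Sum> (h a)^2 = 1.\<close>

lemma h_Gam_sum: "(\<Sum>a\<in>J. Gam (h a) (h a) p) = l"
proof -
 have "L (\<lambda>p. \<Sum>a\<in>J. h a p * h a p) p = (\<Sum>a\<in>J. L (\<lambda>p. h a p * h a p) p)"
  by (intro L_sum finite_J smooth_fun_mult h_smooth)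
 also have "\<dots> = (\<Sum>a\<in>J. 2 * Gam (h a) (h a) p - 2 * l * (h a p)^2)"
  by (intro sum.cong) (simp_all add: L_mult h_smooth h_eigen power2_eq_square)
 also have "\<dots> = 2 * (\<Sum>a\<in>J. Gam (h a) (h a) p) - 2 * l"
  by (simp add: sum_subtractf h_sphere flip: sum_distrib_left)
 finally show ?thesis using h_sphere by (simp add: power2_eq_square L_const)
qed

text \<open>By \<open>comm_Gam\<close> a commutator is twice a gradient pairing, whence the 4, minus
  \<open>l * (h a p * f p)\<close>. Summation over \<open>a\<close> kills the mixed terms by
  \<open>h_Gam_zero\<close>, and Cauchy-Schwarz with \<open>h_Gam_sum\<close> bounds the squared
  pairings.\<close>

lemma comm_pointwise:
 assumes f: "smooth_fun A f"
 shows "(\<Sum>a\<in>J. h a p * comm a f p) = - l * f p"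
  and "(\<Sum>a\<in>J. (comm a f p)^2) \<le> 4 * l * Gam f f p + l^2 * (f p)^2"
proof -
 have "(\<Sum>a\<in>J. h a p * comm a f p) = (\<Sum>a\<in>J. 2 * (h a p * Gam (h a) f p) - l * f p * (h a p)^2)"
  by (intro sum.cong) (simp_all add: comm_Gam f power2_eq_square algebra_simps)
 also have "\<dots> = - l * f p" by (simp add: sum_subtractf h_sphere h_Gam_zero[OF f] flip: sum_distrib_left)
 finally show "(\<Sum>a\<in>J. h a p * comm a f p) = - l * f p" .
 have "(\<Sum>a\<in>J. (comm a f p)^2) = (\<Sum>a\<in>J. 4 * (Gam (h a) f p)^2 - 4 * l * f p * (h a p * Gam (h a) f p) + l^2 * (f p)^2 * (h a p)^2)"
  by (intro sum.cong) (simp_all add: comm_Gam f power2_eq_square algebra_simps)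
 also have "\<dots> = 4 * (\<Sum>a\<in>J. (Gam (h a) f p)^2) + l^2 * (f p)^2"
  by (simp add: sum_subtractf sum.distrib h_sphere h_Gam_zero[OF f] flip: sum_distrib_left)
 also have "(\<Sum>a\<in>J. (Gam (h a) f p)^2) \<le> (\<Sum>a\<in>J. Gam (h a) (h a) p * Gam f f p)"
  by (intro sum_mono Gam_cauchy_schwarz h_smooth f)
 also have "\<dots> = l * Gam f f p" by (simp add: h_Gam_sum flip: sum_distrib_right)
 finally show "(\<Sum>a\<in>J. (comm a f p)^2) \<le> 4 * l * Gam f f p + l^2 * (f p)^2" by simp
qed

lemma comm_smooth: "a \<in> J \<Longrightarrow> smooth_fun A f \<Longrightarrow> smooth_fun A (comm a f)"
 unfolding comm_def[abs_def] by (intro smooth_fun_diff smooth_L smooth_fun_mult h_smooth) auto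

lemma comm_diff: "a \<in> J \<Longrightarrow> f \<in> T \<Longrightarrow> \<psi> \<in> T \<Longrightarrow> comm a (\<lambda>p. f p - \<psi> p) = (\<lambda>p. comm a f p - comm a \<psi> p)"
 using T_diff(2)[OF test_mult[OF _ h_smooth] test_mult[OF _ h_smooth], of f a \<psi> a] T_diff(2)[of f \<psi>]
 by (simp add: comm_def[abs_def] right_diff_distrib algebra_simps)

lemma h_mult_sqi: assumes "a \<in> J" "sqi V u" shows "sqi V (\<lambda>p. h a p * u p)"
 using conv2_bounded_mult[OF conv2_const[OF assms(2)], of "h a" 1] h_bound[OF assms(1)] smooth_fun_measurable[OF h_smooth[OF assms(1)]]
 by (auto simp: conv2_def cong: measurable_cong_sets)

lemma h_nsq_sum: assumes "sqi V u" shows "(\<Sum>a\<in>J. nsq V (\<lambda>p. h a p * u p)) = nsq V u"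
proof -
 have "(\<Sum>a\<in>J. nsq V (\<lambda>p. h a p * u p)) = (LINT p|V. (\<Sum>a\<in>J. (h a p * u p)^2))"
  using h_mult_sqi[OF _ assms] by (subst Bochner_Integration.integral_sum) (auto simp: sqi_def nsq_eq)
 then show ?thesis using h_sphere by (simp add: nsq_eq power_mult_distrib flip: sum_distrib_right)
qed

text \<open>Green's formula turns the gradient integral into minus the inner product of
  \<open>f\<close> and \<open>L f\<close>, which is at most the product of their norms. Both facts
  thus involve only quantities that converge in the graph norm.\<close>

lemma comm_integrals:
 assumes f: "f \<in> T"
 shows "sqi V w \<Longrightarrow> (\<Sum>a\<in>J. ip V (\<lambda>p. h a p * w p) (comm a f)) = - l * ip V w f"
  and "(\<Sum>a\<in>J. nsq V (comm a f)) \<le> l^2 * nsq V f + 4 * l * (sqrt (nsq V f) * sqrt (nsq V (L f)))"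
proof -
 have sm: "smooth_fun A f" by (rule test_smooth[OF f])
 have cs: "smooth_fun A (comm a f)" if "a \<in> J" for a by (rule comm_smooth[OF that sm])
 show "(\<Sum>a\<in>J. ip V (\<lambda>p. h a p * w p) (comm a f)) = - l * ip V w f" if w: "sqi V w"
 proof -
  have "(\<Sum>a\<in>J. ip V (\<lambda>p. h a p * w p) (comm a f)) = (\<Sum>a\<in>J. ip V w (\<lambda>p. h a p * comm a f p))"
   by (simp add: ip_def mult_ac)
  also have "\<dots> = ip V w (\<lambda>p. \<Sum>a\<in>J. h a p * comm a f p)"
   using cs by (intro ip_sum(2)[symmetric] finite_J w smooth_sqi smooth_fun_mult h_smooth)
  also have "\<dots> = - l * ip V w f" unfolding comm_pointwise(1)[OF sm] ip_cmult ..
  finally show ?thesis .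
 qed
 have "(\<Sum>a\<in>J. nsq V (comm a f)) = (LINT p|V. (\<Sum>a\<in>J. (comm a f p)^2))"
  using smooth_sqi[OF cs] by (subst Bochner_Integration.integral_sum) (auto simp: sqi_def nsq_eq)
 also have "\<dots> \<le> (LINT p|V. 4 * l * Gam f f p + l^2 * (f p)^2)"
  using smooth_sqi[OF cs] smooth_sqi[OF sm] smooth_integrable[OF smooth_Gam[OF sm sm]]
  by (intro integral_mono comm_pointwise(2)[OF sm]) (auto simp: sqi_def)
 also have "\<dots> = 4 * l * (LINT p|V. Gam f f p) + l^2 * nsq V f"
  using smooth_sqi[OF sm] smooth_integrable[OF smooth_Gam[OF sm sm]] by (simp add: sqi_def nsq_eq)
 also have "(LINT p|V. Gam f f p) \<le> sqrt (nsq V f) * sqrt (nsq V (L f))"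
  using green[OF sm sm] ip_abs_le[OF smooth_sqi[OF sm] smooth_sqi[OF smooth_L[OF sm]]] by (simp add: ip_def)
 finally show "(\<Sum>a\<in>J. nsq V (comm a f)) \<le> l^2 * nsq V f + 4 * l * (sqrt (nsq V f) * sqrt (nsq V (L f)))"
  using l_nonneg by (simp add: mult_left_mono)
qed

text \<open>The commutator is of first order and therefore bounded by the graph norm, so it extends
  to the closure.\<close>

lemma comm_limit:
 assumes f: "\<And>n. f n \<in> T" and u: "conv2 V f u" and v: "conv2 V (\<lambda>n. L (f n)) v" and a: "a \<in> J"
 shows "\<exists>t. conv2 V (\<lambda>n. comm a (f n)) t"
proof (rule L2_complete[OF fin], unfold cauchy2_def, intro conjI allI impI)
 show "sqi V (comm a (f n))" for n by (intro smooth_sqi comm_smooth a test_smooth f)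
 fix e :: real assume e: "e > 0"
 \<comment> \<open>The summand 1 makes \<open>c\<close> positive also for \<open>l = 0\<close>,
   which the locale admits.\<close>
 define c where "c = l^2 + 4 * l + 1"
 have c: "c > 0" "l^2 + 4 * l \<le> c" using l_nonneg by (auto simp: c_def add_nonneg_pos)
 have e': "e / (2 * c) > 0" using e c by simp
 obtain N1 where N1: "\<forall>i\<ge>N1. \<forall>j\<ge>N1. nsq V (\<lambda>p. f i p - f j p) < e / (2 * c)"
  using conv2_cauchy2[OF u] e' unfolding cauchy2_def by blast
 obtain N2 where N2: "\<forall>i\<ge>N2. \<forall>j\<ge>N2. nsq V (\<lambda>p. L (f i) p - L (f j) p) < e / (2 * c)"
  using conv2_cauchy2[OF v] e' unfolding cauchy2_def by blast
 show "\<exists>N. \<forall>i\<ge>N. \<forall>j\<ge>N. nsq V (\<lambda>p. comm a (f i) p - comm a (f j) p) < e"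
 proof (intro exI[of _ "N1 + N2"] allI impI)
  fix i j assume ij: "i \<ge> N1 + N2" "j \<ge> N1 + N2"
  define \<psi> where "\<psi> = (\<lambda>p. f i p - f j p)"
  have \<psi>: "\<psi> \<in> T" unfolding \<psi>_def by (rule T_diff(1)[OF f f])
  define x y where "x = nsq V \<psi>" and "y = nsq V (L \<psi>)"
  have x: "0 \<le> x" "x < e / (2 * c)" using N1 ij by (auto simp: x_def \<psi>_def nsq_nonneg)
  have y: "0 \<le> y" "y < e / (2 * c)" using N2 ij T_diff(2)[OF f f] by (auto simp: y_def \<psi>_def nsq_nonneg)
  have xy: "sqrt x * sqrt y \<le> x + y"
   using arith_geo_mean_sqrt[OF x(1) y(1)] x y by (simp add: real_sqrt_mult)
  have "nsq V (comm a \<psi>) \<le> (\<Sum>a\<in>J. nsq V (comm a \<psi>))"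
   by (rule member_le_sum[OF a _ finite_J]) (simp add: nsq_nonneg)
  also have "\<dots> \<le> l^2 * x + 4 * l * (sqrt x * sqrt y)" unfolding x_def y_def by (rule comm_integrals(2)[OF \<psi>])
  also have "\<dots> \<le> l^2 * (x + y) + 4 * l * (x + y)"
   using xy x y l_nonneg by (intro add_mono mult_left_mono) auto
  also have "\<dots> \<le> c * (x + y)" using c x y by (metis distrib_right add_nonneg_nonneg mult_right_mono)
  also have "\<dots> < c * (e / (2 * c) + e / (2 * c))" using c x y by (intro mult_strict_left_mono add_strict_mono)
  also have "\<dots> = e" using c by simp
  finally show "nsq V (\<lambda>p. comm a (f i) p - comm a (f j) p) < e" unfolding \<psi>_def comm_diff[OF a f f] .
 qed
qed

text \<open>\<open>t a\<close> is the commutator extended to the closure: multiplication by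
  \<open>h a\<close> preserves the domain, and the two sums of \<open>comm_integrals\<close> survive
  the limit.\<close>

lemma frame_limit:
 assumes W: "W u v"
 shows "\<exists>t. (\<forall>a\<in>J. W (\<lambda>p. h a p * u p) (\<lambda>p. h a p * v p + t a p)) \<and> (\<forall>a\<in>J. sqi V (t a)) \<and>
  (\<forall>w. sqi V w \<longrightarrow> (\<Sum>a\<in>J. ip V (\<lambda>p. h a p * w p) (t a)) = - l * ip V w u) \<and>
  (\<Sum>a\<in>J. nsq V (t a)) \<le> l^2 * nsq V u + 4 * l * (sqrt (nsq V u) * sqrt (nsq V v))"
proof -
 obtain f where f: "\<forall>n. f n \<in> T" and u: "conv2 V f u" and v: "conv2 V (\<lambda>n. L (f n)) v"
  using W unfolding W_def by (elim exE conjE) (rule that)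
 have "\<exists>t. conv2 V (\<lambda>n. comm a (f n)) t" if "a \<in> J" for a by (rule comm_limit[OF f[rule_format] u v that])
 then have "\<exists>t. a \<in> J \<longrightarrow> conv2 V (\<lambda>n. comm a (f n)) t" for a by blast
 then obtain t where t: "\<And>a. a \<in> J \<Longrightarrow> conv2 V (\<lambda>n. comm a (f n)) (t a)" by metis
 have hb: "h a \<in> borel_measurable V" if "a \<in> J" for a
  using smooth_fun_measurable[OF h_smooth[OF that]] by (simp cong: measurable_cong_sets)
 show ?thesis
 proof (intro exI[of _ t] conjI ballI allI impI)
  fix a assume a: "a \<in> J"
  note hc = conv2_bounded_mult[OF _ hb[OF a] h_bound[OF a]]
  have "conv2 V (\<lambda>n p. h a p * L (f n) p + comm a (f n) p) (\<lambda>p. h a p * v p + t a p)"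
   by (rule conv2_add[OF hc[OF v] t[OF a]])
  then have "conv2 V (\<lambda>n. L (\<lambda>p. h a p * f n p)) (\<lambda>p. h a p * v p + t a p)" by (simp add: comm_def)
  then show "W (\<lambda>p. h a p * u p) (\<lambda>p. h a p * v p + t a p)"
   using hc[OF u] test_mult[OF f[rule_format] h_smooth[OF a]] unfolding W_def by (intro exI[of _ "\<lambda>n p. h a p * f n p"]) blast
  show "sqi V (t a)" using t[OF a] by (simp add: conv2_def)
 next
  fix w assume w: "sqi V w"
  have "(\<lambda>n. \<Sum>a\<in>J. ip V (\<lambda>p. h a p * w p) (comm a (f n))) \<longlonglongrightarrow> (\<Sum>a\<in>J. ip V (\<lambda>p. h a p * w p) (t a))"
   by (intro tendsto_sum conv2_ip[OF conv2_const] t h_mult_sqi w)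
  moreover have "(\<lambda>n. - l * ip V w (f n)) \<longlonglongrightarrow> - l * ip V w u"
   by (intro tendsto_intros conv2_ip[OF conv2_const] w u)
  ultimately show "(\<Sum>a\<in>J. ip V (\<lambda>p. h a p * w p) (t a)) = - l * ip V w u"
   unfolding comm_integrals(1)[OF f[rule_format] w] by (rule LIMSEQ_unique)
 next
  have "(\<lambda>n. \<Sum>a\<in>J. nsq V (comm a (f n))) \<longlonglongrightarrow> (\<Sum>a\<in>J. nsq V (t a))"
   by (intro tendsto_sum conv2_nsq t)
  moreover have "(\<lambda>n. l^2 * nsq V (f n) + 4 * l * (sqrt (nsq V (f n)) * sqrt (nsq V (L (f n))))) \<longlonglongrightarrow>
    l^2 * nsq V u + 4 * l * (sqrt (nsq V u) * sqrt (nsq V v))"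
   by (intro tendsto_intros conv2_nsq u v)
  ultimately show "(\<Sum>a\<in>J. nsq V (t a)) \<le> l^2 * nsq V u + 4 * l * (sqrt (nsq V u) * sqrt (nsq V v))"
   by (rule LIMSEQ_le) (use comm_integrals(2)[OF f[rule_format]] in blast)
 qed
qed

end

section \<open>Eigenfunctions of the clamped plate\<close>

context clamped_plate begin

definition weak_eigen :: "real \<Rightarrow> ('a \<Rightarrow> real) \<Rightarrow> ('a \<Rightarrow> real) \<Rightarrow> bool" where
 "weak_eigen \<mu> u v \<longleftrightarrow> W u v \<and> (\<forall>u' v'. W u' v' \<longrightarrow> ip V v v' = \<mu> * ip V u u')"

lemma weak_eigenD: "weak_eigen \<mu> u v \<Longrightarrow> W u v" "weak_eigen \<mu> u v \<Longrightarrow> W u' v' \<Longrightarrow> ip V v v' = \<mu> * ip V u u'"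
 by (auto simp: weak_eigen_def)

lemma weak_eigen_sum:
 assumes I: "finite I" and e: "\<And>i. i \<in> I \<Longrightarrow> weak_eigen \<mu> (u i) (v i)"
 shows "weak_eigen \<mu> (\<lambda>p. \<Sum>i\<in>I. a i * u i p) (\<lambda>p. \<Sum>i\<in>I. a i * v i p)"
 unfolding weak_eigen_def
proof (intro conjI allI impI)
 note W = weak_eigenD(1)[OF e]
 show "W (\<lambda>p. \<Sum>i\<in>I. a i * u i p) (\<lambda>p. \<Sum>i\<in>I. a i * v i p)" by (intro W_sum W_cmult W I)
 fix u' v' assume w: "W u' v'"
 have "ip V (\<lambda>p. \<Sum>i\<in>I. a i * v i p) v' = (\<Sum>i\<in>I. a i * ip V (v i) v')"
  using ip_sum(1)[OF I _ W_sqi(2)[OF w], of "\<lambda>i p. a i * v i p"] W_sqi(2)[OF W] by (simp add: sqi_cmult ip_cmult)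
 also have "\<dots> = (\<Sum>i\<in>I. \<mu> * (a i * ip V (u i) u'))"
  using weak_eigenD(2)[OF e w] by (intro sum.cong) (auto simp: mult_ac)
 also have "\<dots> = \<mu> * ip V (\<lambda>p. \<Sum>i\<in>I. a i * u i p) u'"
  using ip_sum(1)[OF I _ W_sqi(1)[OF w], of "\<lambda>i p. a i * u i p"] W_sqi(1)[OF W] by (simp add: sqi_cmult ip_cmult sum_distrib_left)
 finally show "ip V (\<lambda>p. \<Sum>i\<in>I. a i * v i p) v' = \<mu> * ip V (\<lambda>p. \<Sum>i\<in>I. a i * u i p) u'" .
qed

text \<open>Gram-Schmidt is carried out separately for each eigenvalue, and eigenfunctions of
  different eigenvalues are orthogonal by symmetry. The last clause is the completeness by which
  \<open>variational_inequality\<close> rules out further eigenfunctions.\<close>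

lemma orthonormal_eigenbasis:
 assumes eig: "clamped_plate_eigenvalues A g \<Omega> lam"
 shows "\<exists>e d. (\<forall>i\<ge>1. weak_eigen (lam i) (e i) (d i)) \<and> orthonormal2 V {1..} e \<and>
  (\<forall>\<mu> x y. weak_eigen \<mu> x y \<longrightarrow> (\<forall>i\<ge>1. lam i = \<mu> \<longrightarrow> ip V (e i) x = 0) \<longrightarrow> nsq V x = 0)"
proof -
 define I where "I \<mu> = {i. 1 \<le> i \<and> lam i = \<mu>}" for \<mu>
 obtain u where u: "\<forall>\<mu>. (\<forall>i\<in>I \<mu>. u i \<in> clamped_plate_solutions A g \<Omega> \<mu>) \<and>
   (\<forall>a. (AE p in V. (\<Sum>i\<in>I \<mu>. a i * u i p) = 0) \<longrightarrow> (\<forall>i\<in>I \<mu>. a i = 0)) \<and>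
   (\<forall>v\<in>clamped_plate_solutions A g \<Omega> \<mu>. \<exists>a. AE p in V. v p = (\<Sum>i\<in>I \<mu>. a i * u i p))"
  using eig[unfolded clamped_plate_eigenvalues_def Let_def, folded I_def] by (elim exE) (rule that)
 have ind: "\<forall>a. (AE p in V. (\<Sum>i\<in>I \<mu>. a i * u i p) = 0) \<longrightarrow> (\<forall>i\<in>I \<mu>. a i = 0)" for \<mu> using u by blast
 have fI: "finite (I \<mu>)" for \<mu>
 proof (rule ccontr)
  assume inf: "infinite (I \<mu>)"
  \<comment> \<open>A sum over an infinite set is 0 by convention, so the coefficients 1 would
    violate independence.\<close>
  then have "AE p in V. (\<Sum>i\<in>I \<mu>. 1 * u i p) = 0" by simp
  then have "\<forall>i\<in>I \<mu>. (1::real) = 0" using spec[OF ind, of "\<lambda>_. 1"] by (rule rev_mp)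
  then have "I \<mu> = {}" by auto
  then show False using inf by simp
 qed
 have "\<exists>v. i \<in> I \<mu> \<longrightarrow> weak_eigen \<mu> (u i) v" for i \<mu>
  using u solutions_iff[of "u i" \<mu>] unfolding weak_eigen_def by blast
 then have "\<exists>v. 1 \<le> i \<longrightarrow> weak_eigen (lam i) (u i) v" for i by (auto simp: I_def)
 then obtain v where v: "\<And>i. 1 \<le> i \<Longrightarrow> weak_eigen (lam i) (u i) (v i)" by metis
 then have v': "weak_eigen \<mu> (u i) (v i)" if "i \<in> I \<mu>" for i \<mu> using that by (auto simp: I_def)
 have us: "\<forall>i\<in>I \<mu>. sqi V (u i)" for \<mu> using W_sqi(1)[OF weak_eigenD(1)[OF v']] by blast
 define Q where "Q \<mu> e \<longleftrightarrow> (\<forall>j\<in>I \<mu>. \<exists>a. e j = (\<lambda>x. \<Sum>i\<in>I \<mu>. a i * u i x)) \<and> orthonormal2 V (I \<mu>) e \<and>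
  (\<forall>w. sqi V w \<longrightarrow> (\<forall>j\<in>I \<mu>. ip V (e j) w = 0) \<longrightarrow> (\<forall>i\<in>I \<mu>. ip V (u i) w = 0))" for \<mu> and e :: "nat \<Rightarrow> 'a \<Rightarrow> real"
 have "\<exists>e. Q \<mu> e" for \<mu>
 proof -
  from gram_schmidt[OF fI us, of \<mu>] show ?thesis unfolding Q_def using ind[of \<mu>] by (elim exE conjE) (intro exI conjI; auto)
 qed
 then obtain E where E: "\<And>\<mu>. Q \<mu> (E \<mu>)" by metis
 \<comment> \<open>Each index belongs only to the group of its own eigenvalue, so the separate bases
   combine to one family.\<close>
 define e where "e i = E (lam i) i" for i
 have eE: "e i = E \<mu> i" if "i \<in> I \<mu>" for i \<mu> using that by (simp add: e_def I_def)
 have "\<exists>d. 1 \<le> i \<longrightarrow> weak_eigen (lam i) (e i) d" for i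
 proof (cases "1 \<le> i")
  case True
  then have "i \<in> I (lam i)" by (simp add: I_def)
  then have "\<exists>a. E (lam i) i = (\<lambda>x. \<Sum>j\<in>I (lam i). a j * u j x)" using E[of "lam i"] unfolding Q_def by simp
  then show ?thesis
  proof
   fix a assume a: "E (lam i) i = (\<lambda>x. \<Sum>j\<in>I (lam i). a j * u j x)"
   have "weak_eigen (lam i) (e i) (\<lambda>x. \<Sum>j\<in>I (lam i). a j * v j x)"
    unfolding e_def a by (rule weak_eigen_sum[OF fI v'])
   then show ?thesis by blast
  qed
 qed simp
 then obtain d where d: "\<And>i. 1 \<le> i \<Longrightarrow> weak_eigen (lam i) (e i) (d i)" by metis
 have on: "ip V (e i) (e j) = (if i = j then 1 else 0)" if ij: "1 \<le> i" "1 \<le> j" for i j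
 proof (cases "lam i = lam j")
  case True
  then have "i \<in> I (lam i)" "j \<in> I (lam i)" using ij by (auto simp: I_def)
  then show ?thesis using E[of "lam i"] eE[of i "lam i"] eE[of j "lam i"] unfolding Q_def orthonormal2_def by simp
 next
  case False
  have "lam i * ip V (e i) (e j) = lam j * ip V (e i) (e j)"
   using weak_eigenD(2)[OF d[OF ij(1)] weak_eigenD(1)[OF d[OF ij(2)]]]
    weak_eigenD(2)[OF d[OF ij(2)] weak_eigenD(1)[OF d[OF ij(1)]]] by (simp add: ip_commute)
  then show ?thesis using False by auto
 qed
 have zero: "nsq V x = 0" if x: "weak_eigen \<mu> x y" and perp: "\<And>i. 1 \<le> i \<Longrightarrow> lam i = \<mu> \<Longrightarrow> ip V (e i) x = 0" for \<mu> x y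
 proof -
  have xs: "sqi V x" by (rule W_sqi(1)[OF weak_eigenD(1)[OF x]])
  have "\<forall>j\<in>I \<mu>. ip V (E \<mu> j) x = 0" using perp eE by (auto simp: I_def e_def)
  then have ux: "ip V (u i) x = 0" if "i \<in> I \<mu>" for i using E[of \<mu>] xs that unfolding Q_def by blast
  have "x \<in> clamped_plate_solutions A g \<Omega> \<mu>" using x solutions_iff unfolding weak_eigen_def by blast
  then obtain a where a: "AE p in V. x p = (\<Sum>i\<in>I \<mu>. a i * u i p)" using u by blast
  have s: "sqi V (\<lambda>p. \<Sum>i\<in>I \<mu>. a i * u i p)" using us by (intro sqi_sum fI sqi_cmult) auto
  have "nsq V x = ip V (\<lambda>p. \<Sum>i\<in>I \<mu>. a i * u i p) x" by (rule ip_cong_AE[OF a xs s xs])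
  also have "\<dots> = 0" using ip_sum(1)[OF fI _ xs, of \<mu> "\<lambda>i p. a i * u i p"] us ux by (simp add: sqi_cmult ip_cmult)
  finally show ?thesis .
 qed
 show ?thesis
  by (intro exI[of _ e] exI[of _ d] conjI allI impI) (use d on zero in \<open>auto simp: orthonormal2_def\<close>)
qed

text \<open>A violation would produce, by \<open>minimiser\<close>, an eigenfunction with eigenvalue
  \<mu> < \<Lambda> orthogonal to \<open>e i\<close> for 1 <= i <= k. An index with
  \<open>lam i = \<mu>\<close> cannot exceed \<open>k\<close>, so completeness forces this
  eigenfunction to vanish, although its norm is 1.\<close>

lemma variational_inequality:
 fixes lam :: "nat \<Rightarrow> real"
 assumes ef: "\<And>i. 1 \<le> i \<Longrightarrow> weak_eigen (lam i) (e i) (d i)" and on: "orthonormal2 V {1..} e"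
  and complete: "\<And>\<mu> x y. weak_eigen \<mu> x y \<Longrightarrow> (\<And>i. 1 \<le> i \<Longrightarrow> lam i = \<mu> \<Longrightarrow> ip V (e i) x = 0) \<Longrightarrow> nsq V x = 0"
  and mono: "\<And>i. k < i \<Longrightarrow> \<Lambda> \<le> lam i"
  and w: "W w z" and perp: "\<And>i. i \<in> {1..k} \<Longrightarrow> ip V (e i) w = 0"
 shows "\<Lambda> * nsq V w \<le> nsq V z"
proof (rule ccontr)
 assume neg: "\<not> ?thesis"
 have W: "W (e i) (d i)" and eq: "W u v \<Longrightarrow> ip V (d i) v = lam i * ip V (e i) u" if "i \<in> {1..k}" for i u v
  using weak_eigenD[OF ef, of i] that by auto
 have on': "ip V (e i) (e j) = (if i = j then 1 else 0)" if "i \<in> {1..k}" "j \<in> {1..k}" for i j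
  using on that by (auto simp: orthonormal2_def)
 have lt: "nsq V z < \<Lambda> * nsq V w" using neg by simp
 show False
 proof (rule minimiser[of "{1..k}" e d lam w z \<Lambda>])
  show "finite {1..k}" by simp
  fix x y \<mu> assume x: "\<mu> < \<Lambda>" "W x y" "nsq V x = 1" "\<And>i. i \<in> {1..k} \<Longrightarrow> ip V (e i) x = 0"
   "\<And>u v. W u v \<Longrightarrow> ip V y v = \<mu> * ip V x u"
  have "weak_eigen \<mu> x y" using x(2,5) by (simp add: weak_eigen_def)
  moreover have "ip V (e i) x = 0" if "1 \<le> i" "lam i = \<mu>" for i
   using x(1) x(4)[of i] mono[of i] that by (cases "k < i") auto
  ultimately have "nsq V x = 0" by (rule complete)
  then show False using x(3) by simp
 qed (use W on' eq w perp lt in blast)+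
qed

end

section \<open>The eigenvalue inequality\<close>

text \<open>The terms of (i, j) and (j, i) add up to the quadratic form X a b + \<delta> Y a^2 + Z /
  (4 \<delta>) b^2, whose discriminant X^2 - Y Z is nonpositive by \<open>fg\<close>.\<close>

lemma symmetrised_form_nonneg:
 fixes a b :: "'i \<Rightarrow> 'i \<Rightarrow> real"
 assumes sym: "\<And>i j. i \<in> I \<Longrightarrow> j \<in> I \<Longrightarrow> a i j = a j i" "\<And>i j. i \<in> I \<Longrightarrow> j \<in> I \<Longrightarrow> b i j = - b j i"
  and \<delta>: "\<delta> > 0" and F: "\<And>i. i \<in> I \<Longrightarrow> F i > 0"
  and fg: "\<And>i j. i \<in> I \<Longrightarrow> j \<in> I \<Longrightarrow> (f i - f j)^2 + (F i + F j) * ((g i - g j) * (l i - l j)) \<le> 0"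
 shows "0 \<le> (\<Sum>i\<in>I. \<Sum>j\<in>I. f i * (a i j * b i j) + \<delta> * g i * ((l j - l i) * (a i j)^2) + F i / (4 * \<delta>) * (b i j)^2)"
  (is "0 \<le> (\<Sum>i\<in>I. \<Sum>j\<in>I. ?s i j)")
proof -
 have "0 \<le> ?s i j + ?s j i" if ij: "i \<in> I" "j \<in> I" for i j
 proof -
  define X Y Z where "X = f i - f j" and "Y = - ((g i - g j) * (l i - l j))" and "Z = F i + F j"
  have Z: "Z > 0" using F ij by (simp add: Z_def add_pos_pos)
  have XY: "X^2 \<le> Y * Z" using fg[OF ij] by (simp add: X_def Y_def Z_def mult.commute)
  have "?s i j + ?s j i = X * (a i j * b i j) + \<delta> * (Y * (a i j)^2) + Z / (4 * \<delta>) * (b i j)^2"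
   unfolding sym(1)[OF ij(2,1)] sym(2)[OF ij(2,1)] X_def Y_def Z_def
   by (simp add: algebra_simps add_divide_distrib)
  \<comment> \<open>Multiplication by 4 \<delta> Z > 0 turns the form into the square of Z b + 2
    \<delta> X a plus a nonnegative remainder.\<close>
  moreover have "0 \<le> (4 * \<delta> * Z) * (X * (a i j * b i j) + \<delta> * (Y * (a i j)^2) + Z / (4 * \<delta>) * (b i j)^2)"
  proof -
   have "0 \<le> (Z * b i j + 2 * \<delta> * X * a i j)^2" by simp
   also have "\<dots> = 4 * \<delta> * Z * (X * (a i j * b i j)) + (4 * \<delta>^2 * (a i j)^2) * X^2 + Z^2 * (b i j)^2"
    by (simp add: power2_eq_square algebra_simps)
   also have "\<dots> \<le> 4 * \<delta> * Z * (X * (a i j * b i j)) + (4 * \<delta>^2 * (a i j)^2) * (Y * Z) + Z^2 * (b i j)^2"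
    by (rule add_right_mono, rule add_left_mono, rule mult_left_mono[OF XY]) simp
   also have "\<dots> = (4 * \<delta> * Z) * (X * (a i j * b i j) + \<delta> * (Y * (a i j)^2) + Z / (4 * \<delta>) * (b i j)^2)"
    using \<delta> by (simp add: power2_eq_square algebra_simps)
   finally show ?thesis .
  qed
  moreover have "4 * \<delta> * Z > 0" using \<delta> Z by simp
  ultimately show ?thesis by (simp add: zero_le_mult_iff)
 qed
 then have "0 \<le> (\<Sum>i\<in>I. \<Sum>j\<in>I. ?s i j + ?s j i)" by (intro sum_nonneg)
 also have "\<dots> = (\<Sum>i\<in>I. \<Sum>j\<in>I. ?s i j) + (\<Sum>i\<in>I. \<Sum>j\<in>I. ?s j i)" by (simp only: sum.distrib)
 also have "(\<Sum>i\<in>I. \<Sum>j\<in>I. ?s j i) = (\<Sum>i\<in>I. \<Sum>j\<in>I. ?s i j)" by (rule sum.swap)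
 finally show ?thesis by linarith
qed

lemma abs_le_sum_of_square_le:
 fixes c x y :: real
 assumes "c^2 \<le> 4 * (x * y)" "x \<ge> 0" "y \<ge> 0"
 shows "\<bar>c\<bar> \<le> x + y"
proof -
 have "(x + y)^2 = 4 * (x * y) + (x - y)^2" by (simp add: power2_sum power2_diff)
 then have "c^2 \<le> (x + y)^2" using assms(1) by (metis add.right_neutral add_mono zero_le_power2)
 then have "\<bar>c\<bar> \<le> \<bar>x + y\<bar>" by (simp only: abs_le_square_iff)
 then show ?thesis using assms(2,3) by simp
qed

lemma nsq_sub_projection:
 assumes I: "finite I" and on: "orthonormal2 M I e" and e: "\<And>i. i \<in> I \<Longrightarrow> sqi M (e i)" and x: "sqi M x"
 shows "nsq M (\<lambda>p. x p - (\<Sum>i\<in>I. ip M x (e i) * e i p)) = nsq M x - (\<Sum>i\<in>I. (ip M x (e i))^2)"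
  and "j \<in> I \<Longrightarrow> ip M (e j) (\<lambda>p. x p - (\<Sum>i\<in>I. ip M x (e i) * e i p)) = 0"
proof -
 define y where "y = (\<lambda>p. \<Sum>i\<in>I. ip M x (e i) * e i p)"
 have yp: "(\<Sum>i\<in>I. ip M x (e i) * e i p) = y p" for p by (simp add: y_def)
 have y: "sqi M y" unfolding y_def using e by (intro sqi_sum I sqi_cmult)
 have ey: "ip M (e j) y = ip M x (e j)" if "j \<in> I" for j
  unfolding y_def by (rule orthonormal2_sum[OF I on]) (use e that in auto)
 have *: "ip M y w = (\<Sum>i\<in>I. ip M x (e i) * ip M (e i) w)" if "sqi M w" for w
  unfolding y_def using ip_sum(1)[OF I _ that, of "\<lambda>i p. ip M x (e i) * e i p"] e by (simp add: sqi_cmult ip_cmult)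
 show "nsq M (\<lambda>p. x p - (\<Sum>i\<in>I. ip M x (e i) * e i p)) = nsq M x - (\<Sum>i\<in>I. (ip M x (e i))^2)"
  unfolding yp nsq_diff[OF x y] *[OF y] ip_commute[of M x y] *[OF x]
  by (simp add: ey ip_commute[of M "e _" x] power2_eq_square)
 show "ip M (e j) (\<lambda>p. x p - (\<Sum>i\<in>I. ip M x (e i) * e i p)) = 0" if "j \<in> I"
  unfolding yp ip_diff(2)[OF x y e[OF that]] ey[OF that] by (simp add: ip_commute)
qed

context symmetric_operator begin

text \<open>Here \<open>x i\<close> stands for h * e i, \<open>z i\<close> for its Laplacian and
  \<open>t i\<close> for the commutator; \<open>sym\<close> holds because multiplication by h is
  symmetric and its commutator with a symmetric operator antisymmetric. The trial function
  \<open>w\<close> is \<open>x i\<close> minus its projection onto the \<open>e j\<close>. The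
  variational bound and Young's inequality leave sums in \<open>a i j\<close> and
  \<open>b i j\<close>, which add up to the form of \<open>symmetrised_form_nonneg\<close>.\<close>

lemma commutator_sum_inequality:
 fixes e d x z t :: "'i \<Rightarrow> 'a \<Rightarrow> real" and f g l :: "'i \<Rightarrow> real"
 assumes I: "finite I" and ed: "\<And>i. i \<in> I \<Longrightarrow> W (e i) (d i)" and on: "orthonormal2 M I e"
  and eig: "\<And>i u v. i \<in> I \<Longrightarrow> W u v \<Longrightarrow> ip M (d i) v = l i * ip M (e i) u"
  and var: "\<And>u v. W u v \<Longrightarrow> (\<And>i. i \<in> I \<Longrightarrow> ip M (e i) u = 0) \<Longrightarrow> \<Lambda> * nsq M u \<le> nsq M v"
  and xz: "\<And>i. i \<in> I \<Longrightarrow> W (x i) (z i)" and t: "\<And>i. i \<in> I \<Longrightarrow> sqi M (t i)"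
  and sym: "\<And>i j. i \<in> I \<Longrightarrow> j \<in> I \<Longrightarrow> ip M (x i) (e j) = ip M (x j) (e i)"
   "\<And>i j. i \<in> I \<Longrightarrow> j \<in> I \<Longrightarrow> ip M (t i) (e j) = - ip M (t j) (e i)"
  and pos: "\<And>i. i \<in> I \<Longrightarrow> l i < \<Lambda> \<and> 0 < f i \<and> 0 < g i" and \<delta>: "\<delta> > 0"
  and F: "\<And>i. F i = (f i)^2 / (g i * (\<Lambda> - l i))"
  and fg: "\<And>i j. i \<in> I \<Longrightarrow> j \<in> I \<Longrightarrow> (f i - f j)^2 + (F i + F j) * ((g i - g j) * (l i - l j)) \<le> 0"
 shows "(\<Sum>i\<in>I. f i * (- ip M (x i) (t i))) \<le>
  \<delta> * (\<Sum>i\<in>I. g i * (nsq M (z i) - l i * nsq M (x i))) + (\<Sum>i\<in>I. F i * nsq M (t i)) / (4 * \<delta>)"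
proof -
 define a b where "a i j = ip M (x i) (e j)" and "b i j = ip M (t i) (e j)" for i j
 have es: "sqi M (e i)" "sqi M (d i)" if "i \<in> I" for i by (rule W_sqi[OF ed[OF that]])+
 have *: "f i * (- ip M (x i) (t i)) \<le> \<delta> * (g i * (nsq M (z i) - l i * nsq M (x i))) + F i * nsq M (t i) / (4 * \<delta>)
   - (\<Sum>j\<in>I. f i * (a i j * b i j) + \<delta> * g i * ((l j - l i) * (a i j)^2) + F i / (4 * \<delta>) * (b i j)^2)" if i: "i \<in> I" for i
 proof -
  note xs = W_sqi[OF xz[OF i]]
  define w where "w = (\<lambda>p. x i p - (\<Sum>j\<in>I. a i j * e j p))"
  define \<zeta> where "\<zeta> = (\<lambda>p. z i p - (\<Sum>j\<in>I. a i j * d j p))"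
  define r where "r = (\<lambda>p. t i p - (\<Sum>j\<in>I. b i j * e j p))"
  have W: "W w \<zeta>" unfolding w_def \<zeta>_def by (intro W_diff xz i W_sum I W_cmult ed)
  note ws = W_sqi[OF W]
  have rs: "sqi M r" unfolding r_def by (intro sqi_diff t i sqi_sum I sqi_cmult es)
  have nw: "nsq M w = nsq M (x i) - (\<Sum>j\<in>I. (a i j)^2)" and we: "ip M (e j) w = 0" if "j \<in> I" for j
   unfolding w_def a_def using nsq_sub_projection[OF I on es(1) xs(1)] that by blast+
  have nw: "nsq M w = nsq M (x i) - (\<Sum>j\<in>I. (a i j)^2)" by (rule nw[OF i])
  have nr: "nsq M r = nsq M (t i) - (\<Sum>j\<in>I. (b i j)^2)"
   unfolding r_def b_def using nsq_sub_projection(1)[OF I on es(1) t[OF i]] by blast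
  have s: "sqi M (\<lambda>p. \<Sum>j\<in>I. a i j * d j p)" by (intro sqi_sum I sqi_cmult es)
  have dz: "ip M (d j) (z i) = l j * a i j" if "j \<in> I" for j
   using eig[OF that xz[OF i]] by (simp add: a_def ip_commute)
  have d\<zeta>: "ip M (d j) \<zeta> = 0" if "j \<in> I" for j using eig[OF that W] we[OF that] by simp
  have sum: "ip M (\<lambda>p. \<Sum>j\<in>I. a i j * d j p) v = (\<Sum>j\<in>I. a i j * ip M (d j) v)" if "sqi M v" for v
   using ip_sum(1)[OF I _ that, of "\<lambda>j p. a i j * d j p"] es by (simp add: sqi_cmult ip_cmult)
  have n\<zeta>: "nsq M \<zeta> = nsq M (z i) - (\<Sum>j\<in>I. l j * (a i j)^2)"
  proof -
   have "nsq M \<zeta> = ip M (z i) \<zeta> - ip M (\<lambda>p. \<Sum>j\<in>I. a i j * d j p) \<zeta>"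
    unfolding \<zeta>_def using ws(2) by (intro ip_diff(1) xs s) (simp add: \<zeta>_def)
   also have "\<dots> = ip M (z i) \<zeta>" unfolding sum[OF ws(2)] using d\<zeta> by simp
   also have "\<dots> = nsq M (z i) - ip M (z i) (\<lambda>p. \<Sum>j\<in>I. a i j * d j p)"
    unfolding \<zeta>_def by (intro ip_diff(2) xs s)
   also have "ip M (z i) (\<lambda>p. \<Sum>j\<in>I. a i j * d j p) = (\<Sum>j\<in>I. l j * (a i j)^2)"
    unfolding ip_commute[of M "z i"] sum[OF xs(2)] by (intro sum.cong) (auto simp: dz power2_eq_square)
   finally show ?thesis .
  qed
  have ir: "ip M w r = ip M (x i) (t i) - (\<Sum>j\<in>I. a i j * b i j)"
  proof -
   have se: "sqi M (\<lambda>p. \<Sum>j\<in>I. b i j * e j p)" "sqi M (\<lambda>p. \<Sum>j\<in>I. a i j * e j p)" by (rule sqi_sum[OF I sqi_cmult[OF es(1)]], assumption)+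
   have "ip M w r = ip M w (t i) - ip M w (\<lambda>p. \<Sum>j\<in>I. b i j * e j p)"
    unfolding r_def by (intro ip_diff(2) ws t i se)
   also have "ip M w (\<lambda>p. \<Sum>j\<in>I. b i j * e j p) = 0"
    using ip_sum(2)[OF I _ ws(1), of "\<lambda>j p. b i j * e j p"] es we by (simp add: sqi_cmult ip_cmult ip_commute[of M w])
   also have "ip M w (t i) = ip M (x i) (t i) - ip M (\<lambda>p. \<Sum>j\<in>I. a i j * e j p) (t i)"
    unfolding w_def by (rule ip_diff(1)[OF xs(1) se(2) t[OF i]])
   also have "ip M (\<lambda>p. \<Sum>j\<in>I. a i j * e j p) (t i) = (\<Sum>j\<in>I. a i j * b i j)"
    using ip_sum(1)[OF I _ t[OF i], of "\<lambda>j p. a i j * e j p"] es by (simp add: sqi_cmult ip_cmult b_def ip_commute[of M "t i"])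
   finally show ?thesis by simp
  qed
  \<comment> \<open>The variational inequality for \<open>w\<close>, with
    \<open>l i * nsq M w\<close> subtracted on both sides.\<close>
  have lv: "(\<Lambda> - l i) * nsq M w \<le> nsq M (z i) - l i * nsq M (x i) - (\<Sum>j\<in>I. (l j - l i) * (a i j)^2)"
   using var[OF W we] unfolding n\<zeta> by (simp add: nw algebra_simps sum_subtractf sum_distrib_left)
  \<comment> \<open>With this weight in Young's inequality \<open>G * nsq M w\<close> is estimated
    by \<open>lv\<close>, while \<open>(f i)^2 / G\<close> is \<open>F i\<close>.\<close>
  define G where "G = g i * (\<Lambda> - l i)"
  have G: "G > 0" using pos[OF i] by (simp add: G_def)
  have "(f i * ip M w r)^2 \<le> (f i)^2 * (nsq M w * nsq M r)"
   using ip_cauchy_schwarz[OF ws(1) rs] by (simp add: power_mult_distrib mult_left_mono)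
  also have "\<dots> = 4 * ((\<delta> * G * nsq M w) * ((f i)^2 / G * nsq M r / (4 * \<delta>)))" using G \<delta> by simp
  finally have "\<bar>f i * ip M w r\<bar> \<le> \<delta> * G * nsq M w + (f i)^2 / G * nsq M r / (4 * \<delta>)"
   using G \<delta> nsq_nonneg[of M w] nsq_nonneg[of M r] by (intro abs_le_sum_of_square_le) auto
  then have 1: "- (f i * ip M w r) \<le> \<delta> * G * nsq M w + F i * nsq M r / (4 * \<delta>)" by (simp add: F G_def)
  have "\<delta> * g i * ((\<Lambda> - l i) * nsq M w) \<le> \<delta> * g i * (nsq M (z i) - l i * nsq M (x i) - (\<Sum>j\<in>I. (l j - l i) * (a i j)^2))"
   using lv \<delta> pos[OF i] by (intro mult_left_mono) auto
  with 1 have "- (f i * ip M w r) \<le> \<delta> * g i * (nsq M (z i) - l i * nsq M (x i) - (\<Sum>j\<in>I. (l j - l i) * (a i j)^2)) + F i * nsq M r / (4 * \<delta>)"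
   by (simp add: G_def mult.assoc)
  moreover have "(\<Sum>j\<in>I. f i * (a i j * b i j) + \<delta> * g i * ((l j - l i) * (a i j)^2) + F i / (4 * \<delta>) * (b i j)^2)
    = f i * (\<Sum>j\<in>I. a i j * b i j) + \<delta> * g i * (\<Sum>j\<in>I. (l j - l i) * (a i j)^2) + F i / (4 * \<delta>) * (\<Sum>j\<in>I. (b i j)^2)"
   by (simp only: sum.distrib sum_distrib_left)
  ultimately show ?thesis unfolding ir nr by (simp add: algebra_simps diff_divide_distrib)
 qed
 have "0 \<le> (\<Sum>i\<in>I. \<Sum>j\<in>I. f i * (a i j * b i j) + \<delta> * g i * ((l j - l i) * (a i j)^2) + F i / (4 * \<delta>) * (b i j)^2)"
 proof (rule symmetrised_form_nonneg[OF _ _ \<delta> _ fg])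
  show "0 < F i" if "i \<in> I" for i unfolding F using pos[OF that] by (intro divide_pos_pos mult_pos_pos) auto
 qed (unfold a_def b_def, (rule sym, assumption+)+)
 moreover have "(\<Sum>i\<in>I. f i * (- ip M (x i) (t i))) \<le> (\<Sum>i\<in>I. \<delta> * (g i * (nsq M (z i) - l i * nsq M (x i))) + F i * nsq M (t i) / (4 * \<delta>)
   - (\<Sum>j\<in>I. f i * (a i j * b i j) + \<delta> * g i * ((l j - l i) * (a i j)^2) + F i / (4 * \<delta>) * (b i j)^2))"
  by (rule sum_mono) (rule *)
 ultimately show ?thesis by (simp add: sum_subtractf sum.distrib sum_distrib_left sum_divide_distrib)
qed

end

lemma le_sqrt_mult_of_weighted:
 fixes S P Q :: real
 assumes "P > 0" "Q > 0" "\<And>\<delta>. \<delta> > 0 \<Longrightarrow> S \<le> \<delta> * P + Q / (4 * \<delta>)"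
 shows "S \<le> sqrt P * sqrt Q"
proof -
 \<comment> \<open>This value of \<delta> makes the two summands equal, the equality case of the
   arithmetic-geometric mean inequality.\<close>
 have "S \<le> (sqrt Q / (2 * sqrt P)) * P + Q / (4 * (sqrt Q / (2 * sqrt P)))" by (rule assms(3)) (use assms in simp)
 also have "(sqrt Q / (2 * sqrt P)) * P = sqrt P * sqrt Q / 2"
  using assms(1) real_div_sqrt[of P] by (simp add: field_simps)
 also have "Q / (4 * (sqrt Q / (2 * sqrt P))) = sqrt P * sqrt Q / 2"
  using assms(2) real_div_sqrt[of Q] by (simp add: field_simps)
 finally show ?thesis by simp
qed

context framed_plate begin

lemma frame_eigenvalue_inequality:
 fixes \<gamma> f :: "nat \<Rightarrow> real"
 assumes eig: "clamped_plate_eigenvalues A g \<Omega> lam" and \<Lambda>: "\<And>i. k < i \<Longrightarrow> \<Lambda> \<le> lam i"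
  and pos: "\<And>i. i \<in> {1..k} \<Longrightarrow> 0 < lam i \<and> lam i < \<Lambda> \<and> 0 < f i \<and> 0 < \<gamma> i" and l: "l > 0" and \<delta>: "\<delta> > 0"
  and F: "\<And>i. F i = (f i)^2 / (\<gamma> i * (\<Lambda> - lam i))"
  and fg: "\<And>i j. i \<in> {1..k} \<Longrightarrow> j \<in> {1..k} \<Longrightarrow> (f i - f j)^2 + (F i + F j) * ((\<gamma> i - \<gamma> j) * (lam i - lam j)) \<le> 0"
 shows "(\<Sum>i=1..k. f i) \<le> \<delta> * (\<Sum>i=1..k. \<gamma> i * (l + 6 * sqrt (lam i))) + (\<Sum>i=1..k. F i * (l + 4 * sqrt (lam i))) / (4 * \<delta>)"
proof -
 obtain e d where ed: "\<forall>i\<ge>1. weak_eigen (lam i) (e i) (d i)" and on: "orthonormal2 V {1..} e"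
  and complete: "\<forall>\<mu> x y. weak_eigen \<mu> x y \<longrightarrow> (\<forall>i\<ge>1. lam i = \<mu> \<longrightarrow> ip V (e i) x = 0) \<longrightarrow> nsq V x = 0"
  using orthonormal_eigenbasis[OF eig] by (elim exE conjE) (rule that)
 have W: "W (e i) (d i)" and ip_eig: "W u v \<Longrightarrow> ip V (d i) v = lam i * ip V (e i) u" if "i \<in> {1..k}" for i u v
  using weak_eigenD[OF ed[rule_format], of i] that by auto
 have on': "orthonormal2 V {1..k} e" using on by (auto simp: orthonormal2_def)
 have e1: "nsq V (e i) = 1" and d1: "nsq V (d i) = lam i" if "i \<in> {1..k}" for i
  using on' ip_eig[OF that W[OF that]] that by (auto simp: orthonormal2_def)
 have var: "\<Lambda> * nsq V w \<le> nsq V z" if "W w z" "\<And>i. i \<in> {1..k} \<Longrightarrow> ip V (e i) w = 0" for w z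
  by (rule variational_inequality[OF ed[rule_format] on complete[rule_format] \<Lambda> that])
 define R where "R i t \<longleftrightarrow> (\<forall>a\<in>J. W (\<lambda>p. h a p * e i p) (\<lambda>p. h a p * d i p + t a p)) \<and> (\<forall>a\<in>J. sqi V (t a)) \<and>
  (\<forall>w. sqi V w \<longrightarrow> (\<Sum>a\<in>J. ip V (\<lambda>p. h a p * w p) (t a)) = - l * ip V w (e i)) \<and>
  (\<Sum>a\<in>J. nsq V (t a)) \<le> l^2 * nsq V (e i) + 4 * l * (sqrt (nsq V (e i)) * sqrt (nsq V (d i)))" for i t
 have "\<exists>t. i \<in> {1..k} \<longrightarrow> R i t" for i
  using frame_limit[OF W, of i] unfolding R_def by blast
 then obtain t where R: "\<And>i. i \<in> {1..k} \<Longrightarrow> R i (t i)" by metis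
 have Wh: "W (\<lambda>p. h a p * e i p) (\<lambda>p. h a p * d i p + t i a p)" and ts: "sqi V (t i a)" if "i \<in> {1..k}" "a \<in> J" for i a
  using R[OF that(1)] that(2) unfolding R_def by blast+
 have ht: "sqi V w \<Longrightarrow> (\<Sum>a\<in>J. ip V (\<lambda>p. h a p * w p) (t i a)) = - l * ip V w (e i)"
  and tn: "(\<Sum>a\<in>J. nsq V (t i a)) \<le> l^2 + 4 * l * sqrt (lam i)" if i: "i \<in> {1..k}" for i w
  using R[OF i] unfolding R_def by (blast, simp add: e1[OF i] d1[OF i])
 have Fpos: "F i > 0" if "i \<in> {1..k}" for i unfolding F using pos[OF that] by simp
 let ?x = "\<lambda>a i p. h a p * e i p" and ?z = "\<lambda>a i p. h a p * d i p + t i a p"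
 have main: "(\<Sum>i=1..k. f i * (- ip V (?x a i) (t i a))) \<le>
   \<delta> * (\<Sum>i=1..k. \<gamma> i * (nsq V (?z a i) - lam i * nsq V (?x a i))) + (\<Sum>i=1..k. F i * nsq V (t i a)) / (4 * \<delta>)" if a: "a \<in> J" for a
 proof (rule commutator_sum_inequality[of "{1..k}" e d lam \<Lambda> "?x a" "?z a" "\<lambda>i. t i a" f \<gamma> \<delta> F])
  fix i j assume i: "i \<in> {1..k}" and j: "j \<in> {1..k}"
  have mv: "ip V (\<lambda>p. h a p * u p) v = ip V u (\<lambda>p. h a p * v p)" for u v by (simp add: ip_def mult_ac)
  show "ip V (?x a i) (e j) = ip V (?x a j) (e i)" by (simp add: ip_def mult_ac)
  have hd: "sqi V (\<lambda>p. h a p * d i p)" if "i \<in> {1..k}" for i by (rule h_mult_sqi[OF a W_sqi(2)[OF W[OF that]]])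
  \<comment> \<open>Antisymmetry of the commutator in weak form: symmetry of the closure moves the
    Laplacian from \<open>h a * e i\<close> to \<open>e j\<close>, and the resulting difference
    changes its sign when \<open>i\<close> and \<open>j\<close> are exchanged.\<close>
  have T: "ip V (t i a) (e j) = ip V (?x a i) (d j) - ip V (d i) (?x a j)" if "i \<in> {1..k}" "j \<in> {1..k}" for i j
   using W_sym[OF Wh[OF that(1) a] W[OF that(2)]]
    ip_add(1)[OF hd[OF that(1)] ts[OF that(1) a] W_sqi(1)[OF W[OF that(2)]]] mv[of "d i" "e j"] by simp
  show "ip V (t i a) (e j) = - ip V (t j a) (e i)"
   unfolding T[OF i j] T[OF j i] by (simp add: ip_commute)
 qed (use W on' ip_eig var Wh[OF _ a] ts[OF _ a] pos \<delta> F fg in \<open>simp_all only: finite_atLeastAtMost\<close>)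
 \<comment> \<open>Only the sums over \<open>a\<close> are explicit, so the inequality for a single
   \<open>a\<close> is summed before its terms are evaluated.\<close>
 have "(\<Sum>a\<in>J. \<Sum>i=1..k. f i * (- ip V (?x a i) (t i a))) \<le>
   (\<Sum>a\<in>J. \<delta> * (\<Sum>i=1..k. \<gamma> i * (nsq V (?z a i) - lam i * nsq V (?x a i))) + (\<Sum>i=1..k. F i * nsq V (t i a)) / (4 * \<delta>))"
  by (intro sum_mono main)
 also have "(\<Sum>a\<in>J. \<Sum>i=1..k. f i * (- ip V (?x a i) (t i a))) = (\<Sum>i=1..k. f i * l)"
  using ht[OF _ W_sqi(1)[OF W]] e1
  by (subst sum.swap) (auto simp: sum_negf sum_distrib_left[symmetric] intro!: sum.cong)
 also have "(\<Sum>a\<in>J. \<delta> * (\<Sum>i=1..k. \<gamma> i * (nsq V (?z a i) - lam i * nsq V (?x a i))) + (\<Sum>i=1..k. F i * nsq V (t i a)) / (4 * \<delta>))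
   = \<delta> * (\<Sum>i=1..k. \<gamma> i * (\<Sum>a\<in>J. nsq V (?z a i) - lam i * nsq V (?x a i))) + (\<Sum>i=1..k. F i * (\<Sum>a\<in>J. nsq V (t i a))) / (4 * \<delta>)"
  unfolding sum.distrib sum_distrib_left[symmetric] sum_divide_distrib[symmetric]
  by (simp only: sum_distrib_left sum.swap[of _ J])
 also have "\<dots> \<le> \<delta> * (\<Sum>i=1..k. \<gamma> i * (l^2 + 6 * l * sqrt (lam i))) + (\<Sum>i=1..k. F i * (l^2 + 4 * l * sqrt (lam i))) / (4 * \<delta>)"
 proof (intro add_mono mult_left_mono divide_right_mono sum_mono)
  fix i assume i: "i \<in> {1..k}"
  note s = W_sqi[OF W[OF i]]
  have "(\<Sum>a\<in>J. nsq V (?z a i)) = (\<Sum>a\<in>J. nsq V (\<lambda>p. h a p * d i p) + 2 * ip V (\<lambda>p. h a p * d i p) (t i a) + nsq V (t i a))"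
   by (intro sum.cong nsq_add h_mult_sqi ts i s) auto
  also have "\<dots> = lam i + 2 * (- l * ip V (d i) (e i)) + (\<Sum>a\<in>J. nsq V (t i a))"
   by (simp add: sum.distrib h_nsq_sum[OF s(2)] d1[OF i] ht[OF i s(2)] flip: sum_distrib_left)
  \<comment> \<open>The norms of \<open>d i\<close> and \<open>e i\<close> are sqrt (lam i) and 1.
    Doubled, this term raises the coefficient 4 of \<open>tn\<close> to 6.\<close>
  also have "- l * ip V (d i) (e i) \<le> l * sqrt (lam i)"
   using ip_abs_le[OF s(2,1)] l mult_left_mono[of "- ip V (d i) (e i)" "sqrt (lam i)" l] by (simp add: e1[OF i] d1[OF i])
  finally have "(\<Sum>a\<in>J. nsq V (?z a i)) \<le> lam i + 2 * (l * sqrt (lam i)) + (l^2 + 4 * l * sqrt (lam i))" using tn[OF i] by linarith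
  moreover have "(\<Sum>a\<in>J. lam i * nsq V (?x a i)) = lam i" by (simp add: h_nsq_sum[OF s(1)] e1[OF i] flip: sum_distrib_left)
  ultimately show "(\<Sum>a\<in>J. nsq V (?z a i) - lam i * nsq V (?x a i)) \<le> l^2 + 6 * l * sqrt (lam i)"
   unfolding sum_subtractf by linarith
  show "(\<Sum>a\<in>J. nsq V (t i a)) \<le> l^2 + 4 * l * sqrt (lam i)" by (rule tn[OF i])
  show "0 \<le> \<gamma> i" "0 \<le> F i" using pos[OF i] Fpos[OF i] by auto
 qed (use \<delta> in auto)
 also have "\<dots> = l * (\<delta> * (\<Sum>i=1..k. \<gamma> i * (l + 6 * sqrt (lam i))) + (\<Sum>i=1..k. F i * (l + 4 * sqrt (lam i))) / (4 * \<delta>))"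
  by (simp add: sum_distrib_left sum_divide_distrib power2_eq_square algebra_simps)
 also have "(\<Sum>i=1..k. f i * l) = l * (\<Sum>i=1..k. f i)" by (simp add: sum_distrib_left mult.commute)
 finally show ?thesis using l by simp
qed

end

theorem corollary3p1:
  fixes A :: "('a::{t2_space,second_countable_topology}, 'n::finite) chart set"
    and gM :: "('a, 'n) metric_coeffs"
    and \<Omega> :: "'a set"
    and lamM :: real
    and lam :: "nat \<Rightarrow> real"
    and k :: nat
    and f g :: "real \<Rightarrow> real"
  assumes "riemannian_manifold A gM"
    and "compact (UNIV :: 'a set)"
    and "homogeneous A gM"
    and "first_nonzero_laplace_eigenvalue A gM lamM"
    and "bounded_domain \<Omega>"
    and "clamped_plate_eigenvalues A gM \<Omega> lam"
    and "0 < lam 1"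
    and "\<And>i. i \<ge> 1 \<Longrightarrow> lam i \<le> lam (Suc i)"
    and "filterlim lam at_top sequentially"
    and "k \<ge> 1"
    and "lam (k + 1) > lam k"
    and "(f, g) \<in> Im_couples (lam (k + 1))"
  shows "(\<Sum>i=1..k. f (lam i))
    \<le> sqrt (\<Sum>i=1..k. g (lam i) * (lamM + 6 * sqrt (lam i)))
      * sqrt (\<Sum>i=1..k. (f (lam i))\<^sup>2 / (g (lam i) * (lam (k + 1) - lam i)) * (lamM + 4 * sqrt (lam i)))"
proof -
 interpret compact_riem A gM by unfold_locales (rule assms)+
 have lamM: "laplace_eigenvalue A gM lamM" "lamM \<noteq> 0" using assms(4) by (auto simp: first_nonzero_laplace_eigenvalue_def)
 have l0: "lamM \<ge> 0" using lamM(1) eigenvalue_nonneg unfolding laplace_eigenvalue_def by blast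
 then have l: "lamM > 0" using lamM(2) by simp
 obtain J :: "('a \<Rightarrow> real) set" and h where J: "finite J" "\<And>a. a \<in> J \<Longrightarrow> smooth_fun A (h a)"
  "\<And>a p. a \<in> J \<Longrightarrow> L (h a) p = - lamM * h a p" "\<And>p. (\<Sum>a\<in>J. (h a p)^2) = 1"
  by (rule eigen_frame[OF assms(3) lamM(1)]) (rule that)
 interpret framed_plate A gM \<Omega> J h lamM by unfold_locales (rule J l0; assumption?)+
 have mono: "lam i \<le> lam j" if "1 \<le> i" "i \<le> j" for i j
  using that(2)
 proof (induction j rule: dec_induct)
  case (step n)
  then show ?case using assms(8)[of n] that(1) by linarith
 qed simp
 have range: "0 < lam i" "lam i < lam (k + 1)" if "i \<in> {1..k}" for i
  using mono[of 1 i] mono[of i k] assms(7,11) that by auto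
 have fg: "0 < f (lam i)" "0 < g (lam i)" if "i \<in> {1..k}" for i
  using assms(12) range[OF that] by (auto simp: Im_couples_def)
 define F where "F i = (f (lam i))^2 / (g (lam i) * (lam (k + 1) - lam i))" for i
 have ineq: "(f (lam i) - f (lam j))^2 + (F i + F j) * ((g (lam i) - g (lam j)) * (lam i - lam j)) \<le> 0"
  if ij: "i \<in> {1..k}" "j \<in> {1..k}" for i j
 \<comment> \<open>The defining condition of the couples concerns distinct points; for a multiple
   eigenvalue the left side is 0.\<close>
 proof (cases "lam i = lam j")
  case False
  define D where "D = lam i - lam j"
  have "D \<noteq> 0" using False by (simp add: D_def)
  have "((f (lam i) - f (lam j)) / D)^2 + (F i + F j) * ((g (lam i) - g (lam j)) / D) \<le> 0"
   using assms(12) range[OF ij(1)] range[OF ij(2)] False unfolding Im_couples_def D_def F_def by auto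
  then have "D^2 * (((f (lam i) - f (lam j)) / D)^2 + (F i + F j) * ((g (lam i) - g (lam j)) / D)) \<le> 0"
   by (intro mult_nonneg_nonpos) auto
  moreover have "D^2 * (((f (lam i) - f (lam j)) / D)^2 + (F i + F j) * ((g (lam i) - g (lam j)) / D))
    = (f (lam i) - f (lam j))^2 + (F i + F j) * ((g (lam i) - g (lam j)) * D)"
   using \<open>D \<noteq> 0\<close> by (simp add: distrib_left power_divide) (simp add: power2_eq_square)
  ultimately show ?thesis by (simp add: D_def)
 qed simp
 have ne: "{1..k} \<noteq> {}" using assms(10) by simp
 have F: "F i > 0" if "i \<in> {1..k}" for i using fg[OF that] range[OF that] by (simp add: F_def)
 show ?thesis
  unfolding F_def[symmetric]
 proof (rule le_sqrt_mult_of_weighted)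
  show "0 < (\<Sum>i=1..k. g (lam i) * (lamM + 6 * sqrt (lam i)))" "0 < (\<Sum>i=1..k. F i * (lamM + 4 * sqrt (lam i)))"
   using fg F range l ne by (auto intro!: sum_pos mult_pos_pos add_pos_pos)
  fix \<delta> :: real assume "\<delta> > 0"
  then show "(\<Sum>i=1..k. f (lam i)) \<le> \<delta> * (\<Sum>i=1..k. g (lam i) * (lamM + 6 * sqrt (lam i))) + (\<Sum>i=1..k. F i * (lamM + 4 * sqrt (lam i))) / (4 * \<delta>)"
   using fg range l ineq mono[of "k + 1"]
   by (intro frame_eigenvalue_inequality[OF assms(6), of k "lam (k + 1)"]) (auto simp: F_def)
 qed
qed

end
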